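(* Let $k\in\mathbb N$ and $n_1,\dots,n_k\in\mathbb N$ with $\sum_{i=1}^kn_i=n$. Let $\beta_i\in Q_{n_i}^+$ for each $1\le i\le k$ and set $\beta:=\sum_{i=1}^k\beta_i$. Suppose that $\beta_1,\dots,\beta_k$ are pairwise separated. Then there is an equivalence of categories $$\mathscr R_\beta\text{-mod}\ \sim\ \bigl(\mathscr R_{\beta_1}\boxtimes\dots\boxtimes\mathscr R_{\beta_k}\bigr)\text{-mod}.$$
   Context: $K$ is an algebraically closed field and, for a $K$-algebra $A$, $A\text{-mod}$ is the category of finite dimensional left $A$-modules; $\boxtimes$ is the (outer) tensor product of $K$-algebras over $K$. $e\in\{0,2,3,\dots\}$, $I=\mathbb Z/e\mathbb Z$; in the paper either $1\ne q\in K^\times$ is given with $e$ the least positive integer $m$ with $1+q+\dots+q^{m-1}=0$ ($e=0$ if none), or $\operatorname{char}K=e$. $Q^+=\bigoplus_{i\in I}\mathbb N\alpha_i$ ($\alpha_i$ simple roots); $Q_n^+$ is the set of $\sum k_i\alpha_i$ with $\sum k_i=n$; $I^\beta=\{\mathbf i\in I^n:\alpha_{i_1}+\dots+\alpha_{i_n}=\beta\}$; $s_r$ exchanges the $r$-th and $(r+1)$-st entries of $\mathbf i$. Separated: $\alpha=\sum_{i\in I}l_i\alpha_i$ and $\beta=\sum_{i\in I}k_i\alpha_i$ in $Q^+$ are separated if for any $i,j\in I$ with $j-i\in\{0,1,-1\}$, either $l_i=0$ or $k_j=0$. Quiver Hecke algebra $\mathscr R_\beta$ for $\beta\in Q_n^+$.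 Below, $i\to j$ means $j=i+1\ne i-1$, $i\leftarrow j$ means $j=i-1\neq i+1$, $i\rightleftarrows j$ means $j=i+1=i-1$ (so $e=2$). $\mathscr R_\beta$ is the unital $K$-algebra with generators $\psi_1,\dots,\psi_{n-1},y_1,\dots,y_n,e(\mathbf i)$ ($\mathbf i\in I^\beta$) and relations: $e(\mathbf i)e(\mathbf j)=\delta_{\mathbf i\mathbf j}e(\mathbf i)$; $\sum e(\mathbf i)=1$; $y_re(\mathbf i)=e(\mathbf i)y_r$; $\psi_re(\mathbf i)=e(s_r\mathbf i)\psi_r$; $y_ry_s=y_sy_r$; $\psi_ry_{r+1}e(\mathbf i)=(y_r\psi_r+\delta_{i_ri_{r+1}})e(\mathbf i)$; $y_{r+1}\psi_re(\mathbf i)=(\psi_ry_r+\delta_{i_ri_{r+1}})e(\mathbf i)$; $\psi_ry_s=y_s\psi_r$ ($s\ne r,r+1$); $\psi_r\psi_s=\psi_s\psi_r$ ($|r-s|>1$); $\psi_r^2e(\mathbf i)=0$, $(y_{r+1}-y_r)e(\mathbf i)$, $(y_r-y_{r+1})e(\mathbf i)$, $(y_{r+1}-y_r)(y_r-y_{r+1})e(\mathbf i)$, $e(\mathbf i)$ according as $i_r=i_{r+1}$, $i_r\to i_{r+1}$, $i_r\leftarrow i_{r+1}$, $i_r\rightleftarrows i_{r+1}$, otherwise; $\psi_r\psi_{r+1}\psi_re(\mathbf i)=(\psi_{r+1}\psi_r\psi_{r+1}+c)e(\mathbf i)$ with $c=1$, $-1$, $y_r-2y_{r+1}+y_{r+2}$,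 $0$ according as $i_r=i_{r+2}\to i_{r+1}$, $i_r=i_{r+2}\leftarrow i_{r+1}$, $i_r=i_{r+2}\rightleftarrows i_{r+1}$, otherwise. *)

theory Defs
  imports
    "HOL-Algebra.QuotRing"
    "HOL-Algebra.Module"
    "HOL-Algebra.Product_Groups"
    "HOL-Library.Poly_Mapping"
    "HOL-Computational_Algebra.Polynomial"
begin

section \<open>Categories and their equivalence\<close>

text \<open>
  Hom-sets of different pairs of objects need not be disjoint, so composition takes the three
  objects as arguments: \<open>ccomp C a b c g f\<close> is the composite of \<open>f : a \<rightarrow> b\<close> and \<open>g : b \<rightarrow> c\<close>.
  For the same reason the morphism part of a functor takes the source and target.
\<close>

record ('o, 'm) cat =
  cobj :: "'o set"
  chom :: "'o \<Rightarrow> 'o \<Rightarrow> 'm set"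
  cid :: "'o \<Rightarrow> 'm"
  ccomp :: "'o \<Rightarrow> 'o \<Rightarrow> 'o \<Rightarrow> 'm \<Rightarrow> 'm \<Rightarrow> 'm"

locale category =
  fixes C :: "('o, 'm) cat"
  assumes id_in_hom: "a \<in> cobj C \<Longrightarrow> cid C a \<in> chom C a a"
    and comp_in_hom:
      "\<lbrakk>a \<in> cobj C; b \<in> cobj C; c \<in> cobj C; f \<in> chom C a b; g \<in> chom C b c\<rbrakk>
        \<Longrightarrow> ccomp C a b c g f \<in> chom C a c"
    and comp_id_right:
      "\<lbrakk>a \<in> cobj C; b \<in> cobj C; f \<in> chom C a b\<rbrakk> \<Longrightarrow> ccomp C a a b f (cid C a) = f"
    and comp_id_left:
      "\<lbrakk>a \<in> cobj C; b \<in> cobj C; f \<in> chom C a b\<rbrakk> \<Longrightarrow> ccomp C a b b (cid C b) f = f"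
    and comp_assoc:
      "\<lbrakk>a \<in> cobj C; b \<in> cobj C; c \<in> cobj C; d \<in> cobj C;
        f \<in> chom C a b; g \<in> chom C b c; h \<in> chom C c d\<rbrakk>
        \<Longrightarrow> ccomp C a b d (ccomp C b c d h g) f = ccomp C a c d h (ccomp C a b c g f)"

locale cat_functor = source: category C + target: category D
  for C :: "('o, 'm) cat" and D :: "('p, 'n) cat" +
  fixes F :: "'o \<Rightarrow> 'p" and Fm :: "'o \<Rightarrow> 'o \<Rightarrow> 'm \<Rightarrow> 'n"
  assumes map_obj: "a \<in> cobj C \<Longrightarrow> F a \<in> cobj D"
    and map_hom:
      "\<lbrakk>a \<in> cobj C; b \<in> cobj C; f \<in> chom C a b\<rbrakk> \<Longrightarrow> Fm a b f \<in> chom D (F a) (F b)"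
    and map_id: "a \<in> cobj C \<Longrightarrow> Fm a a (cid C a) = cid D (F a)"
    and map_comp:
      "\<lbrakk>a \<in> cobj C; b \<in> cobj C; c \<in> cobj C; f \<in> chom C a b; g \<in> chom C b c\<rbrakk>
        \<Longrightarrow> Fm a c (ccomp C a b c g f) = ccomp D (F a) (F b) (F c) (Fm b c g) (Fm a b f)"

definition cat_iso :: "('o, 'm) cat \<Rightarrow> 'o \<Rightarrow> 'o \<Rightarrow> 'm \<Rightarrow> bool" where
  "cat_iso C a b f \<longleftrightarrow> f \<in> chom C a b \<and>
     (\<exists>g \<in> chom C b a. ccomp C a b a g f = cid C a \<and> ccomp C b a b f g = cid C b)"

locale natural_iso = F: cat_functor C D F Fm + G: cat_functor C D G Gm
  for C :: "('o, 'm) cat" and D :: "('p, 'n) cat" and F Fm G Gm +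
  fixes \<eta> :: "'o \<Rightarrow> 'n"
  assumes component_iso: "a \<in> cobj C \<Longrightarrow> cat_iso D (F a) (G a) (\<eta> a)"
    and naturality:
      "\<lbrakk>a \<in> cobj C; b \<in> cobj C; f \<in> chom C a b\<rbrakk>
        \<Longrightarrow> ccomp D (F a) (G a) (G b) (Gm a b f) (\<eta> a) = ccomp D (F a) (F b) (G b) (\<eta> b) (Fm a b f)"

definition equivalent_categories :: "('o, 'm) cat \<Rightarrow> ('p, 'n) cat \<Rightarrow> bool" where
  "equivalent_categories C D \<longleftrightarrow>
     (\<exists>F Fm G Gm \<eta> \<epsilon>.
        cat_functor C D F Fm \<and> cat_functor D C G Gm \<and>
        natural_iso C C (\<lambda>a. a) (\<lambda>a b f. f)
          (\<lambda>a. G (F a)) (\<lambda>a b f. Gm (F a) (F b) (Fm a b f)) \<eta> \<and>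
        natural_iso D D (\<lambda>a. F (G a)) (\<lambda>a b f. Fm (G a) (G b) (Gm a b f))
          (\<lambda>a. a) (\<lambda>a b f. f) \<epsilon>)"


section \<open>Algebras over a field and finite dimensional modules\<close>

text \<open>
  An algebra over the field \<open>'k\<close> is given by the record type \<^typ>\<open>('k, 'a) module\<close>
  of \<^theory>\<open>HOL-Algebra.Module\<close>, with all ring operations and scalar multiplication by \<open>'k\<close>.
  A left module over it is given by the record type \<^typ>\<open>('a, 'v) module\<close>; as in the locale
  \<^locale>\<open>module\<close>, which requires a commutative ring, the multiplication and unit of that record
  are not used.
\<close>

locale left_module = abelian_group M
  for A :: "('k, 'a) module" and M :: "('a, 'v) module" +
  assumes act_closed: "\<lbrakk>a \<in> carrier A; x \<in> carrier M\<rbrakk> \<Longrightarrow> a \<odot>\<^bsub>M\<^esub> x \<in> carrier M"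
    and act_add_left:
      "\<lbrakk>a \<in> carrier A; b \<in> carrier A; x \<in> carrier M\<rbrakk>
        \<Longrightarrow> (a \<oplus>\<^bsub>A\<^esub> b) \<odot>\<^bsub>M\<^esub> x = a \<odot>\<^bsub>M\<^esub> x \<oplus>\<^bsub>M\<^esub> b \<odot>\<^bsub>M\<^esub> x"
    and act_add_right:
      "\<lbrakk>a \<in> carrier A; x \<in> carrier M; y \<in> carrier M\<rbrakk>
        \<Longrightarrow> a \<odot>\<^bsub>M\<^esub> (x \<oplus>\<^bsub>M\<^esub> y) = a \<odot>\<^bsub>M\<^esub> x \<oplus>\<^bsub>M\<^esub> a \<odot>\<^bsub>M\<^esub> y"
    and act_mult:
      "\<lbrakk>a \<in> carrier A; b \<in> carrier A; x \<in> carrier M\<rbrakk>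
        \<Longrightarrow> (a \<otimes>\<^bsub>A\<^esub> b) \<odot>\<^bsub>M\<^esub> x = a \<odot>\<^bsub>M\<^esub> (b \<odot>\<^bsub>M\<^esub> x)"
    and act_one: "x \<in> carrier M \<Longrightarrow> \<one>\<^bsub>A\<^esub> \<odot>\<^bsub>M\<^esub> x = x"

text \<open>The field acts on a module through its image \<open>c \<mapsto> c \<cdot> 1\<close> in the algebra.\<close>

definition finite_dim :: "('k, 'a) module \<Rightarrow> ('a, 'v) module \<Rightarrow> bool" where
  "finite_dim A M \<longleftrightarrow>
     (\<exists>B. finite B \<and> B \<subseteq> carrier M \<and>
        (\<forall>x \<in> carrier M. \<exists>c :: 'v \<Rightarrow> 'k.
           x = (\<Oplus>\<^bsub>M\<^esub>b\<in>B. (c b \<odot>\<^bsub>A\<^esub> \<one>\<^bsub>A\<^esub>) \<odot>\<^bsub>M\<^esub> b)))"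

definition left_module_hom ::
    "('k, 'a) module \<Rightarrow> ('a, 'v) module \<Rightarrow> ('a, 'v) module \<Rightarrow> ('v \<Rightarrow> 'v) set" where
  "left_module_hom A M N =
     {f \<in> carrier M \<rightarrow>\<^sub>E carrier N.
        (\<forall>x \<in> carrier M. \<forall>y \<in> carrier M. f (x \<oplus>\<^bsub>M\<^esub> y) = f x \<oplus>\<^bsub>N\<^esub> f y) \<and>
        (\<forall>a \<in> carrier A. \<forall>x \<in> carrier M. f (a \<odot>\<^bsub>M\<^esub> x) = a \<odot>\<^bsub>N\<^esub> f x)}"

text \<open>
  The underlying sets of the modules are arbitrary subsets of a type \<open>'v\<close>, which plays the role of
  the set-theoretic universe. If \<open>'k\<close> is infinite and injects into \<open>'v\<close>, then every finite
  dimensional module is isomorphic to one of those with underlying set in this type.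
\<close>

definition fd_modules ::
    "'v itself \<Rightarrow> ('k, 'a) module \<Rightarrow> (('a, 'v) module, 'v \<Rightarrow> 'v) cat" where
  "fd_modules V A =
     \<lparr>cobj = {M. left_module A M \<and> finite_dim A M},
      chom = left_module_hom A,
      cid = (\<lambda>M. \<lambda>x\<in>carrier M. x),
      ccomp = (\<lambda>L M N g f. compose (carrier L) g f)\<rparr>"

lemma category_fd_modules: "category (fd_modules V A)"
proof (unfold_locales; unfold fd_modules_def cat.simps)
  fix M N f assume f: "f \<in> left_module_hom A M N"
  then have ext: "f \<in> carrier M \<rightarrow>\<^sub>E carrier N" by (simp add: left_module_hom_def)
  show "compose (carrier M) f (\<lambda>x\<in>carrier M. x) = f"
    using ext by (auto simp: compose_def restrict_def PiE_def extensional_def)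
  show "compose (carrier M) (\<lambda>x\<in>carrier N. x) f = f"
    using ext by (auto simp: compose_def restrict_def PiE_def extensional_def fun_eq_iff)
next
  fix M assume "M \<in> {M. left_module A M \<and> finite_dim A M}"
  then interpret left_module A M by simp
  show "(\<lambda>x\<in>carrier M. x) \<in> left_module_hom A M M"
    by (auto simp: left_module_hom_def act_closed)
next
  fix L M N f g
  assume "L \<in> {M. left_module A M \<and> finite_dim A M}"
  then interpret left_module A L by simp
  assume "f \<in> left_module_hom A L M" "g \<in> left_module_hom A M N"
  then show "compose (carrier L) g f \<in> left_module_hom A L N"
    by (auto simp: left_module_hom_def compose_def PiE_iff act_closed Pi_iff)
next
  fix K L M N f g h
  assume "f \<in> left_module_hom A K L"
  then have "f \<in> carrier K \<rightarrow> carrier L" by (auto simp: left_module_hom_def)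
  then show "compose (carrier K) (compose (carrier L) h g) f =
             compose (carrier K) h (compose (carrier K) g f)"
    by (simp add: compose_assoc)
qed


section \<open>Monoid algebras, quotient algebras and tensor products\<close>

definition monoid_algebra :: "('m, 'x) monoid_scheme \<Rightarrow> ('k::field, 'm \<Rightarrow>\<^sub>0 'k) module" where
  "monoid_algebra G =
     \<lparr>carrier = {p. Poly_Mapping.keys p \<subseteq> carrier G},
      monoid.mult = (\<lambda>p q. \<Sum>x\<in>Poly_Mapping.keys p. \<Sum>y\<in>Poly_Mapping.keys q.
        Poly_Mapping.single (x \<otimes>\<^bsub>G\<^esub> y) (Poly_Mapping.lookup p x * Poly_Mapping.lookup q y)),
      one = Poly_Mapping.single \<one>\<^bsub>G\<^esub> 1,
      ring.zero = 0,
      add = (+),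
      module.smult = (\<lambda>c p. Poly_Mapping.map ((*) c) p)\<rparr>"

definition quotient_algebra :: "('k, 'a) module \<Rightarrow> 'a set \<Rightarrow> ('k, 'a set) module" where
  "quotient_algebra A J = ring.extend (A Quot J)
     (module.fields (\<lambda>c X. \<Union>x\<in>X. J +>\<^bsub>A\<^esub> (c \<odot>\<^bsub>A\<^esub> x)))"

text \<open>
  The tensor product over the field of a family of algebras: the vector space freely spanned by the
  tuples in the product of the algebras, with componentwise multiplication of tuples, modulo the
  multilinearity relations. The span of these relations is already a two-sided ideal.
\<close>

inductive_set multilinear_relations ::
    "'i set \<Rightarrow> ('i \<Rightarrow> ('k::field, 'a) module) \<Rightarrow> (('i \<Rightarrow> 'a) \<Rightarrow>\<^sub>0 'k) set"
  for S :: "'i set" and A :: "'i \<Rightarrow> ('k, 'a) module" where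
  additive:
    "\<lbrakk>x \<in> (\<Pi>\<^sub>E i\<in>S. carrier (A i)); i \<in> S; a \<in> carrier (A i); b \<in> carrier (A i)\<rbrakk> \<Longrightarrow>
       Poly_Mapping.single (x(i := a \<oplus>\<^bsub>A i\<^esub> b)) 1
         - (Poly_Mapping.single (x(i := a)) 1 + Poly_Mapping.single (x(i := b)) 1)
       \<in> multilinear_relations S A"
| homogeneous:
    "\<lbrakk>x \<in> (\<Pi>\<^sub>E i\<in>S. carrier (A i)); i \<in> S; a \<in> carrier (A i)\<rbrakk> \<Longrightarrow>
       Poly_Mapping.single (x(i := c \<odot>\<^bsub>A i\<^esub> a)) 1 - Poly_Mapping.single (x(i := a)) c
       \<in> multilinear_relations S A"

definition tensor_algebras ::
    "'i set \<Rightarrow> ('i \<Rightarrow> ('k::field, 'a) module) \<Rightarrow> ('k, (('i \<Rightarrow> 'a) \<Rightarrow>\<^sub>0 'k) set) module" where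
  "tensor_algebras S A =
     (let T = monoid_algebra (product_group S A)
      in quotient_algebra T (Idl\<^bsub>T\<^esub> (multilinear_relations S A)))"

definition free_algebra :: "'g set \<Rightarrow> ('k::field, 'g list \<Rightarrow>\<^sub>0 'k) module" where
  "free_algebra G = monoid_algebra \<lparr>carrier = lists G, monoid.mult = (@), one = []\<rparr>"


section \<open>The root lattice\<close>

text \<open>
  \<open>I = \<int>/e\<int>\<close> is represented by canonical representatives; as \<open>x mod 0 = x\<close>, this is all of \<open>\<int>\<close>
  for \<open>e = 0\<close>.
\<close>

definition vertices :: "nat \<Rightarrow> int set" where
  "vertices e = {i. i mod int e = i}"

definition succ_vertex :: "nat \<Rightarrow> int \<Rightarrow> int" where
  "succ_vertex e i = (i + 1) mod int e"

definition pred_vertex :: "nat \<Rightarrow> int \<Rightarrow> int" where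
  "pred_vertex e i = (i - 1) mod int e"

definition simple_root :: "int \<Rightarrow> (int \<Rightarrow>\<^sub>0 nat)" where
  "simple_root i = Poly_Mapping.single i 1"

definition height :: "(int \<Rightarrow>\<^sub>0 nat) \<Rightarrow> nat" where
  "height \<beta> = (\<Sum>i\<in>Poly_Mapping.keys \<beta>. Poly_Mapping.lookup \<beta> i)"

definition Q_plus :: "nat \<Rightarrow> (int \<Rightarrow>\<^sub>0 nat) set" where
  "Q_plus e = {\<beta>. Poly_Mapping.keys \<beta> \<subseteq> vertices e}"

definition Q_plus_n :: "nat \<Rightarrow> nat \<Rightarrow> (int \<Rightarrow>\<^sub>0 nat) set" where
  "Q_plus_n e n = {\<beta> \<in> Q_plus e. height \<beta> = n}"

definition separated :: "nat \<Rightarrow> (int \<Rightarrow>\<^sub>0 nat) \<Rightarrow> (int \<Rightarrow>\<^sub>0 nat) \<Rightarrow> bool" where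
  "separated e \<alpha> \<beta> \<longleftrightarrow>
     (\<forall>i \<in> vertices e. \<forall>j \<in> vertices e. j \<in> {i, succ_vertex e i, pred_vertex e i} \<longrightarrow>
        Poly_Mapping.lookup \<alpha> i = 0 \<or> Poly_Mapping.lookup \<beta> j = 0)"

definition quantum_characteristic :: "'k::field \<Rightarrow> nat" where
  "quantum_characteristic q =
     (if \<exists>m>0. (\<Sum>j<m. q ^ j) = 0 then LEAST m. 0 < m \<and> (\<Sum>j<m. q ^ j) = 0 else 0)"


section \<open>Quiver Hecke algebras\<close>

definition residue_seqs :: "nat \<Rightarrow> (int \<Rightarrow>\<^sub>0 nat) \<Rightarrow> int list set" where
  "residue_seqs e \<beta> = {is. set is \<subseteq> vertices e \<and> (\<Sum>i\<leftarrow>is. simple_root i) = \<beta>}"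

text \<open>Positions in a sequence are counted from 1.\<close>

definition entry :: "int list \<Rightarrow> nat \<Rightarrow> int" where
  "entry is r = is ! (r - 1)"

definition swap_entries :: "nat \<Rightarrow> int list \<Rightarrow> int list" where
  "swap_entries r is = is[r - 1 := entry is (r + 1), r := entry is r]"

definition arrow_right :: "nat \<Rightarrow> int \<Rightarrow> int \<Rightarrow> bool" where
  "arrow_right e i j \<longleftrightarrow> j = succ_vertex e i \<and> j \<noteq> pred_vertex e i"

definition arrow_left :: "nat \<Rightarrow> int \<Rightarrow> int \<Rightarrow> bool" where
  "arrow_left e i j \<longleftrightarrow> j = pred_vertex e i \<and> j \<noteq> succ_vertex e i"

definition arrow_both :: "nat \<Rightarrow> int \<Rightarrow> int \<Rightarrow> bool" where
  "arrow_both e i j \<longleftrightarrow> j = succ_vertex e i \<and> j = pred_vertex e i"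

datatype qh_gen = Psi nat | Y nat | E "int list"

definition qh_gens :: "nat \<Rightarrow> (int \<Rightarrow>\<^sub>0 nat) \<Rightarrow> qh_gen set" where
  "qh_gens e \<beta> = Psi ` {1..<height \<beta>} \<union> Y ` {1..height \<beta>} \<union> E ` residue_seqs e \<beta>"

abbreviation qh_free :: "nat \<Rightarrow> (int \<Rightarrow>\<^sub>0 nat) \<Rightarrow> ('k::field, qh_gen list \<Rightarrow>\<^sub>0 'k) module" where
  "qh_free e \<beta> \<equiv> free_algebra (qh_gens e \<beta>)"

abbreviation psi :: "nat \<Rightarrow> qh_gen list \<Rightarrow>\<^sub>0 'k::field" where
  "psi r \<equiv> Poly_Mapping.single [Psi r] 1"

abbreviation yy :: "nat \<Rightarrow> qh_gen list \<Rightarrow>\<^sub>0 'k::field" where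
  "yy r \<equiv> Poly_Mapping.single [Y r] 1"

abbreviation idem :: "int list \<Rightarrow> qh_gen list \<Rightarrow>\<^sub>0 'k::field" where
  "idem is \<equiv> Poly_Mapping.single [E is] 1"

text \<open>
  The elements \<open>Q\<close> and \<open>c\<close> for which \<open>\<psi>\<^sub>r\<^sup>2 e(\<^bold>i) = Q e(\<^bold>i)\<close> and
  \<open>\<psi>\<^sub>r \<psi>\<^sub>r\<^sub>+\<^sub>1 \<psi>\<^sub>r e(\<^bold>i) = (\<psi>\<^sub>r\<^sub>+\<^sub>1 \<psi>\<^sub>r \<psi>\<^sub>r\<^sub>+\<^sub>1 + c) e(\<^bold>i)\<close>.
\<close>

definition psi_square ::
    "nat \<Rightarrow> (int \<Rightarrow>\<^sub>0 nat) \<Rightarrow> nat \<Rightarrow> int list \<Rightarrow> (qh_gen list \<Rightarrow>\<^sub>0 'k::field)" where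
  "psi_square e \<beta> r is =
     (let i = entry is r; j = entry is (r + 1) in
      if i = j then 0
      else if arrow_right e i j then yy (r + 1) - yy r
      else if arrow_left e i j then yy r - yy (r + 1)
      else if arrow_both e i j then (yy (r + 1) - yy r) \<otimes>\<^bsub>qh_free e \<beta>\<^esub> (yy r - yy (r + 1))
      else \<one>\<^bsub>qh_free e \<beta>\<^esub>)"

definition braid_error ::
    "nat \<Rightarrow> (int \<Rightarrow>\<^sub>0 nat) \<Rightarrow> nat \<Rightarrow> int list \<Rightarrow> (qh_gen list \<Rightarrow>\<^sub>0 'k::field)" where
  "braid_error e \<beta> r is =
     (let i = entry is r; j = entry is (r + 1); l = entry is (r + 2) in
      if i = l \<and> arrow_right e l j then \<one>\<^bsub>qh_free e \<beta>\<^esub>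
      else if i = l \<and> arrow_left e l j then - \<one>\<^bsub>qh_free e \<beta>\<^esub>
      else if i = l \<and> arrow_both e l j then yy r - (yy (r + 1) + yy (r + 1)) + yy (r + 2)
      else 0)"

text \<open>A relation \<open>u = v\<close> is encoded as the element \<open>u - v\<close> of the free algebra.\<close>

inductive_set qh_relations ::
    "nat \<Rightarrow> (int \<Rightarrow>\<^sub>0 nat) \<Rightarrow> (qh_gen list \<Rightarrow>\<^sub>0 'k::field) set"
  for e :: nat and \<beta> :: "int \<Rightarrow>\<^sub>0 nat" where
  idem_idem:
    "\<lbrakk>is \<in> residue_seqs e \<beta>; js \<in> residue_seqs e \<beta>\<rbrakk> \<Longrightarrow>
       idem is \<otimes>\<^bsub>qh_free e \<beta>\<^esub> idem js - (if is = js then idem is else 0) \<in> qh_relations e \<beta>"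
| idem_sum:
    "(\<Sum>is\<in>residue_seqs e \<beta>. idem is) - \<one>\<^bsub>qh_free e \<beta>\<^esub> \<in> qh_relations e \<beta>"
| y_idem:
    "\<lbrakk>r \<in> {1..height \<beta>}; is \<in> residue_seqs e \<beta>\<rbrakk> \<Longrightarrow>
       yy r \<otimes>\<^bsub>qh_free e \<beta>\<^esub> idem is - idem is \<otimes>\<^bsub>qh_free e \<beta>\<^esub> yy r \<in> qh_relations e \<beta>"
| psi_idem:
    "\<lbrakk>r \<in> {1..<height \<beta>}; is \<in> residue_seqs e \<beta>\<rbrakk> \<Longrightarrow>
       psi r \<otimes>\<^bsub>qh_free e \<beta>\<^esub> idem is - idem (swap_entries r is) \<otimes>\<^bsub>qh_free e \<beta>\<^esub> psi r
       \<in> qh_relations e \<beta>"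
| y_y:
    "\<lbrakk>r \<in> {1..height \<beta>}; s \<in> {1..height \<beta>}\<rbrakk> \<Longrightarrow>
       yy r \<otimes>\<^bsub>qh_free e \<beta>\<^esub> yy s - yy s \<otimes>\<^bsub>qh_free e \<beta>\<^esub> yy r \<in> qh_relations e \<beta>"
| psi_y_succ:
    "\<lbrakk>r \<in> {1..<height \<beta>}; is \<in> residue_seqs e \<beta>\<rbrakk> \<Longrightarrow>
       psi r \<otimes>\<^bsub>qh_free e \<beta>\<^esub> yy (r + 1) \<otimes>\<^bsub>qh_free e \<beta>\<^esub> idem is
         - (yy r \<otimes>\<^bsub>qh_free e \<beta>\<^esub> psi r
              + (if entry is r = entry is (r + 1) then \<one>\<^bsub>qh_free e \<beta>\<^esub> else 0))
           \<otimes>\<^bsub>qh_free e \<beta>\<^esub> idem is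
       \<in> qh_relations e \<beta>"
| y_succ_psi:
    "\<lbrakk>r \<in> {1..<height \<beta>}; is \<in> residue_seqs e \<beta>\<rbrakk> \<Longrightarrow>
       yy (r + 1) \<otimes>\<^bsub>qh_free e \<beta>\<^esub> psi r \<otimes>\<^bsub>qh_free e \<beta>\<^esub> idem is
         - (psi r \<otimes>\<^bsub>qh_free e \<beta>\<^esub> yy r
              + (if entry is r = entry is (r + 1) then \<one>\<^bsub>qh_free e \<beta>\<^esub> else 0))
           \<otimes>\<^bsub>qh_free e \<beta>\<^esub> idem is
       \<in> qh_relations e \<beta>"
| psi_y_commute:
    "\<lbrakk>r \<in> {1..<height \<beta>}; s \<in> {1..height \<beta>}; s \<noteq> r; s \<noteq> r + 1\<rbrakk> \<Longrightarrow>
       psi r \<otimes>\<^bsub>qh_free e \<beta>\<^esub> yy s - yy s \<otimes>\<^bsub>qh_free e \<beta>\<^esub> psi r \<in> qh_relations e \<beta>"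
| psi_psi_commute:
    "\<lbrakk>r \<in> {1..<height \<beta>}; s \<in> {1..<height \<beta>}; 1 < \<bar>int r - int s\<bar>\<rbrakk> \<Longrightarrow>
       psi r \<otimes>\<^bsub>qh_free e \<beta>\<^esub> psi s - psi s \<otimes>\<^bsub>qh_free e \<beta>\<^esub> psi r \<in> qh_relations e \<beta>"
| psi_psi:
    "\<lbrakk>r \<in> {1..<height \<beta>}; is \<in> residue_seqs e \<beta>\<rbrakk> \<Longrightarrow>
       psi r \<otimes>\<^bsub>qh_free e \<beta>\<^esub> psi r \<otimes>\<^bsub>qh_free e \<beta>\<^esub> idem is
         - psi_square e \<beta> r is \<otimes>\<^bsub>qh_free e \<beta>\<^esub> idem is
       \<in> qh_relations e \<beta>"
| braid:
    "\<lbrakk>r \<in> {1..<height \<beta>}; r + 1 \<in> {1..<height \<beta>}; is \<in> residue_seqs e \<beta>\<rbrakk> \<Longrightarrow>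
       psi r \<otimes>\<^bsub>qh_free e \<beta>\<^esub> psi (r + 1) \<otimes>\<^bsub>qh_free e \<beta>\<^esub> psi r \<otimes>\<^bsub>qh_free e \<beta>\<^esub> idem is
         - (psi (r + 1) \<otimes>\<^bsub>qh_free e \<beta>\<^esub> psi r \<otimes>\<^bsub>qh_free e \<beta>\<^esub> psi (r + 1) + braid_error e \<beta> r is)
           \<otimes>\<^bsub>qh_free e \<beta>\<^esub> idem is
       \<in> qh_relations e \<beta>"

definition quiver_hecke ::
    "'k::field itself \<Rightarrow> nat \<Rightarrow> (int \<Rightarrow>\<^sub>0 nat) \<Rightarrow> ('k, (qh_gen list \<Rightarrow>\<^sub>0 'k) set) module" where
  "quiver_hecke K e \<beta> =
     quotient_algebra (qh_free e \<beta>) (Idl\<^bsub>qh_free e \<beta> :: ('k, _) module\<^esub> (qh_relations e \<beta>))"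

end

theory Submission
  imports Defs
begin

text \<open>
  Give every residue in the support of \<open>\<beta>\<close> the index of the block \<open>\<beta>\<^sub>c\<close> containing it as its colour.
  An \<open>R\<^sub>\<beta>\<close>-module is a space graded by residue sequences on which operators \<open>y\<^sub>r\<close> and \<open>\<psi>\<^sub>r\<close> act.
  At neighbours of different colours separatedness gives \<open>\<psi>\<^sub>r\<^sup>2 = 1\<close> and makes the
  error term of a braid relation vanish unless its three strands have the same colour, so bubble sort by colours
  identifies the component of a sequence \<open>i\<close> with the component of the stably sorted sequence,
  independently of the choice of the swaps. Under this identification \<open>y\<^sub>r\<close> and \<open>\<psi>\<^sub>r\<close> become \<open>y\<^sub>p\<close> and \<open>\<psi>\<^sub>p\<close>,
  or the identity, where \<open>p\<close> is the position of the \<open>r\<close>-th entry after sorting. Therefore cutting a module down to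
  its sorted components is fully faithful. What acts on the sorted components is one family of quiver
  Hecke operators for each block, and different families commute: a module over the tensor product. It is essentially
  surjective, since a module over the tensor product can be copied to every residue sequence.
\<close>

subsection \<open>Equivalences of categories\<close>

text \<open>The argument avoids a basis theorem for quiver Hecke algebras: the truncation of the
  algebra at the sorted idempotents is never computed. Everything runs on modules instead. A module
  over a presented algebra is a space with operators satisfying the relations, a morphism is a
  linear map commuting with these operators, and a tensor product of algebras acts through commuting
  families of operators that share the scalars.

  The square of \<open>psi r\<close> depends on the residues at r and r + 1: on some components
  \<open>psi r\<close> is invertible, on others it squares to zero. So the identification
  \<open>Phi\<close> is made component by component, and most statements concern one homogeneous
  vector.

  Full faithfulness holds because \<open>Phi\<close> commutes with morphisms. For essential
  surjectivity \<open>Phi\<close> cannot be used, as it presupposes a module. Instead the formulas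
  that \<open>Phi_y\<close>, \<open>Phi_psi\<close> and \<open>Phi_far\<close> force on a module
  become the definition of operators on labelled copies of the sorted components, and every relation
  is verified afresh for them.\<close>

lemma (in category) cat_isoI:
  assumes "f \<in> chom C a b" "g \<in> chom C b a" "ccomp C a b a g f = cid C a" "ccomp C b a b f g = cid C b"
  shows "cat_iso C a b f"
  using assms unfolding cat_iso_def by blast

text \<open>A quasi-inverse is chosen on objects by density. A morphism is conjugated by the chosen
  isomorphisms \<epsilon> and pulled back along the bijection on hom-sets, so every identity in
  \<open>C\<close> may be checked after \<open>Fm\<close>, and there after composing with
  \<epsilon>.\<close>

lemma equivalent_categories_fully_faithful:
  assumes "cat_functor C D F Fm"
    and faithful: "\<And>a b. a \<in> cobj C \<Longrightarrow> b \<in> cobj C \<Longrightarrow> inj_on (Fm a b) (chom C a b)"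
    and full: "\<And>a b h. a \<in> cobj C \<Longrightarrow> b \<in> cobj C \<Longrightarrow> h \<in> chom D (F a) (F b) \<Longrightarrow>
                 \<exists>f \<in> chom C a b. Fm a b f = h"
    and dense: "\<And>d. d \<in> cobj D \<Longrightarrow> \<exists>a \<in> cobj C. \<exists>h. cat_iso D (F a) d h"
  shows "equivalent_categories C D"
proof -
  interpret cat_functor C D F Fm by fact
  obtain G \<epsilon> where G: "\<And>d. d \<in> cobj D \<Longrightarrow> G d \<in> cobj C"
      and \<epsilon>_iso: "\<And>d. d \<in> cobj D \<Longrightarrow> cat_iso D (F (G d)) d (\<epsilon> d)"
    using dense by metis
  obtain \<epsilon>' where \<epsilon>: "\<And>d. d \<in> cobj D \<Longrightarrow> \<epsilon> d \<in> chom D (F (G d)) d"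
      and \<epsilon>': "\<And>d. d \<in> cobj D \<Longrightarrow> \<epsilon>' d \<in> chom D d (F (G d))"
      and inv1: "\<And>d. d \<in> cobj D \<Longrightarrow> ccomp D (F (G d)) d (F (G d)) (\<epsilon>' d) (\<epsilon> d) = cid D (F (G d))"
      and inv2: "\<And>d. d \<in> cobj D \<Longrightarrow> ccomp D d (F (G d)) d (\<epsilon> d) (\<epsilon>' d) = cid D d"
    using \<epsilon>_iso unfolding cat_iso_def by metis
  \<comment> \<open>Full faithfulness makes \<open>pre\<close> the inverse of \<open>Fm\<close> on
    hom-sets.\<close>
  define pre where "pre a b h = (SOME f. f \<in> chom C a b \<and> Fm a b f = h)" for a b h
  have pre: "pre a b h \<in> chom C a b \<and> Fm a b (pre a b h) = h"
    if "a \<in> cobj C" "b \<in> cobj C" "h \<in> chom D (F a) (F b)" for a b h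
    unfolding pre_def by (rule someI_ex) (use full[OF that] in blast)
  have eqI: "f = g" if "a \<in> cobj C" "b \<in> cobj C" "f \<in> chom C a b" "g \<in> chom C a b"
      "Fm a b f = Fm a b g" for a b f g
    using faithful[OF that(1,2)] that(3-) by (auto dest: inj_onD)
  \<comment> \<open>The conjugate of \<open>h\<close> by the isomorphisms \<epsilon>: the only
    candidate for the image under \<open>Fm\<close> of the new morphism that makes \<epsilon>
    natural.\<close>
  define Hm where "Hm d d' h = ccomp D (F (G d)) d' (F (G d')) (\<epsilon>' d') (ccomp D (F (G d)) d d' h (\<epsilon> d))" for d d' h
  have Hm: "Hm d d' h \<in> chom D (F (G d)) (F (G d'))"
    if "d \<in> cobj D" "d' \<in> cobj D" "h \<in> chom D d d'" for d d' h
    unfolding Hm_def using that by (intro target.comp_in_hom map_obj G \<epsilon> \<epsilon>') auto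
  define Gm where "Gm d d' h = pre (G d) (G d') (Hm d d' h)" for d d' h
  have Gm: "Gm d d' h \<in> chom C (G d) (G d')" and FGm: "Fm (G d) (G d') (Gm d d' h) = Hm d d' h"
    if "d \<in> cobj D" "d' \<in> cobj D" "h \<in> chom D d d'" for d d' h
    unfolding Gm_def using pre[OF G G Hm] that by auto
  have Hm_id: "Hm d d (cid D d) = cid D (F (G d))" if "d \<in> cobj D" for d
    unfolding Hm_def using that
    by (simp add: target.comp_id_left[OF map_obj[OF G] _ \<epsilon>] inv1)
  have \<epsilon>_Hm: "ccomp D (F (G d)) (F (G d')) d' (\<epsilon> d') (Hm d d' h) = ccomp D (F (G d)) d d' h (\<epsilon> d)"
    if d: "d \<in> cobj D" "d' \<in> cobj D" "h \<in> chom D d d'" for d d' h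
  proof -
    have c: "ccomp D (F (G d)) d d' h (\<epsilon> d) \<in> chom D (F (G d)) d'"
      using d by (intro target.comp_in_hom map_obj G \<epsilon>) auto
    have "ccomp D (F (G d)) (F (G d')) d' (\<epsilon> d') (Hm d d' h) =
      ccomp D (F (G d)) d' d' (ccomp D d' (F (G d')) d' (\<epsilon> d') (\<epsilon>' d')) (ccomp D (F (G d)) d d' h (\<epsilon> d))"
      unfolding Hm_def using d
      by (intro target.comp_assoc[symmetric] map_obj G \<epsilon> \<epsilon>' c) auto
    also have "\<dots> = ccomp D (F (G d)) d d' h (\<epsilon> d)"
      using d by (simp add: inv2 target.comp_id_left[OF map_obj[OF G] _ c])
    finally show ?thesis .
  qed
  \<comment> \<open>\<epsilon> has a left inverse, hence is monic; functoriality and naturality are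
    tested after composing with it.\<close>
  have \<epsilon>_cancel: "f = g" if d: "a \<in> cobj D" "d \<in> cobj D" "f \<in> chom D a (F (G d))" "g \<in> chom D a (F (G d))"
      "ccomp D a (F (G d)) d (\<epsilon> d) f = ccomp D a (F (G d)) d (\<epsilon> d) g" for a d f g
  proof -
    have *: "f = ccomp D a d (F (G d)) (\<epsilon>' d) (ccomp D a (F (G d)) d (\<epsilon> d) f)"
      if "f \<in> chom D a (F (G d))" for f
    proof -
      have "f = ccomp D a (F (G d)) (F (G d)) (cid D (F (G d))) f"
        using that d by (intro target.comp_id_left[symmetric] map_obj G) auto
      also have "\<dots> = ccomp D a d (F (G d)) (\<epsilon>' d) (ccomp D a (F (G d)) d (\<epsilon> d) f)"
        unfolding inv1[OF d(2), symmetric] using that d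
        by (intro target.comp_assoc map_obj G \<epsilon> \<epsilon>') auto
      finally show ?thesis .
    qed
    show ?thesis using *[OF d(3)] *[OF d(4)] d(5) by metis
  qed
  have Hm_comp: "Hm a c (ccomp D a b c g f) = ccomp D (F (G a)) (F (G b)) (F (G c)) (Hm b c g) (Hm a b f)"
    if d: "a \<in> cobj D" "b \<in> cobj D" "c \<in> cobj D" "f \<in> chom D a b" "g \<in> chom D b c" for a b c f g
  proof (rule \<epsilon>_cancel[of "F (G a)" c])
    let ?A = "F (G a)" and ?B = "F (G b)" and ?C = "F (G c)"
    have gf: "ccomp D a b c g f \<in> chom D a c" by (intro target.comp_in_hom d)
    have o: "?A \<in> cobj D" "?B \<in> cobj D" "?C \<in> cobj D" using d by (auto intro: map_obj G)
    have "ccomp D ?A ?C c (\<epsilon> c) (Hm a c (ccomp D a b c g f)) = ccomp D ?A b c g (ccomp D ?A a b f (\<epsilon> a))"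
      using d gf o by (simp add: \<epsilon>_Hm target.comp_assoc[OF o(1) d(1,2,3) \<epsilon>])
    also have "\<dots> = ccomp D ?A b c g (ccomp D ?A ?B b (\<epsilon> b) (Hm a b f))"
      using d by (simp add: \<epsilon>_Hm)
    also have "\<dots> = ccomp D ?A ?B c (ccomp D ?B b c g (\<epsilon> b)) (Hm a b f)"
      using d o by (intro target.comp_assoc[symmetric] \<epsilon> Hm) auto
    also have "\<dots> = ccomp D ?A ?B c (ccomp D ?B ?C c (\<epsilon> c) (Hm b c g)) (Hm a b f)"
      using d by (simp add: \<epsilon>_Hm)
    also have "\<dots> = ccomp D ?A ?C c (\<epsilon> c) (ccomp D ?A ?B ?C (Hm b c g) (Hm a b f))"
      using d o by (intro target.comp_assoc \<epsilon> Hm) auto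
    finally show "ccomp D ?A ?C c (\<epsilon> c) (Hm a c (ccomp D a b c g f)) =
      ccomp D ?A ?C c (\<epsilon> c) (ccomp D ?A ?B ?C (Hm b c g) (Hm a b f))" .
  qed (use d in \<open>auto intro!: map_obj G Hm target.comp_in_hom\<close>)
  have GF: "cat_functor D C G Gm"
  proof (unfold_locales, goal_cases)
    case (3 a)
    have "cid D a \<in> chom D a a" using 3 by (rule target.id_in_hom)
    then show ?case using 3
      by (intro eqI[OF G G]) (auto simp: FGm Hm_id map_id G Gm source.id_in_hom)
  next
    case (4 a b c f g)
    have gf: "ccomp D a b c g f \<in> chom D a c" by (intro target.comp_in_hom 4)
    have "Fm (G a) (G c) (Gm a c (ccomp D a b c g f)) =
        Fm (G a) (G c) (ccomp C (G a) (G b) (G c) (Gm b c g) (Gm a b f))"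
      using 4 gf by (simp add: FGm Hm_comp map_comp[OF G G G Gm Gm])
    then show ?case using 4 gf
      by (intro eqI[OF G G]) (auto intro!: Gm source.comp_in_hom[OF G G G Gm Gm])
  qed (simp_all add: G Gm)
  \<comment> \<open>The unit is the preimage of the inverse of \<epsilon>, so its naturality is that
    of \<epsilon> read backwards.\<close>
  define \<eta> where "\<eta> a = pre a (G (F a)) (\<epsilon>' (F a))" for a
  have \<eta>: "\<eta> a \<in> chom C a (G (F a))" "Fm a (G (F a)) (\<eta> a) = \<epsilon>' (F a)" if "a \<in> cobj C" for a
    unfolding \<eta>_def using pre[of a "G (F a)" "\<epsilon>' (F a)"] that by (auto intro: G map_obj \<epsilon>')
  have \<eta>iso: "cat_iso C a (G (F a)) (\<eta> a)" if a: "a \<in> cobj C" for a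
  proof -
    have o: "F a \<in> cobj D" "G (F a) \<in> cobj C" using a by (auto intro: map_obj G)
    let ?g = "pre (G (F a)) a (\<epsilon> (F a))"
    have g: "?g \<in> chom C (G (F a)) a" "Fm (G (F a)) a ?g = \<epsilon> (F a)"
      using pre[OF o(2) a \<epsilon>[OF o(1)]] by auto
    show ?thesis
    proof (rule source.cat_isoI[OF \<eta>(1)[OF a] g(1)])
      show "ccomp C a (G (F a)) a ?g (\<eta> a) = cid C a"
        using a o g \<eta>[OF a]
        by (intro eqI[OF a a] source.comp_in_hom[of _ "G (F a)"] source.id_in_hom)
           (auto simp: map_comp[of a "G (F a)" a] map_id inv2)
      show "ccomp C (G (F a)) a (G (F a)) (\<eta> a) ?g = cid C (G (F a))"
        using a o g \<eta>[OF a]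
        by (intro eqI[OF o(2) o(2)] source.comp_in_hom[of _ a] source.id_in_hom)
           (auto simp: map_comp[of "G (F a)" a "G (F a)"] map_id inv1)
    qed
  qed
  have nat1: "natural_iso C C (\<lambda>a. a) (\<lambda>a b f. f) (\<lambda>a. G (F a)) (\<lambda>a b f. Gm (F a) (F b) (Fm a b f)) \<eta>"
  proof (unfold_locales, goal_cases)
    case (5 a) then show ?case by (intro G map_obj)
  next
    case (6 a b f) then show ?case by (intro Gm map_obj map_hom)
  next
    case (7 a) then show ?case using GF by (simp add: map_id cat_functor.map_id map_obj)
  next
    case (8 a b c f g)
    then show ?case by (simp add: map_comp cat_functor.map_comp[OF GF] map_obj map_hom)
  next
    case (9 a) then show ?case by (rule \<eta>iso)
  next
    case (10 a b f)
    have o: "F a \<in> cobj D" "F b \<in> cobj D" "G (F a) \<in> cobj C" "G (F b) \<in> cobj C"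
        "F (G (F a)) \<in> cobj D" "F (G (F b)) \<in> cobj D"
      using 10 by (auto intro: map_obj G)
    have f: "Fm a b f \<in> chom D (F a) (F b)" using 10 by (intro map_hom)
    have m: "Gm (F a) (F b) (Fm a b f) \<in> chom C (G (F a)) (G (F b))" using o f by (intro Gm)
    have "ccomp D (F a) (F (G (F a))) (F (G (F b))) (Hm (F a) (F b) (Fm a b f)) (\<epsilon>' (F a))
        = ccomp D (F a) (F b) (F (G (F b))) (\<epsilon>' (F b)) (Fm a b f)" (is "?l = ?r")
    proof (rule \<epsilon>_cancel)
      show "F a \<in> cobj D" "F b \<in> cobj D" by fact+
      show "?l \<in> chom D (F a) (F (G (F b)))" using o f by (intro target.comp_in_hom \<epsilon>' Hm)
      show "?r \<in> chom D (F a) (F (G (F b)))" using o f by (intro target.comp_in_hom \<epsilon>')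
      have "ccomp D (F a) (F (G (F b))) (F b) (\<epsilon> (F b)) ?l =
        ccomp D (F a) (F (G (F a))) (F b) (ccomp D (F (G (F a))) (F a) (F b) (Fm a b f) (\<epsilon> (F a))) (\<epsilon>' (F a))"
        by (subst target.comp_assoc[symmetric]) (use o f in \<open>auto intro!: \<epsilon> \<epsilon>' Hm simp: \<epsilon>_Hm\<close>)
      also have "\<dots> = Fm a b f"
        by (subst target.comp_assoc) (use o f in \<open>auto intro!: \<epsilon> \<epsilon>' simp: inv2 target.comp_id_right\<close>)
      also have "\<dots> = ccomp D (F a) (F (G (F b))) (F b) (\<epsilon> (F b)) ?r"
        by (subst target.comp_assoc[symmetric]) (use o f in \<open>auto intro!: \<epsilon> \<epsilon>' simp: inv2 target.comp_id_left\<close>)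
      finally show "ccomp D (F a) (F (G (F b))) (F b) (\<epsilon> (F b)) ?l = ccomp D (F a) (F (G (F b))) (F b) (\<epsilon> (F b)) ?r" .
    qed
    then show ?case
      using 10 o f m \<eta>[of a] \<eta>[of b]
      by (intro eqI[of a "G (F b)"] source.comp_in_hom[of a "G (F a)"] source.comp_in_hom[of a b])
         (auto simp: map_comp FGm)
  qed simp_all
  have nat2: "natural_iso D D (\<lambda>a. F (G a)) (\<lambda>a b f. Fm (G a) (G b) (Gm a b f)) (\<lambda>a. a) (\<lambda>a b f. f) \<epsilon>"
  proof (unfold_locales, goal_cases)
    case (1 a) then show ?case by (simp add: G map_obj)
  next
    case (2 a b f) then show ?case by (simp add: FGm Hm)
  next
    case (3 a) then show ?case by (simp add: FGm Hm_id target.id_in_hom)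
  next
    case (4 a b c f g)
    then show ?case by (simp add: FGm Hm_comp target.comp_in_hom[of a b c])
  next
    case (9 a) then show ?case by (simp add: \<epsilon>_iso)
  next
    case (10 a b f) then show ?case by (simp add: FGm \<epsilon>_Hm)
  qed simp_all
  show ?thesis
    unfolding equivalent_categories_def using nat1 nat2 GF assms(1) by blast
qed

subsection \<open>Spaces over a field and linear maps\<close>

text \<open>The scalar action is a parameter and not part of the record, because the
  \<open>smult\<close> slot of a module record holds the action of the algebra. Only the additive
  part of \<open>M\<close> is read.\<close>

locale kspace = abelian_group M for M (structure) +
  fixes sc :: "'k::field \<Rightarrow> 'a \<Rightarrow> 'a"
  assumes sc_closed [simp]: "x \<in> carrier M \<Longrightarrow> sc c x \<in> carrier M"
    and sc_add_left: "x \<in> carrier M \<Longrightarrow> sc (c + d) x = sc c x \<oplus> sc d x"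
    and sc_add_right: "x \<in> carrier M \<Longrightarrow> y \<in> carrier M \<Longrightarrow> sc c (x \<oplus> y) = sc c x \<oplus> sc c y"
    and sc_mult: "x \<in> carrier M \<Longrightarrow> sc (c * d) x = sc c (sc d x)"
    and sc_one [simp]: "x \<in> carrier M \<Longrightarrow> sc 1 x = x"

text \<open>Values outside the carrier are left free, unlike for the morphisms of
  \<open>fd_modules\<close>, which are extensional; \<open>restrict\<close> and
  \<open>klin_cong\<close> pass between the two.\<close>

definition klin :: "('a, 'm) ring_scheme \<Rightarrow> ('k \<Rightarrow> 'a \<Rightarrow> 'a) \<Rightarrow> ('b, 'n) ring_scheme \<Rightarrow> ('k \<Rightarrow> 'b \<Rightarrow> 'b) \<Rightarrow>
    ('a \<Rightarrow> 'b) \<Rightarrow> bool" where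
  "klin M sc N tc f \<longleftrightarrow> f \<in> carrier M \<rightarrow> carrier N \<and>
     (\<forall>x\<in>carrier M. \<forall>y\<in>carrier M. f (x \<oplus>\<^bsub>M\<^esub> y) = f x \<oplus>\<^bsub>N\<^esub> f y) \<and>
     (\<forall>c. \<forall>x\<in>carrier M. f (sc c x) = tc c (f x))"

lemma klinI:
  assumes "\<And>x. x \<in> carrier M \<Longrightarrow> f x \<in> carrier N"
    "\<And>x y. x \<in> carrier M \<Longrightarrow> y \<in> carrier M \<Longrightarrow> f (x \<oplus>\<^bsub>M\<^esub> y) = f x \<oplus>\<^bsub>N\<^esub> f y"
    "\<And>c x. x \<in> carrier M \<Longrightarrow> f (sc c x) = tc c (f x)"
  shows "klin M sc N tc f"
  using assms by (auto simp: klin_def)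

lemma klin_closed: "klin M sc N tc f \<Longrightarrow> x \<in> carrier M \<Longrightarrow> f x \<in> carrier N"
  and klin_add: "klin M sc N tc f \<Longrightarrow> x \<in> carrier M \<Longrightarrow> y \<in> carrier M \<Longrightarrow> f (x \<oplus>\<^bsub>M\<^esub> y) = f x \<oplus>\<^bsub>N\<^esub> f y"
  and klin_sc: "klin M sc N tc f \<Longrightarrow> x \<in> carrier M \<Longrightarrow> f (sc c x) = tc c (f x)"
  by (auto simp: klin_def)

lemma klin_comp: "klin L rc M sc f \<Longrightarrow> klin M sc N tc g \<Longrightarrow> klin L rc N tc (\<lambda>x. g (f x))"
  by (auto simp: klin_def Pi_iff)

lemma klin_cong:
  assumes "kspace M sc" "klin M sc N tc f" "\<And>x. x \<in> carrier M \<Longrightarrow> f x = g x"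
  shows "klin M sc N tc g"
proof -
  interpret kspace M sc by fact
  show ?thesis
    using assms(2,3) by (intro klinI) (metis klin_closed, metis klin_add a_closed, metis klin_sc sc_closed)
qed

lemma klin_zero:
  assumes "klin M sc N tc f" "abelian_group M" "abelian_group N"
  shows "f \<zero>\<^bsub>M\<^esub> = \<zero>\<^bsub>N\<^esub>"
proof -
  interpret M: abelian_group M by fact
  interpret N: abelian_group N by fact
  have f0: "f \<zero>\<^bsub>M\<^esub> \<in> carrier N" using assms by (auto intro: klin_closed)
  have "f \<zero>\<^bsub>M\<^esub> \<oplus>\<^bsub>N\<^esub> f \<zero>\<^bsub>M\<^esub> = f \<zero>\<^bsub>M\<^esub>" using klin_add[OF assms(1) M.zero_closed M.zero_closed] by simp
  then show ?thesis using f0 by (metis N.add.l_cancel_one N.zero_closed)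
qed

lemma klin_minus:
  assumes "klin M sc N tc f" "abelian_group M" "abelian_group N" "x \<in> carrier M" "y \<in> carrier M"
  shows "f (x \<ominus>\<^bsub>M\<^esub> y) = f x \<ominus>\<^bsub>N\<^esub> f y"
proof -
  interpret M: abelian_group M by fact
  interpret N: abelian_group N by fact
  have c: "f x \<in> carrier N" "f y \<in> carrier N" "f (x \<ominus>\<^bsub>M\<^esub> y) \<in> carrier N"
    using assms by (auto intro: klin_closed M.minus_closed)
  have "f x = f ((x \<ominus>\<^bsub>M\<^esub> y) \<oplus>\<^bsub>M\<^esub> y)"
    using assms by (simp add: a_minus_def M.a_assoc M.l_neg)
  also have "\<dots> = f (x \<ominus>\<^bsub>M\<^esub> y) \<oplus>\<^bsub>N\<^esub> f y" using assms by (simp add: klin_add M.minus_closed)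
  finally show ?thesis using c by (simp add: a_minus_def N.a_assoc N.r_neg)
qed

lemma klin_finsum:
  assumes "klin M sc N tc f" "abelian_group M" "abelian_group N" "g \<in> A \<rightarrow> carrier M"
  shows "f (finsum M g A) = finsum N (\<lambda>a. f (g a)) A"
proof -
  interpret M: abelian_group M by fact
  interpret N: abelian_group N by fact
  show ?thesis using assms(4)
  proof (induction A rule: infinite_finite_induct)
    case (infinite A) then show ?case by (simp add: klin_zero[OF assms(1-3)])
  next
    case empty then show ?case by (simp add: klin_zero[OF assms(1-3)])
  next
    case (insert a A)
    then have "g \<in> A \<rightarrow> carrier M" "g a \<in> carrier M" by auto
    then show ?case using insert
      by (simp add: klin_add[OF assms(1)] klin_closed[OF assms(1)] M.finsum_closed Pi_iff)
  qed
qed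

text \<open>A subspace is a separate record with its own finite sums. The inclusion is linear for
  the dummy scalar action that fixes every vector, so it carries sums to sums.\<close>

lemma finsum_subspace:
  assumes "abelian_group M" "abelian_group N" "carrier N \<subseteq> carrier M" "\<zero>\<^bsub>N\<^esub> = \<zero>\<^bsub>M\<^esub>"
    "\<And>x y. x \<in> carrier N \<Longrightarrow> y \<in> carrier N \<Longrightarrow> x \<oplus>\<^bsub>N\<^esub> y = x \<oplus>\<^bsub>M\<^esub> y" "g \<in> A \<rightarrow> carrier N"
  shows "finsum N g A = finsum M g A"
  using klin_finsum[of N "\<lambda>_ x. x" M "\<lambda>_ x. x" "\<lambda>x. x" g A] assms by (auto simp: klin_def)

context kspace
begin

lemma sc_klin: "klin M sc M sc (sc c)"
  by (rule klinI) (auto simp: sc_add_right sc_mult[symmetric] mult.commute)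

lemma sc_zero_right [simp]: "sc c \<zero> = \<zero>"
  using klin_zero[OF sc_klin abelian_group_axioms abelian_group_axioms] .

lemma sc_zero_left [simp]: "x \<in> carrier M \<Longrightarrow> sc 0 x = \<zero>"
  using sc_add_left[of x 0 0] by (metis add.l_cancel_one add.right_neutral sc_closed)

lemma sc_minus_one: "x \<in> carrier M \<Longrightarrow> sc (- 1) x = \<ominus> x"
  using sc_add_left[of x "-1" 1] by (metis add.inv_equality add.left_inverse sc_closed sc_one sc_zero_left)

lemma klin_id: "klin M sc M sc (\<lambda>x. x)" by (auto intro: klinI)

lemma klin_0: "kspace L rc \<Longrightarrow> klin L rc M sc (\<lambda>x. \<zero>)" by (auto intro: klinI)

lemma klin_plus:
  assumes "klin L rc M sc f" "klin L rc M sc g" "kspace L rc"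
  shows "klin L rc M sc (\<lambda>x. f x \<oplus> g x)"
proof -
  have [simp]: "f x \<in> carrier M" "g x \<in> carrier M" if "x \<in> carrier L" for x
    using assms that by (auto intro: klin_closed)
  show ?thesis using assms
    by (intro klinI) (auto simp: klin_add klin_sc sc_add_right a_ac)
qed

lemma klin_uminus:
  assumes "klin L rc M sc f" "kspace L rc"
  shows "klin L rc M sc (\<lambda>x. \<ominus> f x)"
proof -
  have "klin L rc M sc (\<lambda>x. sc (-1) (f x))" by (rule klin_comp[OF assms(1) sc_klin])
  then show ?thesis
    by (rule klin_cong[OF assms(2)]) (simp add: sc_minus_one klin_closed[OF assms(1)])
qed

lemma klin_diff:
  assumes "klin L rc M sc f" "klin L rc M sc g" "kspace L rc"
  shows "klin L rc M sc (\<lambda>x. f x \<ominus> g x)"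
  unfolding a_minus_def by (rule klin_plus[OF assms(1) klin_uminus[OF assms(2,3)] assms(3)])

lemma klin_sum:
  assumes "\<And>a. a \<in> A \<Longrightarrow> klin L rc M sc (f a)" "kspace L rc"
  shows "klin L rc M sc (\<lambda>x. \<Oplus>a\<in>A. f a x)"
  using assms(1)
proof (induction A rule: infinite_finite_induct)
  case (insert a A)
  then have fa: "klin L rc M sc (f a)" and fA: "klin L rc M sc (\<lambda>x. \<Oplus>a\<in>A. f a x)"
    by simp_all
  have "(\<lambda>a. f a x) \<in> A \<rightarrow> carrier M" if "x \<in> carrier L" for x
    using insert.prems that klin_closed by fast
  then show ?case using insert(1,2) fa fA
    by (intro klin_cong[OF assms(2) klin_plus[OF fa fA assms(2)]]) (simp add: klin_closed[OF fa])
qed (auto intro: klin_0 assms(2))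

end

text \<open>The linear extension of \<theta> to the monoid algebra; for words in generators this is
  evaluation of noncommutative polynomials in operators.\<close>

definition lin_act :: "('a, 'm) ring_scheme \<Rightarrow> ('k::field \<Rightarrow> 'a \<Rightarrow> 'a) \<Rightarrow> ('g \<Rightarrow> 'a \<Rightarrow> 'a) \<Rightarrow> ('g \<Rightarrow>\<^sub>0 'k) \<Rightarrow> 'a \<Rightarrow> 'a" where
  "lin_act M sc \<theta> p x = (\<Oplus>\<^bsub>M\<^esub>g\<in>Poly_Mapping.keys p. sc (Poly_Mapping.lookup p g) (\<theta> g x))"

lemma keys_subset_add: "Poly_Mapping.keys p \<subseteq> X \<Longrightarrow> Poly_Mapping.keys q \<subseteq> X \<Longrightarrow> Poly_Mapping.keys (p + q) \<subseteq> X"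
  by (meson Poly_Mapping.keys_add Un_least dual_order.trans)

text \<open>Keeps the support inside \<open>X\<close> throughout, so identities in a monoid algebra
  can be reduced to basis elements that lie in the carrier of the monoid.\<close>

lemma poly_mapping_keys_induct [consumes 1, case_names zero single add]:
  fixes p :: "'a \<Rightarrow>\<^sub>0 'b::comm_monoid_add"
  assumes "Poly_Mapping.keys p \<subseteq> X"
    and "P 0" and "\<And>x c. x \<in> X \<Longrightarrow> P (Poly_Mapping.single x c)"
    and "\<And>p q. Poly_Mapping.keys p \<subseteq> X \<Longrightarrow> Poly_Mapping.keys q \<subseteq> X \<Longrightarrow> P p \<Longrightarrow> P q \<Longrightarrow> P (p + q)"
  shows "P p"
proof -
  let ?f = "\<lambda>x. Poly_Mapping.single x (Poly_Mapping.lookup p x)"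
  have "P (sum ?f Z) \<and> Poly_Mapping.keys (sum ?f Z) \<subseteq> X" if "finite Z" "Z \<subseteq> X" for Z
    using that
  proof (induction Z)
    case (insert y Z)
    then have X: "Poly_Mapping.keys (?f y) \<subseteq> X" "Poly_Mapping.keys (sum ?f Z) \<subseteq> X" and P: "P (sum ?f Z)" "P (?f y)"
      using assms(3) by (auto split: if_splits)
    show ?case using X assms(4)[OF X P(2,1)] keys_subset_add[OF X] insert(1,2) by simp
  qed (simp add: assms(2))
  from this[OF finite_keys assms(1)] show ?thesis
  proof (elim conjE back_subst[of P])
    show "sum ?f (Poly_Mapping.keys p) = p"
    proof (rule poly_mapping_eqI)
      fix k
      show "Poly_Mapping.lookup (sum ?f (Poly_Mapping.keys p)) k = Poly_Mapping.lookup p k"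
        by (cases "k \<in> Poly_Mapping.keys p") (simp_all add: lookup_sum lookup_single when_def in_keys_iff)
    qed
  qed
qed

subsection \<open>Monoid algebras\<close>

lemma carrier_monoid_algebra: "p \<in> carrier (monoid_algebra G) \<longleftrightarrow> Poly_Mapping.keys p \<subseteq> carrier G"
  by (simp add: monoid_algebra_def)

lemma single_in_carrier_monoid_algebra: "g \<in> carrier G \<Longrightarrow> Poly_Mapping.single g c \<in> carrier (monoid_algebra G)"
  by (simp add: carrier_monoid_algebra)

lemma monoid_algebra_simps [simp]:
  "\<zero>\<^bsub>monoid_algebra G\<^esub> = 0" "\<one>\<^bsub>monoid_algebra G\<^esub> = Poly_Mapping.single \<one>\<^bsub>G\<^esub> 1"
  "p \<oplus>\<^bsub>monoid_algebra G\<^esub> q = p + q" "c \<odot>\<^bsub>monoid_algebra G\<^esub> p = Poly_Mapping.map ((*) c) p"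
  by (simp_all add: monoid_algebra_def)

text \<open>Supports may shrink under cancellation in a sum. With index sets enlarged to common
  finite supersets, distributivity becomes a computation with sums.\<close>

lemma monoid_algebra_mult_superset:
  assumes "finite X" "finite Z" "Poly_Mapping.keys p \<subseteq> X" "Poly_Mapping.keys q \<subseteq> Z"
  shows "p \<otimes>\<^bsub>monoid_algebra G\<^esub> q =
    (\<Sum>x\<in>X. \<Sum>y\<in>Z. Poly_Mapping.single (x \<otimes>\<^bsub>G\<^esub> y) (Poly_Mapping.lookup p x * Poly_Mapping.lookup q y))"
proof -
  have "(\<Sum>y\<in>Z. Poly_Mapping.single (x \<otimes>\<^bsub>G\<^esub> y) (Poly_Mapping.lookup p x * Poly_Mapping.lookup q y)) =
     (\<Sum>y\<in>Poly_Mapping.keys q. Poly_Mapping.single (x \<otimes>\<^bsub>G\<^esub> y) (Poly_Mapping.lookup p x * Poly_Mapping.lookup q y))" for x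
    by (rule sum.mono_neutral_right) (use assms in \<open>auto simp: in_keys_iff\<close>)
  then show ?thesis unfolding monoid_algebra_def using assms
    by simp (rule sum.mono_neutral_left, auto simp: in_keys_iff)
qed

lemma monoid_algebra_distrib_right:
  "(p + q) \<otimes>\<^bsub>monoid_algebra G\<^esub> r = p \<otimes>\<^bsub>monoid_algebra G\<^esub> r + q \<otimes>\<^bsub>monoid_algebra G\<^esub> r"
proof -
  let ?X = "Poly_Mapping.keys p \<union> Poly_Mapping.keys q" and ?Z = "Poly_Mapping.keys r"
  have "Poly_Mapping.keys (p + q) \<subseteq> ?X" by (rule Poly_Mapping.keys_add)
  then show ?thesis
    by (subst (1 2 3) monoid_algebra_mult_superset[of ?X ?Z])
       (auto simp: lookup_add distrib_right single_add sum.distrib)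
qed

lemma monoid_algebra_distrib_left:
  "r \<otimes>\<^bsub>monoid_algebra G\<^esub> (p + q) = r \<otimes>\<^bsub>monoid_algebra G\<^esub> p + r \<otimes>\<^bsub>monoid_algebra G\<^esub> q"
proof -
  let ?X = "Poly_Mapping.keys p \<union> Poly_Mapping.keys q" and ?Z = "Poly_Mapping.keys r"
  have "Poly_Mapping.keys (p + q) \<subseteq> ?X" by (rule Poly_Mapping.keys_add)
  then show ?thesis
    by (subst (1 2 3) monoid_algebra_mult_superset[of ?Z ?X])
       (auto simp: lookup_add distrib_left single_add sum.distrib)
qed

lemma monoid_algebra_mult_single:
  "Poly_Mapping.single x a \<otimes>\<^bsub>monoid_algebra G\<^esub> Poly_Mapping.single y b = Poly_Mapping.single (x \<otimes>\<^bsub>G\<^esub> y) (a * b)"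
  by (subst monoid_algebra_mult_superset[of "{x}" "{y}"]) auto

lemma monoid_algebra_mult_0 [simp]:
  "0 \<otimes>\<^bsub>monoid_algebra G\<^esub> p = 0" "p \<otimes>\<^bsub>monoid_algebra G\<^esub> 0 = 0"
  by (simp_all add: monoid_algebra_def)

context monoid
begin

lemma monoid_algebra_mult_closed:
  assumes "p \<in> carrier (monoid_algebra G)" "q \<in> carrier (monoid_algebra G)"
  shows "p \<otimes>\<^bsub>monoid_algebra G\<^esub> q \<in> carrier (monoid_algebra G)"
  using assms unfolding carrier_monoid_algebra
proof (induction p rule: poly_mapping_keys_induct)
  case (single x c)
  show ?case using single(2)
    by (induction q rule: poly_mapping_keys_induct)
       (use single(1) in \<open>auto simp: monoid_algebra_mult_single monoid_algebra_distrib_left keys_subset_add\<close>)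
qed (auto simp: monoid_algebra_distrib_right keys_subset_add)

lemma monoid_algebra_mult_assoc:
  assumes "p \<in> carrier (monoid_algebra G)" "q \<in> carrier (monoid_algebra G)" "r \<in> carrier (monoid_algebra G)"
  shows "(p \<otimes>\<^bsub>monoid_algebra G\<^esub> q) \<otimes>\<^bsub>monoid_algebra G\<^esub> r = p \<otimes>\<^bsub>monoid_algebra G\<^esub> (q \<otimes>\<^bsub>monoid_algebra G\<^esub> r)"
  using assms unfolding carrier_monoid_algebra
proof (induction p rule: poly_mapping_keys_induct)
  case (single x a)
  show ?case using single(2)
  proof (induction q rule: poly_mapping_keys_induct)
    case (single y b)
    show ?case using assms(3) \<open>x \<in> carrier G\<close> single unfolding carrier_monoid_algebra
      by (induction r rule: poly_mapping_keys_induct)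
         (auto simp: monoid_algebra_mult_single monoid_algebra_distrib_left m_assoc mult.assoc)
  qed (auto simp: monoid_algebra_distrib_right monoid_algebra_distrib_left)
qed (auto simp: monoid_algebra_distrib_right)

lemma monoid_algebra_one_mult:
  assumes "p \<in> carrier (monoid_algebra G)"
  shows "Poly_Mapping.single \<one> 1 \<otimes>\<^bsub>monoid_algebra G\<^esub> p = p" "p \<otimes>\<^bsub>monoid_algebra G\<^esub> Poly_Mapping.single \<one> 1 = p"
  using assms unfolding carrier_monoid_algebra
  by (induction p rule: poly_mapping_keys_induct)
     (auto simp: monoid_algebra_mult_single monoid_algebra_distrib_left monoid_algebra_distrib_right)

lemma ring_monoid_algebra: "ring (monoid_algebra G :: ('k::field, 'a \<Rightarrow>\<^sub>0 'k) module)"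
proof (rule ringI)
  show "abelian_group (monoid_algebra G :: ('k, 'a \<Rightarrow>\<^sub>0 'k) module)"
  proof (rule abelian_groupI)
    fix p :: "'a \<Rightarrow>\<^sub>0 'k" assume "p \<in> carrier (monoid_algebra G)"
    then show "\<exists>q\<in>carrier (monoid_algebra G). q \<oplus>\<^bsub>monoid_algebra G\<^esub> p = \<zero>\<^bsub>monoid_algebra G\<^esub>"
      by (intro bexI[of _ "-p"]) (auto simp: carrier_monoid_algebra)
  qed (auto simp: carrier_monoid_algebra keys_subset_add add.assoc add.commute simp del: keys_add)
  show "monoid (monoid_algebra G :: ('k, 'a \<Rightarrow>\<^sub>0 'k) module)"
    by (rule monoidI)
       (auto simp: monoid_algebra_mult_closed monoid_algebra_mult_assoc monoid_algebra_one_mult single_in_carrier_monoid_algebra)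
qed (simp_all add: monoid_algebra_distrib_left monoid_algebra_distrib_right)

text \<open>Turns scaling into multiplication by a ring element, so that two-sided ideals are stable
  under scalars.\<close>

lemma monoid_algebra_smult_conv:
  assumes "p \<in> carrier (monoid_algebra G)"
  shows "c \<odot>\<^bsub>monoid_algebra G\<^esub> p = Poly_Mapping.single \<one> c \<otimes>\<^bsub>monoid_algebra G\<^esub> p"
  using assms unfolding carrier_monoid_algebra monoid_algebra_simps
proof (induction p rule: poly_mapping_keys_induct)
  case (add p q)
  have "Poly_Mapping.map ((*) c) (p + q) = Poly_Mapping.map ((*) c) p + Poly_Mapping.map ((*) c) q"
    by (rule poly_mapping_eqI) (auto simp: lookup_add Poly_Mapping.map.rep_eq when_def simp flip: distrib_left)
  then show ?case using add by (simp add: monoid_algebra_distrib_left)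
next
  case zero
  show ?case by (rule poly_mapping_eqI) (simp_all add: Poly_Mapping.map.rep_eq)
qed (auto simp: monoid_algebra_mult_single map_single)

end

lemma (in monoid) monoid_algebra_a_inv:
  fixes p :: "'a \<Rightarrow>\<^sub>0 'k::field"
  assumes "p \<in> carrier (monoid_algebra G)"
  shows "\<ominus>\<^bsub>monoid_algebra G\<^esub> p = - p"
proof -
  interpret T: ring "monoid_algebra G :: ('k, 'a \<Rightarrow>\<^sub>0 'k) module" by (rule ring_monoid_algebra)
  show ?thesis using assms by (intro T.minus_equality) (auto simp: carrier_monoid_algebra)
qed

locale monoid_rep = G: monoid G + kspace M sc
  for G :: "('g, 'x) monoid_scheme" and M :: "('a, 'm) ring_scheme" (structure)
    and sc :: "'k::field \<Rightarrow> 'a \<Rightarrow> 'a" +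
  fixes \<theta> :: "'g \<Rightarrow> 'a \<Rightarrow> 'a"
  assumes \<theta>_klin: "g \<in> carrier G \<Longrightarrow> klin M sc M sc (\<theta> g)"
    and \<theta>_one: "x \<in> carrier M \<Longrightarrow> \<theta> \<one>\<^bsub>G\<^esub> x = x"
    and \<theta>_mult: "g \<in> carrier G \<Longrightarrow> h \<in> carrier G \<Longrightarrow> x \<in> carrier M \<Longrightarrow> \<theta> (g \<otimes>\<^bsub>G\<^esub> h) x = \<theta> g (\<theta> h x)"
begin

abbreviation "act \<equiv> lin_act M sc \<theta>"
abbreviation "T \<equiv> (monoid_algebra G :: ('k, 'g \<Rightarrow>\<^sub>0 'k) module)"

lemma \<theta>_closed [simp]: "g \<in> carrier G \<Longrightarrow> x \<in> carrier M \<Longrightarrow> \<theta> g x \<in> carrier M"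
  using \<theta>_klin klin_closed by fast

lemma act_superset:
  assumes "finite X" "X \<subseteq> carrier G" "Poly_Mapping.keys p \<subseteq> X" "x \<in> carrier M"
  shows "act p x = (\<Oplus>g\<in>X. sc (Poly_Mapping.lookup p g) (\<theta> g x))"
  unfolding lin_act_def
  by (rule add.finprod_mono_neutral_cong_left) (use assms in \<open>auto simp: in_keys_iff subset_iff\<close>)

lemma act_0 [simp]: "act 0 x = \<zero>"
  by (simp add: lin_act_def)

lemma act_single:
  assumes "g \<in> carrier G" "x \<in> carrier M"
  shows "act (Poly_Mapping.single g c) x = sc c (\<theta> g x)"
  using act_superset[of "{g}" "Poly_Mapping.single g c" x] assms by simp

lemma act_klin: "p \<in> carrier T \<Longrightarrow> klin M sc M sc (act p)"
  unfolding lin_act_def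
  by (intro klin_sum klin_comp[OF \<theta>_klin sc_klin] kspace_axioms) (auto simp: carrier_monoid_algebra)

lemma act_closed: "p \<in> carrier T \<Longrightarrow> x \<in> carrier M \<Longrightarrow> act p x \<in> carrier M"
  using act_klin klin_closed by fast

lemma act_add:
  assumes "p \<in> carrier T" "q \<in> carrier T" "x \<in> carrier M"
  shows "act (p + q) x = act p x \<oplus> act q x"
proof -
  let ?X = "Poly_Mapping.keys p \<union> Poly_Mapping.keys q"
  have X: "finite ?X" "?X \<subseteq> carrier G" using assms by (auto simp: carrier_monoid_algebra)
  have "Poly_Mapping.keys (p + q) \<subseteq> ?X" by (rule Poly_Mapping.keys_add)
  then have "act (p + q) x = (\<Oplus>g\<in>?X. sc (Poly_Mapping.lookup (p + q) g) (\<theta> g x))"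
    by (rule act_superset[OF X _ assms(3)])
  also have "\<dots> = (\<Oplus>g\<in>?X. sc (Poly_Mapping.lookup p g) (\<theta> g x) \<oplus> sc (Poly_Mapping.lookup q g) (\<theta> g x))"
    using X(2) assms(3) by (intro finsum_cong') (auto simp: lookup_add sc_add_left subset_iff)
  also have "\<dots> = (\<Oplus>g\<in>?X. sc (Poly_Mapping.lookup p g) (\<theta> g x)) \<oplus> (\<Oplus>g\<in>?X. sc (Poly_Mapping.lookup q g) (\<theta> g x))"
    using X(2) assms(3) by (intro finsum_addf) (auto simp: subset_iff)
  also have "\<dots> = act p x \<oplus> act q x"
    using act_superset[OF X Un_upper1 assms(3)] act_superset[OF X Un_upper2 assms(3)] by simp
  finally show ?thesis .
qed

lemma act_uminus:
  assumes "p \<in> carrier T" "x \<in> carrier M"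
  shows "act (- p) x = \<ominus> act p x"
proof -
  have "- p \<in> carrier T" using assms by (simp add: carrier_monoid_algebra)
  then have "act (- p) x \<oplus> act p x = \<zero>" using act_add[of "-p" p x] assms by simp
  then show ?thesis using assms \<open>- p \<in> carrier T\<close> by (simp add: act_closed minus_equality)
qed

lemma act_diff:
  assumes "p \<in> carrier T" "q \<in> carrier T" "x \<in> carrier M"
  shows "act (p - q) x = act p x \<ominus> act q x"
proof -
  have "- q \<in> carrier T" using assms by (simp add: carrier_monoid_algebra)
  then show ?thesis using act_add[of p "-q" x] assms by (simp add: act_uminus a_minus_def)
qed

lemma act_mult:
  assumes "p \<in> carrier T" "q \<in> carrier T" "x \<in> carrier M"
  shows "act (p \<otimes>\<^bsub>T\<^esub> q) x = act p (act q x)"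
  using assms(1) unfolding carrier_monoid_algebra
proof (induction p rule: poly_mapping_keys_induct)
  case (single g c)
  show ?case using assms(2) unfolding carrier_monoid_algebra
  proof (induction q rule: poly_mapping_keys_induct)
    case zero
    then show ?case using single by (simp add: act_single klin_zero[OF \<theta>_klin[OF single] abelian_group_axioms abelian_group_axioms])
  next
    case (single h d)
    then show ?case using \<open>g \<in> carrier G\<close> assms(3)
      by (simp add: monoid_algebra_mult_single act_single \<theta>_mult klin_sc[OF \<theta>_klin] sc_mult)
  next
    case (add p q)
    then have "p \<in> carrier T" "q \<in> carrier T" by (simp_all add: carrier_monoid_algebra)
    then show ?case using add single assms(3)
      by (simp add: monoid_algebra_distrib_left act_add G.monoid_algebra_mult_closed single_in_carrier_monoid_algebra
          klin_add[OF act_klin] act_closed)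
  qed
next
  case (add p r)
  then have "p \<in> carrier T" "r \<in> carrier T" by (simp_all add: carrier_monoid_algebra)
  then show ?case using add assms(2,3)
    by (simp add: monoid_algebra_distrib_right act_add G.monoid_algebra_mult_closed act_closed)
qed simp

lemma act_one: "x \<in> carrier M \<Longrightarrow> act (Poly_Mapping.single \<one>\<^bsub>G\<^esub> 1) x = x"
  by (simp add: act_single \<theta>_one)

text \<open>Combined with the minimality of a generated ideal: if the relations act by zero, so does
  the whole ideal that they generate.\<close>

lemma annihilator_ideal: "ideal {p \<in> carrier T. \<forall>x\<in>carrier M. act p x = \<zero>} T"
proof -
  interpret T: ring T by (rule G.ring_monoid_algebra)
  show ?thesis
  proof (rule idealI[OF G.ring_monoid_algebra])
    show "subgroup {p \<in> carrier T. \<forall>x\<in>carrier M. act p x = \<zero>} (add_monoid T)"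
    proof (rule T.add.subgroupI)
      fix p assume p: "p \<in> {p \<in> carrier T. \<forall>x\<in>carrier M. act p x = \<zero>}"
      then show "\<ominus>\<^bsub>T\<^esub> p \<in> {p \<in> carrier T. \<forall>x\<in>carrier M. act p x = \<zero>}"
        using T.a_inv_closed[of p] by (auto simp: G.monoid_algebra_a_inv act_uminus)
    qed (use T.a_closed T.zero_closed in \<open>auto simp: act_add\<close>)
  next
    fix a p assume ap: "a \<in> {p \<in> carrier T. \<forall>x\<in>carrier M. act p x = \<zero>}" "p \<in> carrier T"
    have "act p \<zero> = \<zero>" by (rule klin_zero[OF act_klin[OF ap(2)] abelian_group_axioms abelian_group_axioms])
    then show "p \<otimes>\<^bsub>T\<^esub> a \<in> {p \<in> carrier T. \<forall>x\<in>carrier M. act p x = \<zero>}"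
      using ap by (auto simp: act_mult G.monoid_algebra_mult_closed)
    show "a \<otimes>\<^bsub>T\<^esub> p \<in> {p \<in> carrier T. \<forall>x\<in>carrier M. act p x = \<zero>}"
      using ap by (auto simp: act_mult G.monoid_algebra_mult_closed act_closed)
  qed
qed

end

subsection \<open>Modules over presented algebras\<close>

text \<open>Replaces only the action, so one and the same space can be made a module over several
  algebras.\<close>

definition with_smult :: "('a, 'm) ring_scheme \<Rightarrow> ('b \<Rightarrow> 'a \<Rightarrow> 'a) \<Rightarrow> ('b, 'a) module" where
  "with_smult M s = \<lparr>carrier = carrier M, monoid.mult = undefined, one = undefined,
     ring.zero = \<zero>\<^bsub>M\<^esub>, add = add M, module.smult = s\<rparr>"

lemma with_smult_simps [simp]:
  "carrier (with_smult M s) = carrier M" "\<zero>\<^bsub>with_smult M s\<^esub> = \<zero>\<^bsub>M\<^esub>" "add (with_smult M s) = add M"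
  "module.smult (with_smult M s) = s"
  by (simp_all add: with_smult_def)

lemma abelian_group_with_smult: "abelian_group M \<Longrightarrow> abelian_group (with_smult M s)"
proof -
  assume "abelian_group M"
  then interpret abelian_group M .
  show ?thesis by (rule abelian_groupI) (auto simp: a_ac intro: l_neg r_neg)
qed

definition scalar_act :: "('k, 'a) module \<Rightarrow> ('a, 'v) module \<Rightarrow> 'k \<Rightarrow> 'v \<Rightarrow> 'v" where
  "scalar_act A M c x = (c \<odot>\<^bsub>A\<^esub> \<one>\<^bsub>A\<^esub>) \<odot>\<^bsub>M\<^esub> x"

text \<open>Quiver Hecke algebras and tensor products of algebras are both quotients of a monoid
  algebra by the ideal of given relations: words in generators in the first case, tuples under
  componentwise multiplication in the second.\<close>

locale presented_algebra = G: monoid G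
  for G :: "('g, 'x) monoid_scheme" and Rel :: "('g \<Rightarrow>\<^sub>0 'k::field) set" +
  assumes Rel_sub: "Rel \<subseteq> carrier (monoid_algebra G)"
begin

abbreviation "T \<equiv> (monoid_algebra G :: ('k, 'g \<Rightarrow>\<^sub>0 'k) module)"
definition "J = Idl\<^bsub>T\<^esub> Rel"
definition "A = quotient_algebra T J"
definition "cls p = J +>\<^bsub>T\<^esub> p"

sublocale T: ring T by (rule G.ring_monoid_algebra)

lemma J_ideal: "ideal J T"
  unfolding J_def by (rule T.genideal_ideal[OF Rel_sub])

sublocale J: ideal J T by (rule J_ideal)

lemma carrier_A: "carrier A = cls ` carrier T"
  unfolding A_def quotient_algebra_def by (auto simp: ring.defs FactRing_def A_RCOSETS_def' cls_def module.defs)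

lemma cls_in [simp]: "p \<in> carrier T \<Longrightarrow> cls p \<in> carrier A"
  by (simp add: carrier_A)

lemma mult_A: "p \<in> carrier T \<Longrightarrow> q \<in> carrier T \<Longrightarrow> cls p \<otimes>\<^bsub>A\<^esub> cls q = cls (p \<otimes>\<^bsub>T\<^esub> q)"
  unfolding A_def quotient_algebra_def cls_def by (simp add: ring.defs FactRing_def J.rcoset_mult_add module.defs)

lemma add_A: "p \<in> carrier T \<Longrightarrow> q \<in> carrier T \<Longrightarrow> cls p \<oplus>\<^bsub>A\<^esub> cls q = cls (p + q)"
  unfolding A_def quotient_algebra_def cls_def using J.a_rcos_sum[of p q] by (simp add: ring.defs FactRing_def module.defs)

lemma one_A: "\<one>\<^bsub>A\<^esub> = cls (Poly_Mapping.single \<one>\<^bsub>G\<^esub> 1)"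
  unfolding A_def quotient_algebra_def cls_def by (simp add: ring.defs FactRing_def module.defs)

lemma self_in_cls: "p \<in> carrier T \<Longrightarrow> p \<in> cls p"
  unfolding cls_def using J.a_rcos_self by blast

lemma cls_eqI: "p \<in> carrier T \<Longrightarrow> q \<in> cls p \<Longrightarrow> cls q = cls p"
  unfolding cls_def using J.a_repr_independence'[of q p] by simp

lemma cls_sub: "p \<in> carrier T \<Longrightarrow> q \<in> cls p \<Longrightarrow> q \<in> carrier T"
  unfolding cls_def using J.a_elemrcos_carrier by fast

lemma cls_Rel: "r \<in> Rel \<Longrightarrow> cls r = cls 0"
proof -
  assume r: "r \<in> Rel"
  then have "r \<in> J" unfolding J_def using T.genideal_self[OF Rel_sub] by auto
  then have "cls r = J" "cls 0 = J"
    unfolding cls_def using J.a_rcos_const J.zero_closed by simp_all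
  then show ?thesis by simp
qed


text \<open>The scalar multiple of a coset is defined as a union over its representatives. All of
  them contribute the same coset, because scaling is a ring multiplication and respects the
  ideal.\<close>

lemma smult_A:
  assumes p: "p \<in> carrier T"
  shows "c \<odot>\<^bsub>A\<^esub> cls p = cls (c \<odot>\<^bsub>T\<^esub> p)"
proof -
  let ?s = "Poly_Mapping.single \<one>\<^bsub>G\<^esub> c"
  have s: "?s \<in> carrier T" by (simp add: carrier_monoid_algebra)
  have *: "cls (c \<odot>\<^bsub>T\<^esub> q) = cls (c \<odot>\<^bsub>T\<^esub> p)" if q: "q \<in> cls p" for q
  proof -
    have qT: "q \<in> carrier T" using cls_sub[OF p q] .
    have "cls (?s \<otimes>\<^bsub>T\<^esub> q) = cls (?s \<otimes>\<^bsub>T\<^esub> p)"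
      using mult_A[OF s p] mult_A[OF s qT] cls_eqI[OF p q] by simp
    then show ?thesis by (simp only: G.monoid_algebra_smult_conv[OF p] G.monoid_algebra_smult_conv[OF qT])
  qed
  have "c \<odot>\<^bsub>A\<^esub> cls p = (\<Union>q\<in>cls p. cls (c \<odot>\<^bsub>T\<^esub> q))"
    unfolding A_def quotient_algebra_def cls_def by (simp add: ring.defs FactRing_def module.defs)
  also have "\<dots> = (\<Union>q\<in>cls p. cls (c \<odot>\<^bsub>T\<^esub> p))" by (rule SUP_cong[OF refl *])
  also have "\<dots> = cls (c \<odot>\<^bsub>T\<^esub> p)" using self_in_cls[OF p] by blast
  finally show ?thesis .
qed

lemma scalar_A: "c \<odot>\<^bsub>A\<^esub> \<one>\<^bsub>A\<^esub> = cls (Poly_Mapping.single \<one>\<^bsub>G\<^esub> c)"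
  by (simp add: one_A smult_A carrier_monoid_algebra map_single)

text \<open>A coset acts through a chosen representative. Two representatives differ by an element
  of \<open>J\<close>, and \<open>J\<close> lies in the annihilator because the relations
  do.\<close>

lemma module_of_rep:
  assumes "monoid_rep G M sc \<theta>" and Rel: "\<And>r x. r \<in> Rel \<Longrightarrow> x \<in> carrier M \<Longrightarrow> lin_act M sc \<theta> r x = \<zero>\<^bsub>M\<^esub>"
  shows "\<exists>s. left_module A (with_smult M s) \<and>
           (\<forall>p\<in>carrier T. \<forall>x\<in>carrier M. s (cls p) x = lin_act M sc \<theta> p x)"
proof -
  interpret M: monoid_rep G M sc \<theta> by fact
  define s where "s X x = M.act (SOME p. p \<in> X) x" for X x
  have s: "s (cls p) x = M.act p x" if p: "p \<in> carrier T" and x: "x \<in> carrier M" for p x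
  proof -
    let ?q = "SOME q. q \<in> cls p"
    have q: "?q \<in> cls p" using self_in_cls[OF p] by (rule someI)
    then have qT: "?q \<in> carrier T" by (rule cls_sub[OF p])
    have "?q \<ominus>\<^bsub>T\<^esub> p \<in> J" using J.a_rcos_module_imp[OF p] q unfolding cls_def a_minus_def by blast
    then have "?q - p \<in> J" using p by (simp add: a_minus_def G.monoid_algebra_a_inv)
    also have "J \<subseteq> {p \<in> carrier T. \<forall>x\<in>carrier M. M.act p x = \<zero>\<^bsub>M\<^esub>}"
      unfolding J_def using Rel Rel_sub by (intro T.genideal_minimal M.annihilator_ideal) auto
    finally have d: "?q - p \<in> carrier T" "M.act (?q - p) x = \<zero>\<^bsub>M\<^esub>" using x by auto
    have "M.act ?q x = M.act (?q - p) x \<oplus>\<^bsub>M\<^esub> M.act p x"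
      using M.act_add[OF d(1) p x] by simp
    then show ?thesis using d p x by (simp add: s_def M.act_closed)
  qed
  have "left_module A (with_smult M s)"
    unfolding left_module_def left_module_axioms_def carrier_A
    by (auto simp: abelian_group_with_smult M.abelian_group_axioms s M.act_closed add_A mult_A one_A
        T.a_closed[simplified] M.act_add G.monoid_algebra_mult_closed M.act_mult single_in_carrier_monoid_algebra
        M.act_one klin_add[OF M.act_klin])
  then show ?thesis using s by blast
qed

text \<open>The converse of \<open>module_of_rep\<close>: the classes of monoid elements act as a
  representation, its linear extension is the given action, and relations act by zero because their
  class is that of 0.\<close>

lemma rep_of_module:
  assumes "left_module A M"
  shows "monoid_rep G M (scalar_act A M) (\<lambda>g x. cls (Poly_Mapping.single g 1) \<odot>\<^bsub>M\<^esub> x)"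
    and "p \<in> carrier T \<Longrightarrow> x \<in> carrier M \<Longrightarrow>
      lin_act M (scalar_act A M) (\<lambda>g x. cls (Poly_Mapping.single g 1) \<odot>\<^bsub>M\<^esub> x) p x = cls p \<odot>\<^bsub>M\<^esub> x"
    and "r \<in> Rel \<Longrightarrow> x \<in> carrier M \<Longrightarrow>
      lin_act M (scalar_act A M) (\<lambda>g x. cls (Poly_Mapping.single g 1) \<odot>\<^bsub>M\<^esub> x) r x = \<zero>\<^bsub>M\<^esub>"
proof -
  interpret M: left_module A M by fact
  let ?\<theta> = "\<lambda>g x. cls (Poly_Mapping.single g 1) \<odot>\<^bsub>M\<^esub> x"
  have single_at [simp]: "Poly_Mapping.single g c \<in> carrier T" if "g \<in> carrier G" for g c
    using that by (rule single_in_carrier_monoid_algebra)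
  have add': "cls (p + q) \<odot>\<^bsub>M\<^esub> x = cls p \<odot>\<^bsub>M\<^esub> x \<oplus>\<^bsub>M\<^esub> cls q \<odot>\<^bsub>M\<^esub> x"
    if "p \<in> carrier T" "q \<in> carrier T" "x \<in> carrier M" for p q x
    using that M.act_add_left[of "cls p" "cls q" x] by (simp add: add_A)
  have mult': "cls p \<odot>\<^bsub>M\<^esub> (cls q \<odot>\<^bsub>M\<^esub> x) = cls (p \<otimes>\<^bsub>T\<^esub> q) \<odot>\<^bsub>M\<^esub> x"
    if "p \<in> carrier T" "q \<in> carrier T" "x \<in> carrier M" for p q x
    using that M.act_mult[of "cls p" "cls q" x] by (simp add: mult_A)
  have one': "cls (Poly_Mapping.single \<one>\<^bsub>G\<^esub> 1) \<odot>\<^bsub>M\<^esub> x = x" if "x \<in> carrier M" for x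
    using M.act_one[OF that] by (simp add: one_A)
  have "kspace M (scalar_act A M)"
  proof
    fix x y and c d :: 'k assume x: "x \<in> carrier M"
    show "scalar_act A M c x \<in> carrier M" using x by (simp add: scalar_act_def scalar_A M.act_closed)
    show "scalar_act A M (c + d) x = scalar_act A M c x \<oplus>\<^bsub>M\<^esub> scalar_act A M d x"
      using x by (simp add: scalar_act_def scalar_A add'[symmetric] single_add)
    show "scalar_act A M (c * d) x = scalar_act A M c (scalar_act A M d x)"
      using x by (simp add: scalar_act_def scalar_A mult' monoid_algebra_mult_single)
    show "scalar_act A M 1 x = x" using x by (simp add: scalar_act_def scalar_A one')
    show "scalar_act A M c (x \<oplus>\<^bsub>M\<^esub> y) = scalar_act A M c x \<oplus>\<^bsub>M\<^esub> scalar_act A M c y" if "y \<in> carrier M"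
      using x that by (simp add: scalar_act_def scalar_A M.act_add_right)
  qed
  then interpret K: kspace M "scalar_act A M" .
  have R: "monoid_rep G M (scalar_act A M) ?\<theta>"
  proof
    fix g h x assume g: "g \<in> carrier G"
    show "klin M (scalar_act A M) M (scalar_act A M) (?\<theta> g)"
      using g by (intro klinI) (auto simp: M.act_closed M.act_add_right scalar_act_def scalar_A mult' monoid_algebra_mult_single)
    show "h \<in> carrier G \<Longrightarrow> x \<in> carrier M \<Longrightarrow> ?\<theta> (g \<otimes>\<^bsub>G\<^esub> h) x = ?\<theta> g (?\<theta> h x)"
      using g by (simp add: mult' monoid_algebra_mult_single)
  qed (simp add: one')
  then show "monoid_rep G M (scalar_act A M) ?\<theta>" .
  interpret R: monoid_rep G M "scalar_act A M" ?\<theta> by (rule R)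
  have zero': "cls 0 \<odot>\<^bsub>M\<^esub> x = \<zero>\<^bsub>M\<^esub>" if "x \<in> carrier M" for x
  proof -
    have z: "0 \<in> carrier T" by (simp add: carrier_monoid_algebra)
    then have "cls 0 \<odot>\<^bsub>M\<^esub> x \<oplus>\<^bsub>M\<^esub> cls 0 \<odot>\<^bsub>M\<^esub> x = cls 0 \<odot>\<^bsub>M\<^esub> x" "cls 0 \<odot>\<^bsub>M\<^esub> x \<in> carrier M"
      using add'[OF z z that] M.act_closed[of "cls 0" x] that by simp_all
    then show ?thesis by (metis M.add.l_cancel_one M.zero_closed)
  qed
  show act: "R.act p x = cls p \<odot>\<^bsub>M\<^esub> x" if "p \<in> carrier T" "x \<in> carrier M" for p x
    using that(1) unfolding carrier_monoid_algebra
  proof (induction p rule: poly_mapping_keys_induct)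
    case zero then show ?case using that zero' by simp
  next
    case (single g c)
    then show ?case using that
      by (simp add: R.act_single) (simp add: scalar_act_def scalar_A mult' monoid_algebra_mult_single)
  next
    case (add p q) then show ?case using that(2)
      by (simp add: R.act_add add' carrier_monoid_algebra)
  qed
  show "R.act r x = \<zero>\<^bsub>M\<^esub>" if "r \<in> Rel" "x \<in> carrier M" for r x
    using that Rel_sub by (subst act) (auto simp: cls_Rel zero')
qed

text \<open>The classes of monoid elements span the quotient, so a linear map that commutes with
  them is a morphism.\<close>

lemma hom_iff:
  assumes "left_module A M" "left_module A N"
  shows "f \<in> left_module_hom A M N \<longleftrightarrow> f \<in> carrier M \<rightarrow>\<^sub>E carrier N \<and> klin M (scalar_act A M) N (scalar_act A N) f \<and>
    (\<forall>g\<in>carrier G. \<forall>x\<in>carrier M. f (cls (Poly_Mapping.single g 1) \<odot>\<^bsub>M\<^esub> x) = cls (Poly_Mapping.single g 1) \<odot>\<^bsub>N\<^esub> f x)"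
    (is "?l \<longleftrightarrow> ?r")
proof
  show ?r if ?l
    using that by (auto simp: left_module_hom_def klin_def scalar_act_def scalar_A carrier_A single_in_carrier_monoid_algebra)
next
  assume r: ?r
  let ?M = "\<lambda>g x. cls (Poly_Mapping.single g 1) \<odot>\<^bsub>M\<^esub> x" and ?N = "\<lambda>g x. cls (Poly_Mapping.single g 1) \<odot>\<^bsub>N\<^esub> x"
  interpret M: monoid_rep G M "scalar_act A M" ?M by (rule rep_of_module[OF assms(1)])
  interpret N: monoid_rep G N "scalar_act A N" ?N by (rule rep_of_module[OF assms(2)])
  have fx: "f x \<in> carrier N" if "x \<in> carrier M" for x using r that by auto
  have k: "klin M (scalar_act A M) N (scalar_act A N) f" using r by blast
  have "f (cls p \<odot>\<^bsub>M\<^esub> x) = cls p \<odot>\<^bsub>N\<^esub> f x" if "p \<in> carrier T" "x \<in> carrier M" for p x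
  proof -
    have "f (M.act p x) = N.act p (f x)"
      using that(1) unfolding carrier_monoid_algebra
    proof (induction p rule: poly_mapping_keys_induct)
      case zero
      then show ?case using klin_zero[OF k M.abelian_group_axioms N.abelian_group_axioms] by simp
    next
      case (single g c)
      then show ?case using that(2) r fx by (simp add: M.act_single N.act_single klin_sc[OF k] del: M.sc_one)
    next
      case (add p q)
      then have "p \<in> carrier T" "q \<in> carrier T" by (simp_all add: carrier_monoid_algebra)
      then show ?case using add that(2) fx by (simp add: M.act_add N.act_add klin_add[OF k] M.act_closed)
    qed
    then show ?thesis using rep_of_module(2)[OF assms(1) that] rep_of_module(2)[OF assms(2) that(1) fx[OF that(2)]] by simp
  qed
  then show ?l using r by (auto simp: left_module_hom_def klin_def carrier_A)
qed

end

subsection \<open>Residue sequences\<close>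

lemma lookup_sum_simple_roots:
  "Poly_Mapping.lookup (\<Sum>i\<leftarrow>is. simple_root i) j = count_list is j"
  by (induction "is") (auto simp: simple_root_def lookup_add lookup_single when_def)

text \<open>The coefficients of the sum of simple roots are the multiplicities of the residues;
  hence the set is closed under permutation of the entries.\<close>

lemma residue_seqs_iff:
  "is \<in> residue_seqs e \<beta> \<longleftrightarrow> set is \<subseteq> vertices e \<and> count_list is = Poly_Mapping.lookup \<beta>"
proof -
  have "(\<Sum>i\<leftarrow>is. simple_root i) = \<beta> \<longleftrightarrow> count_list is = Poly_Mapping.lookup \<beta>"
    by (auto simp: fun_eq_iff poly_mapping_eq_iff lookup_sum_simple_roots)
  then show ?thesis by (simp add: residue_seqs_def)
qed

lemma set_residue_seq: "is \<in> residue_seqs e \<beta> \<Longrightarrow> set is = Poly_Mapping.keys \<beta>"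
  using count_list_0_iff[of "is"] by (auto simp: residue_seqs_iff in_keys_iff)

lemma length_residue_seq: "is \<in> residue_seqs e \<beta> \<Longrightarrow> length is = height \<beta>"
  using sum_count_set[of "is" "Poly_Mapping.keys \<beta>"] set_residue_seq[of "is" e \<beta>]
  by (auto simp: height_def residue_seqs_iff)

lemma finite_residue_seqs: "finite (residue_seqs e \<beta>)"
  by (rule finite_subset[OF _ finite_lists_length_eq[of "Poly_Mapping.keys \<beta>" "height \<beta>"]])
     (auto dest: set_residue_seq length_residue_seq)

lemma swap_entries_conv:
  "r \<in> {1..<length is} \<Longrightarrow> swap_entries r is = is[r - 1 := is ! r, r := is ! (r - 1)]"
  by (simp add: swap_entries_def entry_def)

lemma length_swap_entries [simp]: "length (swap_entries r is) = length is"
  by (simp add: swap_entries_def)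

lemma mset_swap_entries: "r \<in> {1..<length is} \<Longrightarrow> mset (swap_entries r is) = mset is"
  by (simp only: swap_entries_conv) (rule mset_swap; auto)

lemma residue_seqs_mset_cong: "mset is = mset js \<Longrightarrow> is \<in> residue_seqs e \<beta> \<longleftrightarrow> js \<in> residue_seqs e \<beta>"
  by (metis residue_seqs_iff set_mset_mset count_mset ext)

lemma swap_residue_seq: "is \<in> residue_seqs e \<beta> \<Longrightarrow> r \<in> {1..<height \<beta>} \<Longrightarrow> swap_entries r is \<in> residue_seqs e \<beta>"
  using residue_seqs_mset_cong[OF mset_swap_entries] length_residue_seq by metis

subsection \<open>Quiver Hecke relations for families of operators\<close>

text \<open>\<open>psi_square\<close> evaluated on operators. It takes two residues and two
  operators instead of a sequence and a position, so the same expression can be read at r and at the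
  sorted position of r. In the case of a double arrow the product is expanded in its left factor,
  which is how the free algebra acts.\<close>

definition sq_act :: "('a, 'm) ring_scheme \<Rightarrow> nat \<Rightarrow> int \<Rightarrow> int \<Rightarrow> ('a \<Rightarrow> 'a) \<Rightarrow> ('a \<Rightarrow> 'a) \<Rightarrow> 'a \<Rightarrow> 'a" where
  "sq_act M e i j y1 y2 x =
     (if i = j then \<zero>\<^bsub>M\<^esub>
      else if arrow_right e i j then y2 x \<ominus>\<^bsub>M\<^esub> y1 x
      else if arrow_left e i j then y1 x \<ominus>\<^bsub>M\<^esub> y2 x
      else if arrow_both e i j then y2 (y1 x \<ominus>\<^bsub>M\<^esub> y2 x) \<ominus>\<^bsub>M\<^esub> y1 (y1 x \<ominus>\<^bsub>M\<^esub> y2 x)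
      else x)"

text \<open>\<open>braid_error\<close> evaluated on operators, parametrised like
  \<open>sq_act\<close>.\<close>

definition braid_act :: "('a, 'm) ring_scheme \<Rightarrow> nat \<Rightarrow> int \<Rightarrow> int \<Rightarrow> int \<Rightarrow> ('a \<Rightarrow> 'a) \<Rightarrow> ('a \<Rightarrow> 'a) \<Rightarrow> ('a \<Rightarrow> 'a) \<Rightarrow> 'a \<Rightarrow> 'a" where
  "braid_act M e i j l y1 y2 y3 x =
     (if i = l \<and> arrow_right e l j then x
      else if i = l \<and> arrow_left e l j then \<ominus>\<^bsub>M\<^esub> x
      else if i = l \<and> arrow_both e l j then (y1 x \<ominus>\<^bsub>M\<^esub> (y2 x \<oplus>\<^bsub>M\<^esub> y2 x)) \<oplus>\<^bsub>M\<^esub> y3 x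
      else \<zero>\<^bsub>M\<^esub>)"

text \<open>With \<open>D = {1..<n}\<close> this is a module over a quiver Hecke algebra; on its sorted components only the \<open>\<psi>\<^sub>r\<close> with \<open>r\<close> in a smaller \<open>D\<close> act.\<close>

locale qh_rep = kspace M sc for M :: "('a, 'm) ring_scheme" (structure) and sc :: "'k::field \<Rightarrow> 'a \<Rightarrow> 'a" +
  fixes e n :: nat and S :: "int list set" and D :: "nat set"
    and ee :: "int list \<Rightarrow> 'a \<Rightarrow> 'a" and y psi :: "nat \<Rightarrow> 'a \<Rightarrow> 'a"
  assumes finite_S: "finite S" and length_S: "is \<in> S \<Longrightarrow> length is = n"
    and D_sub: "D \<subseteq> {1..<n}" and swap_S: "r \<in> D \<Longrightarrow> is \<in> S \<Longrightarrow> swap_entries r is \<in> S"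
    and ee_klin: "is \<in> S \<Longrightarrow> klin M sc M sc (ee is)"
    and y_klin: "r \<in> {1..n} \<Longrightarrow> klin M sc M sc (y r)"
    and psi_klin: "r \<in> D \<Longrightarrow> klin M sc M sc (psi r)"
    and ee_ee: "is \<in> S \<Longrightarrow> js \<in> S \<Longrightarrow> x \<in> carrier M \<Longrightarrow> ee is (ee js x) = (if is = js then ee is x else \<zero>)"
    and ee_sum: "x \<in> carrier M \<Longrightarrow> (\<Oplus>is\<in>S. ee is x) = x"
    and y_ee: "r \<in> {1..n} \<Longrightarrow> is \<in> S \<Longrightarrow> x \<in> carrier M \<Longrightarrow> y r (ee is x) = ee is (y r x)"
    and psi_ee: "r \<in> D \<Longrightarrow> is \<in> S \<Longrightarrow> x \<in> carrier M \<Longrightarrow> psi r (ee is x) = ee (swap_entries r is) (psi r x)"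
    and y_y: "r \<in> {1..n} \<Longrightarrow> s \<in> {1..n} \<Longrightarrow> x \<in> carrier M \<Longrightarrow> y r (y s x) = y s (y r x)"
    and psi_y_succ: "r \<in> D \<Longrightarrow> is \<in> S \<Longrightarrow> x \<in> carrier M \<Longrightarrow>
      psi r (y (r + 1) (ee is x)) = y r (psi r (ee is x)) \<oplus> (if entry is r = entry is (r + 1) then ee is x else \<zero>)"
    and y_succ_psi: "r \<in> D \<Longrightarrow> is \<in> S \<Longrightarrow> x \<in> carrier M \<Longrightarrow>
      y (r + 1) (psi r (ee is x)) = psi r (y r (ee is x)) \<oplus> (if entry is r = entry is (r + 1) then ee is x else \<zero>)"
    and psi_y: "r \<in> D \<Longrightarrow> s \<in> {1..n} \<Longrightarrow> s \<noteq> r \<Longrightarrow> s \<noteq> r + 1 \<Longrightarrow> x \<in> carrier M \<Longrightarrow> psi r (y s x) = y s (psi r x)"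
    and psi_comm: "r \<in> D \<Longrightarrow> s \<in> D \<Longrightarrow> 1 < \<bar>int r - int s\<bar> \<Longrightarrow> x \<in> carrier M \<Longrightarrow> psi r (psi s x) = psi s (psi r x)"
    and psi_psi: "r \<in> D \<Longrightarrow> is \<in> S \<Longrightarrow> x \<in> carrier M \<Longrightarrow>
      psi r (psi r (ee is x)) = sq_act M e (entry is r) (entry is (r + 1)) (y r) (y (r + 1)) (ee is x)"
    and braid: "r \<in> D \<Longrightarrow> r + 1 \<in> D \<Longrightarrow> is \<in> S \<Longrightarrow> x \<in> carrier M \<Longrightarrow>
      psi r (psi (r + 1) (psi r (ee is x))) = psi (r + 1) (psi r (psi (r + 1) (ee is x))) \<oplus>
        braid_act M e (entry is r) (entry is (r + 1)) (entry is (r + 2)) (y r) (y (r + 1)) (y (r + 2)) (ee is x)"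

abbreviation word_monoid :: "'g set \<Rightarrow> 'g list monoid" where
  "word_monoid G \<equiv> \<lparr>carrier = lists G, monoid.mult = (@), one = []\<rparr>"

lemma monoid_word_monoid: "monoid (word_monoid G)"
  by (rule monoidI) auto

lemma qh_gens_memb: "r \<in> {1..height \<beta>} \<Longrightarrow> Y r \<in> qh_gens e \<beta>" "r \<in> {1..<height \<beta>} \<Longrightarrow> Psi r \<in> qh_gens e \<beta>" "is \<in> residue_seqs e \<beta> \<Longrightarrow> E is \<in> qh_gens e \<beta>"
  by (auto simp: qh_gens_def)

lemma qh_gen_closed: "g \<in> qh_gens e \<beta> \<Longrightarrow> Poly_Mapping.single [g] 1 \<in> carrier (qh_free e \<beta>)"
  unfolding free_algebra_def by (simp add: carrier_monoid_algebra)

lemma qh_free_closed: "0 \<in> carrier (qh_free e \<beta>)" "p \<in> carrier (qh_free e \<beta>) \<Longrightarrow> q \<in> carrier (qh_free e \<beta>) \<Longrightarrow> p + q \<in> carrier (qh_free e \<beta>)"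
  "p \<in> carrier (qh_free e \<beta>) \<Longrightarrow> - p \<in> carrier (qh_free e \<beta>)" "p \<in> carrier (qh_free e \<beta>) \<Longrightarrow> q \<in> carrier (qh_free e \<beta>) \<Longrightarrow> p - q \<in> carrier (qh_free e \<beta>)"
  "p \<in> carrier (qh_free e \<beta>) \<Longrightarrow> q \<in> carrier (qh_free e \<beta>) \<Longrightarrow> p \<otimes>\<^bsub>qh_free e \<beta>\<^esub> q \<in> carrier (qh_free e \<beta>)" "\<one>\<^bsub>qh_free e \<beta>\<^esub> \<in> carrier (qh_free e \<beta>)"
proof -
  show mn: "- p \<in> carrier (qh_free e \<beta>)" if "p \<in> carrier (qh_free e \<beta>)" for p
    using that unfolding free_algebra_def by (simp add: carrier_monoid_algebra)
  show pl: "p + q \<in> carrier (qh_free e \<beta>)" if "p \<in> carrier (qh_free e \<beta>)" "q \<in> carrier (qh_free e \<beta>)" for p q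
    using that unfolding free_algebra_def carrier_monoid_algebra by (rule keys_subset_add)
  show "p \<in> carrier (qh_free e \<beta>) \<Longrightarrow> q \<in> carrier (qh_free e \<beta>) \<Longrightarrow> p - q \<in> carrier (qh_free e \<beta>)"
    using pl[of p "-q"] mn[of q] by simp
qed (simp_all add: free_algebra_def carrier_monoid_algebra[of 0] carrier_monoid_algebra[of "Poly_Mapping.single _ _"] monoid.monoid_algebra_mult_closed[OF monoid_word_monoid])

lemma qh_free_sum_closed: "(\<And>a. a \<in> B \<Longrightarrow> f a \<in> carrier (qh_free e \<beta>)) \<Longrightarrow> sum f B \<in> carrier (qh_free e \<beta>)"
  by (induction B rule: infinite_finite_induct) (auto simp: qh_free_closed)

lemma qh_relations_in: "(qh_relations e \<beta> :: (qh_gen list \<Rightarrow>\<^sub>0 'k::field) set) \<subseteq> carrier (qh_free e \<beta>)"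
proof
  fix p :: "qh_gen list \<Rightarrow>\<^sub>0 'k::field" assume "p \<in> qh_relations e \<beta>"
  then show "p \<in> carrier (qh_free e \<beta>)"
    by cases (auto intro!: qh_free_closed qh_gen_closed qh_free_sum_closed qh_gens_memb swap_residue_seq simp: psi_square_def braid_error_def Let_def)
qed

text \<open>Words form a free monoid, so any linear operators for the letters give a representation.
  \<open>foldr\<close> lets the rightmost letter act first, as a left action requires.\<close>

lemma monoid_rep_foldr:
  assumes "kspace M sc" "\<And>g. g \<in> G \<Longrightarrow> klin M sc M sc (\<rho> g)"
  shows "monoid_rep (word_monoid G) M sc (foldr \<rho>)"
proof -
  interpret kspace M sc by fact
  interpret W: monoid "word_monoid G" by (rule monoid_word_monoid)
  show ?thesis
  proof
    fix w assume "w \<in> carrier (word_monoid G)"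
    then have "w \<in> lists G" by simp
    then show "klin M sc M sc (foldr \<rho> w)"
    proof (induction w)
      case (Cons g w)
      then show ?case using klin_comp[OF Cons.IH assms(2)[OF Cons.hyps(1)]] by (simp add: comp_def)
    qed (simp add: id_def klin_id)
  qed simp_all
qed

text \<open>Operators for the generators before any relation is imposed, that is, a module over the
  free algebra.\<close>

locale qh_ops = kspace M sc for M :: "('a, 'm) ring_scheme" (structure) and sc :: "'k::field \<Rightarrow> 'a \<Rightarrow> 'a" +
  fixes e :: nat and \<beta> :: "int \<Rightarrow>\<^sub>0 nat" and \<rho> :: "qh_gen \<Rightarrow> 'a \<Rightarrow> 'a"
  assumes \<rho>_klin: "g \<in> qh_gens e \<beta> \<Longrightarrow> klin M sc M sc (\<rho> g)"
begin

abbreviation "n \<equiv> height \<beta>"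
abbreviation "S \<equiv> residue_seqs e \<beta>"
abbreviation "F \<equiv> (qh_free e \<beta> :: ('k, qh_gen list \<Rightarrow>\<^sub>0 'k) module)"

sublocale rep: monoid_rep "word_monoid (qh_gens e \<beta>)" M sc "foldr \<rho>"
  by (rule monoid_rep_foldr[OF kspace_axioms \<rho>_klin])

abbreviation "ac \<equiv> lin_act M sc (foldr \<rho>)"

lemma ac_gen: "g \<in> qh_gens e \<beta> \<Longrightarrow> x \<in> carrier M \<Longrightarrow> ac (Poly_Mapping.single [g] 1) x = \<rho> g x"
  using klin_closed[OF \<rho>_klin] by (simp add: rep.act_single)

lemma ac_simps:
  assumes "x \<in> carrier M"
  shows "ac 0 x = \<zero>" "ac \<one>\<^bsub>F\<^esub> x = x"
    "p \<in> carrier F \<Longrightarrow> q \<in> carrier F \<Longrightarrow> ac (p + q) x = ac p x \<oplus> ac q x"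
    "p \<in> carrier F \<Longrightarrow> q \<in> carrier F \<Longrightarrow> ac (p - q) x = ac p x \<ominus> ac q x"
    "p \<in> carrier F \<Longrightarrow> ac (- p) x = \<ominus> ac p x"
    "p \<in> carrier F \<Longrightarrow> q \<in> carrier F \<Longrightarrow> ac (p \<otimes>\<^bsub>F\<^esub> q) x = ac p (ac q x)"
    "p \<in> carrier F \<Longrightarrow> ac p x \<in> carrier M"
  using assms rep.act_one[of x] unfolding free_algebra_def
  by (simp_all add: rep.act_add rep.act_diff rep.act_uminus rep.act_mult rep.act_closed)

lemma ac_sum: "(\<And>a. a \<in> B \<Longrightarrow> f a \<in> carrier F) \<Longrightarrow> x \<in> carrier M \<Longrightarrow> ac (sum f B) x = (\<Oplus>a\<in>B. ac (f a) x)"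
proof (induction B rule: infinite_finite_induct)
  case (insert a B)
  then show ?case by (simp add: ac_simps qh_free_sum_closed Pi_iff)
qed (simp_all add: ac_simps)

lemma minus_eq_zero_iff: "u \<in> carrier M \<Longrightarrow> v \<in> carrier M \<Longrightarrow> u \<ominus> v = \<zero> \<longleftrightarrow> u = v"
  by (metis a_minus_def add.inv_solve_right l_zero minus_closed r_neg zero_closed)

lemma ac_psi_square:
  assumes "r \<in> {1..<n}" "x \<in> carrier M"
  shows "ac (psi_square e \<beta> r is) x = sq_act M e (entry is r) (entry is (r + 1)) (\<rho> (Y r)) (\<rho> (Y (r + 1))) x"
    "psi_square e \<beta> r is \<in> carrier F"
  using assms unfolding psi_square_def sq_act_def Let_def
  by (simp_all add: ac_simps qh_free_closed qh_gen_closed qh_gens_memb ac_gen klin_closed[OF \<rho>_klin] minus_closed)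

lemma ac_braid_error:
  assumes "r \<in> {1..<n}" "r + 1 \<in> {1..<n}" "x \<in> carrier M"
  shows "ac (braid_error e \<beta> r is) x =
      braid_act M e (entry is r) (entry is (r + 1)) (entry is (r + 2)) (\<rho> (Y r)) (\<rho> (Y (r + 1))) (\<rho> (Y (r + 2))) x"
    "braid_error e \<beta> r is \<in> carrier F"
  using assms unfolding braid_error_def braid_act_def Let_def
  by (simp_all add: ac_simps qh_free_closed qh_gen_closed qh_gens_memb ac_gen klin_closed[OF \<rho>_klin] minus_closed)

lemmas ac_eval = ac_simps qh_free_closed qh_gen_closed qh_gens_memb ac_gen klin_closed[OF \<rho>_klin] minus_closed swap_residue_seq
   ac_psi_square ac_braid_error minus_eq_zero_iff

lemma sq_act_closed: "r \<in> {1..<n} \<Longrightarrow> x \<in> carrier M \<Longrightarrow> sq_act M e i j (\<rho> (Y r)) (\<rho> (Y (r + 1))) x \<in> carrier M"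
  unfolding sq_act_def by (simp add: klin_closed[OF \<rho>_klin] minus_closed qh_gens_memb)

lemma braid_act_closed: "r \<in> {1..<n} \<Longrightarrow> r + 1 \<in> {1..<n} \<Longrightarrow> x \<in> carrier M \<Longrightarrow>
   braid_act M e i j l (\<rho> (Y r)) (\<rho> (Y (r + 1))) (\<rho> (Y (r + 2))) x \<in> carrier M"
  unfolding braid_act_def by (simp add: klin_closed[OF \<rho>_klin] minus_closed qh_gens_memb)

text \<open>A relation is encoded as a difference, so it acts by zero exactly when two operators
  agree. After evaluation with \<open>ac_eval\<close> the eleven relations are the last eleven
  axioms of \<open>qh_rep\<close>.\<close>

lemma qh_rep_iff:
  "(\<forall>p\<in>(qh_relations e \<beta> :: (qh_gen list \<Rightarrow>\<^sub>0 'k) set). \<forall>x\<in>carrier M. ac p x = \<zero>) \<longleftrightarrow>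
   qh_rep M sc e n S {1..<n} (\<lambda>is. \<rho> (E is)) (\<lambda>r. \<rho> (Y r)) (\<lambda>r. \<rho> (Psi r))"
  (is "?l \<longleftrightarrow> ?r")
proof
  assume ?l
  then have z: "p \<in> qh_relations e \<beta> \<Longrightarrow> x \<in> carrier M \<Longrightarrow> ac p x = \<zero>" for p x by blast
  show ?r
  proof
    show "finite S" by (rule finite_residue_seqs)
  next
    fix "is" assume "is \<in> S" then show "length is = n" by (rule length_residue_seq)
  next
    fix r "is" assume "r \<in> {1..<n}" "is \<in> S" then show "swap_entries r is \<in> S" by (intro swap_residue_seq)
  next
    fix "is" assume "is \<in> S" then show "klin M sc M sc (\<rho> (E is))" by (intro \<rho>_klin qh_gens_memb)
  next
    fix r assume "r \<in> {1..n}" then show "klin M sc M sc (\<rho> (Y r))" by (intro \<rho>_klin qh_gens_memb)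
  next
    fix r assume "r \<in> {1..<n}" then show "klin M sc M sc (\<rho> (Psi r))" by (intro \<rho>_klin qh_gens_memb)
  next
    fix x "is" js assume "is \<in> S" "js \<in> S" "x \<in> carrier M"
    then show "\<rho> (E is) (\<rho> (E js) x) = (if is = js then \<rho> (E is) x else \<zero>)"
      using z[OF qh_relations.idem_idem[of "is" e \<beta> js], of x]
      by (auto simp: ac_eval split: if_splits)
  next
    fix x assume x: "x \<in> carrier M"
    then show "(\<Oplus>is\<in>S. \<rho> (E is) x) = x"
      using z[OF qh_relations.idem_sum[of e \<beta>] x]
      by (simp add: ac_eval qh_free_sum_closed ac_sum Pi_iff cong: finsum_cong)
  next
    fix x r "is" assume "r \<in> {1..n}" "is \<in> S" "x \<in> carrier M"
    then show "\<rho> (Y r) (\<rho> (E is) x) = \<rho> (E is) (\<rho> (Y r) x)"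
      using z[OF qh_relations.y_idem[of r \<beta> "is" e], of x] by (simp add: ac_eval)
  next
    fix x r "is" assume "r \<in> {1..<n}" "is \<in> S" "x \<in> carrier M"
    then show "\<rho> (Psi r) (\<rho> (E is) x) = \<rho> (E (swap_entries r is)) (\<rho> (Psi r) x)"
      using z[OF qh_relations.psi_idem[of r \<beta> "is" e], of x] by (simp add: ac_eval)
  next
    fix x r s assume "r \<in> {1..n}" "s \<in> {1..n}" "x \<in> carrier M"
    then show "\<rho> (Y r) (\<rho> (Y s) x) = \<rho> (Y s) (\<rho> (Y r) x)"
      using z[OF qh_relations.y_y[of r \<beta> s e], of x] by (simp add: ac_eval)
  next
    fix x r "is" assume "r \<in> {1..<n}" "is \<in> S" "x \<in> carrier M"
    then show "\<rho> (Psi r) (\<rho> (Y (r + 1)) (\<rho> (E is) x)) = \<rho> (Y r) (\<rho> (Psi r) (\<rho> (E is) x)) \<oplus>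
        (if entry is r = entry is (r + 1) then \<rho> (E is) x else \<zero>)"
      using z[OF qh_relations.psi_y_succ[of r \<beta> "is" e], of x] by (simp add: ac_eval split: if_splits)
  next
    fix x r "is" assume "r \<in> {1..<n}" "is \<in> S" "x \<in> carrier M"
    then show "\<rho> (Y (r + 1)) (\<rho> (Psi r) (\<rho> (E is) x)) = \<rho> (Psi r) (\<rho> (Y r) (\<rho> (E is) x)) \<oplus>
        (if entry is r = entry is (r + 1) then \<rho> (E is) x else \<zero>)"
      using z[OF qh_relations.y_succ_psi[of r \<beta> "is" e], of x] by (simp add: ac_eval split: if_splits)
  next
    fix x r s assume "r \<in> {1..<n}" "s \<in> {1..n}" "s \<noteq> r" "s \<noteq> r + 1" "x \<in> carrier M"
    then show "\<rho> (Psi r) (\<rho> (Y s) x) = \<rho> (Y s) (\<rho> (Psi r) x)"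
      using z[OF qh_relations.psi_y_commute[of r \<beta> s e], of x] by (simp add: ac_eval)
  next
    fix x r s assume "r \<in> {1..<n}" "s \<in> {1..<n}" "1 < \<bar>int r - int s\<bar>" "x \<in> carrier M"
    then show "\<rho> (Psi r) (\<rho> (Psi s) x) = \<rho> (Psi s) (\<rho> (Psi r) x)"
      using z[OF qh_relations.psi_psi_commute[of r \<beta> s e], of x] by (simp add: ac_eval)
  next
    fix x r "is" assume "r \<in> {1..<n}" "is \<in> S" "x \<in> carrier M"
    then show "\<rho> (Psi r) (\<rho> (Psi r) (\<rho> (E is) x)) =
       sq_act M e (entry is r) (entry is (r + 1)) (\<rho> (Y r)) (\<rho> (Y (r + 1))) (\<rho> (E is) x)"
      using z[OF qh_relations.psi_psi[of r \<beta> "is" e], of x] sq_act_closed[of r] by (simp add: ac_eval)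
  next
    fix x r "is" assume "r \<in> {1..<n}" "r + 1 \<in> {1..<n}" "is \<in> S" "x \<in> carrier M"
    then show "\<rho> (Psi r) (\<rho> (Psi (r + 1)) (\<rho> (Psi r) (\<rho> (E is) x))) =
       \<rho> (Psi (r + 1)) (\<rho> (Psi r) (\<rho> (Psi (r + 1)) (\<rho> (E is) x))) \<oplus>
       braid_act M e (entry is r) (entry is (r + 1)) (entry is (r + 2)) (\<rho> (Y r)) (\<rho> (Y (r + 1))) (\<rho> (Y (r + 2))) (\<rho> (E is) x)"
      using z[OF qh_relations.braid[of r \<beta> "is" e], of x] braid_act_closed[of r] by (simp add: ac_eval)
  qed simp
next
  assume ?r
  then interpret R: qh_rep M sc e n S "{1..<n}" "\<lambda>is. \<rho> (E is)" "\<lambda>r. \<rho> (Y r)" "\<lambda>r. \<rho> (Psi r)" .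
  show ?l
  proof (intro ballI)
    fix p :: "qh_gen list \<Rightarrow>\<^sub>0 'k" and x assume p: "p \<in> qh_relations e \<beta>" and x: "x \<in> carrier M"
    show "ac p x = \<zero>" using p
    proof cases
      case (idem_idem "is" js) then show ?thesis using x R.ee_ee[of "is" js x] by (simp add: ac_eval)
    next
      case idem_sum then show ?thesis using x R.ee_sum[of x]
        by (simp add: ac_eval qh_free_sum_closed ac_sum Pi_iff cong: finsum_cong)
    next
      case (y_idem r "is") then show ?thesis using x R.y_ee[of r "is" x] by (simp add: ac_eval)
    next
      case (psi_idem r "is") then show ?thesis using x R.psi_ee[of r "is" x] by (simp add: ac_eval)
    next
      case (y_y r s) then show ?thesis using x R.y_y[of r s x] by (simp add: ac_eval)
    next
      case (psi_y_succ r "is") then show ?thesis using x R.psi_y_succ[of r "is" x] by (simp add: ac_eval)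
    next
      case (y_succ_psi r "is") then show ?thesis using x R.y_succ_psi[of r "is" x] by (simp add: ac_eval)
    next
      case (psi_y_commute r s) then show ?thesis using x R.psi_y[of r s x] by (simp add: ac_eval)
    next
      case (psi_psi_commute r s) then show ?thesis using x R.psi_comm[of r s x] by (simp add: ac_eval)
    next
      case (psi_psi r "is") then show ?thesis using x R.psi_psi[of r "is" x] sq_act_closed[of r] by (simp add: ac_eval)
    next
      case (braid r "is") then show ?thesis using x R.braid[of r "is" x] braid_act_closed[of r] by (simp add: ac_eval)
    qed
  qed
qed

end

section \<open>Modules over a quiver Hecke algebra as families of operators\<close>

lemma presented_quiver_hecke:
  "presented_algebra (word_monoid (qh_gens e \<beta>)) (qh_relations e \<beta> :: (qh_gen list \<Rightarrow>\<^sub>0 'k::field) set)"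
  using qh_relations_in[where 'k='k] monoid_word_monoid
  by (auto simp: presented_algebra_def presented_algebra_axioms_def free_algebra_def)

definition qh_elt :: "'k::field itself \<Rightarrow> nat \<Rightarrow> (int \<Rightarrow>\<^sub>0 nat) \<Rightarrow> qh_gen \<Rightarrow> (qh_gen list \<Rightarrow>\<^sub>0 'k) set" where
  "qh_elt K e \<beta> g = presented_algebra.cls (word_monoid (qh_gens e \<beta>)) (qh_relations e \<beta>) (Poly_Mapping.single [g] 1)"

lemma quiver_hecke_conv:
  "quiver_hecke TYPE('k::field) e \<beta> = presented_algebra.A (word_monoid (qh_gens e \<beta>)) (qh_relations e \<beta>)"
  using presented_quiver_hecke[of e \<beta>, where 'k='k]
  by (simp add: quiver_hecke_def presented_algebra.A_def presented_algebra.J_def free_algebra_def)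

context presented_algebra
begin

text \<open>This and the next lemmas are what \<open>algebra_family\<close> asks of the factors of a
  tensor product.\<close>

lemma monoid_A: "monoid A"
  by (rule monoidI) (auto simp: carrier_A mult_A one_A G.monoid_algebra_mult_closed G.monoid_algebra_mult_assoc
      G.monoid_algebra_one_mult single_in_carrier_monoid_algebra intro!: imageI)

lemma add_A_closed: "a \<in> carrier A \<Longrightarrow> b \<in> carrier A \<Longrightarrow> a \<oplus>\<^bsub>A\<^esub> b \<in> carrier A"
  using T.a_closed by (auto simp: carrier_A add_A)

lemma smult_A_closed: "a \<in> carrier A \<Longrightarrow> c \<odot>\<^bsub>A\<^esub> a \<in> carrier A"
proof -
  have "c \<odot>\<^bsub>T\<^esub> p \<in> carrier T" if "p \<in> carrier T" for p
    unfolding G.monoid_algebra_smult_conv[OF that]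
    using that by (intro G.monoid_algebra_mult_closed) (auto simp: carrier_monoid_algebra)
  then show "a \<in> carrier A \<Longrightarrow> c \<odot>\<^bsub>A\<^esub> a \<in> carrier A"
    by (auto simp: carrier_A smult_A simp del: monoid_algebra_simps)
qed

lemma smult_A_central: "a \<in> carrier A \<Longrightarrow> a \<otimes>\<^bsub>A\<^esub> (c \<odot>\<^bsub>A\<^esub> \<one>\<^bsub>A\<^esub>) = (c \<odot>\<^bsub>A\<^esub> \<one>\<^bsub>A\<^esub>) \<otimes>\<^bsub>A\<^esub> a"
proof -
  have "p \<otimes>\<^bsub>T\<^esub> Poly_Mapping.single \<one>\<^bsub>G\<^esub> c = Poly_Mapping.single \<one>\<^bsub>G\<^esub> c \<otimes>\<^bsub>T\<^esub> p" if "p \<in> carrier T" for p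
    using that unfolding carrier_monoid_algebra
    by (induction p rule: poly_mapping_keys_induct)
       (auto simp: monoid_algebra_mult_single monoid_algebra_distrib_left monoid_algebra_distrib_right mult.commute)
  then show "a \<in> carrier A \<Longrightarrow> ?thesis"
    by (auto simp: scalar_A carrier_A mult_A carrier_monoid_algebra[of "Poly_Mapping.single _ _"])
qed

lemma smult_A_conv: "a \<in> carrier A \<Longrightarrow> c \<odot>\<^bsub>A\<^esub> a = (c \<odot>\<^bsub>A\<^esub> \<one>\<^bsub>A\<^esub>) \<otimes>\<^bsub>A\<^esub> a"
  by (auto simp: scalar_A carrier_A smult_A mult_A carrier_monoid_algebra G.monoid_algebra_smult_conv
      simp del: monoid_algebra_simps)

end

text \<open>In a module a word acts at once, in \<open>qh_ops\<close> letter by letter;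
  multiplicativity of \<theta> makes the two agree.\<close>

lemma word_act_foldr:
  assumes "monoid_rep (word_monoid G) M sc \<theta>" "w \<in> lists G" "x \<in> carrier M"
  shows "foldr (\<lambda>g. \<theta> [g]) w x = \<theta> w x"
  using assms(2)
proof (induction w)
  case Nil
  then show ?case using monoid_rep.\<theta>_one[OF assms(1,3)] by simp
next
  case (Cons g w)
  then show ?case using monoid_rep.\<theta>_mult[OF assms(1), of "[g]" w x] assms(3) by simp
qed

context
  fixes e :: nat and \<beta> :: "int \<Rightarrow>\<^sub>0 nat" and QH and elt
  defines "QH \<equiv> quiver_hecke TYPE('k::field) e \<beta>" and "elt \<equiv> qh_elt TYPE('k) e \<beta>"
begin

interpretation P: presented_algebra "word_monoid (qh_gens e \<beta>)" "qh_relations e \<beta> :: (qh_gen list \<Rightarrow>\<^sub>0 'k) set"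
  by (rule presented_quiver_hecke)

lemma QH_conv: "QH = P.A" unfolding QH_def by (rule quiver_hecke_conv)

lemma qh_elt_in: "g \<in> qh_gens e \<beta> \<Longrightarrow> elt g \<in> carrier QH"
  by (simp add: QH_conv elt_def qh_elt_def single_in_carrier_monoid_algebra)

lemma qh_rep_of_module:
  assumes "left_module QH M"
  shows "qh_rep M (scalar_act QH M) e (height \<beta>) (residue_seqs e \<beta>) {1..<height \<beta>}
    (\<lambda>is x. elt (E is) \<odot>\<^bsub>M\<^esub> x) (\<lambda>r x. elt (Y r) \<odot>\<^bsub>M\<^esub> x) (\<lambda>r x. elt (Psi r) \<odot>\<^bsub>M\<^esub> x)"
proof -
  let ?\<theta> = "\<lambda>w x. P.cls (Poly_Mapping.single w 1) \<odot>\<^bsub>M\<^esub> x" and ?\<rho> = "\<lambda>g x. elt g \<odot>\<^bsub>M\<^esub> x"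
  have M: "left_module P.A M" using assms by (simp add: QH_conv)
  have mr: "monoid_rep (word_monoid (qh_gens e \<beta>)) M (scalar_act P.A M) ?\<theta>"
    by (rule P.rep_of_module(1)[OF M])
  interpret R: monoid_rep "word_monoid (qh_gens e \<beta>)" M "scalar_act P.A M" ?\<theta> by (rule mr)
  interpret Q: qh_ops M "scalar_act P.A M" e \<beta> ?\<rho>
    by unfold_locales (use R.\<theta>_klin in \<open>simp add: elt_def qh_elt_def\<close>)
  have "Q.ac p x = \<zero>\<^bsub>M\<^esub>" if p: "p \<in> qh_relations e \<beta>" and x: "x \<in> carrier M" for p x
  proof -
    have keys: "Poly_Mapping.keys p \<subseteq> lists (qh_gens e \<beta>)"
      using subsetD[OF P.Rel_sub p] by (simp add: carrier_monoid_algebra)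
    have "Q.ac p x = R.act p x"
      unfolding lin_act_def
    proof (intro R.finsum_cong' refl)
      show "(\<lambda>w. scalar_act P.A M (Poly_Mapping.lookup p w) (?\<theta> w x)) \<in> Poly_Mapping.keys p \<rightarrow> carrier M"
        using subsetD[OF keys] R.\<theta>_closed[OF _ x] by (intro Pi_I R.sc_closed) simp
      show "scalar_act P.A M (Poly_Mapping.lookup p w) (foldr ?\<rho> w x) =
          scalar_act P.A M (Poly_Mapping.lookup p w) (?\<theta> w x)" if "w \<in> Poly_Mapping.keys p" for w
        unfolding elt_def qh_elt_def using word_act_foldr[OF mr subsetD[OF keys that] x] by simp
    qed
    then show ?thesis using P.rep_of_module(3)[OF M p x] by simp
  qed
  then show ?thesis using Q.qh_rep_iff by (simp add: QH_conv)
qed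

text \<open>The converse of \<open>qh_rep_of_module\<close>. It also keeps track of the scalars,
  since tensor factors will have to share them.\<close>

lemma module_of_qh_rep:
  assumes "qh_rep M sc e (height \<beta>) (residue_seqs e \<beta>) {1..<height \<beta>} ee y ps"
  shows "\<exists>s. left_module QH (with_smult M s) \<and>
    (\<forall>c. \<forall>x\<in>carrier M. scalar_act QH (with_smult M s) c x = sc c x) \<and>
    (\<forall>x\<in>carrier M. (\<forall>is\<in>residue_seqs e \<beta>. s (elt (E is)) x = ee is x) \<and>
      (\<forall>r\<in>{1..height \<beta>}. s (elt (Y r)) x = y r x) \<and> (\<forall>r\<in>{1..<height \<beta>}. s (elt (Psi r)) x = ps r x))"
proof -
  define \<rho> where "\<rho> g = (case g of Psi r \<Rightarrow> ps r | Y r \<Rightarrow> y r | E is \<Rightarrow> ee is)" for g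
  interpret R: qh_rep M sc e "height \<beta>" "residue_seqs e \<beta>" "{1..<height \<beta>}" ee y ps by fact
  interpret Q: qh_ops M sc e \<beta> \<rho>
    by unfold_locales (auto simp: qh_gens_def \<rho>_def R.ee_klin R.y_klin R.psi_klin)
  have "qh_rep M sc e (height \<beta>) (residue_seqs e \<beta>) {1..<height \<beta>} (\<lambda>is. \<rho> (E is)) (\<lambda>r. \<rho> (Y r)) (\<lambda>r. \<rho> (Psi r))"
    using assms by (simp add: \<rho>_def)
  then have "\<forall>p\<in>qh_relations e \<beta>. \<forall>x\<in>carrier M. Q.ac p x = \<zero>\<^bsub>M\<^esub>" using Q.qh_rep_iff by blast
  then obtain s where s: "left_module P.A (with_smult M s)"
      "\<And>p x. p \<in> carrier P.T \<Longrightarrow> x \<in> carrier M \<Longrightarrow> s (P.cls p) x = Q.ac p x"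
    using P.module_of_rep[OF Q.rep.monoid_rep_axioms] by blast
  have "s (elt g) x = \<rho> g x" if "g \<in> qh_gens e \<beta>" "x \<in> carrier M" for g x
    using that s(2)[of "Poly_Mapping.single [g] 1" x]
    by (simp add: elt_def qh_elt_def single_in_carrier_monoid_algebra Q.ac_gen)
  moreover have "scalar_act P.A (with_smult M s) c x = sc c x" if "x \<in> carrier M" for c x
    using that s(2)[of "Poly_Mapping.single [] c" x]
    by (simp add: scalar_act_def P.scalar_A single_in_carrier_monoid_algebra Q.rep.act_single)
  ultimately show ?thesis
    using s(1) unfolding QH_conv by (intro exI[of _ s]) (auto simp: \<rho>_def qh_gens_def)
qed

text \<open>Commuting with the generators extends to words by induction on their length, and words
  determine a morphism by \<open>hom_iff\<close>.\<close>

lemma qh_hom_iff: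
  assumes "left_module QH M" "left_module QH N"
  shows "f \<in> left_module_hom QH M N \<longleftrightarrow> f \<in> carrier M \<rightarrow>\<^sub>E carrier N \<and> klin M (scalar_act QH M) N (scalar_act QH N) f \<and>
    (\<forall>g\<in>qh_gens e \<beta>. \<forall>x\<in>carrier M. f (elt g \<odot>\<^bsub>M\<^esub> x) = elt g \<odot>\<^bsub>N\<^esub> f x)"
proof -
  have M: "left_module P.A M" and N: "left_module P.A N" using assms by (simp_all add: QH_conv)
  let ?M = "\<lambda>w x. P.cls (Poly_Mapping.single w 1) \<odot>\<^bsub>M\<^esub> x" and ?N = "\<lambda>w x. P.cls (Poly_Mapping.single w 1) \<odot>\<^bsub>N\<^esub> x"
  interpret M: monoid_rep "word_monoid (qh_gens e \<beta>)" M "scalar_act P.A M" ?M by (rule P.rep_of_module(1)[OF M])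
  interpret N: monoid_rep "word_monoid (qh_gens e \<beta>)" N "scalar_act P.A N" ?N by (rule P.rep_of_module(1)[OF N])
  have "f (?M w x) = ?N w (f x)"
    if f: "f \<in> carrier M \<rightarrow> carrier N" "\<forall>g\<in>qh_gens e \<beta>. \<forall>x\<in>carrier M. f (elt g \<odot>\<^bsub>M\<^esub> x) = elt g \<odot>\<^bsub>N\<^esub> f x"
      and w: "w \<in> lists (qh_gens e \<beta>)" and x: "x \<in> carrier M" for w x
    using w
  proof (induction w)
    case Nil
    show ?case using M.\<theta>_one[OF x] N.\<theta>_one[OF funcset_mem[OF f(1) x]] by simp
  next
    case (Cons g w)
    have fx: "f x \<in> carrier N" using f x by auto
    have mx: "?M w x \<in> carrier M" using M.\<theta>_closed[of w x] Cons.hyps x by simp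
    have "f (?M (g # w) x) = f (?M [g] (?M w x))"
      using M.\<theta>_mult[of "[g]" w x] Cons.hyps x by simp
    also have "\<dots> = ?N [g] (f (?M w x))"
      using f(2) Cons.hyps mx by (simp add: elt_def qh_elt_def)
    also have "\<dots> = ?N (g # w) (f x)"
      using N.\<theta>_mult[of "[g]" w "f x"] Cons fx by simp
    finally show ?case .
  qed
  moreover have "[g] \<in> lists (qh_gens e \<beta>)" if "g \<in> qh_gens e \<beta>" for g using that by simp
  ultimately show ?thesis
    unfolding QH_conv P.hom_iff[OF M N] by (auto simp: PiE_iff elt_def qh_elt_def)
qed

end

lemma monoid_algebra_closed:
  fixes p q :: "'g \<Rightarrow>\<^sub>0 'k::field"
  shows "p \<in> carrier (monoid_algebra G) \<Longrightarrow> q \<in> carrier (monoid_algebra G) \<Longrightarrow> p + q \<in> carrier (monoid_algebra G)"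
    and "p \<in> carrier (monoid_algebra G) \<Longrightarrow> - p \<in> carrier (monoid_algebra G)"
    and "p \<in> carrier (monoid_algebra G) \<Longrightarrow> q \<in> carrier (monoid_algebra G) \<Longrightarrow> p - q \<in> carrier (monoid_algebra G)"
  using keys_subset_add[of p "carrier G" q] keys_subset_add[of p "carrier G" "- q"]
  by (simp_all add: carrier_monoid_algebra)

subsection \<open>Modules over tensor products of algebras\<close>

text \<open>The list \<open>L\<close> fixes an order in which the components of a tuple act one
  after another.\<close>

locale algebra_family =
  fixes I :: "'i set" and A :: "'i \<Rightarrow> ('k::field, 'a) module" and L :: "'i list"
  assumes monoid_A: "i \<in> I \<Longrightarrow> monoid (A i)"
    and add_closed: "i \<in> I \<Longrightarrow> a \<in> carrier (A i) \<Longrightarrow> b \<in> carrier (A i) \<Longrightarrow> a \<oplus>\<^bsub>A i\<^esub> b \<in> carrier (A i)"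
    and smult_closed: "i \<in> I \<Longrightarrow> a \<in> carrier (A i) \<Longrightarrow> c \<odot>\<^bsub>A i\<^esub> a \<in> carrier (A i)"
    and smult_conv: "i \<in> I \<Longrightarrow> a \<in> carrier (A i) \<Longrightarrow> c \<odot>\<^bsub>A i\<^esub> a = (c \<odot>\<^bsub>A i\<^esub> \<one>\<^bsub>A i\<^esub>) \<otimes>\<^bsub>A i\<^esub> a"
    and smult_central: "i \<in> I \<Longrightarrow> a \<in> carrier (A i) \<Longrightarrow>
      a \<otimes>\<^bsub>A i\<^esub> (c \<odot>\<^bsub>A i\<^esub> \<one>\<^bsub>A i\<^esub>) = (c \<odot>\<^bsub>A i\<^esub> \<one>\<^bsub>A i\<^esub>) \<otimes>\<^bsub>A i\<^esub> a"
    and L: "distinct L" "set L = I"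
begin

abbreviation "G \<equiv> product_group I A"
abbreviation "Rel \<equiv> multilinear_relations I A"

lemma one_in: "i \<in> I \<Longrightarrow> \<one>\<^bsub>A i\<^esub> \<in> carrier (A i)"
  using monoid_A by (rule monoid.one_closed)

lemma upd_in: "t \<in> (\<Pi>\<^sub>E i\<in>I. carrier (A i)) \<Longrightarrow> i \<in> I \<Longrightarrow> a \<in> carrier (A i) \<Longrightarrow> t(i := a) \<in> (\<Pi>\<^sub>E i\<in>I. carrier (A i))"
  by (auto simp: PiE_iff extensional_def)

lemma monoid_G: "monoid G"
  by (rule monoidI) (auto simp: monoid_A monoid.m_closed monoid.m_assoc one_in monoid.l_one monoid.r_one PiE_iff extensional_def fun_eq_iff)

sublocale P: presented_algebra G Rel
proof (intro presented_algebra.intro monoid_G presented_algebra_axioms.intro subsetI)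
  fix p :: "('i \<Rightarrow> 'a) \<Rightarrow>\<^sub>0 'k" assume "p \<in> Rel"
  then show "p \<in> carrier (monoid_algebra G)"
  proof cases
    case (additive x i a b)
    have s: "Poly_Mapping.single (x(i := d)) 1 \<in> carrier (monoid_algebra G)" if "d \<in> carrier (A i)" for d
      using additive upd_in that by (intro single_in_carrier_monoid_algebra) simp
    show ?thesis using additive add_closed by (auto intro!: monoid_algebra_closed s)
  next
    case (homogeneous x i a c)
    have s: "Poly_Mapping.single (x(i := d)) c \<in> carrier (monoid_algebra G)" if "d \<in> carrier (A i)" for d and c :: 'k
      using homogeneous upd_in that by (intro single_in_carrier_monoid_algebra) simp
    show ?thesis using homogeneous smult_closed by (auto intro!: monoid_algebra_closed s)
  qed
qed

lemma tensor_algebras_conv: "tensor_algebras I A = P.A"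
  by (simp add: tensor_algebras_def P.A_def P.J_def Let_def)

definition telt :: "('i \<Rightarrow> 'a) \<Rightarrow> (('i \<Rightarrow> 'a) \<Rightarrow>\<^sub>0 'k) set" where
  "telt t = P.cls (Poly_Mapping.single t 1)"

text \<open>The tuple of the pure tensor with \<open>a\<close> in slot i and units elsewhere; it
  realises the embedding of the i-th factor.\<close>

definition comp_tuple :: "'i \<Rightarrow> 'a \<Rightarrow> 'i \<Rightarrow> 'a" where
  "comp_tuple i a = (\<lambda>j\<in>I. \<one>\<^bsub>A j\<^esub>)(i := a)"

lemma comp_tuple_in: "i \<in> I \<Longrightarrow> a \<in> carrier (A i) \<Longrightarrow> comp_tuple i a \<in> (\<Pi>\<^sub>E i\<in>I. carrier (A i))"
  unfolding comp_tuple_def by (rule upd_in) (auto simp: one_in)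

abbreviation "TA \<equiv> tensor_algebras I A"

context
  fixes N :: "((('i \<Rightarrow> 'a) \<Rightarrow>\<^sub>0 'k) set, 'v) module"
  assumes N: "left_module TA N"
begin

lemma left_module_presented: "left_module P.A N" using N by (simp add: tensor_algebras_conv)

lemma tensor_rep: "monoid_rep G N (scalar_act TA N) (\<lambda>t x. telt t \<odot>\<^bsub>N\<^esub> x)"
  unfolding tensor_algebras_conv telt_def using P.rep_of_module(1)[OF left_module_presented] .

interpretation R: monoid_rep G N "scalar_act TA N" "\<lambda>t x. telt t \<odot>\<^bsub>N\<^esub> x" by (rule tensor_rep)

lemma kspace_tensor: "kspace N (scalar_act TA N)" by (rule R.kspace_axioms)

lemma telt_mult:
  "t \<in> (\<Pi>\<^sub>E i\<in>I. carrier (A i)) \<Longrightarrow> u \<in> (\<Pi>\<^sub>E i\<in>I. carrier (A i)) \<Longrightarrow> x \<in> carrier N \<Longrightarrow>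
    telt t \<odot>\<^bsub>N\<^esub> (telt u \<odot>\<^bsub>N\<^esub> x) = telt (\<lambda>i\<in>I. t i \<otimes>\<^bsub>A i\<^esub> u i) \<odot>\<^bsub>N\<^esub> x"
  using R.\<theta>_mult[of t u x] by simp

lemma telt_klin: "t \<in> (\<Pi>\<^sub>E i\<in>I. carrier (A i)) \<Longrightarrow> klin N (scalar_act TA N) N (scalar_act TA N) (\<lambda>x. telt t \<odot>\<^bsub>N\<^esub> x)"
  using R.\<theta>_klin[of t] by simp

text \<open>The multilinear relation acts by zero. Adding its subtracted part back on both sides
  turns this into the desired equation without handling negatives in \<open>N\<close>.\<close>

lemma telt_additive:
  assumes t: "t \<in> (\<Pi>\<^sub>E i\<in>I. carrier (A i))" and i: "i \<in> I" and ab: "a \<in> carrier (A i)" "b \<in> carrier (A i)" and x: "x \<in> carrier N"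
  shows "telt (t(i := a \<oplus>\<^bsub>A i\<^esub> b)) \<odot>\<^bsub>N\<^esub> x = telt (t(i := a)) \<odot>\<^bsub>N\<^esub> x \<oplus>\<^bsub>N\<^esub> telt (t(i := b)) \<odot>\<^bsub>N\<^esub> x"
proof -
  let ?r = "Poly_Mapping.single (t(i := a \<oplus>\<^bsub>A i\<^esub> b)) 1 -
    (Poly_Mapping.single (t(i := a)) 1 + Poly_Mapping.single (t(i := b)) 1) :: ('i \<Rightarrow> 'a) \<Rightarrow>\<^sub>0 'k"
  let ?u = "Poly_Mapping.single (t(i := a)) 1 + Poly_Mapping.single (t(i := b)) 1 :: ('i \<Rightarrow> 'a) \<Rightarrow>\<^sub>0 'k"
  have s: "Poly_Mapping.single (t(i := d)) 1 \<in> carrier R.T" if "d \<in> carrier (A i)" for d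
    using upd_in[OF t i that] by (intro single_in_carrier_monoid_algebra) simp
  have u: "?u \<in> carrier R.T"
    using s ab by (intro monoid_algebra_closed)
  have rr: "?r \<in> Rel" by (rule multilinear_relations.additive[OF t i ab])
  then have r: "?r \<in> carrier R.T" using P.Rel_sub by blast
  have "R.act ?r x = \<zero>\<^bsub>N\<^esub>"
    using P.rep_of_module(3)[OF left_module_presented rr x] unfolding tensor_algebras_conv telt_def .
  then have "R.act (?r + ?u) x = R.act ?u x"
    using r u x by (simp only: R.act_add R.l_zero R.act_closed)
  then show ?thesis
    using s ab x add_closed[OF i ab] upd_in[OF t i] by (simp add: R.act_add R.act_single)
qed

lemma telt_homogeneous:
  assumes t: "t \<in> (\<Pi>\<^sub>E i\<in>I. carrier (A i))" and i: "i \<in> I" and a: "a \<in> carrier (A i)" and x: "x \<in> carrier N"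
  shows "telt (t(i := c \<odot>\<^bsub>A i\<^esub> a)) \<odot>\<^bsub>N\<^esub> x = scalar_act TA N c (telt (t(i := a)) \<odot>\<^bsub>N\<^esub> x)"
proof -
  let ?r = "Poly_Mapping.single (t(i := c \<odot>\<^bsub>A i\<^esub> a)) 1 - Poly_Mapping.single (t(i := a)) c :: ('i \<Rightarrow> 'a) \<Rightarrow>\<^sub>0 'k"
  let ?u = "Poly_Mapping.single (t(i := a)) c :: ('i \<Rightarrow> 'a) \<Rightarrow>\<^sub>0 'k"
  have u: "?u \<in> carrier R.T"
    using upd_in[OF t i a] by (intro single_in_carrier_monoid_algebra) simp
  have rr: "?r \<in> Rel" by (rule multilinear_relations.homogeneous[OF t i a])
  then have r: "?r \<in> carrier R.T" using P.Rel_sub by blast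
  have "R.act ?r x = \<zero>\<^bsub>N\<^esub>"
    using P.rep_of_module(3)[OF left_module_presented rr x] unfolding tensor_algebras_conv telt_def .
  then have "R.act (?r + ?u) x = R.act ?u x"
    using r u x by (simp only: R.act_add R.l_zero R.act_closed)
  then show ?thesis
    using a x smult_closed[OF i a] upd_in[OF t i] by (simp add: R.act_single)
qed

lemma telt_one: "x \<in> carrier N \<Longrightarrow> telt (\<lambda>j\<in>I. \<one>\<^bsub>A j\<^esub>) \<odot>\<^bsub>N\<^esub> x = x"
  using R.\<theta>_one[of x] by simp

lemma comp_tuple_mult:
  "i \<in> I \<Longrightarrow> a \<in> carrier (A i) \<Longrightarrow> t \<in> (\<Pi>\<^sub>E i\<in>I. carrier (A i)) \<Longrightarrow> x \<in> carrier N \<Longrightarrow>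
    telt (comp_tuple i a) \<odot>\<^bsub>N\<^esub> (telt t \<odot>\<^bsub>N\<^esub> x) = telt (t(i := a \<otimes>\<^bsub>A i\<^esub> t i)) \<odot>\<^bsub>N\<^esub> x"
  by (subst telt_mult[OF comp_tuple_in])
     (auto intro!: arg_cong[where f = "\<lambda>t. telt t \<odot>\<^bsub>N\<^esub> x"]
       simp: fun_eq_iff comp_tuple_def PiE_iff extensional_def monoid.l_one[OF monoid_A])

text \<open>Restriction of \<open>N\<close> along the embedding of the i-th factor. By homogeneity
  in slot i it carries the scalars of \<open>N\<close>, whatever i is.\<close>

definition comp_module :: "'i \<Rightarrow> ('a, 'v) module" where
  "comp_module i = with_smult N (\<lambda>a x. telt (comp_tuple i a) \<odot>\<^bsub>N\<^esub> x)"

lemma comp_module: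
  assumes i: "i \<in> I"
  shows "left_module (A i) (comp_module i)"
    and "x \<in> carrier N \<Longrightarrow> scalar_act (A i) (comp_module i) c x = scalar_act TA N c x"
proof -
  have one: "(\<lambda>j\<in>I. \<one>\<^bsub>A j\<^esub>) \<in> (\<Pi>\<^sub>E i\<in>I. carrier (A i))" by (auto simp: one_in)
  have ct: "comp_tuple i \<one>\<^bsub>A i\<^esub> = (\<lambda>j\<in>I. \<one>\<^bsub>A j\<^esub>)" using i by (auto simp: comp_tuple_def fun_eq_iff)
  have "comp_tuple i a i = a" "(comp_tuple i a)(i := b) = comp_tuple i b" for a b
    by (simp_all add: comp_tuple_def)
  then show "left_module (A i) (comp_module i)"
    unfolding left_module_def left_module_axioms_def comp_module_def
    using telt_additive[OF one i] comp_tuple_in[OF i] klin_closed[OF telt_klin] klin_add[OF telt_klin]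
    by (simp add: abelian_group_with_smult R.abelian_group_axioms comp_tuple_mult[OF i] telt_one ct)
       (simp add: comp_tuple_def)
  show "scalar_act (A i) (comp_module i) c x = scalar_act TA N c x" if "x \<in> carrier N"
    using telt_homogeneous[OF one i one_in[OF i] that, of c] telt_one[OF that] ct
    by (simp add: comp_module_def scalar_act_def comp_tuple_def)
qed

text \<open>A pure tensor is the product of its components placed in their own slots. The induction
  fills the slots of a sublist and leaves units in the others.\<close>

lemma telt_foldr:
  assumes t: "t \<in> (\<Pi>\<^sub>E i\<in>I. carrier (A i))" and x: "x \<in> carrier N"
  shows "telt t \<odot>\<^bsub>N\<^esub> x = foldr (\<lambda>i x. telt (comp_tuple i (t i)) \<odot>\<^bsub>N\<^esub> x) L x"
proof -
  have "foldr (\<lambda>i x. telt (comp_tuple i (t i)) \<odot>\<^bsub>N\<^esub> x) K x = telt (\<lambda>i\<in>I. if i \<in> set K then t i else \<one>\<^bsub>A i\<^esub>) \<odot>\<^bsub>N\<^esub> x"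
    if "distinct K" "set K \<subseteq> I" for K
    using that
  proof (induction K)
    case Nil then show ?case using telt_one[OF x] by (simp add: restrict_def)
  next
    case (Cons i K)
    let ?u = "\<lambda>i\<in>I. if i \<in> set K then t i else \<one>\<^bsub>A i\<^esub>"
    have i: "i \<in> I" "t i \<in> carrier (A i)" using Cons t by auto
    have u: "?u \<in> (\<Pi>\<^sub>E i\<in>I. carrier (A i))" using t by (auto simp: one_in)
    have eq: "?u(i := t i \<otimes>\<^bsub>A i\<^esub> ?u i) = (\<lambda>j\<in>I. if j \<in> set (i # K) then t j else \<one>\<^bsub>A j\<^esub>)"
      using Cons.prems i monoid.r_one[OF monoid_A[OF i(1)] i(2)] by (auto simp: fun_eq_iff)
    show ?case using Cons comp_tuple_mult[OF i u x] unfolding eq by (simp add: restrict_def)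
  qed
  from this[of L] L have "foldr (\<lambda>i x. telt (comp_tuple i (t i)) \<odot>\<^bsub>N\<^esub> x) L x = telt (\<lambda>i\<in>I. t i) \<odot>\<^bsub>N\<^esub> x"
    by (simp add: restrict_def cong: if_cong)
  then show ?thesis using t by (metis PiE_restrict)
qed

end

lemma tensor_hom_iff:
  assumes N: "left_module TA N" and N2: "left_module TA N2"
  shows "f \<in> left_module_hom TA N N2 \<longleftrightarrow> f \<in> carrier N \<rightarrow>\<^sub>E carrier N2 \<and>
    klin N (scalar_act TA N) N2 (scalar_act TA N2) f \<and>
    (\<forall>t\<in>(\<Pi>\<^sub>E i\<in>I. carrier (A i)). \<forall>x\<in>carrier N. f (telt t \<odot>\<^bsub>N\<^esub> x) = telt t \<odot>\<^bsub>N2\<^esub> f x)"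
  using P.hom_iff[of N N2 f] assms by (simp add: tensor_algebras_conv telt_def)

text \<open>By \<open>telt_foldr\<close> every pure tensor is a composite of single-slot actions, so
  commuting with those is enough.\<close>

lemma tensor_homI:
  assumes N: "left_module TA N" and N2: "left_module TA N2"
    and f: "f \<in> carrier N \<rightarrow>\<^sub>E carrier N2" "klin N (scalar_act TA N) N2 (scalar_act TA N2) f"
    and comm: "\<And>i a x. i \<in> I \<Longrightarrow> a \<in> carrier (A i) \<Longrightarrow> x \<in> carrier N \<Longrightarrow>
      f (telt (comp_tuple i a) \<odot>\<^bsub>N\<^esub> x) = telt (comp_tuple i a) \<odot>\<^bsub>N2\<^esub> f x"
  shows "f \<in> left_module_hom TA N N2"
  unfolding tensor_hom_iff[OF N N2]
proof (intro conjI f ballI)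
  fix t x assume t: "t \<in> (\<Pi>\<^sub>E i\<in>I. carrier (A i))" and x: "x \<in> carrier N"
  have fx: "f x \<in> carrier N2" using f x by auto
  have "f (foldr (\<lambda>i x. telt (comp_tuple i (t i)) \<odot>\<^bsub>N\<^esub> x) K x) = foldr (\<lambda>i x. telt (comp_tuple i (t i)) \<odot>\<^bsub>N2\<^esub> x) K (f x) \<and>
     foldr (\<lambda>i x. telt (comp_tuple i (t i)) \<odot>\<^bsub>N\<^esub> x) K x \<in> carrier N"
    if "set K \<subseteq> I" for K
    using that
  proof (induction K)
    case (Cons i K)
    then have "i \<in> I" "t i \<in> carrier (A i)" using t by auto
    then show ?case using Cons comm klin_closed[OF telt_klin[OF N comp_tuple_in]] by simp
  qed (simp add: x)
  from this[of L] show "f (telt t \<odot>\<^bsub>N\<^esub> x) = telt t \<odot>\<^bsub>N2\<^esub> f x"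
    using L by (simp add: telt_foldr[OF N t x] telt_foldr[OF N2 t fx])
qed

text \<open>The universal property of the tensor product for modules. A tuple acts by the composite
  of its components along \<open>L\<close>; commutation makes this multiplicative, and the shared
  scalars make it multilinear.\<close>

lemma module_of_family:
  assumes K: "kspace N sc"
    and s: "\<And>i. i \<in> I \<Longrightarrow> left_module (A i) (with_smult N (s i))"
    and sc: "\<And>i c x. i \<in> I \<Longrightarrow> x \<in> carrier N \<Longrightarrow> scalar_act (A i) (with_smult N (s i)) c x = sc c x"
    and comm: "\<And>i j a b x. i \<in> I \<Longrightarrow> j \<in> I \<Longrightarrow> i \<noteq> j \<Longrightarrow> a \<in> carrier (A i) \<Longrightarrow> b \<in> carrier (A j) \<Longrightarrow> x \<in> carrier N \<Longrightarrow>
      s i a (s j b x) = s j b (s i a x)"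
  shows "\<exists>\<sigma>. left_module TA (with_smult N \<sigma>) \<and>
    (\<forall>c. \<forall>x\<in>carrier N. scalar_act TA (with_smult N \<sigma>) c x = sc c x) \<and>
    (\<forall>t\<in>(\<Pi>\<^sub>E i\<in>I. carrier (A i)). \<forall>x\<in>carrier N. \<sigma> (telt t) x = foldr (\<lambda>i. s i (t i)) L x)"
proof -
  interpret kspace N sc by fact
  define \<theta> where "\<theta> K t = foldr (\<lambda>i. s i (t i)) K" for K t
  have sc1: "s i (c \<odot>\<^bsub>A i\<^esub> \<one>\<^bsub>A i\<^esub>) x = sc c x" if "i \<in> I" "x \<in> carrier N" for i c x
    using sc[OF that, of c] by (simp add: scalar_act_def)
  have s_closed: "s i a x \<in> carrier N" if "i \<in> I" "a \<in> carrier (A i)" "x \<in> carrier N" for i a x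
    using left_module.act_closed[OF s[OF that(1)] that(2)] that(3) by simp
  have s_mult: "s i (a \<otimes>\<^bsub>A i\<^esub> b) x = s i a (s i b x)" if "i \<in> I" "a \<in> carrier (A i)" "b \<in> carrier (A i)" "x \<in> carrier N" for i a b x
    using left_module.act_mult[OF s[OF that(1)] that(2,3)] that(4) by simp
  have s_add: "s i (a \<oplus>\<^bsub>A i\<^esub> b) x = s i a x \<oplus>\<^bsub>N\<^esub> s i b x" if "i \<in> I" "a \<in> carrier (A i)" "b \<in> carrier (A i)" "x \<in> carrier N" for i a b x
    using left_module.act_add_left[OF s[OF that(1)] that(2,3)] that(4) by simp
  have s_one: "s i \<one>\<^bsub>A i\<^esub> x = x" if "i \<in> I" "x \<in> carrier N" for i x
    using left_module.act_one[OF s[OF that(1)]] that(2) by simp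
  \<comment> \<open>Scalars are multiples of the unit and central in each algebra, so each algebra
    acts by linear maps for the common scalar action.\<close>
  have s_sc: "s i a (sc c x) = sc c (s i a x)" "s i (c \<odot>\<^bsub>A i\<^esub> a) x = sc c (s i a x)"
    if i: "i \<in> I" "a \<in> carrier (A i)" "x \<in> carrier N" for i a c x
  proof -
    have c1: "c \<odot>\<^bsub>A i\<^esub> \<one>\<^bsub>A i\<^esub> \<in> carrier (A i)" using i by (intro smult_closed one_in)
    show "s i (c \<odot>\<^bsub>A i\<^esub> a) x = sc c (s i a x)"
      using smult_conv[OF i(1,2), of c] s_mult[OF i(1) c1 i(2,3)] sc1 s_closed i by simp
    show "s i a (sc c x) = sc c (s i a x)"
      using smult_central[OF i(1,2), of c] s_mult[OF i(1) c1 i(2,3)] s_mult[OF i(1,2) c1 i(3)] sc1 s_closed i by simp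
  qed
  have s_klin: "klin N sc N sc (s i a)" if "i \<in> I" "a \<in> carrier (A i)" for i a
    using that s_closed s_sc left_module.act_add_right[OF s[OF that(1)] that(2)] by (intro klinI) auto
  have \<theta>_klin: "klin N sc N sc (\<theta> K t)" if "set K \<subseteq> I" "t \<in> (\<Pi>\<^sub>E i\<in>I. carrier (A i))" for K t
    using that(1)
  proof (induction K)
    case (Cons i K)
    then have "klin N sc N sc (s i (t i))" using that(2) by (intro s_klin) auto
    from klin_comp[OF _ this] Cons show ?case by (simp add: \<theta>_def comp_def)
  qed (simp add: \<theta>_def klin_id id_def)
  have \<theta>_comm: "s i a (\<theta> K t x) = \<theta> K t (s i a x)"
    if "set K \<subseteq> I" "i \<in> I" "i \<notin> set K" "t \<in> (\<Pi>\<^sub>E i\<in>I. carrier (A i))" "a \<in> carrier (A i)" "x \<in> carrier N" for K i a t x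
    using that(1,3)
  proof (induction K)
    case (Cons j K)
    have "\<theta> K t x \<in> carrier N" using Cons.prems by (intro klin_closed[OF \<theta>_klin[OF _ that(4)] that(6)]) simp
    moreover have "t j \<in> carrier (A j)" using Cons.prems that(4) by auto
    ultimately have "s i a (s j (t j) (\<theta> K t x)) = s j (t j) (s i a (\<theta> K t x))"
      using Cons.prems that by (intro comm) auto
    then show ?case using Cons by (simp add: \<theta>_def)
  qed (simp add: \<theta>_def)
  \<comment> \<open>The component of \<open>u\<close> at the head slot has to pass the operators of
    \<open>t\<close> on the remaining slots: this is where commutation enters.\<close>
  have \<theta>_mult: "\<theta> K (\<lambda>i\<in>I. t i \<otimes>\<^bsub>A i\<^esub> u i) x = \<theta> K t (\<theta> K u x)"
    if "distinct K" "set K \<subseteq> I" "t \<in> (\<Pi>\<^sub>E i\<in>I. carrier (A i))" "u \<in> (\<Pi>\<^sub>E i\<in>I. carrier (A i))" "x \<in> carrier N" for K t u x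
    using that(1,2)
  proof (induction K)
    case (Cons i K)
    have i: "i \<in> I" "t i \<in> carrier (A i)" "u i \<in> carrier (A i)" "set K \<subseteq> I" "i \<notin> set K" using Cons that by auto
    have "\<theta> K u x \<in> carrier N" by (rule klin_closed[OF \<theta>_klin[OF i(4) that(4)] that(5)])
    moreover from this have "\<theta> K t (\<theta> K u x) \<in> carrier N" by (rule klin_closed[OF \<theta>_klin[OF i(4) that(3)]])
    ultimately show ?case
      using Cons i \<theta>_comm[OF i(4,1,5) that(3) i(3), of "\<theta> K u x"] by (simp add: \<theta>_def s_mult)
  qed (simp add: \<theta>_def)
  have \<theta>_one: "\<theta> K (\<lambda>i\<in>I. \<one>\<^bsub>A i\<^esub>) x = x" if "set K \<subseteq> I" "x \<in> carrier N" for K x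
    using that by (induction K) (auto simp: \<theta>_def s_one)
  interpret G: monoid G by (rule monoid_G)
  interpret R: monoid_rep G N sc "\<theta> L"
    by unfold_locales (use L \<theta>_klin \<theta>_one \<theta>_mult in simp_all)
  \<comment> \<open>The i-th slot occurs once in \<open>L\<close>, so the composite depends on it
    through a single factor between two fixed linear maps. Multilinearity follows.\<close>
  have upd: "\<exists>P Q. klin N sc N sc P \<and> klin N sc N sc Q \<and> (\<forall>a x. \<theta> L (t(i := a)) x = P (s i a (Q x)))"
    if t: "t \<in> (\<Pi>\<^sub>E i\<in>I. carrier (A i))" and i: "i \<in> I" for t i
  proof -
    obtain K1 K2 where K: "L = K1 @ i # K2" using L i split_list by metis
    then have "i \<notin> set K1" "i \<notin> set K2" using L(1) by auto
    then have "\<theta> K1 (t(i := a)) x = \<theta> K1 t x" "\<theta> K2 (t(i := a)) x = \<theta> K2 t x" for a x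
      unfolding \<theta>_def by (auto intro!: foldr_cong)
    then have "\<theta> L (t(i := a)) x = \<theta> K1 t (s i a (\<theta> K2 t x))" for a x
      by (simp add: K \<theta>_def)
    moreover have "set K1 \<subseteq> I" "set K2 \<subseteq> I" using L K by auto
    ultimately show ?thesis using \<theta>_klin[OF _ t] by blast
  qed
  have single_at: "Poly_Mapping.single t c \<in> carrier R.T" if "t \<in> (\<Pi>\<^sub>E i\<in>I. carrier (A i))" for t and c :: 'k
    using that by (intro single_in_carrier_monoid_algebra) simp
  have "R.act r x = \<zero>\<^bsub>N\<^esub>" if r: "r \<in> Rel" and x: "x \<in> carrier N" for r x
    using r
  proof cases
    case (additive t i a b)
    obtain P Q where PQ: "klin N sc N sc P" "klin N sc N sc Q" "\<And>a x. \<theta> L (t(i := a)) x = P (s i a (Q x))"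
      using upd[OF additive(2,3)] by blast
    have Qx: "Q x \<in> carrier N" by (rule klin_closed[OF PQ(2) x])
    have u: "Poly_Mapping.single (t(i := a)) 1 + Poly_Mapping.single (t(i := b)) 1 \<in> carrier R.T"
      using additive upd_in[OF additive(2,3)] by (intro monoid_algebra_closed single_at)
    note up = upd_in[OF additive(2,3)] and ab = add_closed[OF additive(3-5)]
    have Pc: "P (s i d (Q x)) \<in> carrier N" if "d \<in> carrier (A i)" for d
      by (rule klin_closed[OF PQ(1) s_closed[OF additive(3) that Qx]])
    have "R.act r x = \<theta> L (t(i := a \<oplus>\<^bsub>A i\<^esub> b)) x \<ominus>\<^bsub>N\<^esub> (\<theta> L (t(i := a)) x \<oplus>\<^bsub>N\<^esub> \<theta> L (t(i := b)) x)"
      unfolding additive(1) using up ab additive(4,5) u x Pc PQ(3)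
      by (simp add: R.act_diff R.act_add R.act_single single_at)
    moreover have "\<theta> L (t(i := a \<oplus>\<^bsub>A i\<^esub> b)) x = \<theta> L (t(i := a)) x \<oplus>\<^bsub>N\<^esub> \<theta> L (t(i := b)) x"
      unfolding PQ(3) s_add[OF additive(3-5) Qx] using additive(3-5) Qx by (intro klin_add[OF PQ(1)] s_closed)
    ultimately show ?thesis using Pc additive(4,5) by (simp add: PQ(3) a_minus_def r_neg)
  next
    case (homogeneous t i a c)
    obtain P Q where PQ: "klin N sc N sc P" "klin N sc N sc Q" "\<And>a x. \<theta> L (t(i := a)) x = P (s i a (Q x))"
      using upd[OF homogeneous(2,3)] by blast
    have Qx: "Q x \<in> carrier N" by (rule klin_closed[OF PQ(2) x])
    note up = upd_in[OF homogeneous(2,3)] and ca = smult_closed[OF homogeneous(3,4), of c]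
    have Pc: "P (s i d (Q x)) \<in> carrier N" if "d \<in> carrier (A i)" for d
      by (rule klin_closed[OF PQ(1) s_closed[OF homogeneous(3) that Qx]])
    have "R.act r x = \<theta> L (t(i := c \<odot>\<^bsub>A i\<^esub> a)) x \<ominus>\<^bsub>N\<^esub> sc c (\<theta> L (t(i := a)) x)"
      unfolding homogeneous(1) using up ca homogeneous(4) x Pc PQ(3)
      by (simp add: R.act_diff R.act_single single_at)
    moreover have "\<theta> L (t(i := c \<odot>\<^bsub>A i\<^esub> a)) x = sc c (\<theta> L (t(i := a)) x)"
      unfolding PQ(3) s_sc(2)[OF homogeneous(3,4) Qx] using homogeneous(3,4) Qx by (intro klin_sc[OF PQ(1)] s_closed)
    ultimately show ?thesis using Pc homogeneous(4) by (simp add: PQ(3) a_minus_def r_neg)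
  qed
  then obtain \<sigma> where \<sigma>: "left_module P.A (with_smult N \<sigma>)"
      "\<And>p x. p \<in> carrier R.T \<Longrightarrow> x \<in> carrier N \<Longrightarrow> \<sigma> (P.cls p) x = R.act p x"
    using P.module_of_rep[OF R.monoid_rep_axioms] by blast
  have one: "(\<lambda>j\<in>I. \<one>\<^bsub>A j\<^esub>) \<in> (\<Pi>\<^sub>E i\<in>I. carrier (A i))" by (auto simp: one_in)
  have "scalar_act P.A (with_smult N \<sigma>) c x = sc c x" if "x \<in> carrier N" for c x
    using that \<sigma>(2)[OF single_at[OF one, of c] that] one \<theta>_one[of L x] L
    by (simp add: scalar_act_def P.scalar_A R.act_single)
  moreover have "\<sigma> (telt t) x = \<theta> L t x" if "t \<in> (\<Pi>\<^sub>E i\<in>I. carrier (A i))" "x \<in> carrier N" for t x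
    using \<sigma>(2)[OF single_at[OF that(1), of 1] that(2)] that R.\<theta>_closed[of t x] by (simp add: telt_def R.act_single)
  ultimately show ?thesis
    using \<sigma>(1) unfolding tensor_algebras_conv \<theta>_def by blast
qed

end

subsection \<open>Stable sorting by colours\<close>

lemma entry_ext:
  assumes "length is = n" "length js = n" "\<And>s. s \<in> {1..n} \<Longrightarrow> entry is s = entry js s"
  shows "is = js"
proof (rule nth_equalityI)
  fix i assume "i < length is"
  then show "is ! i = js ! i" using assms(3)[of "Suc i"] assms(1) by (simp add: entry_def)
qed (simp add: assms)

lemma entry_swap:
  assumes "r \<in> {1..<length is}" "s \<ge> 1"
  shows "entry (swap_entries r is) s = (if s = r then entry is (r + 1) else if s = r + 1 then entry is r else entry is s)"
proof -
  have "s - 1 = r - 1 \<longleftrightarrow> s = r" "s - 1 = r \<longleftrightarrow> s = r + 1" using assms by auto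
  then show ?thesis using assms by (auto simp: swap_entries_def entry_def nth_list_update)
qed

lemma swap_swap: "r \<in> {1..<length is} \<Longrightarrow> swap_entries r (swap_entries r is) = is"
  by (rule entry_ext[of _ "length is"]) (auto simp: entry_swap)

lemma swap_comm:
  "r \<in> {1..<length is} \<Longrightarrow> s \<in> {1..<length is} \<Longrightarrow> 1 < \<bar>int r - int s\<bar> \<Longrightarrow>
    swap_entries r (swap_entries s is) = swap_entries s (swap_entries r is)"
  by (rule entry_ext[of _ "length is"]) (auto simp: entry_swap)

lemma swap_braid:
  "r \<in> {1..<length is} \<Longrightarrow> r + 1 \<in> {1..<length is} \<Longrightarrow>
    swap_entries r (swap_entries (r + 1) (swap_entries r is)) = swap_entries (r + 1) (swap_entries r (swap_entries (r + 1) is))"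
  by (rule entry_ext[of _ "length is"]) (auto simp: entry_swap)

text \<open>All that is kept of separatedness is \<open>far\<close>. Since all sequences have the
  same multiset of colours, \<open>w0\<close> is the colour word of every sorted sequence.\<close>

locale coloured =
  fixes e n :: nat and S :: "int list set" and col :: "int \<Rightarrow> nat" and w0 :: "nat list"
  assumes finite_S: "finite S" and length_S: "is \<in> S \<Longrightarrow> length is = n"
    and perm_S: "is \<in> S \<Longrightarrow> mset js = mset is \<Longrightarrow> js \<in> S"
    and far: "is \<in> S \<Longrightarrow> i \<in> set is \<Longrightarrow> j \<in> set is \<Longrightarrow> col i \<noteq> col j \<Longrightarrow>
      \<not> arrow_right e i j \<and> \<not> arrow_left e i j \<and> \<not> arrow_both e i j"
    and colours: "is \<in> S \<Longrightarrow> mset (map col is) = mset w0"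
    and sorted_w0: "sorted w0"
begin

definition colour_at :: "int list \<Rightarrow> nat \<Rightarrow> nat" where "colour_at is s = col (entry is s)"

definition S0 :: "int list set" where "S0 = {is \<in> S. map col is = w0}"

text \<open>The positions r for which r and r + 1 lie in the same run of \<open>w0\<close>: swaps at
  other positions leave the sorted sequences.\<close>

definition D0 :: "nat set" where "D0 = {r \<in> {1..<n}. w0 ! (r - 1) = w0 ! r}"

text \<open>Counts the entries that stable sorting places at or before the r-th one. The entry
  itself is counted, so positions start at 1.\<close>

definition sort_pos :: "int list \<Rightarrow> nat \<Rightarrow> nat" where
  "sort_pos is r = card {s \<in> {1..n}. colour_at is s < colour_at is r \<or> colour_at is s = colour_at is r \<and> s \<le> r}"

text \<open>The inverse exists because \<open>sort_pos is\<close> permutes the positions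
  (\<open>sort_pos_image\<close>).\<close>

definition sort_seq :: "int list \<Rightarrow> int list" where
  "sort_seq is = map (\<lambda>p. entry is (inv_into {1..n} (sort_pos is) p)) [1..<n + 1]"

lemma swap_S: "is \<in> S \<Longrightarrow> r \<in> {1..<n} \<Longrightarrow> swap_entries r is \<in> S"
  using perm_S mset_swap_entries length_S by metis

lemma colour_at_swap:
  "is \<in> S \<Longrightarrow> r \<in> {1..<n} \<Longrightarrow> s \<ge> 1 \<Longrightarrow>
    colour_at (swap_entries r is) s = (if s = r then colour_at is (r + 1) else if s = r + 1 then colour_at is r else colour_at is s)"
  using entry_swap[of r "is" s] length_S by (simp add: colour_at_def)

lemma entry_in: "is \<in> S \<Longrightarrow> s \<in> {1..n} \<Longrightarrow> entry is s \<in> set is"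
  using length_S by (auto simp: entry_def)

lemma far_entry:
  assumes "is \<in> S" "r \<in> {1..n}" "s \<in> {1..n}" "colour_at is r \<noteq> colour_at is s"
  shows "entry is r \<noteq> entry is s" "\<not> arrow_right e (entry is r) (entry is s)"
    "\<not> arrow_left e (entry is r) (entry is s)" "\<not> arrow_both e (entry is r) (entry is s)"
  using far[OF assms(1) entry_in[OF assms(1,2)] entry_in[OF assms(1,3)]] assms(4) by (auto simp: colour_at_def)

lemma sort_pos_mono:
  assumes "r \<in> {1..n}" "s \<in> {1..n}" "colour_at is r < colour_at is s \<or> colour_at is r = colour_at is s \<and> r < s"
  shows "sort_pos is r < sort_pos is s"
  unfolding sort_pos_def
proof (rule psubset_card_mono)
  have "s \<in> {t \<in> {1..n}. colour_at is t < colour_at is s \<or> colour_at is t = colour_at is s \<and> t \<le> s}"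
    "s \<notin> {t \<in> {1..n}. colour_at is t < colour_at is r \<or> colour_at is t = colour_at is r \<and> t \<le> r}"
    using assms by auto
  moreover have "{t \<in> {1..n}. colour_at is t < colour_at is r \<or> colour_at is t = colour_at is r \<and> t \<le> r} \<subseteq>
      {t \<in> {1..n}. colour_at is t < colour_at is s \<or> colour_at is t = colour_at is s \<and> t \<le> s}"
    using assms by auto
  ultimately show "{t \<in> {1..n}. colour_at is t < colour_at is r \<or> colour_at is t = colour_at is r \<and> t \<le> r} \<subset>
      {t \<in> {1..n}. colour_at is t < colour_at is s \<or> colour_at is t = colour_at is s \<and> t \<le> s}" by blast
qed simp

lemma sort_pos_in: "r \<in> {1..n} \<Longrightarrow> sort_pos is r \<in> {1..n}"
proof -
  assume r: "r \<in> {1..n}"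
  let ?X = "{s \<in> {1..n}. colour_at is s < colour_at is r \<or> colour_at is s = colour_at is r \<and> s \<le> r}"
  have "r \<in> ?X" using r by auto
  then have "card ?X > 0" by (intro card_gt_0_iff[THEN iffD2]) auto
  moreover have "card ?X \<le> card {1..n}" by (intro card_mono) auto
  ultimately show ?thesis by (simp add: sort_pos_def)
qed

lemma inj_sort_pos: "inj_on (sort_pos is) {1..n}"
proof (rule inj_onI)
  fix r s assume rs: "r \<in> {1..n}" "s \<in> {1..n}" "sort_pos is r = sort_pos is s"
  show "r = s"
    using sort_pos_mono[OF rs(1,2), of "is"] sort_pos_mono[OF rs(2,1), of "is"] rs(3) by (metis less_irrefl linorder_neqE_nat)
qed

lemma sort_pos_image: "sort_pos is ` {1..n} = {1..n}"
  by (rule endo_inj_surj[OF finite_atLeastAtMost _ inj_sort_pos]) (use sort_pos_in in blast)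

text \<open>Exchanging neighbours of different colours does not change their order after sorting, so
  the sorted position just follows the transposition.\<close>

lemma sort_pos_swap_far:
  assumes "is \<in> S" "r \<in> {1..<n}" "colour_at is r \<noteq> colour_at is (r + 1)" "s \<in> {1..n}"
  shows "sort_pos (swap_entries r is) s = sort_pos is (if s = r then r + 1 else if s = r + 1 then r else s)"
proof -
  define t where "t s = (if s = r then r + 1 else if s = r + 1 then r else s)" for s :: nat
  have tt: "t (t s) = s" for s by (auto simp: t_def)
  have ti: "t s \<in> {1..n}" if "s \<in> {1..n}" for s using that assms(2) by (auto simp: t_def)
  have colour_at: "colour_at (swap_entries r is) s = colour_at is (t s)" if "s \<in> {1..n}" for s
    using colour_at_swap[OF assms(1,2)] that by (auto simp: t_def)
  \<comment> \<open>The transposition reverses the order of the pair r, r + 1 only. These have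
    different colours, so their positions are never compared.\<close>
  have ord: "u \<le> s \<longleftrightarrow> t u \<le> t s" if "colour_at is (t u) = colour_at is (t s)" for u s
    using that assms(3) unfolding t_def by (auto split: if_splits)
  have "sort_pos (swap_entries r is) s = card {u \<in> {1..n}. colour_at is (t u) < colour_at is (t s) \<or> colour_at is (t u) = colour_at is (t s) \<and> u \<le> s}"
    unfolding sort_pos_def using colour_at assms(4) by (intro arg_cong[where f = card]) auto
  also have "\<dots> = card (t ` {u \<in> {1..n}. colour_at is (t u) < colour_at is (t s) \<or> colour_at is (t u) = colour_at is (t s) \<and> u \<le> s})"
    by (intro card_image[symmetric] inj_onI) (metis tt)
  also have "t ` {u \<in> {1..n}. colour_at is (t u) < colour_at is (t s) \<or> colour_at is (t u) = colour_at is (t s) \<and> u \<le> s} =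
      {u \<in> {1..n}. colour_at is u < colour_at is (t s) \<or> colour_at is u = colour_at is (t s) \<and> u \<le> t s}" (is "t ` ?X = ?Y")
  proof
    show "t ` ?X \<subseteq> ?Y" using ti ord by blast
    show "?Y \<subseteq> t ` ?X"
    proof
      fix u assume u: "u \<in> ?Y"
      then have "t u \<in> ?X" using ti[of u] ord[of "t u" s] unfolding mem_Collect_eq tt by blast
      from imageI[OF this, of t] show "u \<in> t ` ?X" unfolding tt .
    qed
  qed
  finally show ?thesis by (simp add: sort_pos_def t_def)
qed

text \<open>With equal colours the swap leaves the colour word as it is, and stable sorting keeps
  the two strands adjacent.\<close>

lemma sort_pos_same:
  assumes "is \<in> S" "r \<in> {1..<n}" "colour_at is r = colour_at is (r + 1)"
  shows "sort_pos is (r + 1) = sort_pos is r + 1" and "s \<in> {1..n} \<Longrightarrow> sort_pos (swap_entries r is) s = sort_pos is s"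
proof -
  let ?X = "{s \<in> {1..n}. colour_at is s < colour_at is r \<or> colour_at is s = colour_at is r \<and> s \<le> r}"
  have "{s \<in> {1..n}. colour_at is s < colour_at is (r + 1) \<or> colour_at is s = colour_at is (r + 1) \<and> s \<le> r + 1} = insert (r + 1) ?X"
    using assms by (auto simp: le_Suc_eq)
  moreover have "card (insert (r + 1) ?X) = Suc (card ?X)" by (rule card_insert_disjoint) (use assms in auto)
  ultimately show "sort_pos is (r + 1) = sort_pos is r + 1" unfolding sort_pos_def by (simp only: Suc_eq_plus1)
  have colour_at: "colour_at (swap_entries r is) s = colour_at is s" if "s \<in> {1..n}" for s
    using colour_at_swap[OF assms(1,2)] that assms(3) by auto
  show "sort_pos (swap_entries r is) s = sort_pos is s" if "s \<in> {1..n}"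
    unfolding sort_pos_def using colour_at that by (intro arg_cong[where f = card]) auto
qed

lemma S0_colour_at: "is \<in> S0 \<Longrightarrow> s \<in> {1..n} \<Longrightarrow> colour_at is s = w0 ! (s - 1)"
  using length_S[of "is"] nth_map[of "s - 1" "is" col] by (auto simp: S0_def colour_at_def entry_def)

lemma length_w0: "is \<in> S \<Longrightarrow> length w0 = n"
  using colours[of "is"] length_S[of "is"] by (metis length_map mset_eq_length)

text \<open>A nondecreasing colour word is the sorted form of its multiset, hence equal to
  \<open>w0\<close>; so sortedness is a condition on neighbours.\<close>

lemma S0_iff: "is \<in> S0 \<longleftrightarrow> is \<in> S \<and> (\<forall>r\<in>{1..<n}. colour_at is r \<le> colour_at is (r + 1))"
proof
  assume "is \<in> S0"
  then show "is \<in> S \<and> (\<forall>r\<in>{1..<n}. colour_at is r \<le> colour_at is (r + 1))"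
    using S0_colour_at[of "is"] length_w0[of "is"] sorted_nth_mono[OF sorted_w0] by (auto simp: S0_def)
next
  assume a: "is \<in> S \<and> (\<forall>r\<in>{1..<n}. colour_at is r \<le> colour_at is (r + 1))"
  have "sorted (map col is)"
    unfolding sorted_iff_nth_Suc
  proof (intro allI impI)
    fix i assume "Suc i < length (map col is)"
    then show "map col is ! i \<le> map col is ! Suc i"
      using a[THEN conjunct2, rule_format, of "Suc i"] length_S[of "is"] a by (simp add: colour_at_def entry_def)
  qed
  with colours[of "is"] a sorted_w0 have "map col is = w0"
    by (metis properties_for_sort)
  then show "is \<in> S0" using a by (simp add: S0_def)
qed

lemma S0_sub: "S0 \<subseteq> S" by (auto simp: S0_def)

lemma D0_sub: "D0 \<subseteq> {1..<n}" by (auto simp: D0_def)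

lemma S0_swap: "r \<in> D0 \<Longrightarrow> is \<in> S0 \<Longrightarrow> swap_entries r is \<in> S0"
proof -
  assume r: "r \<in> D0" and i: "is \<in> S0"
  have rn: "r \<in> {1..<n}" and iS: "is \<in> S" using r i D0_sub S0_sub by auto
  have eq: "colour_at is r = colour_at is (r + 1)" using S0_colour_at[OF i, of r] S0_colour_at[OF i, of "r + 1"] r by (auto simp: D0_def)
  then have "colour_at (swap_entries r is) s = colour_at is s" if "s \<ge> 1" for s using colour_at_swap[OF iS rn that] by auto
  then show ?thesis using i swap_S[OF iS rn] by (auto simp: S0_iff)
qed

lemma sort_pos_sorted: "is \<in> S0 \<Longrightarrow> r \<in> {1..n} \<Longrightarrow> sort_pos is r = r"
proof -
  assume a: "is \<in> S0" "r \<in> {1..n}"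
  have mono: "colour_at is s \<le> colour_at is t" if "s \<in> {1..n}" "t \<in> {1..n}" "s \<le> t" for s t
    using S0_colour_at[OF a(1)] that length_w0[of "is"] a(1) sorted_nth_mono[OF sorted_w0, of "s - 1" "t - 1"] by (auto simp: S0_def)
  have "colour_at is s < colour_at is r \<or> colour_at is s = colour_at is r \<and> s \<le> r \<longleftrightarrow> s \<le> r" if "s \<in> {1..n}" for s
    using mono[OF that a(2)] mono[OF a(2) that] by linarith
  then have "{s \<in> {1..n}. colour_at is s < colour_at is r \<or> colour_at is s = colour_at is r \<and> s \<le> r} = {s \<in> {1..n}. s \<le> r}" by blast
  also have "\<dots> = {1..r}" using a(2) by auto
  finally show ?thesis by (simp add: sort_pos_def)
qed

lemma length_sort_seq [simp]: "length (sort_seq is) = n"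
  by (simp add: sort_seq_def)

lemma entry_sort_seq: "r \<in> {1..n} \<Longrightarrow> entry (sort_seq is) (sort_pos is r) = entry is r"
proof -
  assume r: "r \<in> {1..n}"
  then have "sort_pos is r - 1 < length [1..<n + 1]" "[1..<n + 1] ! (sort_pos is r - 1) = sort_pos is r"
    using sort_pos_in[of r "is"] by (auto simp: nth_upt simp del: upt_Suc)
  then show ?thesis
    using inv_into_f_f[OF inj_sort_pos r, of "is"] by (simp add: sort_seq_def entry_def[of "map _ _"] del: upt_Suc length_upt)
qed

lemma entry_sort_seq_ext:
  assumes "length js = n" "\<And>r. r \<in> {1..n} \<Longrightarrow> entry js (sort_pos is r) = entry is r"
  shows "sort_seq is = js"
proof (rule entry_ext[of _ n])
  fix s assume "s \<in> {1..n}"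
  then obtain r where "r \<in> {1..n}" "s = sort_pos is r" using sort_pos_image[of "is"] by blast
  then show "entry (sort_seq is) s = entry js s" using assms(2) entry_sort_seq by simp
qed (simp_all add: assms)

lemma mset_sort_seq: "is \<in> S \<Longrightarrow> mset (sort_seq is) = mset is"
proof -
  assume "is \<in> S"
  then have len: "length is = n" by (rule length_S)
  let ?i = "inv_into {1..n} (sort_pos is)"
  have *: "{1..<n + 1} = {1..n}" by auto
  have inj: "inj_on ?i {1..n}" using inj_on_inv_into[of "{1..n}" "sort_pos is" "{1..n}"] sort_pos_image by simp
  have im: "?i ` {1..n} = {1..n}" by (metis inv_into_image_cancel inj_sort_pos order_refl sort_pos_image)
  have "mset (sort_seq is) = image_mset (entry is) (image_mset ?i (mset_set {1..n}))"
    unfolding sort_seq_def mset_map mset_upt * by (simp add: multiset.map_comp comp_def)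
  also have "\<dots> = image_mset (entry is) (mset_set {1..n})"
    by (simp only: image_mset_mset_set[OF inj] im)
  also have "\<dots> = mset (map (entry is) [1..<n + 1])" unfolding mset_map mset_upt * ..
  also have "map (entry is) [1..<n + 1] = is"
    using len by (intro nth_equalityI) (auto simp: entry_def simp del: upt_Suc)
  finally show ?thesis .
qed

lemma sort_seq_S0: "is \<in> S \<Longrightarrow> sort_seq is \<in> S0"
proof -
  assume "is": "is \<in> S"
  have "colour_at (sort_seq is) r \<le> colour_at (sort_seq is) (r + 1)" if r: "r \<in> {1..<n}" for r
  proof -
    have "r \<in> sort_pos is ` {1..n}" "r + 1 \<in> sort_pos is ` {1..n}" unfolding sort_pos_image using r by auto
    then obtain a b where ab: "a \<in> {1..n}" "r = sort_pos is a" "b \<in> {1..n}" "r + 1 = sort_pos is b" by blast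
    then have "\<not> colour_at is b < colour_at is a" using sort_pos_mono[of b a "is"] by force
    then show ?thesis using entry_sort_seq[of a "is"] entry_sort_seq[of b "is"] ab by (simp add: colour_at_def)
  qed
  then show ?thesis using perm_S[OF "is" mset_sort_seq[OF "is"]] by (simp add: S0_iff)
qed

lemma sort_seq_sorted: "is \<in> S0 \<Longrightarrow> sort_seq is = is"
  by (rule entry_sort_seq_ext) (auto simp: S0_def length_S sort_pos_sorted simp del: atLeastAtMost_iff)

lemma sort_seq_swap_far:
  assumes "is \<in> S" "r \<in> {1..<n}" "colour_at is r \<noteq> colour_at is (r + 1)"
  shows "sort_seq (swap_entries r is) = sort_seq is"
proof (rule entry_sort_seq_ext)
  fix s assume s: "s \<in> {1..n}"
  let ?t = "if s = r then r + 1 else if s = r + 1 then r else s"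
  have "?t \<in> {1..n}" using s assms(2) by auto
  then show "entry (sort_seq is) (sort_pos (swap_entries r is) s) = entry (swap_entries r is) s"
    using entry_swap[of r "is" s] s length_S[OF assms(1)] assms(2)
    by (simp only: sort_pos_swap_far[OF assms s] entry_sort_seq) auto
qed simp

text \<open>Strands of one colour stay neighbours under stable sorting, so their swap survives
  sorting as a swap inside a run of \<open>w0\<close>.\<close>

lemma sort_seq_swap_same:
  assumes "is \<in> S" "r \<in> {1..<n}" "colour_at is r = colour_at is (r + 1)"
  shows "sort_seq (swap_entries r is) = swap_entries (sort_pos is r) (sort_seq is)" and "sort_pos is r \<in> D0"
proof -
  have r: "r \<in> {1..n}" "r + 1 \<in> {1..n}" using assms(2) by auto
  have s1: "sort_pos is r \<in> {1..<n}" using sort_pos_in[OF r(1), of "is"] sort_pos_in[OF r(2), of "is"] sort_pos_same(1)[OF assms] by auto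
  show "sort_seq (swap_entries r is) = swap_entries (sort_pos is r) (sort_seq is)"
  proof (rule entry_sort_seq_ext)
    fix s assume s: "s \<in> {1..n}"
    have sg: "sort_pos is s = sort_pos is r \<longleftrightarrow> s = r" "sort_pos is s = sort_pos is r + 1 \<longleftrightarrow> s = r + 1"
      using inj_onD[OF inj_sort_pos[of "is"]] s r sort_pos_same(1)[OF assms] by metis+
    have "entry (swap_entries (sort_pos is r) (sort_seq is)) (sort_pos is s) =
       (if s = r then entry is (r + 1) else if s = r + 1 then entry is r else entry is s)"
      using entry_swap[of "sort_pos is r" "sort_seq is" "sort_pos is s"] s1 sort_pos_in[OF s, of "is"] sg
        entry_sort_seq[OF s, of "is"] entry_sort_seq[OF r(1), of "is"] entry_sort_seq[OF r(2), of "is"] sort_pos_same(1)[OF assms] by auto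
    then show "entry (swap_entries (sort_pos is r) (sort_seq is)) (sort_pos (swap_entries r is) s) = entry (swap_entries r is) s"
      using entry_swap[of r "is" s] s assms(2) length_S[OF assms(1)] sort_pos_same(2)[OF assms s] by auto
  qed simp
  have "colour_at (sort_seq is) (sort_pos is r) = colour_at (sort_seq is) (sort_pos is r + 1)"
    using entry_sort_seq[OF r(1), of "is"] entry_sort_seq[OF r(2), of "is"] assms(3) sort_pos_same(1)[OF assms] by (simp add: colour_at_def)
  then show "sort_pos is r \<in> D0" using S0_colour_at[OF sort_seq_S0[OF assms(1)]] s1 by (auto simp: D0_def)
qed

definition descent :: "int list \<Rightarrow> nat \<Rightarrow> bool" where
  "descent is r \<longleftrightarrow> r \<in> {1..<n} \<and> colour_at is (r + 1) < colour_at is r"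

text \<open>The weights decrease from left to right, so moving a larger colour to the right lowers
  the sum.\<close>

definition sort_measure :: "int list \<Rightarrow> nat" where
  "sort_measure is = (\<Sum>s\<in>{1..n}. (n - s) * colour_at is s)"

lemma no_descent: "is \<in> S \<Longrightarrow> (\<And>r. \<not> descent is r) \<Longrightarrow> is \<in> S0"
  unfolding S0_iff descent_def using not_less by blast

lemma S0_no_descent: "is \<in> S0 \<Longrightarrow> \<not> descent is r"
  unfolding S0_iff descent_def using not_less by blast

lemma sort_measure_swap:
  assumes "is \<in> S" "descent is r"
  shows "sort_measure (swap_entries r is) < sort_measure is"
proof -
  have r: "r \<in> {1..<n}" and c: "colour_at is (r + 1) < colour_at is r" using assms(2) by (auto simp: descent_def)
  have *: "sort_measure js = (n - r) * colour_at js r + (n - (r + 1)) * colour_at js (r + 1) + (\<Sum>s\<in>{1..n} - {r, r + 1}. (n - s) * colour_at js s)" for js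
  proof -
    have "sort_measure js = (\<Sum>s\<in>{1..n} - {r, r + 1}. (n - s) * colour_at js s) + (\<Sum>s\<in>{r, r + 1}. (n - s) * colour_at js s)"
      unfolding sort_measure_def by (rule sum.subset_diff) (use r in auto)
    then show ?thesis by simp
  qed
  have "(\<Sum>s\<in>{1..n} - {r, r + 1}. (n - s) * colour_at (swap_entries r is) s) = (\<Sum>s\<in>{1..n} - {r, r + 1}. (n - s) * colour_at is s)"
    by (rule sum.cong) (use colour_at_swap[OF assms(1) r] in auto)
  \<comment> \<open>For colours a > b at r and r + 1 the contribution of the pair drops from (d + 1)
    a + d b to (d + 1) b + d a.\<close>
  moreover obtain d where "n - r = Suc d" "n - (r + 1) = d" using r by (metis Suc_diff_Suc Suc_eq_plus1 atLeastLessThan_iff)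
  moreover have "colour_at (swap_entries r is) r = colour_at is (r + 1)" "colour_at (swap_entries r is) (r + 1) = colour_at is r"
    using colour_at_swap[OF assms(1) r] r by auto
  ultimately show ?thesis using c by (simp add: *)
qed

end

section \<open>Homogeneous vectors and maps defined on components\<close>

context qh_rep
begin

definition homog :: "int list \<Rightarrow> 'a \<Rightarrow> bool" where "homog is x \<longleftrightarrow> x \<in> carrier M \<and> ee is x = x"

lemma homog_closed: "homog is x \<Longrightarrow> x \<in> carrier M" by (simp add: homog_def)

lemma homog_eq: "homog is x \<Longrightarrow> ee is x = x" by (simp add: homog_def)

lemma ee_closed: "is \<in> S \<Longrightarrow> x \<in> carrier M \<Longrightarrow> ee is x \<in> carrier M" by (rule klin_closed[OF ee_klin])

lemma y_closed: "r \<in> {1..n} \<Longrightarrow> x \<in> carrier M \<Longrightarrow> y r x \<in> carrier M" by (rule klin_closed[OF y_klin])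

lemma psi_closed: "r \<in> D \<Longrightarrow> x \<in> carrier M \<Longrightarrow> psi r x \<in> carrier M" by (rule klin_closed[OF psi_klin])

lemma homog_ee: "is \<in> S \<Longrightarrow> x \<in> carrier M \<Longrightarrow> homog is (ee is x)"
  by (simp add: homog_def ee_ee ee_closed)

lemma ee_homog: "is \<in> S \<Longrightarrow> js \<in> S \<Longrightarrow> homog js x \<Longrightarrow> ee is x = (if is = js then x else \<zero>)"
  using ee_ee[of "is" js x] by (auto simp: homog_def)

lemma homog_y: "is \<in> S \<Longrightarrow> r \<in> {1..n} \<Longrightarrow> homog is x \<Longrightarrow> homog is (y r x)"
  using y_ee[of r "is" x] by (simp add: homog_def y_closed)

lemma homog_psi: "is \<in> S \<Longrightarrow> r \<in> D \<Longrightarrow> homog is x \<Longrightarrow> homog (swap_entries r is) (psi r x)"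
  using psi_ee[of r "is" x] by (simp add: homog_def psi_closed)

lemma psi_y_succ_homog: "r \<in> D \<Longrightarrow> is \<in> S \<Longrightarrow> homog is x \<Longrightarrow>
    psi r (y (r + 1) x) = y r (psi r x) \<oplus> (if entry is r = entry is (r + 1) then x else \<zero>)"
  using psi_y_succ[of r "is" x] by (simp add: homog_def)

lemma y_succ_psi_homog: "r \<in> D \<Longrightarrow> is \<in> S \<Longrightarrow> homog is x \<Longrightarrow>
    y (r + 1) (psi r x) = psi r (y r x) \<oplus> (if entry is r = entry is (r + 1) then x else \<zero>)"
  using y_succ_psi[of r "is" x] by (simp add: homog_def)

lemma psi_psi_homog: "r \<in> D \<Longrightarrow> is \<in> S \<Longrightarrow> homog is x \<Longrightarrow>
    psi r (psi r x) = sq_act M e (entry is r) (entry is (r + 1)) (y r) (y (r + 1)) x"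
  using psi_psi[of r "is" x] by (simp add: homog_def)

lemma braid_homog: "r \<in> D \<Longrightarrow> r + 1 \<in> D \<Longrightarrow> is \<in> S \<Longrightarrow> homog is x \<Longrightarrow>
    psi r (psi (r + 1) (psi r x)) = psi (r + 1) (psi r (psi (r + 1) x)) \<oplus>
      braid_act M e (entry is r) (entry is (r + 1)) (entry is (r + 2)) (y r) (y (r + 1)) (y (r + 2)) x"
  using braid[of r "is" x] by (simp add: homog_def)

text \<open>The idempotents sum to the identity, so a linear map is determined by its values on
  homogeneous vectors.\<close>

lemma homog_ext:
  assumes "klin M sc N tc f" "klin M sc N tc g" "abelian_group N"
    and "\<And>is x. is \<in> S \<Longrightarrow> homog is x \<Longrightarrow> f x = g x" and x: "x \<in> carrier M"
  shows "f x = g x"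
proof -
  interpret N: abelian_group N by fact
  have c: "(\<lambda>is. ee is x) \<in> S \<rightarrow> carrier M" using x by (auto intro: ee_closed)
  have "f x = f (\<Oplus>is\<in>S. ee is x)" by (simp add: ee_sum x)
  also have "\<dots> = finsum N (\<lambda>is. f (ee is x)) S" by (rule klin_finsum[OF assms(1) abelian_group_axioms assms(3) c])
  also have "\<dots> = finsum N (\<lambda>is. g (ee is x)) S"
    using assms(4)[OF _ homog_ee[OF _ x]] c by (intro N.finsum_cong' refl) (auto intro!: klin_closed[OF assms(2)])
  also have "\<dots> = g (\<Oplus>is\<in>S. ee is x)" by (rule klin_finsum[OF assms(2) abelian_group_axioms assms(3) c, symmetric])
  also have "\<dots> = g x" by (simp add: ee_sum x)
  finally show ?thesis .
qed

text \<open>Only the composites with the projections must be linear. Hence \<open>f is\<close> may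
  be chosen on the component of \<open>is\<close> alone, without control elsewhere.\<close>

lemma glue:
  assumes N: "kspace N tc" and f: "\<And>is. is \<in> S \<Longrightarrow> klin M sc N tc (\<lambda>x. f is (ee is x))"
  shows "klin M sc N tc (\<lambda>x. finsum N (\<lambda>is. f is (ee is x)) S)"
    and "is \<in> S \<Longrightarrow> homog is x \<Longrightarrow> finsum N (\<lambda>js. f js (ee js x)) S = f is x"
proof -
  interpret N: kspace N tc by fact
  show "klin M sc N tc (\<lambda>x. finsum N (\<lambda>is. f is (ee is x)) S)"
    by (rule N.klin_sum[OF f kspace_axioms])
  assume i: "is \<in> S" and h: "homog is x"
  have x: "x \<in> carrier M" using h by (rule homog_closed)
  have fc: "(\<lambda>js. f js (ee js x)) \<in> S \<rightarrow> carrier N" using klin_closed[OF f x] by blast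
  have "f js (ee js x) = (if is = js then f js (ee js x) else \<zero>\<^bsub>N\<^esub>)" if js: "js \<in> S" for js
  proof (cases "is = js")
    case False
    then have "ee js x = \<zero>" using ee_homog[OF js i h] by simp
    moreover have "ee js \<zero> = \<zero>" by (rule klin_zero[OF ee_klin[OF js] abelian_group_axioms abelian_group_axioms])
    ultimately show ?thesis
      using klin_zero[OF f[OF js] abelian_group_axioms N.abelian_group_axioms] False by simp
  qed simp
  then have "finsum N (\<lambda>js. f js (ee js x)) S = finsum N (\<lambda>js. if is = js then f js (ee js x) else \<zero>\<^bsub>N\<^esub>) S"
    using fc by (intro N.finsum_cong' refl) (auto simp: Pi_iff)
  also have "\<dots> = f is (ee is x)" using N.finsum_singleton[OF i finite_S fc] .
  finally show "finsum N (\<lambda>js. f js (ee js x)) S = f is x" using h by (simp add: homog_eq)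
qed

end

subsection \<open>Straightening by intertwiners\<close>

locale coloured_rep = coloured e n S col w0 + R: qh_rep M sc e n S "{1..<n}" ee y psi
  for e n :: nat and S col w0 and M :: "('a, 'm) ring_scheme" (structure) and sc :: "'k::field \<Rightarrow> 'a \<Rightarrow> 'a" and ee y psi
begin

text \<open>Different colours exclude equal residues and all arrows, so \<open>sq_act\<close> falls
  into its last case.\<close>

lemma psi_far: "is \<in> S \<Longrightarrow> r \<in> {1..<n} \<Longrightarrow> colour_at is r \<noteq> colour_at is (r + 1) \<Longrightarrow> R.homog is x \<Longrightarrow> psi r (psi r x) = x"
  using R.psi_psi_homog[of r "is" x] far_entry[of "is" r "r + 1"] by (simp add: sq_act_def)

text \<open>The error term needs equal residues on the two outer strands, which different outer
  colours forbid; the middle strand is arbitrary.\<close>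

lemma psi_braid_far:
  assumes "is \<in> S" "r \<in> {1..<n}" "r + 1 \<in> {1..<n}" "colour_at is r \<noteq> colour_at is (r + 2)" "R.homog is x"
  shows "psi r (psi (r + 1) (psi r x)) = psi (r + 1) (psi r (psi (r + 1) x))"
proof -
  have "entry is r \<noteq> entry is (r + 2)" using far_entry[of "is" r "r + 2"] assms by auto
  then have "psi r (psi (r + 1) (psi r x)) = psi (r + 1) (psi r (psi (r + 1) x)) \<oplus> \<zero>"
    using R.braid_homog[OF assms(2,3,1,5)] by (simp add: braid_act_def)
  then show ?thesis using assms R.psi_closed R.homog_closed by simp
qed

text \<open>Different colours mean different residues, so the correction terms vanish and
  \<open>psi r\<close> carries the operators \<open>y\<close> along its transposition.\<close>

lemma psi_y_far:
  assumes "is \<in> S" "r \<in> {1..<n}" "s \<in> {1..n}" "colour_at is r \<noteq> colour_at is (r + 1)" "R.homog is x"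
  shows "psi r (y s x) = y (if s = r then r + 1 else if s = r + 1 then r else s) (psi r x)"
proof -
  have x: "x \<in> carrier M" "psi r x \<in> carrier M" using assms R.homog_closed R.psi_closed by auto
  have r: "r \<in> {1..n}" "r + 1 \<in> {1..n}" using assms(2) by auto
  have c: "psi r (y r x) \<in> carrier M" "y r (psi r x) \<in> carrier M"
    by (rule R.psi_closed[OF assms(2) R.y_closed[OF r(1) x(1)]], rule R.y_closed[OF r(1) x(2)])
  have ne: "entry is r \<noteq> entry is (r + 1)" using far_entry[OF assms(1) r assms(4)] by simp
  consider "s = r" | "s = r + 1" | "s \<noteq> r" "s \<noteq> r + 1" by blast
  then show ?thesis
  proof cases
    case 1
    then show ?thesis using R.y_succ_psi_homog[OF assms(2,1,5)] ne c by simp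
  next
    case 2
    then show ?thesis using R.psi_y_succ_homog[OF assms(2,1,5)] ne c by simp
  next
    case 3
    then show ?thesis using R.psi_y[OF assms(2,3) 3 x(1)] by simp
  qed
qed

text \<open>The first argument only bounds the number of swaps; \<open>sort_measure\<close> is always enough.\<close>

primrec phi_fuel :: "nat \<Rightarrow> int list \<Rightarrow> 'a \<Rightarrow> 'a" where
  "phi_fuel 0 is x = x"
| "phi_fuel (Suc k) is x =
     (if \<exists>r. descent is r then let r = (SOME r. descent is r) in phi_fuel k (swap_entries r is) (psi r x) else x)"

text \<open>Meant on the component of \<open>is\<close>, which it carries to that of
  \<open>sort_seq is\<close> (\<open>Phi_homog\<close>).\<close>

definition Phi :: "int list \<Rightarrow> 'a \<Rightarrow> 'a" where "Phi is = phi_fuel (sort_measure is) is"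

lemma descent_in: "descent is r \<Longrightarrow> r \<in> {1..<n}" by (simp add: descent_def)

text \<open>Each swap at a descent lowers the measure, so the recursion reaches a sequence without
  descents before the bound is exhausted.\<close>

lemma phi_fuel_eq: "is \<in> S \<Longrightarrow> sort_measure is \<le> k \<Longrightarrow> sort_measure is \<le> l \<Longrightarrow> phi_fuel k is x = phi_fuel l is x"
proof (induction k arbitrary: l "is" x)
  case 0
  have "\<not> descent is r" for r using sort_measure_swap[OF 0(1)] 0(2) by fastforce
  then show ?case by (cases l) auto
next
  case (Suc k)
  show ?case
  proof (cases "\<exists>r. descent is r")
    case True
    let ?r = "SOME r. descent is r"
    have r: "descent is ?r" using True by (rule someI_ex)
    have m: "sort_measure (swap_entries ?r is) < sort_measure is" by (rule sort_measure_swap[OF Suc.prems(1) r])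
    then obtain l' where l: "l = Suc l'" using Suc.prems by (cases l) auto
    show ?thesis
      using Suc.IH[OF swap_S[OF Suc.prems(1) descent_in[OF r]], of l'] m Suc.prems True l by (simp add: Let_def)
  qed (cases l; auto)
qed

lemma Phi_S0: "is \<in> S0 \<Longrightarrow> Phi is x = x"
  using S0_no_descent[of "is"] by (cases "sort_measure is") (auto simp: Phi_def)

lemma Phi_step:
  assumes "is \<in> S" "is \<notin> S0"
  obtains r where "descent is r" "\<And>x. Phi is x = Phi (swap_entries r is) (psi r x)"
proof
  let ?r = "SOME r. descent is r"
  have ex: "\<exists>r. descent is r" using no_descent[of "is"] assms by blast
  then show r: "descent is ?r" by (rule someI_ex)
  show "Phi is x = Phi (swap_entries ?r is) (psi ?r x)" for x
  proof -
    have m: "sort_measure (swap_entries ?r is) < sort_measure is" by (rule sort_measure_swap[OF assms(1) r])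
    then obtain k where k: "sort_measure is = Suc k" by (cases "sort_measure is") auto
    have "Phi is x = phi_fuel k (swap_entries ?r is) (psi ?r x)"
      using ex by (simp add: Phi_def k Let_def)
    also have "\<dots> = Phi (swap_entries ?r is) (psi ?r x)"
      unfolding Phi_def using m k by (intro phi_fuel_eq swap_S[OF assms(1) descent_in[OF r]]) auto
    finally show ?thesis .
  qed
qed

text \<open>A diamond argument by induction on the measure. Distant descents commute; for adjacent
  ones both routes continue to a common sequence, and the braid relation identifies the operators.
  So \<open>Phi\<close> does not depend on the descents selected by its recursion.\<close>

lemma Phi_descent: "is \<in> S \<Longrightarrow> R.homog is x \<Longrightarrow> descent is r \<Longrightarrow> Phi is x = Phi (swap_entries r is) (psi r x)"
proof (induction "sort_measure is" arbitrary: "is" x r rule: less_induct)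
  case less
  note S = less.prems(1) and homog = less.prems(2)
  have len: "length is = n" using S by (rule length_S)
  have sw: "swap_entries r is \<in> S" "R.homog (swap_entries r is) (psi r x)" "sort_measure (swap_entries r is) < sort_measure is"
    if "descent is r" for r
    using swap_S[OF S] R.homog_psi[OF S _ homog] sort_measure_swap[OF S that] descent_in[OF that] by auto
  have confl: "Phi (swap_entries r is) (psi r x) = Phi (swap_entries s is) (psi s x)"
    if r: "descent is r" and s: "descent is s" and rs: "r < s" for r s
  proof -
    note rn = descent_in[OF r] and sn = descent_in[OF s]
    show ?thesis
    proof (cases "s = r + 1")
      case False
      have d: "descent (swap_entries r is) s" "descent (swap_entries s is) r"
        using r s rs False colour_at_swap[OF S rn] colour_at_swap[OF S sn] by (auto simp: descent_def)
      have "Phi (swap_entries r is) (psi r x) = Phi (swap_entries s (swap_entries r is)) (psi s (psi r x))"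
        by (rule less.hyps[OF sw(3,1,2)[OF r] d(1)])
      also have "\<dots> = Phi (swap_entries r (swap_entries s is)) (psi r (psi s x))"
        using swap_comm[of r "is" s] R.psi_comm[of r s x] rs False rn sn len R.homog_closed[OF homog] by simp
      also have "\<dots> = Phi (swap_entries s is) (psi s x)"
        by (rule less.hyps[OF sw(3,1,2)[OF s] d(2), symmetric])
      finally show ?thesis .
    next
      case True
      let ?a = "swap_entries r is" and ?b = "swap_entries s is"
      \<comment> \<open>Three strictly decreasing colours: both routes need three swaps and end in
        the same sequence. The outer colours differ, so the braid relation has no error
        term.\<close>
      have c: "colour_at is (r + 1) < colour_at is r" "colour_at is (r + 2) < colour_at is (r + 1)" using r s True by (auto simp: descent_def)
      have d: "descent ?a s" "descent ?b r"
        using c colour_at_swap[OF S rn] colour_at_swap[OF S sn] rn sn True by (auto simp: descent_def)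
      have a: "swap_entries s ?a \<in> S" "R.homog (swap_entries s ?a) (psi s (psi r x))" "sort_measure (swap_entries s ?a) < sort_measure is"
        using swap_S[OF sw(1)[OF r] sn] R.homog_psi[OF sw(1)[OF r] sn sw(2)[OF r]] sort_measure_swap[OF sw(1)[OF r] d(1)] sw(3)[OF r] by auto
      have b: "swap_entries r ?b \<in> S" "R.homog (swap_entries r ?b) (psi r (psi s x))" "sort_measure (swap_entries r ?b) < sort_measure is"
        using swap_S[OF sw(1)[OF s] rn] R.homog_psi[OF sw(1)[OF s] rn sw(2)[OF s]] sort_measure_swap[OF sw(1)[OF s] d(2)] sw(3)[OF s] by auto
      have d2: "descent (swap_entries s ?a) r" "descent (swap_entries r ?b) s"
        using c colour_at_swap[OF S rn] colour_at_swap[OF S sn] colour_at_swap[OF sw(1)[OF r] sn] colour_at_swap[OF sw(1)[OF s] rn] rn sn True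
        by (auto simp: descent_def)
      have "Phi ?a (psi r x) = Phi (swap_entries r (swap_entries s ?a)) (psi r (psi s (psi r x)))"
        using less.hyps[OF sw(3,1,2)[OF r] d(1)] less.hyps[OF a(3,1,2) d2(1)] by simp
      also have "\<dots> = Phi (swap_entries s (swap_entries r ?b)) (psi s (psi r (psi s x)))"
        using swap_braid[of r "is"] psi_braid_far[OF S rn _ _ homog] rn sn len c True by simp
      also have "\<dots> = Phi ?b (psi s x)"
        using less.hyps[OF sw(3,1,2)[OF s] d(2)] less.hyps[OF b(3,1,2) d2(2)] by simp
      finally show ?thesis .
    qed
  qed
  have "is \<notin> S0" using less.prems(3) S0_no_descent by blast
  \<comment> \<open>The descent selected by the recursion is compared with the given one by
    \<open>confl\<close>.\<close>
  then obtain s where s: "descent is s" "Phi is x = Phi (swap_entries s is) (psi s x)"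
    using Phi_step[OF S] by metis
  then show ?case using confl[of r s] confl[of s r] less.prems(3) by (metis linorder_neqE_nat)
qed

text \<open>Extends \<open>Phi_descent\<close> to ascents: there the swapped sequence has a descent
  at r, and swapping back returns x because \<open>psi r\<close> squares to the identity.\<close>

lemma Phi_far:
  assumes "is \<in> S" "r \<in> {1..<n}" "colour_at is r \<noteq> colour_at is (r + 1)" "R.homog is x"
  shows "Phi (swap_entries r is) (psi r x) = Phi is x"
proof (cases "descent is r")
  case True
  then show ?thesis using Phi_descent assms by simp
next
  case False
  then have d: "descent (swap_entries r is) r"
    using assms colour_at_swap[OF assms(1,2)] by (auto simp: descent_def)
  have len: "length is = n" using assms(1) by (rule length_S)
  show ?thesis
    using Phi_descent[OF swap_S[OF assms(1,2)] R.homog_psi[OF assms(1,2,4)] d] psi_far[OF assms] swap_swap[of r "is"] assms(2) len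
    by simp
qed

text \<open>The hypothesis covers all sequences of smaller measure and not just the swapped one,
  because \<open>Phi_psi\<close> descends two swaps at once.\<close>

lemma descent_induct [consumes 1, case_names sorted step]:
  assumes "is \<in> S"
    and "\<And>is. is \<in> S0 \<Longrightarrow> P is"
    and "\<And>is r. is \<in> S \<Longrightarrow> descent is r \<Longrightarrow> (\<And>js. js \<in> S \<Longrightarrow> sort_measure js < sort_measure is \<Longrightarrow> P js) \<Longrightarrow> P is"
  shows "P is"
  using assms(1)
proof (induction "sort_measure is" arbitrary: "is" rule: less_induct)
  case less
  show ?case
  proof (cases "is \<in> S0")
    case False
    then obtain r where "descent is r" using no_descent less.prems by blast
    then show ?thesis using assms(3) less by blast
  qed (rule assms(2))
qed

lemma descent_facts:
  assumes "is \<in> S" "descent is r"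
  shows "r \<in> {1..<n}" "swap_entries r is \<in> S" "sort_measure (swap_entries r is) < sort_measure is" "colour_at is r \<noteq> colour_at is (r + 1)"
    "sort_seq (swap_entries r is) = sort_seq is" "R.homog is x \<Longrightarrow> R.homog (swap_entries r is) (psi r x)"
    "R.homog is x \<Longrightarrow> Phi is x = Phi (swap_entries r is) (psi r x)"
proof -
  show r: "r \<in> {1..<n}" by (rule descent_in[OF assms(2)])
  show ne: "colour_at is r \<noteq> colour_at is (r + 1)" using assms(2) by (auto simp: descent_def)
  show "swap_entries r is \<in> S" "sort_measure (swap_entries r is) < sort_measure is" using swap_S sort_measure_swap assms r by auto
  show "sort_seq (swap_entries r is) = sort_seq is" by (rule sort_seq_swap_far[OF assms(1) r ne])
  show "R.homog is x \<Longrightarrow> R.homog (swap_entries r is) (psi r x)" by (rule R.homog_psi[OF assms(1) r])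
  show "R.homog is x \<Longrightarrow> Phi is x = Phi (swap_entries r is) (psi r x)" using Phi_descent assms by blast
qed

text \<open>Stated after the projection because the rewriting along a given descent is available for
  homogeneous vectors.\<close>

lemma Phi_klin_homog:
  assumes "is \<in> S"
  shows "klin M sc M sc (\<lambda>x. Phi is (ee is x))"
  using assms
proof (induction "is" rule: descent_induct)
  case (sorted "is")
  then show ?case using R.ee_klin[of "is"] by (simp add: Phi_S0 S0_def)
next
  case (step "is" r)
  note d = descent_facts[OF step.hyps]
  have "klin M sc M sc (\<lambda>x. Phi (swap_entries r is) (ee (swap_entries r is) (psi r x)))"
    by (rule klin_comp[OF R.psi_klin[OF d(1)] step.IH[OF d(2,3)]])
  then show ?case
    by (rule klin_cong[OF R.kspace_axioms])
       (use d step.hyps R.psi_ee[OF d(1) step.hyps(1)] R.homog_ee[OF step.hyps(1)] in simp)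
qed

lemma Phi_homog: "is \<in> S \<Longrightarrow> R.homog is x \<Longrightarrow> R.homog (sort_seq is) (Phi is x)"
proof (induction "is" arbitrary: x rule: descent_induct)
  case (sorted "is")
  then show ?case by (simp add: Phi_S0 sort_seq_sorted)
next
  case (step "is" r)
  note d = descent_facts[OF step.hyps]
  show ?case using step.IH[OF d(2,3) d(6)[OF step.prems]] d(5,7) step.prems by simp
qed

lemma Phi_y:
  "is \<in> S \<Longrightarrow> R.homog is x \<Longrightarrow> r \<in> {1..n} \<Longrightarrow> Phi is (y r x) = y (sort_pos is r) (Phi is x)"
proof (induction "is" arbitrary: x r rule: descent_induct)
  case (sorted "is")
  then show ?case by (simp add: Phi_S0 sort_pos_sorted)
next
  case (step "is" s)
  note d = descent_facts[OF step.hyps]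
  let ?t = "if r = s then s + 1 else if r = s + 1 then s else r"
  have t: "?t \<in> {1..n}" "(if ?t = s then s + 1 else if ?t = s + 1 then s else ?t) = r" using step.prems d(1) by auto
  have "Phi is (y r x) = Phi (swap_entries s is) (psi s (y r x))"
    by (rule d(7)[OF R.homog_y[OF step.hyps(1) step.prems(2,1)]])
  also have "psi s (y r x) = y ?t (psi s x)"
    by (rule psi_y_far[OF step.hyps(1) d(1) step.prems(2) d(4) step.prems(1)])
  also have "Phi (swap_entries s is) (y ?t (psi s x)) = y (sort_pos (swap_entries s is) ?t) (Phi (swap_entries s is) (psi s x))"
    by (rule step.IH[OF d(2,3) d(6)[OF step.prems(1)] t(1)])
  also have "sort_pos (swap_entries s is) ?t = sort_pos is r"
    using sort_pos_swap_far[OF step.hyps(1) d(1,4) t(1)] unfolding t(2) .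
  finally show ?case using d(7)[OF step.prems(1)] by simp
qed

text \<open>Let s be a descent. If it is far from r, the operators commute. Otherwise the third
  strand involved has a different colour, and the braid relation without error moves
  \<open>psi r\<close> across it, where it becomes \<open>psi s\<close> for a sequence of smaller
  measure.\<close>

lemma Phi_psi:
  "is \<in> S \<Longrightarrow> R.homog is x \<Longrightarrow> r \<in> {1..<n} \<Longrightarrow> colour_at is r = colour_at is (r + 1) \<Longrightarrow>
    Phi (swap_entries r is) (psi r x) = psi (sort_pos is r) (Phi is x)"
proof (induction "is" arbitrary: x r rule: descent_induct)
  case (sorted "is")
  then have "is \<in> S" by (simp add: S0_def)
  have "swap_entries r is \<in> S0"
    using sorted(1) colour_at_swap[OF \<open>is \<in> S\<close> sorted(3)] sorted(3,4) swap_S[OF \<open>is \<in> S\<close> sorted(3)] by (auto simp: S0_iff)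
  then show ?case using sorted sort_pos_sorted[of "is" r] by (simp add: Phi_S0)
next
  case (step "is" s)
  note S = step.hyps(1) and homog = step.prems(1) and rn = step.prems(2)
  note d = descent_facts[OF step.hyps]
  have len: "length is = n" using S by (rule length_S)
  have sn: "s \<in> {1..<n}" by (rule d(1))
  have x: "x \<in> carrier M" using homog by (rule R.homog_closed)
  let ?a = "swap_entries r is" and ?b = "swap_entries s is"
  have aS: "?a \<in> S" "R.homog ?a (psi r x)" using swap_S[OF S rn] R.homog_psi[OF S rn homog] by auto
  have rs: "r \<noteq> s" using d(4) step.prems(3) by auto
  then consider "1 < \<bar>int r - int s\<bar>" | "s = r + 1" | "r = s + 1" by linarith
  then show ?case
  proof cases
    case 1
    have da: "descent ?a s" using step.hyps(2) 1 colour_at_swap[OF S rn] by (auto simp: descent_def)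
    have cb: "colour_at ?b r = colour_at ?b (r + 1)" using colour_at_swap[OF S sn] 1 step.prems(3) rn by auto
    have "Phi ?a (psi r x) = Phi (swap_entries s ?a) (psi s (psi r x))"
      by (rule Phi_descent[OF aS da])
    also have "\<dots> = Phi (swap_entries r ?b) (psi r (psi s x))"
      using swap_comm[of r "is" s] R.psi_comm[OF rn sn 1 x] rn sn 1 len by simp
    also have "\<dots> = psi (sort_pos ?b r) (Phi ?b (psi s x))"
      by (rule step.IH[OF d(2,3) d(6)[OF homog] rn cb])
    also have "sort_pos ?b r = sort_pos is r"
      using sort_pos_swap_far[OF S sn d(4), of r] rn 1 by auto
    finally show ?thesis using d(7)[OF homog] by simp
  next
    \<comment> \<open>Two strands of equal colour with a smaller colour to their right: that strand
      is moved to the left across both.\<close>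
    case 2
    have ds: "colour_at is (r + 2) < colour_at is (r + 1)" using step.hyps(2) 2 by (auto simp: descent_def)
    have da: "descent ?a s" using ds 2 step.prems(3) sn colour_at_swap[OF S rn] by (auto simp: descent_def)
    have a2: "swap_entries s ?a \<in> S" "R.homog (swap_entries s ?a) (psi s (psi r x))"
      using swap_S[OF aS(1) sn] R.homog_psi[OF aS(1) sn aS(2)] by auto
    have da2: "descent (swap_entries s ?a) r"
      using ds 2 step.prems(3) rn sn colour_at_swap[OF S rn] colour_at_swap[OF aS(1) sn] by (auto simp: descent_def)
    have db: "descent ?b r" using ds 2 step.prems(3) rn colour_at_swap[OF S sn] by (auto simp: descent_def)
    note f = descent_facts[OF d(2) db]
    have cj: "colour_at (swap_entries r ?b) s = colour_at (swap_entries r ?b) (s + 1)"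
      using ds 2 step.prems(3) rn sn colour_at_swap[OF S sn] colour_at_swap[OF d(2) rn] by auto
    have "Phi ?a (psi r x) = Phi (swap_entries r (swap_entries s ?a)) (psi r (psi s (psi r x)))"
      using Phi_descent[OF aS da] Phi_descent[OF a2 da2] by simp
    also have "\<dots> = Phi (swap_entries s (swap_entries r ?b)) (psi s (psi r (psi s x)))"
      using swap_braid[of r "is"] psi_braid_far[OF S rn _ _ homog] rn sn len ds step.prems(3) 2 by simp
    also have "\<dots> = psi (sort_pos (swap_entries r ?b) s) (Phi (swap_entries r ?b) (psi r (psi s x)))"
      using f(3) d(3) by (intro step.IH f(2,6) d(6) homog sn cj) simp
    also have "Phi (swap_entries r ?b) (psi r (psi s x)) = Phi is x"
      using f(7)[OF d(6)[OF homog]] d(7)[OF homog] by simp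
    also have "sort_pos (swap_entries r ?b) s = sort_pos is r"
      using sort_pos_swap_far[OF d(2) rn f(4), of s] sort_pos_swap_far[OF S sn d(4), of r] rn sn 2 by auto
    finally show ?thesis .
  next
    \<comment> \<open>The mirror situation: a strand of larger colour on the left is moved to the
      right across two strands of equal colour.\<close>
    case 3
    have ds: "colour_at is (s + 1) < colour_at is s" using step.hyps(2) by (auto simp: descent_def)
    have cr: "colour_at is (s + 2) = colour_at is (s + 1)" using step.prems(3) 3 by simp
    have da: "descent ?a s" using ds cr 3 sn rn colour_at_swap[OF S rn] by (auto simp: descent_def)
    have a2: "swap_entries s ?a \<in> S" "R.homog (swap_entries s ?a) (psi s (psi r x))"
      using swap_S[OF aS(1) sn] R.homog_psi[OF aS(1) sn aS(2)] by auto
    have da2: "descent (swap_entries s ?a) r"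
      using ds 3 cr rn sn colour_at_swap[OF S rn] colour_at_swap[OF aS(1) sn] by (auto simp: descent_def)
    have db: "descent ?b r" using ds 3 cr rn colour_at_swap[OF S sn] by (auto simp: descent_def)
    note f = descent_facts[OF d(2) db]
    have cj: "colour_at (swap_entries r ?b) s = colour_at (swap_entries r ?b) (s + 1)"
      using ds 3 cr rn sn colour_at_swap[OF S sn] colour_at_swap[OF d(2) rn] by auto
    have "Phi ?a (psi r x) = Phi (swap_entries r (swap_entries s ?a)) (psi r (psi s (psi r x)))"
      using Phi_descent[OF aS da] Phi_descent[OF a2 da2] by simp
    also have "\<dots> = Phi (swap_entries s (swap_entries r ?b)) (psi s (psi r (psi s x)))"
      using swap_braid[of s "is"] psi_braid_far[OF S sn _ _ homog] rn sn len ds cr 3 by simp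
    also have "\<dots> = psi (sort_pos (swap_entries r ?b) s) (Phi (swap_entries r ?b) (psi r (psi s x)))"
      using f(3) d(3) by (intro step.IH f(2,6) d(6) homog sn cj) simp
    also have "Phi (swap_entries r ?b) (psi r (psi s x)) = Phi is x"
      using f(7)[OF d(6)[OF homog]] d(7)[OF homog] by simp
    also have "sort_pos (swap_entries r ?b) s = sort_pos is r"
      using sort_pos_swap_far[OF d(2) rn f(4), of s] sort_pos_swap_far[OF S sn d(4), of s] rn sn 3 by auto
    finally show ?thesis .
  qed
qed

lemma Phi_inj: "is \<in> S \<Longrightarrow> R.homog is x \<Longrightarrow> R.homog is z \<Longrightarrow> Phi is x = Phi is z \<Longrightarrow> x = z"
proof (induction "is" arbitrary: x z rule: descent_induct)
  case (sorted "is")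
  then show ?case by (simp add: Phi_S0)
next
  case (step "is" r)
  note d = descent_facts[OF step.hyps]
  have "psi r x = psi r z"
    using step.IH[OF d(2,3) d(6)[OF step.prems(1)] d(6)[OF step.prems(2)]] d(7)[OF step.prems(1)] d(7)[OF step.prems(2)] step.prems(3)
    by simp
  then show ?case using psi_far[OF step.hyps(1) d(1,4)] step.prems by metis
qed

text \<open>A preimage is found by undoing the swaps: where the colours differ, \<open>psi r\<close>
  inverts itself.\<close>

lemma Phi_surj: "is \<in> S \<Longrightarrow> R.homog (sort_seq is) z \<Longrightarrow> \<exists>x. R.homog is x \<and> Phi is x = z"
proof (induction "is" rule: descent_induct)
  case (sorted "is")
  then show ?case by (auto simp: Phi_S0 sort_seq_sorted)
next
  case (step "is" r)
  note d = descent_facts[OF step.hyps]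
  have len: "length is = n" using step.hyps(1) by (rule length_S)
  obtain x where x: "R.homog (swap_entries r is) x" "Phi (swap_entries r is) x = z"
    using step.IH[OF d(2,3)] step.prems d(5) by auto
  have ne: "colour_at (swap_entries r is) r \<noteq> colour_at (swap_entries r is) (r + 1)"
    using colour_at_swap[OF step.hyps(1) d(1)] d(1,4) by auto
  have "R.homog is (psi r x)"
    using R.homog_psi[OF d(2,1) x(1)] swap_swap[of r "is"] d(1) len by simp
  moreover from this have "Phi is (psi r x) = z"
    using d(7)[of "psi r x"] psi_far[OF d(2,1) ne x(1)] x(2) by simp
  ultimately show ?case by blast
qed

end

subsection \<open>Induction from the sorted components\<close>

text \<open>The starting point of the converse construction: operators on sorted components only,
  with \<open>psi r\<close> for r in \<open>D0\<close>.\<close>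

locale sorted_rep = coloured e n S col w0 + Q: qh_rep N sc e n "coloured.S0 S col w0" "coloured.D0 n w0" ee y psi
  for e n :: nat and S col w0 and N :: "('a, 'm) ring_scheme" (structure) and sc :: "'k::field \<Rightarrow> 'a \<Rightarrow> 'a" and ee y psi
begin

lemma sort_seq_in: "is \<in> S \<Longrightarrow> sort_seq is \<in> S0" by (rule sort_seq_S0)

text \<open>Dictated by \<open>Phi_psi\<close> and \<open>Phi_far\<close>: what \<open>psi r\<close>
  does to the copy labelled \<open>js\<close>, expressed in the sorted component. For different
  colours only the label changes.\<close>

definition sorted_psi :: "nat \<Rightarrow> int list \<Rightarrow> 'a \<Rightarrow> 'a" where
  "sorted_psi r js v = (if colour_at js r = colour_at js (r + 1) then psi (sort_pos js r) v else v)"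

lemma sorted_psi_klin: "js \<in> S \<Longrightarrow> r \<in> {1..<n} \<Longrightarrow> klin N sc N sc (sorted_psi r js)"
  using Q.psi_klin[OF sort_seq_swap_same(2)] by (cases "colour_at js r = colour_at js (r + 1)") (simp_all add: sorted_psi_def[abs_def] Q.klin_id)

lemma sorted_psi_homog: 
  assumes "js \<in> S" "r \<in> {1..<n}" "Q.homog (sort_seq js) v"
  shows "Q.homog (sort_seq (swap_entries r js)) (sorted_psi r js v)"
proof (cases "colour_at js r = colour_at js (r + 1)")
  case True
  then show ?thesis using Q.homog_psi[OF sort_seq_in[OF assms(1)] sort_seq_swap_same(2)[OF assms(1,2) True] assms(3)]
    by (simp add: sorted_psi_def sort_seq_swap_same(1)[OF assms(1,2) True])
qed (use assms in \<open>simp add: sorted_psi_def sort_seq_swap_far\<close>)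

lemma sort_pos_ne: "s \<in> {1..n} \<Longrightarrow> t \<in> {1..n} \<Longrightarrow> s \<noteq> t \<Longrightarrow> sort_pos js s \<noteq> sort_pos js t"
  by (meson inj_onD inj_sort_pos)

lemma entry_sort_seq_succ:
  assumes "js \<in> S" "r \<in> {1..<n}" "colour_at js r = colour_at js (r + 1)"
  shows "entry (sort_seq js) (sort_pos js r) = entry js r" "entry (sort_seq js) (sort_pos js r + 1) = entry js (r + 1)"
  using entry_sort_seq[of r js] entry_sort_seq[of "r + 1" js] assms(2) sort_pos_same(1)[OF assms] by auto

text \<open>From here to \<open>sorted_psi_braid\<close>: the relations of the induced module, read
  on one labelled copy. For equal colours each is the relation at the sorted position; for different
  colours the factors \<psi> are identities and the sorted positions are permuted.\<close>

lemma sorted_psi_y: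
  assumes "js \<in> S" "r \<in> {1..<n}" "s \<in> {1..n}" "s \<noteq> r" "s \<noteq> r + 1" "Q.homog (sort_seq js) v"
  shows "sorted_psi r js (y (sort_pos js s) v) = y (sort_pos (swap_entries r js) s) (sorted_psi r js v)"
proof (cases "colour_at js r = colour_at js (r + 1)")
  case True
  have "sort_pos js s \<noteq> sort_pos js r" "sort_pos js s \<noteq> sort_pos js r + 1"
    using sort_pos_ne[of s r js] sort_pos_ne[of s "r + 1" js] assms sort_pos_same(1)[OF assms(1,2) True] by auto
  then show ?thesis
    using Q.psi_y[OF sort_seq_swap_same(2)[OF assms(1,2) True] sort_pos_in[OF assms(3), of js]] Q.homog_closed[OF assms(6)]
      sort_pos_same(2)[OF assms(1,2) True assms(3)] True by (simp add: sorted_psi_def)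
next
  case False
  then show ?thesis using sort_pos_swap_far[OF assms(1,2) False assms(3)] assms by (simp add: sorted_psi_def)
qed

lemma sorted_psi_y_succ:
  assumes "js \<in> S" "r \<in> {1..<n}" "Q.homog (sort_seq js) v"
  shows "sorted_psi r js (y (sort_pos js (r + 1)) v) =
    y (sort_pos (swap_entries r js) r) (sorted_psi r js v) \<oplus> (if entry js r = entry js (r + 1) then v else \<zero>)"
proof (cases "colour_at js r = colour_at js (r + 1)")
  case True
  then show ?thesis
    using Q.psi_y_succ_homog[OF sort_seq_swap_same(2)[OF assms(1,2) True] sort_seq_in[OF assms(1)] assms(3)]
      entry_sort_seq_succ[OF assms(1,2) True] sort_pos_same(1)[OF assms(1,2) True] sort_pos_same(2)[OF assms(1,2) True, of r] assms(2) by (simp add: sorted_psi_def)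
next
  case False
  then have "entry js r \<noteq> entry js (r + 1)" by (auto simp: colour_at_def)
  moreover have "y (sort_pos js (r + 1)) v \<in> carrier N"
    using Q.y_closed[OF sort_pos_in Q.homog_closed[OF assms(3)], of "r + 1"] assms(2) by auto
  ultimately show ?thesis using sort_pos_swap_far[OF assms(1,2) False, of r] assms(2) False by (simp add: sorted_psi_def)
qed

lemma sorted_psi_succ_y:
  assumes "js \<in> S" "r \<in> {1..<n}" "Q.homog (sort_seq js) v"
  shows "y (sort_pos (swap_entries r js) (r + 1)) (sorted_psi r js v) =
    sorted_psi r js (y (sort_pos js r) v) \<oplus> (if entry js r = entry js (r + 1) then v else \<zero>)"
proof (cases "colour_at js r = colour_at js (r + 1)")
  case True
  then show ?thesis
    using Q.y_succ_psi_homog[OF sort_seq_swap_same(2)[OF assms(1,2) True] sort_seq_in[OF assms(1)] assms(3)]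
      entry_sort_seq_succ[OF assms(1,2) True] sort_pos_same(1)[OF assms(1,2) True] sort_pos_same(2)[OF assms(1,2) True, of "r + 1"] assms(2) by (simp add: sorted_psi_def)
next
  case False
  then have "entry js r \<noteq> entry js (r + 1)" by (auto simp: colour_at_def)
  moreover have "y (sort_pos js r) v \<in> carrier N"
    using Q.y_closed[OF sort_pos_in Q.homog_closed[OF assms(3)], of r] assms(2) by auto
  ultimately show ?thesis using sort_pos_swap_far[OF assms(1,2) False, of "r + 1"] assms(2) False by (simp add: sorted_psi_def)
qed

lemma sorted_psi_sorted_psi:
  assumes "js \<in> S" "r \<in> {1..<n}" "Q.homog (sort_seq js) v"
  shows "sorted_psi r (swap_entries r js) (sorted_psi r js v) =
    sq_act N e (entry js r) (entry js (r + 1)) (y (sort_pos js r)) (y (sort_pos js (r + 1))) v"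
proof (cases "colour_at js r = colour_at js (r + 1)")
  case True
  have "colour_at (swap_entries r js) r = colour_at (swap_entries r js) (r + 1)"
    using colour_at_swap[OF assms(1,2)] True assms(2) by auto
  then show ?thesis
    using Q.psi_psi_homog[OF sort_seq_swap_same(2)[OF assms(1,2) True] sort_seq_in[OF assms(1)] assms(3)]
      entry_sort_seq_succ[OF assms(1,2) True] sort_pos_same(1)[OF assms(1,2) True] sort_pos_same(2)[OF assms(1,2) True, of r] assms(2) True by (simp add: sorted_psi_def)
next
  case False
  have "colour_at (swap_entries r js) r \<noteq> colour_at (swap_entries r js) (r + 1)"
    using colour_at_swap[OF assms(1,2)] False assms(2) by auto
  moreover have "r \<in> {1..n}" "r + 1 \<in> {1..n}" using assms(2) by auto
  ultimately show ?thesis using far_entry[OF assms(1) _ _ False] False by (simp add: sorted_psi_def sq_act_def)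
qed

lemma sort_pos_swap_other:
  assumes "js \<in> S" "r \<in> {1..<n}" "s \<in> {1..n}" "s \<noteq> r" "s \<noteq> r + 1"
  shows "sort_pos (swap_entries r js) s = sort_pos js s"
  using sort_pos_swap_far[OF assms(1,2) _ assms(3)] sort_pos_same(2)[OF assms(1,2) _ assms(3)] assms(4,5) by (metis (full_types))

lemma sorted_psi_comm:
  assumes "js \<in> S" "r \<in> {1..<n}" "s \<in> {1..<n}" "1 < \<bar>int r - int s\<bar>" "Q.homog (sort_seq js) v"
  shows "sorted_psi r (swap_entries s js) (sorted_psi s js v) = sorted_psi s (swap_entries r js) (sorted_psi r js v)"
proof -
  have *: "r \<in> {1..n}" "r + 1 \<in> {1..n}" "s \<in> {1..n}" "s + 1 \<in> {1..n}" using assms by auto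
  have c: "colour_at (swap_entries s js) r = colour_at js r" "colour_at (swap_entries s js) (r + 1) = colour_at js (r + 1)"
    "colour_at (swap_entries r js) s = colour_at js s" "colour_at (swap_entries r js) (s + 1) = colour_at js (s + 1)"
    using colour_at_swap[OF assms(1,2)] colour_at_swap[OF assms(1,3)] assms(2-4) by auto
  have sg: "sort_pos (swap_entries s js) r = sort_pos js r" "sort_pos (swap_entries r js) s = sort_pos js s"
    using sort_pos_swap_other[OF assms(1,2) *(3)] sort_pos_swap_other[OF assms(1,3) *(1)] assms(4) by auto
  show ?thesis
  proof (cases "colour_at js r = colour_at js (r + 1) \<and> colour_at js s = colour_at js (s + 1)")
    case True
    then have r: "colour_at js r = colour_at js (r + 1)" and s: "colour_at js s = colour_at js (s + 1)" by auto
    have "sort_pos js r \<noteq> sort_pos js s" "sort_pos js r + 1 \<noteq> sort_pos js s" "sort_pos js r \<noteq> sort_pos js s + 1"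
      using sort_pos_ne[OF *(1,3), of js] sort_pos_ne[OF *(2,3), of js] sort_pos_ne[OF *(1,4), of js] assms(4)
        sort_pos_same(1)[OF assms(1,2) r] sort_pos_same(1)[OF assms(1,3) s] by auto
    then have "1 < \<bar>int (sort_pos js r) - int (sort_pos js s)\<bar>" by linarith
    then show ?thesis
      using Q.psi_comm[OF sort_seq_swap_same(2)[OF assms(1,2) r] sort_seq_swap_same(2)[OF assms(1,3) s] _ Q.homog_closed[OF assms(5)]] r s c sg
      by (simp add: sorted_psi_def)
  qed (use c sg in \<open>auto simp: sorted_psi_def\<close>)
qed

text \<open>If all three colours agree this is the braid relation at the sorted position. Otherwise
  at most one pair of strands shares a colour, so at most one of the three factors on each side is
  not the identity, and it remains to see that both sides use it at the same sorted
  position.\<close>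

lemma sorted_psi_braid:
  assumes "js \<in> S" "r \<in> {1..<n}" "r + 1 \<in> {1..<n}" "Q.homog (sort_seq js) v"
  shows "sorted_psi r (swap_entries (r + 1) (swap_entries r js)) (sorted_psi (r + 1) (swap_entries r js) (sorted_psi r js v)) =
    sorted_psi (r + 1) (swap_entries r (swap_entries (r + 1) js)) (sorted_psi r (swap_entries (r + 1) js) (sorted_psi (r + 1) js v)) \<oplus>
    braid_act N e (entry js r) (entry js (r + 1)) (entry js (r + 2)) (y (sort_pos js r)) (y (sort_pos js (r + 1))) (y (sort_pos js (r + 2))) v"
    (is "?l = ?r \<oplus> ?b")
proof -
  let ?j1 = "swap_entries r js" and ?k1 = "swap_entries (r + 1) js"
  let ?j2 = "swap_entries (r + 1) ?j1" and ?k2 = "swap_entries r ?k1"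
  have *: "r \<in> {1..n}" "r + 1 \<in> {1..n}" "r + 2 \<in> {1..n}" using assms(2,3) by auto
  have S: "?j1 \<in> S" "?k1 \<in> S" using swap_S assms by auto
  have S2: "?j2 \<in> S" "?k2 \<in> S" using swap_S assms S by auto
  let ?a = "colour_at js r" and ?b = "colour_at js (r + 1)" and ?c = "colour_at js (r + 2)"
  have j1: "colour_at ?j1 r = ?b" "colour_at ?j1 (r + 1) = ?a" "colour_at ?j1 (r + 2) = ?c"
    and k1: "colour_at ?k1 r = ?a" "colour_at ?k1 (r + 1) = ?c" "colour_at ?k1 (r + 2) = ?b"
    using colour_at_swap[OF assms(1,2)] colour_at_swap[OF assms(1,3)] assms(2) by auto
  have j2: "colour_at ?j2 r = ?b" "colour_at ?j2 (r + 1) = ?c" and k2: "colour_at ?k2 (r + 1) = ?a" "colour_at ?k2 (r + 2) = ?b"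
    using colour_at_swap[OF S(1) assms(3)] colour_at_swap[OF S(2) assms(2)] j1 k1 assms(2) by auto
  note v = Q.homog_closed[OF assms(4)]
  have "Q.homog (sort_seq (swap_entries (r + 1) ?k2)) (sorted_psi (r + 1) ?k2 (sorted_psi r ?k1 (sorted_psi (r + 1) js v)))"
    by (intro sorted_psi_homog S S2 assms)
  then have rc: "sorted_psi (r + 1) ?k2 (sorted_psi r ?k1 (sorted_psi (r + 1) js v)) \<in> carrier N" by (rule Q.homog_closed)
  have PPs: "sorted_psi r js v = (if ?a = ?b then psi (sort_pos js r) v else v)"
    "sorted_psi (r + 1) ?j1 u = (if ?a = ?c then psi (sort_pos ?j1 (r + 1)) u else u)"
    "sorted_psi r ?j2 u = (if ?b = ?c then psi (sort_pos ?j2 r) u else u)"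
    "sorted_psi (r + 1) js v = (if ?b = ?c then psi (sort_pos js (r + 1)) v else v)"
    "sorted_psi r ?k1 u = (if ?a = ?c then psi (sort_pos ?k1 r) u else u)"
    "sorted_psi (r + 1) ?k2 u = (if ?a = ?b then psi (sort_pos ?k2 (r + 1)) u else u)" for u
    using j1 k1 j2 k2 by (auto simp: sorted_psi_def)
  show ?thesis
  proof (cases "?a = ?b \<and> ?b = ?c")
    case True
    then have ab: "?a = colour_at js (r + 1)" and bc: "colour_at js (r + 1) = colour_at js ((r + 1) + 1)" by auto
    note s1 = sort_pos_same[OF assms(1,2) ab] and s2 = sort_pos_same[OF assms(1,3) bc]
    have j1e: "colour_at ?j1 (r + 1) = colour_at ?j1 ((r + 1) + 1)" and k1e: "colour_at ?k1 r = colour_at ?k1 (r + 1)"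
      using j1 k1 True by auto
    have sg: "sort_pos ?j1 (r + 1) = sort_pos js r + 1" "sort_pos ?j2 r = sort_pos js r" "sort_pos js (r + 1) = sort_pos js r + 1"
      "sort_pos ?k1 r = sort_pos js r" "sort_pos ?k2 (r + 1) = sort_pos js r + 1" "sort_pos js (r + 2) = sort_pos js r + 2"
      using s1 s2 sort_pos_same(2)[OF S(1) assms(3) j1e *(1)] sort_pos_same(2)[OF S(2) assms(2) k1e *(2)] * by auto
    have D: "sort_pos js r \<in> D0" "sort_pos js r + 1 \<in> D0"
      using sort_seq_swap_same(2)[OF assms(1,2) ab] sort_seq_swap_same(2)[OF assms(1,3) bc] sg(3) by auto
    have en: "entry (sort_seq js) (sort_pos js r) = entry js r" "entry (sort_seq js) (sort_pos js r + 1) = entry js (r + 1)"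
      "entry (sort_seq js) (sort_pos js r + 2) = entry js (r + 2)"
      using entry_sort_seq[OF *(1), of js] entry_sort_seq[OF *(2), of js] entry_sort_seq[OF *(3), of js] sg by simp_all
    show ?thesis
      using Q.braid_homog[OF D sort_seq_in[OF assms(1)] assms(4)] True unfolding PPs sg en by simp
  next
    case False
    \<comment> \<open>The error needs equal outer residues and an arrow to the middle one. If the
      outer colours agree the middle colour differs and there is no arrow; if not, the outer
      residues differ.\<close>
    have bz: "braid_act N e (entry js r) (entry js (r + 1)) (entry js (r + 2)) y1 y2 y3 v = \<zero>" for y1 y2 y3
    proof (cases "?a = ?c")
      case True
      then show ?thesis using far_entry[OF assms(1) *(3,2)] False by (simp add: braid_act_def)
    next
      case ac: False
      then have "entry js r \<noteq> entry js (r + 2)" by (auto simp: colour_at_def)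
      then show ?thesis by (simp add: braid_act_def)
    qed
    have "?l = ?r"
    proof -
      consider "?a = ?b" "?b \<noteq> ?c" "?a \<noteq> ?c" | "?a = ?c" "?a \<noteq> ?b" "?b \<noteq> ?c" | "?b = ?c" "?a \<noteq> ?b" "?a \<noteq> ?c" | "?a \<noteq> ?b" "?b \<noteq> ?c" "?a \<noteq> ?c"
        using False by metis
      then show ?thesis
      proof cases
        case 1
        have "sort_pos ?k2 (r + 1) = sort_pos ?k1 r" using sort_pos_swap_far[OF S(2) assms(2) _ *(2)] k1 1 by simp
        also have "\<dots> = sort_pos js r" using sort_pos_swap_other[OF assms(1,3) *(1)] by simp
        finally show ?thesis using 1 unfolding PPs by simp
      next
        case 2
        have "sort_pos ?j1 (r + 1) = sort_pos js r" using sort_pos_swap_far[OF assms(1,2) _ *(2)] 2 by simp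
        moreover have "sort_pos ?k1 r = sort_pos js r" using sort_pos_swap_other[OF assms(1,3) *(1)] by simp
        ultimately show ?thesis using 2 unfolding PPs by simp
      next
        case 3
        have "sort_pos ?j2 r = sort_pos ?j1 r" using sort_pos_swap_other[OF S(1) assms(3) *(1)] by simp
        also have "\<dots> = sort_pos js (r + 1)" using sort_pos_swap_far[OF assms(1,2) _ *(1)] 3 by simp
        finally show ?thesis using 3 unfolding PPs by simp
      next
        case 4
        then show ?thesis unfolding PPs by simp
      qed
    qed
    then show ?thesis unfolding bz using rc by simp
  qed
qed

text \<open>One copy of the component of \<open>sort_seq is\<close> for each label
  \<open>is\<close>. As \<open>S\<close> is finite, families of vectors form the direct sum;
  extensionality lets equality be tested on \<open>S\<close>.\<close>

definition induced :: "(int list \<Rightarrow> 'a) ring" where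
  "induced = \<lparr>carrier = {x \<in> extensional S. \<forall>is\<in>S. Q.homog (sort_seq is) (x is)}, monoid.mult = undefined, one = undefined,
     ring.zero = (\<lambda>is\<in>S. \<zero>), add = (\<lambda>x z. \<lambda>is\<in>S. x is \<oplus> z is)\<rparr>"

definition induced_sc :: "'k \<Rightarrow> (int list \<Rightarrow> 'a) \<Rightarrow> int list \<Rightarrow> 'a" where
  "induced_sc c x = (\<lambda>is\<in>S. sc c (x is))"

definition single_at :: "int list \<Rightarrow> 'a \<Rightarrow> int list \<Rightarrow> 'a" where
  "single_at js v = (\<lambda>is\<in>S. if is = js then v else \<zero>)"

definition induced_ee :: "int list \<Rightarrow> (int list \<Rightarrow> 'a) \<Rightarrow> int list \<Rightarrow> 'a" where "induced_ee js x = single_at js (x js)"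

definition induced_y :: "nat \<Rightarrow> (int list \<Rightarrow> 'a) \<Rightarrow> int list \<Rightarrow> 'a" where
  "induced_y r x = (\<lambda>is\<in>S. y (sort_pos is r) (x is))"

text \<open>\<open>psi r\<close> moves the label \<open>js\<close> to
  \<open>swap_entries r js\<close>; as the swap is an involution, the value at \<open>is\<close>
  comes from the label \<open>swap_entries r is\<close>.\<close>

definition induced_psi :: "nat \<Rightarrow> (int list \<Rightarrow> 'a) \<Rightarrow> int list \<Rightarrow> 'a" where
  "induced_psi r x = (\<lambda>is\<in>S. sorted_psi r (swap_entries r is) (x (swap_entries r is)))"

lemma induced_carrier: "x \<in> carrier induced \<longleftrightarrow> x \<in> extensional S \<and> (\<forall>is\<in>S. Q.homog (sort_seq is) (x is))"
  and induced_zero: "\<zero>\<^bsub>induced\<^esub> = (\<lambda>is\<in>S. \<zero>)" and induced_add: "x \<oplus>\<^bsub>induced\<^esub> z = (\<lambda>is\<in>S. x is \<oplus> z is)"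
  by (simp_all add: induced_def)

lemma induced_homog: "x \<in> carrier induced \<Longrightarrow> is \<in> S \<Longrightarrow> Q.homog (sort_seq is) (x is)"
  by (simp add: induced_carrier)

lemma induced_in: "x \<in> carrier induced \<Longrightarrow> is \<in> S \<Longrightarrow> x is \<in> carrier N"
  using induced_homog Q.homog_closed by blast

lemma homog_sub:
  assumes "js \<in> S0" shows "Q.homog js \<zero>" "Q.homog js u \<Longrightarrow> Q.homog js v \<Longrightarrow> Q.homog js (u \<oplus> v)" "Q.homog js v \<Longrightarrow> Q.homog js (sc c v)" "Q.homog js v \<Longrightarrow> Q.homog js (\<ominus> v)"
proof -
  note k = Q.ee_klin[OF assms]
  show sc: "Q.homog js v \<Longrightarrow> Q.homog js (sc c v)" for c v by (simp add: Q.homog_def klin_sc[OF k])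
  show "Q.homog js \<zero>" using klin_zero[OF k Q.abelian_group_axioms Q.abelian_group_axioms] by (simp add: Q.homog_def)
  show "Q.homog js u \<Longrightarrow> Q.homog js v \<Longrightarrow> Q.homog js (u \<oplus> v)" by (simp add: Q.homog_def klin_add[OF k])
  show "Q.homog js v \<Longrightarrow> Q.homog js (\<ominus> v)" using sc[of v "-1"] Q.sc_minus_one Q.homog_closed by metis
qed

lemma induced_kspace: "kspace induced induced_sc"
proof -
  note h = homog_sub[OF sort_seq_S0]
  have "abelian_group induced"
  proof (rule abelian_groupI)
    fix x assume x: "x \<in> carrier induced"
    then show "\<exists>z\<in>carrier induced. z \<oplus>\<^bsub>induced\<^esub> x = \<zero>\<^bsub>induced\<^esub>"
      by (intro bexI[of _ "\<lambda>is\<in>S. \<ominus> x is"]) (auto simp: induced_carrier induced_add induced_zero h Q.homog_closed Q.l_neg fun_eq_iff)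
    show "\<zero>\<^bsub>induced\<^esub> \<oplus>\<^bsub>induced\<^esub> x = x"
      using x by (auto simp: induced_carrier induced_add induced_zero Q.homog_closed fun_eq_iff extensional_def)
    fix z assume z: "z \<in> carrier induced"
    show "x \<oplus>\<^bsub>induced\<^esub> z \<in> carrier induced" using x z by (auto simp: induced_carrier induced_add h)
    show "x \<oplus>\<^bsub>induced\<^esub> z = z \<oplus>\<^bsub>induced\<^esub> x" using induced_in[OF x] induced_in[OF z] by (auto simp: induced_add Q.a_comm fun_eq_iff)
    fix u assume u: "u \<in> carrier induced"
    show "x \<oplus>\<^bsub>induced\<^esub> z \<oplus>\<^bsub>induced\<^esub> u = x \<oplus>\<^bsub>induced\<^esub> (z \<oplus>\<^bsub>induced\<^esub> u)"
      using induced_in[OF x] induced_in[OF z] induced_in[OF u] by (auto simp: induced_add Q.a_assoc fun_eq_iff)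
  qed (auto simp: induced_carrier induced_zero h)
  moreover have "induced_sc c x \<in> carrier induced" "induced_sc (c + d) x = induced_sc c x \<oplus>\<^bsub>induced\<^esub> induced_sc d x"
      "induced_sc (c * d) x = induced_sc c (induced_sc d x)" "induced_sc 1 x = x" if x: "x \<in> carrier induced" for c d x
    using x induced_in[OF x] by (auto simp: induced_carrier induced_add induced_sc_def h Q.sc_add_left Q.sc_mult fun_eq_iff extensional_def)
  moreover have "induced_sc c (x \<oplus>\<^bsub>induced\<^esub> z) = induced_sc c x \<oplus>\<^bsub>induced\<^esub> induced_sc c z" if x: "x \<in> carrier induced" and z: "z \<in> carrier induced" for c x z
    using induced_in[OF x] induced_in[OF z] by (auto simp: induced_add induced_sc_def Q.sc_add_right fun_eq_iff)
  ultimately show ?thesis unfolding kspace_def kspace_axioms_def by blast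
qed

sublocale G: kspace induced induced_sc by (rule induced_kspace)

lemma induced_eqI: "x \<in> carrier induced \<Longrightarrow> z \<in> carrier induced \<Longrightarrow> (\<And>is. is \<in> S \<Longrightarrow> x is = z is) \<Longrightarrow> x = z"
  by (rule extensionalityI[of _ S]) (simp_all add: induced_carrier)

lemma single_at_in: "js \<in> S \<Longrightarrow> Q.homog (sort_seq js) v \<Longrightarrow> single_at js v \<in> carrier induced"
  by (auto simp: single_at_def induced_carrier homog_sub sort_seq_S0)

lemma single_at_klin:
  assumes "js \<in> S" "\<And>v. v \<in> carrier L \<Longrightarrow> Q.homog (sort_seq js) (f v)" "klin L tc N sc f"
  shows "klin L tc induced induced_sc (\<lambda>v. single_at js (f v))"
  using assms single_at_in[OF assms(1)]
  by (intro klinI) (auto simp: induced_add induced_sc_def single_at_def fun_eq_iff klin_add[OF assms(3)] klin_sc[OF assms(3)])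

lemma single_at_0: "single_at js \<zero> = \<zero>\<^bsub>induced\<^esub>" by (auto simp: single_at_def induced_zero)

lemma induced_uminus: "x \<in> carrier induced \<Longrightarrow> \<ominus>\<^bsub>induced\<^esub> x = (\<lambda>is\<in>S. \<ominus> x is)"
proof -
  assume x: "x \<in> carrier induced"
  have "(\<lambda>is\<in>S. \<ominus> x is) \<in> carrier induced" using x by (auto simp: induced_carrier homog_sub sort_seq_S0)
  moreover have "(\<lambda>is\<in>S. \<ominus> x is) \<oplus>\<^bsub>induced\<^esub> x = \<zero>\<^bsub>induced\<^esub>" using induced_in[OF x] by (auto simp: induced_add induced_zero Q.l_neg fun_eq_iff)
  ultimately show ?thesis using x by (intro G.minus_equality)
qed

lemma single_at_uminus: "js \<in> S \<Longrightarrow> Q.homog (sort_seq js) v \<Longrightarrow> \<ominus>\<^bsub>induced\<^esub> single_at js v = single_at js (\<ominus> v)"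
  by (subst induced_uminus[OF single_at_in]) (auto simp: single_at_def fun_eq_iff)

lemma single_at_plus: "js \<in> S \<Longrightarrow> Q.homog (sort_seq js) u \<Longrightarrow> Q.homog (sort_seq js) v \<Longrightarrow> single_at js u \<oplus>\<^bsub>induced\<^esub> single_at js v = single_at js (u \<oplus> v)"
  by (auto simp: single_at_def induced_add fun_eq_iff)

lemma single_at_minus: "js \<in> S \<Longrightarrow> Q.homog (sort_seq js) u \<Longrightarrow> Q.homog (sort_seq js) v \<Longrightarrow> single_at js u \<ominus>\<^bsub>induced\<^esub> single_at js v = single_at js (u \<ominus> v)"
  by (simp add: a_minus_def single_at_uminus single_at_plus homog_sub sort_seq_S0)

lemma homog_y_sort_pos: "js \<in> S \<Longrightarrow> r \<in> {1..n} \<Longrightarrow> Q.homog (sort_seq js) v \<Longrightarrow> Q.homog (sort_seq js) (y (sort_pos js r) v)"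
  by (rule Q.homog_y[OF sort_seq_in sort_pos_in])

lemma y_sort_pos_zero: "r \<in> {1..n} \<Longrightarrow> y (sort_pos js r) \<zero> = \<zero>"
  by (rule klin_zero[OF Q.y_klin[OF sort_pos_in] Q.abelian_group_axioms Q.abelian_group_axioms])

lemma sorted_psi_zero: "js \<in> S \<Longrightarrow> r \<in> {1..<n} \<Longrightarrow> sorted_psi r js \<zero> = \<zero>"
  by (rule klin_zero[OF sorted_psi_klin Q.abelian_group_axioms Q.abelian_group_axioms])

lemma swap_S_iff: "is \<in> S \<Longrightarrow> r \<in> {1..<n} \<Longrightarrow> js \<in> S \<Longrightarrow> swap_entries r is = js \<longleftrightarrow> is = swap_entries r js"
  using swap_swap[of r "is"] swap_swap[of r js] length_S by auto

lemma induced_y_single_at: "js \<in> S \<Longrightarrow> r \<in> {1..n} \<Longrightarrow> induced_y r (single_at js v) = single_at js (y (sort_pos js r) v)"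
  using y_sort_pos_zero by (auto simp: induced_y_def single_at_def fun_eq_iff)

lemma induced_psi_single_at: "js \<in> S \<Longrightarrow> r \<in> {1..<n} \<Longrightarrow> induced_psi r (single_at js v) = single_at (swap_entries r js) (sorted_psi r js v)"
proof (rule extensionalityI[of _ S])
  fix "is" assume js: "js \<in> S" and r: "r \<in> {1..<n}" and i: "is \<in> S"
  show "induced_psi r (single_at js v) is = single_at (swap_entries r js) (sorted_psi r js v) is"
    using swap_S_iff[OF i r js] swap_S[OF i r] sorted_psi_zero[OF swap_S[OF i r] r] i by (auto simp: induced_psi_def single_at_def)
qed (simp_all add: induced_psi_def single_at_def)

lemma induced_y_klin: "r \<in> {1..n} \<Longrightarrow> klin induced induced_sc induced induced_sc (induced_y r)"
proof -
  assume r: "r \<in> {1..n}"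
  note k = Q.y_klin[OF sort_pos_in[OF r]]
  show ?thesis
  proof (rule klinI)
    fix x assume x: "x \<in> carrier induced"
    show "induced_y r x \<in> carrier induced" using induced_homog[OF x] homog_y_sort_pos[OF _ r] by (auto simp: induced_carrier induced_y_def)
    show "induced_y r (induced_sc c x) = induced_sc c (induced_y r x)" for c
      using induced_in[OF x] klin_sc[OF k] by (auto simp: induced_y_def induced_sc_def fun_eq_iff)
    show "induced_y r (x \<oplus>\<^bsub>induced\<^esub> z) = induced_y r x \<oplus>\<^bsub>induced\<^esub> induced_y r z" if z: "z \<in> carrier induced" for z
      using induced_in[OF x] induced_in[OF z] klin_add[OF k] by (auto simp: induced_y_def induced_add fun_eq_iff)
  qed
qed

lemma induced_psi_klin:
  assumes r: "r \<in> {1..<n}" shows "klin induced induced_sc induced induced_sc (induced_psi r)"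
proof -
  have h: "Q.homog (sort_seq is) (sorted_psi r (swap_entries r is) (x (swap_entries r is)))" if "x \<in> carrier induced" "is \<in> S" for x "is"
    using sorted_psi_homog[OF swap_S[OF that(2) r] r induced_homog[OF that(1) swap_S[OF that(2) r]]] swap_swap[of r "is"] r length_S[OF that(2)] by simp
  note k = sorted_psi_klin[OF swap_S[OF _ r] r]
  show ?thesis
  proof (rule klinI)
    fix x assume x: "x \<in> carrier induced"
    show "induced_psi r x \<in> carrier induced" using h[OF x] by (auto simp: induced_carrier induced_psi_def)
    show "induced_psi r (induced_sc c x) = induced_sc c (induced_psi r x)" for c
      using induced_in[OF x swap_S[OF _ r]] swap_S[OF _ r] klin_sc[OF k] by (auto simp: induced_psi_def induced_sc_def fun_eq_iff)
    show "induced_psi r (x \<oplus>\<^bsub>induced\<^esub> z) = induced_psi r x \<oplus>\<^bsub>induced\<^esub> induced_psi r z" if z: "z \<in> carrier induced" for z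
      using induced_in[OF x swap_S[OF _ r]] induced_in[OF z swap_S[OF _ r]] swap_S[OF _ r] klin_add[OF k]
      by (auto simp: induced_psi_def induced_add fun_eq_iff)
  qed
qed

lemma induced_ee_klin: "js \<in> S \<Longrightarrow> klin induced induced_sc induced induced_sc (induced_ee js)"
  unfolding induced_ee_def
  by (rule single_at_klin) (auto simp: induced_homog induced_in induced_add induced_sc_def intro!: klinI)

lemma induced_ee_sum: 
  assumes x: "x \<in> carrier induced" shows "(\<Oplus>\<^bsub>induced\<^esub>is\<in>S. induced_ee is x) = x"
proof (rule induced_eqI)
  have c: "(\<lambda>is. induced_ee is x) \<in> S \<rightarrow> carrier induced" using x by (auto simp: induced_ee_def single_at_in induced_homog)
  show "(\<Oplus>\<^bsub>induced\<^esub>is\<in>S. induced_ee is x) \<in> carrier induced" by (rule G.finsum_closed[OF c])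
  fix "is" assume i: "is \<in> S"
  have "klin induced induced_sc N sc (\<lambda>z. z is)" using i induced_in by (auto intro!: klinI simp: induced_add induced_sc_def)
  from klin_finsum[OF this G.abelian_group_axioms Q.abelian_group_axioms c]
  have "(\<Oplus>\<^bsub>induced\<^esub>is\<in>S. induced_ee is x) is = (\<Oplus>js\<in>S. induced_ee js x is)" .
  also have "\<dots> = (\<Oplus>js\<in>S. if is = js then x js else \<zero>)"
    using i induced_in[OF x] by (intro Q.finsum_cong') (auto simp: induced_ee_def single_at_def)
  also have "\<dots> = x is" by (rule Q.finsum_singleton[OF i finite_S]) (use induced_in[OF x] in auto)
  finally show "(\<Oplus>\<^bsub>induced\<^esub>is\<in>S. induced_ee is x) is = x is" .
qed (rule x)

text \<open>Most relations with an idempotent are evaluated on a family concentrated at one label,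
  where \<open>induced_y_single_at\<close> and \<open>induced_psi_single_at\<close> reduce them to
  the lemmas on \<open>sorted_psi\<close>. The relations without idempotents are compared label by
  label.\<close>

lemma induced_rep: "qh_rep induced induced_sc e n S {1..<n} induced_ee induced_y induced_psi"
proof
  show "finite S" by (rule finite_S)
next
  fix "is" assume "is \<in> S" then show "length is = n" by (rule length_S)
next
  fix r "is" assume "r \<in> {1..<n}" "is \<in> S" then show "swap_entries r is \<in> S" by (intro swap_S)
next
  fix "is" assume "is \<in> S" then show "klin induced induced_sc induced induced_sc (induced_ee is)" by (rule induced_ee_klin)
next
  fix r assume "r \<in> {1..n}" then show "klin induced induced_sc induced induced_sc (induced_y r)" by (rule induced_y_klin)
next
  fix r assume "r \<in> {1..<n}" then show "klin induced induced_sc induced induced_sc (induced_psi r)" by (rule induced_psi_klin)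
next
  fix x "is" js assume "is \<in> S" "js \<in> S" "x \<in> carrier induced"
  then show "induced_ee is (induced_ee js x) = (if is = js then induced_ee is x else \<zero>\<^bsub>induced\<^esub>)"
    by (auto simp: induced_ee_def single_at_def induced_zero fun_eq_iff)
next
  fix x assume "x \<in> carrier induced" then show "(\<Oplus>\<^bsub>induced\<^esub>is\<in>S. induced_ee is x) = x" by (rule induced_ee_sum)
next
  fix x r "is" assume "r \<in> {1..n}" "is \<in> S" "x \<in> carrier induced"
  then show "induced_y r (induced_ee is x) = induced_ee is (induced_y r x)"
    by (simp only: induced_ee_def induced_y_single_at) (simp add: induced_y_def)
next
  fix x r "is" assume a: "r \<in> {1..<n}" "is \<in> S" "x \<in> carrier induced"
  then have "swap_entries r (swap_entries r is) = is" using swap_swap length_S by metis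
  then show "induced_psi r (induced_ee is x) = induced_ee (swap_entries r is) (induced_psi r x)"
    using a swap_S[OF a(2,1)] by (simp only: induced_ee_def induced_psi_single_at) (simp add: induced_psi_def)
next
  fix x r s assume "r \<in> {1..n}" "s \<in> {1..n}" "x \<in> carrier induced"
  then show "induced_y r (induced_y s x) = induced_y s (induced_y r x)"
    using Q.y_y[OF sort_pos_in sort_pos_in induced_in] by (auto simp: induced_y_def fun_eq_iff)
next
  fix x r "is" assume a: "r \<in> {1..<n}" "is \<in> S" "x \<in> carrier induced"
  note h = induced_homog[OF a(3,2)]
  have r: "r \<in> {1..n}" "r + 1 \<in> {1..n}" using a(1) by auto
  note S = swap_S[OF a(2,1)]
  \<comment> \<open>The correction term stays at the label \<open>is\<close> while the other terms
    move to the swapped label. It is nonzero only for equal residues, and then the two labels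
    coincide.\<close>
  have d: "Q.homog (sort_seq (swap_entries r is)) (if entry is r = entry is (r + 1) then x is else \<zero>)"
  proof (cases "entry is r = entry is (r + 1)")
    case True
    then have "swap_entries r is = is" using a(1) length_S[OF a(2)] by (intro entry_ext[of _ n]) (auto simp: entry_swap)
    then show ?thesis using h by (simp add: homog_sub sort_seq_S0 a(2))
  qed (simp add: homog_sub sort_seq_S0 S)
  have eq: "single_at (swap_entries r is) (if entry is r = entry is (r + 1) then x is else \<zero>) =
     (if entry is r = entry is (r + 1) then induced_ee is x else \<zero>\<^bsub>induced\<^esub>)"
  proof (cases "entry is r = entry is (r + 1)")
    case True
    then have "swap_entries r is = is" using a(1) length_S[OF a(2)] by (intro entry_ext[of _ n]) (auto simp: entry_swap)
    then show ?thesis by (simp add: induced_ee_def single_at_0)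
  qed (simp add: single_at_0)
  have p: "Q.homog (sort_seq (swap_entries r is)) (sorted_psi r is (x is))" by (rule sorted_psi_homog[OF a(2,1) h])
  have "induced_psi r (induced_y (r + 1) (induced_ee is x)) = single_at (swap_entries r is) (sorted_psi r is (y (sort_pos is (r + 1)) (x is)))"
    by (simp only: induced_ee_def induced_y_single_at[OF a(2) r(2)] induced_psi_single_at[OF a(2,1)])
  also have "\<dots> = single_at (swap_entries r is) (y (sort_pos (swap_entries r is) r) (sorted_psi r is (x is))) \<oplus>\<^bsub>induced\<^esub>
     single_at (swap_entries r is) (if entry is r = entry is (r + 1) then x is else \<zero>)"
    unfolding sorted_psi_y_succ[OF a(2,1) h] by (rule single_at_plus[OF S homog_y_sort_pos[OF S r(1) p] d, symmetric])
  also have "single_at (swap_entries r is) (y (sort_pos (swap_entries r is) r) (sorted_psi r is (x is))) = induced_y r (induced_psi r (induced_ee is x))"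
    by (simp only: induced_ee_def induced_y_single_at[OF S r(1)] induced_psi_single_at[OF a(2,1)])
  finally show "induced_psi r (induced_y (r + 1) (induced_ee is x)) =
      induced_y r (induced_psi r (induced_ee is x)) \<oplus>\<^bsub>induced\<^esub> (if entry is r = entry is (r + 1) then induced_ee is x else \<zero>\<^bsub>induced\<^esub>)"
    unfolding eq .
  have q: "Q.homog (sort_seq (swap_entries r is)) (sorted_psi r is (y (sort_pos is r) (x is)))"
    by (rule sorted_psi_homog[OF a(2,1) homog_y_sort_pos[OF a(2) r(1) h]])
  have "induced_y (r + 1) (induced_psi r (induced_ee is x)) = single_at (swap_entries r is) (y (sort_pos (swap_entries r is) (r + 1)) (sorted_psi r is (x is)))"
    by (simp only: induced_ee_def induced_y_single_at[OF S r(2)] induced_psi_single_at[OF a(2,1)])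
  also have "\<dots> = single_at (swap_entries r is) (sorted_psi r is (y (sort_pos is r) (x is))) \<oplus>\<^bsub>induced\<^esub>
     single_at (swap_entries r is) (if entry is r = entry is (r + 1) then x is else \<zero>)"
    unfolding sorted_psi_succ_y[OF a(2,1) h] by (rule single_at_plus[OF S q d, symmetric])
  also have "single_at (swap_entries r is) (sorted_psi r is (y (sort_pos is r) (x is))) = induced_psi r (induced_y r (induced_ee is x))"
    by (simp only: induced_ee_def induced_y_single_at[OF a(2) r(1)] induced_psi_single_at[OF a(2,1)])
  finally show "induced_y (r + 1) (induced_psi r (induced_ee is x)) =
      induced_psi r (induced_y r (induced_ee is x)) \<oplus>\<^bsub>induced\<^esub> (if entry is r = entry is (r + 1) then induced_ee is x else \<zero>\<^bsub>induced\<^esub>)"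
    unfolding eq .
  have "induced_psi r (induced_psi r (induced_ee is x)) = single_at is (sq_act N e (entry is r) (entry is (r + 1)) (y (sort_pos is r)) (y (sort_pos is (r + 1))) (x is))"
    using swap_swap[of r "is"] a(1) length_S[OF a(2)]
    by (simp only: induced_ee_def induced_psi_single_at[OF a(2,1)] induced_psi_single_at[OF S a(1)] sorted_psi_sorted_psi[OF a(2,1) h])
  also have "\<dots> = sq_act induced e (entry is r) (entry is (r + 1)) (induced_y r) (induced_y (r + 1)) (induced_ee is x)"
  proof -
    have hh: "Q.homog (sort_seq is) (y (sort_pos is t) u)" if "t \<in> {1..n}" "Q.homog (sort_seq is) u" for t u by (rule homog_y_sort_pos[OF a(2) that])
    have hm: "Q.homog (sort_seq is) (u \<ominus> w)" if "Q.homog (sort_seq is) u" "Q.homog (sort_seq is) w" for u w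
      unfolding a_minus_def by (intro homog_sub sort_seq_S0 a that)
    note h1 = hh[OF r(1) h] and h2 = hh[OF r(2) h]
    note h12 = hm[OF h1 h2]
    show ?thesis
      unfolding sq_act_def induced_ee_def induced_y_single_at[OF a(2) r(1)] induced_y_single_at[OF a(2) r(2)]
        single_at_minus[OF a(2) h1 h2] single_at_minus[OF a(2) h2 h1]
        single_at_minus[OF a(2) hh[OF r(2) h12] hh[OF r(1) h12]] induced_y_single_at[OF a(2) r(1)] induced_y_single_at[OF a(2) r(2)]
      by (simp add: single_at_0)
  qed
  finally show "induced_psi r (induced_psi r (induced_ee is x)) = sq_act induced e (entry is r) (entry is (r + 1)) (induced_y r) (induced_y (r + 1)) (induced_ee is x)" .
next
  fix x r s assume a: "r \<in> {1..<n}" "s \<in> {1..n}" "s \<noteq> r" "s \<noteq> r + 1" "x \<in> carrier induced"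
  show "induced_psi r (induced_y s x) = induced_y s (induced_psi r x)"
  \<comment> \<open>No idempotent occurs in this relation, so an arbitrary family is compared at
    each label; the value at \<open>is\<close> comes from the label
    \<open>swap_entries r is\<close>.\<close>
  proof (rule extensionalityI[of _ S])
    fix "is" assume i: "is \<in> S"
    have "swap_entries r (swap_entries r is) = is" using swap_swap length_S[OF i] a(1) by metis
    then show "induced_psi r (induced_y s x) is = induced_y s (induced_psi r x) is"
      using sorted_psi_y[OF swap_S[OF i a(1)] a(1-4) induced_homog[OF a(5) swap_S[OF i a(1)]]] i swap_S[OF i a(1)]
      by (simp add: induced_psi_def induced_y_def)
  qed (simp_all add: induced_psi_def induced_y_def)
next
  fix x r s assume a: "r \<in> {1..<n}" "s \<in> {1..<n}" "1 < \<bar>int r - int s\<bar>" "x \<in> carrier induced"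
  show "induced_psi r (induced_psi s x) = induced_psi s (induced_psi r x)"
  proof (rule extensionalityI[of _ S])
    fix "is" assume i: "is \<in> S"
    let ?j = "swap_entries r (swap_entries s is)"
    have len: "length is = n" by (rule length_S[OF i])
    have Si: "swap_entries r is \<in> S" "swap_entries s is \<in> S" "?j \<in> S" using swap_S i a by auto
    have j: "swap_entries s (swap_entries r is) = ?j" using swap_comm[of s "is" r] a len by auto
    have "swap_entries s ?j = swap_entries r is"
      unfolding j[symmetric] using swap_swap[of s "swap_entries r is"] a len by simp
    moreover have "swap_entries r ?j = swap_entries s is"
      using swap_swap[of r "swap_entries s is"] a len by simp
    ultimately show "induced_psi r (induced_psi s x) is = induced_psi s (induced_psi r x) is"
      using sorted_psi_comm[OF Si(3) a(1-3) induced_homog[OF a(4) Si(3)]] i Si j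
      by (simp add: induced_psi_def)
  qed (simp_all add: induced_psi_def)
next
  fix x r "is" assume a: "r \<in> {1..<n}" "r + 1 \<in> {1..<n}" "is \<in> S" "x \<in> carrier induced"
  note h = induced_homog[OF a(4,3)]
  have r: "r \<in> {1..n}" "r + 1 \<in> {1..n}" "r + 2 \<in> {1..n}" using a(1,2) by auto
  have len: "length is = n" by (rule length_S[OF a(3)])
  let ?j1 = "swap_entries r is" and ?k1 = "swap_entries (r + 1) is"
  let ?j2 = "swap_entries (r + 1) ?j1" and ?k2 = "swap_entries r ?k1"
  let ?f = "swap_entries r ?j2"
  let ?v = "sorted_psi (r + 1) ?k2 (sorted_psi r ?k1 (sorted_psi (r + 1) is (x is)))"
  let ?b = "braid_act N e (entry is r) (entry is (r + 1)) (entry is (r + 2)) (y (sort_pos is r)) (y (sort_pos is (r + 1))) (y (sort_pos is (r + 2))) (x is)"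
  let ?B = "braid_act induced e (entry is r) (entry is (r + 1)) (entry is (r + 2)) (induced_y r) (induced_y (r + 1)) (induced_y (r + 2)) (induced_ee is x)"
  have f: "?f = swap_entries (r + 1) ?k2" using swap_braid[of r "is"] a len by simp
  have Si: "?j1 \<in> S" "?k1 \<in> S" using swap_S a by auto
  have S2: "?j2 \<in> S" "?k2 \<in> S" using swap_S a Si by auto
  have Sf: "?f \<in> S" using swap_S a S2 by auto
  have v: "Q.homog (sort_seq ?f) ?v" unfolding f by (intro sorted_psi_homog Si S2 a h)
  \<comment> \<open>Three swaps exchange the outer entries. The error is nonzero only when these are
    equal, and then \<open>?f\<close> is \<open>is\<close> itself, so the error lives at the same
    label as the main term.\<close>
  have bz: "?b = \<zero> \<and> ?B = \<zero>\<^bsub>induced\<^esub> \<or> Q.homog (sort_seq is) ?b \<and> single_at is ?b = ?B \<and> ?f = is"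
  proof (cases "entry is r = entry is (r + 2)")
    case True
    have "?f = is"
      using True a len by (intro entry_ext[of _ n]) (auto simp: entry_swap)
    moreover have "Q.homog (sort_seq is) ?b"
      using h by (auto simp: braid_act_def a_minus_def homog_sub[OF sort_seq_S0[OF a(3)]] homog_y_sort_pos[OF a(3)] r simp del: atLeastAtMost_iff One_nat_def add_2_eq_Suc')
    moreover have "single_at is ?b = ?B"
    proof -
      have "Q.homog (sort_seq is) (y (sort_pos is t) (x is))" if "t \<in> {1..n}" for t by (rule homog_y_sort_pos[OF a(3) that h])
      note hh = this[OF r(1)] this[OF r(2)] this[OF r(3)]
      note hp = homog_sub(2)[OF sort_seq_S0[OF a(3)] hh(2) hh(2)]
      note hm = homog_sub(2)[OF sort_seq_S0[OF a(3)] hh(1) homog_sub(4)[OF sort_seq_S0[OF a(3)] hp], folded a_minus_def]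
      show ?thesis
        unfolding braid_act_def induced_ee_def induced_y_single_at[OF a(3) r(1)] induced_y_single_at[OF a(3) r(2)] induced_y_single_at[OF a(3) r(3)]
          single_at_plus[OF a(3) hh(2) hh(2)] single_at_minus[OF a(3) hh(1) hp] single_at_plus[OF a(3) hm hh(3)] single_at_uminus[OF a(3) h]
        by (simp add: single_at_0)
    qed
    ultimately show ?thesis by blast
  next
    case False
    then show ?thesis by (simp add: braid_act_def)
  qed
  have "induced_psi r (induced_psi (r + 1) (induced_psi r (induced_ee is x))) = single_at ?f (?v \<oplus> ?b)"
    unfolding induced_ee_def induced_psi_single_at[OF a(3,1)] induced_psi_single_at[OF Si(1) a(2)] induced_psi_single_at[OF S2(1) a(1)] sorted_psi_braid[OF a(3,1,2) h] ..
  also have "\<dots> = single_at ?f ?v \<oplus>\<^bsub>induced\<^esub> ?B"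
    using bz
  proof
    assume z: "?b = \<zero> \<and> ?B = \<zero>\<^bsub>induced\<^esub>"
    then have "?b = \<zero>" "?B = \<zero>\<^bsub>induced\<^esub>" by blast+
    then show ?thesis using single_at_in[OF Sf v] Q.homog_closed[OF v] by (simp only: Q.r_zero G.r_zero)
  next
    assume z: "Q.homog (sort_seq is) ?b \<and> single_at is ?b = ?B \<and> ?f = is"
    then have z: "Q.homog (sort_seq is) ?b" "single_at is ?b = ?B" "?f = is" by blast+
    have "Q.homog (sort_seq ?f) ?b" using z(1) unfolding z(3) .
    then have "single_at ?f (?v \<oplus> ?b) = single_at ?f ?v \<oplus>\<^bsub>induced\<^esub> single_at ?f ?b" by (rule single_at_plus[OF Sf v, symmetric])
    also have "single_at ?f ?b = ?B" unfolding z(3) by (rule z(2))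
    finally show ?thesis .
  qed
  also have "single_at ?f ?v = induced_psi (r + 1) (induced_psi r (induced_psi (r + 1) (induced_ee is x)))"
    unfolding induced_ee_def induced_psi_single_at[OF a(3,2)] induced_psi_single_at[OF Si(2) a(1)] induced_psi_single_at[OF S2(2) a(2)] f ..
  finally show "induced_psi r (induced_psi (r + 1) (induced_psi r (induced_ee is x))) = induced_psi (r + 1) (induced_psi r (induced_psi (r + 1) (induced_ee is x))) \<oplus>\<^bsub>induced\<^esub> ?B" .
qed simp

end

subsection \<open>Restriction to the sorted components\<close>

definition fin_gen :: "('a, 'm) ring_scheme \<Rightarrow> ('k \<Rightarrow> 'a \<Rightarrow> 'a) \<Rightarrow> bool" where
  "fin_gen M sc \<longleftrightarrow> (\<exists>B. finite B \<and> B \<subseteq> carrier M \<and>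
     (\<forall>x\<in>carrier M. \<exists>c. x = (\<Oplus>\<^bsub>M\<^esub>b\<in>B. sc (c b) b)))"

lemma finite_dim_iff: "finite_dim A M \<longleftrightarrow> fin_gen M (scalar_act A M)"
  by (simp add: finite_dim_def fin_gen_def scalar_act_def)

context kspace
begin

definition lspan :: "'a set \<Rightarrow> 'a set" where "lspan B = {x. \<exists>c. x = (\<Oplus>b\<in>B. sc (c b) b)}"

lemma lspan_sub:
  assumes "finite B" "B \<subseteq> carrier M"
  shows "b \<in> B \<Longrightarrow> b \<in> lspan B" "x \<in> lspan B \<Longrightarrow> x \<in> carrier M" "\<zero> \<in> lspan B"
    "x \<in> lspan B \<Longrightarrow> z \<in> lspan B \<Longrightarrow> x \<oplus> z \<in> lspan B" "x \<in> lspan B \<Longrightarrow> sc a x \<in> lspan B"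
proof -
  have c: "(\<lambda>b. sc (c b) b) \<in> B \<rightarrow> carrier M" for c using assms by auto
  show "x \<in> lspan B \<Longrightarrow> x \<in> carrier M" using finsum_closed[OF c] by (auto simp: lspan_def)
  show "\<zero> \<in> lspan B"
  proof -
    have "(\<Oplus>b\<in>B. sc 0 b) = (\<Oplus>b\<in>B. \<zero>)" using assms(2) by (intro finsum_cong') (auto simp: subset_iff)
    then have "(\<Oplus>b\<in>B. sc 0 b) = \<zero>" by simp
    then show ?thesis unfolding lspan_def by (intro CollectI exI[of _ "\<lambda>_. 0"]) simp
  qed
  show "b \<in> lspan B" if b: "b \<in> B"
  proof -
    have "(\<Oplus>a\<in>B. sc (if b = a then 1 else 0) a) = (\<Oplus>a\<in>B. if b = a then a else \<zero>)"
      using assms(2) by (intro finsum_cong') (auto simp: subset_iff)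
    also have "\<dots> = b" using finsum_singleton[OF b assms(1), of "\<lambda>a. a"] assms(2) by auto
    finally show ?thesis unfolding lspan_def by (intro CollectI exI[of _ "\<lambda>a. if b = a then 1 else 0"]) simp
  qed
  show "x \<oplus> z \<in> lspan B" if xz: "x \<in> lspan B" "z \<in> lspan B"
  proof -
    obtain p q where "x = (\<Oplus>b\<in>B. sc (p b) b)" "z = (\<Oplus>b\<in>B. sc (q b) b)" using xz by (auto simp: lspan_def)
    then have "x \<oplus> z = (\<Oplus>b\<in>B. sc (p b) b \<oplus> sc (q b) b)" using finsum_addf[OF c c] by simp
    also have "\<dots> = (\<Oplus>b\<in>B. sc (p b + q b) b)"
      using assms(2) by (intro finsum_cong') (auto simp: sc_add_left subset_iff)
    finally show ?thesis unfolding lspan_def by (intro CollectI exI[of _ "\<lambda>b. p b + q b"])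
  qed
  show "sc a x \<in> lspan B" if x: "x \<in> lspan B"
  proof -
    obtain p where "x = (\<Oplus>b\<in>B. sc (p b) b)" using x by (auto simp: lspan_def)
    then have "sc a x = (\<Oplus>b\<in>B. sc a (sc (p b) b))"
      using klin_finsum[OF sc_klin abelian_group_axioms abelian_group_axioms c] by simp
    also have "\<dots> = (\<Oplus>b\<in>B. sc (a * p b) b)"
      using assms(2) by (intro finsum_cong') (auto simp: sc_mult subset_iff)
    finally show ?thesis unfolding lspan_def by (intro CollectI exI[of _ "\<lambda>b. a * p b"])
  qed
qed

lemma lspan_finsum:
  assumes "finite B" "B \<subseteq> carrier M" "\<And>i. i \<in> I \<Longrightarrow> f i \<in> lspan B"
  shows "(\<Oplus>i\<in>I. f i) \<in> lspan B"
  using assms(3)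
proof (induction I rule: infinite_finite_induct)
  case (insert i I)
  then have "f i \<in> carrier M" "f \<in> I \<rightarrow> carrier M" using lspan_sub(2)[OF assms(1,2)] by auto
  then show ?case using insert lspan_sub(4)[OF assms(1,2)] by simp
qed (simp_all add: lspan_sub(3)[OF assms(1,2)])

end

text \<open>A sum of finitely many images of a finite dimensional space. It serves both directions:
  the corner is a sum of images of projections, and the induced module is a sum of copies of
  components.\<close>

lemma fin_gen_sum:
  assumes M: "kspace M sc" and N: "kspace N tc" and fg: "fin_gen M sc" and J: "finite J"
    and f: "\<And>j. j \<in> J \<Longrightarrow> klin M sc N tc (f j)"
    and sum: "\<And>x. x \<in> carrier N \<Longrightarrow> \<exists>v. (\<forall>j\<in>J. v j \<in> carrier M) \<and> x = finsum N (\<lambda>j. f j (v j)) J"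
  shows "fin_gen N tc"
proof -
  interpret M: kspace M sc by fact
  interpret N: kspace N tc by fact
  obtain B where B: "finite B" "B \<subseteq> carrier M" "\<And>x. x \<in> carrier M \<Longrightarrow> \<exists>c. x = (\<Oplus>\<^bsub>M\<^esub>b\<in>B. sc (c b) b)"
    using fg by (auto simp: fin_gen_def)
  define B' where "B' = (\<Union>j\<in>J. f j ` B)"
  have B': "finite B'" "B' \<subseteq> carrier N" using B J klin_closed[OF f] by (auto simp: B'_def subset_iff)
  have "x \<in> N.lspan B'" if x: "x \<in> carrier N" for x
  proof -
    obtain v where v: "\<forall>j\<in>J. v j \<in> carrier M" "x = finsum N (\<lambda>j. f j (v j)) J" using sum[OF x] by blast
    have "f j (v j) \<in> N.lspan B'" if j: "j \<in> J" for j
    proof -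
      obtain c where c: "v j = (\<Oplus>\<^bsub>M\<^esub>b\<in>B. sc (c b) b)" using B(3) v(1) j by blast
      have "f j (v j) = finsum N (\<lambda>b. f j (sc (c b) b)) B"
        unfolding c using B(2) by (intro klin_finsum[OF f[OF j] M.abelian_group_axioms N.abelian_group_axioms]) auto
      moreover have "f j (sc (c b) b) \<in> N.lspan B'" if "b \<in> B" for b
      proof -
        have "f j b \<in> B'" using j that by (auto simp: B'_def)
        then show ?thesis
          using N.lspan_sub(1,5)[OF B'] klin_sc[OF f[OF j], of b] B(2) that by auto
      qed
      ultimately show ?thesis using N.lspan_finsum[OF B', of B "\<lambda>b. f j (sc (c b) b)"] by simp
    qed
    then show ?thesis unfolding v(2) by (rule N.lspan_finsum[OF B'])
  qed
  then show ?thesis using B' unfolding fin_gen_def N.lspan_def by blast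
qed

lemma fin_gen_image:
  assumes M: "kspace M sc" and N: "kspace N tc" and fg: "fin_gen M sc" and f: "klin M sc N tc f"
    and surj: "\<And>x. x \<in> carrier N \<Longrightarrow> \<exists>v\<in>carrier M. x = f v"
  shows "fin_gen N tc"
proof (rule fin_gen_sum[OF M N fg, of "{()}" "\<lambda>_. f"])
  interpret N: kspace N tc by fact
  fix x assume "x \<in> carrier N"
  then obtain v where "v \<in> carrier M" "x = f v" using surj by blast
  then show "\<exists>v. (\<forall>j\<in>{()}. v j \<in> carrier M) \<and> x = (\<Oplus>\<^bsub>N\<^esub>j\<in>{()}. f (v j))"
    using klin_closed[OF f] by (intro exI[of _ "\<lambda>_. v"]) simp
qed (use f in auto)

lemma a_inv_subspace:
  assumes "abelian_group M" "abelian_group N" "carrier N \<subseteq> carrier M" "\<zero>\<^bsub>N\<^esub> = \<zero>\<^bsub>M\<^esub>"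
    "\<And>x y. x \<in> carrier N \<Longrightarrow> y \<in> carrier N \<Longrightarrow> x \<oplus>\<^bsub>N\<^esub> y = x \<oplus>\<^bsub>M\<^esub> y" "x \<in> carrier N"
  shows "\<ominus>\<^bsub>N\<^esub> x = \<ominus>\<^bsub>M\<^esub> x"
proof -
  interpret M: abelian_group M by fact
  interpret N: abelian_group N by fact
  have "\<ominus>\<^bsub>N\<^esub> x \<oplus>\<^bsub>M\<^esub> x = \<zero>\<^bsub>M\<^esub>" using assms(4-6) N.l_neg[of x] N.a_inv_closed[of x] by metis
  then show ?thesis using subsetD[OF assms(3)] assms(6) N.a_inv_closed[of x] M.minus_equality[of "\<ominus>\<^bsub>N\<^esub> x" x] by simp
qed

text \<open>Relations are inherited by a stable subspace, also with fewer sequences and fewer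
  \<psi>, provided the remaining idempotents still sum to the identity there. Besides cutting out
  the corner it changes record and scalar action while the carrier stays the same.\<close>

lemma qh_rep_sub:
  assumes M: "qh_rep M sc e n S D ee y ps" and N: "kspace N sc'"
    and sub: "carrier N \<subseteq> carrier M" "\<zero>\<^bsub>N\<^esub> = \<zero>\<^bsub>M\<^esub>"
      "\<And>x y. x \<in> carrier N \<Longrightarrow> y \<in> carrier N \<Longrightarrow> x \<oplus>\<^bsub>N\<^esub> y = x \<oplus>\<^bsub>M\<^esub> y"
    and sc': "\<And>c x. x \<in> carrier N \<Longrightarrow> sc' c x = sc c x"
    and S': "S' \<subseteq> S" and D': "D' \<subseteq> D" and swap: "\<And>r is. r \<in> D' \<Longrightarrow> is \<in> S' \<Longrightarrow> swap_entries r is \<in> S'"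
    and ee': "\<And>is x. is \<in> S' \<Longrightarrow> x \<in> carrier N \<Longrightarrow> ee' is x = ee is x \<and> ee is x \<in> carrier N"
    and y': "\<And>r x. r \<in> {1..n} \<Longrightarrow> x \<in> carrier N \<Longrightarrow> y' r x = y r x \<and> y r x \<in> carrier N"
    and ps': "\<And>r x. r \<in> D' \<Longrightarrow> x \<in> carrier N \<Longrightarrow> ps' r x = ps r x \<and> ps r x \<in> carrier N"
    and sum: "\<And>x. x \<in> carrier N \<Longrightarrow> (\<Oplus>\<^bsub>M\<^esub>is\<in>S'. ee is x) = x"
  shows "qh_rep N sc' e n S' D' ee' y' ps'"
proof -
  interpret M: qh_rep M sc e n S D ee y ps by fact
  interpret N: kspace N sc' by fact
  have cM: "x \<in> carrier N \<Longrightarrow> x \<in> carrier M" for x using sub(1) by blast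
  have inv: "x \<in> carrier N \<Longrightarrow> \<ominus>\<^bsub>N\<^esub> x = \<ominus>\<^bsub>M\<^esub> x" for x
    by (rule a_inv_subspace[OF M.abelian_group_axioms N.abelian_group_axioms sub])
  have minus: "x \<in> carrier N \<Longrightarrow> z \<in> carrier N \<Longrightarrow> x \<ominus>\<^bsub>N\<^esub> z = x \<ominus>\<^bsub>M\<^esub> z" for x z
    using sub(3)[of x "\<ominus>\<^bsub>N\<^esub> z"] inv[of z] N.a_inv_closed[of z] by (simp add: a_minus_def)
  have eeN: "\<And>is x. is \<in> S' \<Longrightarrow> x \<in> carrier N \<Longrightarrow> ee' is x = ee is x"
    "\<And>is x. is \<in> S' \<Longrightarrow> x \<in> carrier N \<Longrightarrow> ee is x \<in> carrier N" using ee' by blast+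
  have yN: "\<And>r x. r \<in> {1..n} \<Longrightarrow> x \<in> carrier N \<Longrightarrow> y' r x = y r x"
    "\<And>r x. r \<in> {1..n} \<Longrightarrow> x \<in> carrier N \<Longrightarrow> y r x \<in> carrier N" using y' by blast+
  have psN: "\<And>r x. r \<in> D' \<Longrightarrow> x \<in> carrier N \<Longrightarrow> ps' r x = ps r x"
    "\<And>r x. r \<in> D' \<Longrightarrow> x \<in> carrier N \<Longrightarrow> ps r x \<in> carrier N" using ps' by blast+
  have kl: "klin N sc' N sc' f'" if "klin M sc M sc f" "\<And>x. x \<in> carrier N \<Longrightarrow> f' x = f x \<and> f x \<in> carrier N" for f f'
    using that(2) klin_add[OF that(1)] klin_sc[OF that(1)] cM sub(3) sc' N.a_closed N.sc_closed
    by (intro klinI) (metis, metis, metis)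
  have D: "r \<in> D'" "r \<in> D" "r \<in> {1..n}" "r + 1 \<in> {1..n}" if "r \<in> D'" for r
    using that D' M.D_sub by auto
  have Sin: "is \<in> S' \<Longrightarrow> is \<in> S" for "is" using S' by blast
  have sq: "sq_act N e i j y1' y2' x = sq_act M e i j y1 y2 x"
    if x: "x \<in> carrier N" and 1: "\<And>x. x \<in> carrier N \<Longrightarrow> y1' x = y1 x \<and> y1 x \<in> carrier N" and
     2: "\<And>x. x \<in> carrier N \<Longrightarrow> y2' x = y2 x \<and> y2 x \<in> carrier N" for i j y1' y2' y1 y2 x
  proof -
    have e: "y1' x = y1 x" "y2' x = y2 x" "y1 x \<in> carrier N" "y2 x \<in> carrier N" using 1[OF x] 2[OF x] by auto
    have d: "y1 x \<ominus>\<^bsub>M\<^esub> y2 x \<in> carrier N" using minus[OF e(3,4)] N.minus_closed[OF e(3,4)] by simp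
    note f = 1[OF d] 2[OF d]
    show ?thesis using minus[of "y2 (y1 x \<ominus>\<^bsub>M\<^esub> y2 x)" "y1 (y1 x \<ominus>\<^bsub>M\<^esub> y2 x)"] f
      by (simp add: sq_act_def e minus sub(2))
  qed
  have br: "braid_act N e i j l y1' y2' y3' x = braid_act M e i j l y1 y2 y3 x \<and> braid_act M e i j l y1 y2 y3 x \<in> carrier N"
    if x: "x \<in> carrier N" and 1: "y1' x = y1 x \<and> y1 x \<in> carrier N" "y2' x = y2 x \<and> y2 x \<in> carrier N" "y3' x = y3 x \<and> y3 x \<in> carrier N"
    for i j l y1' y2' y1 y2 y3' y3 x
  proof -
    have s: "y2 x \<oplus>\<^bsub>M\<^esub> y2 x \<in> carrier N" using 1 sub(3) N.a_closed by metis
    then have m: "y1 x \<ominus>\<^bsub>M\<^esub> (y2 x \<oplus>\<^bsub>M\<^esub> y2 x) \<in> carrier N" using 1 minus N.minus_closed by metis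
    then have "(y1 x \<ominus>\<^bsub>M\<^esub> (y2 x \<oplus>\<^bsub>M\<^esub> y2 x)) \<oplus>\<^bsub>M\<^esub> y3 x \<in> carrier N" using 1 sub(3) N.a_closed by metis
    then show ?thesis using x 1 s m inv[OF x] N.a_inv_closed[OF x] N.zero_closed
      by (auto simp: braid_act_def minus sub(2,3))
  qed
  show ?thesis
  proof
    show "finite S'" using S' M.finite_S finite_subset by blast
    show "is \<in> S' \<Longrightarrow> length is = n" for "is" using Sin M.length_S by blast
    show "D' \<subseteq> {1..<n}" using D' M.D_sub by blast
    show "r \<in> D' \<Longrightarrow> is \<in> S' \<Longrightarrow> swap_entries r is \<in> S'" for r "is" by (rule swap)
    show "is \<in> S' \<Longrightarrow> klin N sc' N sc' (ee' is)" for "is" using kl[OF M.ee_klin[OF Sin]] ee' by blast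
    show "r \<in> {1..n} \<Longrightarrow> klin N sc' N sc' (y' r)" for r using kl[OF M.y_klin] y' by blast
    show "r \<in> D' \<Longrightarrow> klin N sc' N sc' (ps' r)" for r using kl[OF M.psi_klin[OF D(2)]] ps' by blast
  next
    fix "is" js x assume "is \<in> S'" "js \<in> S'" "x \<in> carrier N"
    then show "ee' is (ee' js x) = (if is = js then ee' is x else \<zero>\<^bsub>N\<^esub>)"
      using M.ee_ee[of "is" js x] Sin cM by (simp add: eeN sub(2))
  next
    fix x assume x: "x \<in> carrier N"
    have "finsum N (\<lambda>is. ee' is x) S' = finsum N (\<lambda>is. ee is x) S'"
      using eeN x by (intro N.finsum_cong') auto
    also have "\<dots> = finsum M (\<lambda>is. ee is x) S'"
      using eeN x by (intro finsum_subspace[OF M.abelian_group_axioms N.abelian_group_axioms sub]) auto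
    finally show "finsum N (\<lambda>is. ee' is x) S' = x" using sum[OF x] by simp
  next
    fix r "is" x assume "r \<in> {1..n}" "is \<in> S'" "x \<in> carrier N"
    then show "y' r (ee' is x) = ee' is (y' r x)"
      using M.y_ee[of r "is" x] Sin cM by (simp only: eeN yN)
  next
    fix r "is" x assume a: "r \<in> D'" "is \<in> S'" "x \<in> carrier N"
    note r = D[OF a(1)]
    show "ps' r (ee' is x) = ee' (swap_entries r is) (ps' r x)"
      using a r M.psi_ee[of r "is" x] Sin cM swap[OF a(1,2)] by (simp only: eeN psN)
    have c: "ps r (y r (ee is x)) \<in> carrier N" "y r (ps r (ee is x)) \<in> carrier N" "ee is x \<in> carrier N" "\<zero>\<^bsub>M\<^esub> \<in> carrier N"
      using a r N.zero_closed by (simp_all only: eeN yN psN sub(2))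
    have d: "(if entry is r = entry is (r + 1) then ee is x else \<zero>\<^bsub>M\<^esub>) \<in> carrier N" using c by simp
    have de: "(if entry is r = entry is (r + 1) then ee is x else \<zero>\<^bsub>N\<^esub>) = (if entry is r = entry is (r + 1) then ee is x else \<zero>\<^bsub>M\<^esub>)"
      using sub(2) by simp
    show "ps' r (y' (r + 1) (ee' is x)) = y' r (ps' r (ee' is x)) \<oplus>\<^bsub>N\<^esub> (if entry is r = entry is (r + 1) then ee' is x else \<zero>\<^bsub>N\<^esub>)"
      using a r M.psi_y_succ[of r "is" x] Sin cM by (simp only: eeN yN psN sub(3)[OF c(2) d] de)
    show "y' (r + 1) (ps' r (ee' is x)) = ps' r (y' r (ee' is x)) \<oplus>\<^bsub>N\<^esub> (if entry is r = entry is (r + 1) then ee' is x else \<zero>\<^bsub>N\<^esub>)"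
      using a r M.y_succ_psi[of r "is" x] Sin cM by (simp only: eeN yN psN sub(3)[OF c(1) d] de)
    have "sq_act N e (entry is r) (entry is (r + 1)) (y' r) (y' (r + 1)) (ee is x) =
        sq_act M e (entry is r) (entry is (r + 1)) (y r) (y (r + 1)) (ee is x)"
      by (rule sq[OF c(3)]) (use y'[OF r(3)] y'[OF r(4)] in auto)
    then show "ps' r (ps' r (ee' is x)) = sq_act N e (entry is r) (entry is (r + 1)) (y' r) (y' (r + 1)) (ee' is x)"
      using a r M.psi_psi[of r "is" x] Sin cM by (simp only: eeN psN)
  next
    fix r s x assume "r \<in> {1..n}" "s \<in> {1..n}" "x \<in> carrier N"
    then show "y' r (y' s x) = y' s (y' r x)" using M.y_y[of r s x] cM by (simp only: yN)
  next
    fix r s x assume a: "r \<in> D'" "s \<in> {1..n}" "s \<noteq> r" "s \<noteq> r + 1" "x \<in> carrier N"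
    then show "ps' r (y' s x) = y' s (ps' r x)" using M.psi_y[OF D(2)[OF a(1)] a(2-4) cM[OF a(5)]] by (simp only: yN psN)
  next
    fix r s x assume a: "r \<in> D'" "s \<in> D'" "1 < \<bar>int r - int s\<bar>" "x \<in> carrier N"
    then show "ps' r (ps' s x) = ps' s (ps' r x)" using M.psi_comm[of r s x] D[OF a(1)] D[OF a(2)] cM by (simp only: psN)
  next
    fix r "is" x assume a: "r \<in> D'" "r + 1 \<in> D'" "is \<in> S'" "x \<in> carrier N"
    note r = D[OF a(1)] D[OF a(2)]
    have r2: "r + 2 \<in> {1..n}" using r by auto
    have c: "ee is x \<in> carrier N" "ps (r + 1) (ps r (ps (r + 1) (ee is x))) \<in> carrier N"
      using a r by (simp_all only: eeN psN)
    note b = br[where y1' = "y' r" and ?y1.0 = "y r" and y2' = "y' (r + 1)" and ?y2.0 = "y (r + 1)"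
        and y3' = "y' (r + 2)" and ?y3.0 = "y (r + 2)" and i = "entry is r" and j = "entry is (r + 1)" and l = "entry is (r + 2)",
        OF c(1) y'[OF r(3) c(1)] y'[OF r(4) c(1)] y'[OF r2 c(1)]]
    show "ps' r (ps' (r + 1) (ps' r (ee' is x))) = ps' (r + 1) (ps' r (ps' (r + 1) (ee' is x))) \<oplus>\<^bsub>N\<^esub>
        braid_act N e (entry is r) (entry is (r + 1)) (entry is (r + 2)) (y' r) (y' (r + 1)) (y' (r + 2)) (ee' is x)"
      using a r M.braid[of r "is" x] Sin cM b sub(3)[OF c(2) b[THEN conjunct2]] by (simp only: eeN psN)
  qed
qed

section \<open>The corner spanned by the sorted components\<close>

context coloured_rep
begin

text \<open>Cut out as the common kernel of the idempotents of unsorted sequences, so membership is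
  a condition on one vector; \<open>corner_space_sum\<close> shows that it is the sum of the sorted
  components.\<close>

definition corner_space :: "'a ring" where
  "corner_space = \<lparr>carrier = {x \<in> carrier M. \<forall>is\<in>S - S0. ee is x = \<zero>}, monoid.mult = undefined, one = undefined,
     ring.zero = \<zero>, add = add M\<rparr>"

lemma corner_space_simps: "x \<in> carrier corner_space \<longleftrightarrow> x \<in> carrier M \<and> (\<forall>is\<in>S - S0. ee is x = \<zero>)"
    "\<zero>\<^bsub>corner_space\<^esub> = \<zero>" "x \<oplus>\<^bsub>corner_space\<^esub> z = x \<oplus> z"
  by (auto simp: corner_space_def)

lemma ops_zero: "is \<in> S \<Longrightarrow> ee is \<zero> = \<zero>" "r \<in> {1..n} \<Longrightarrow> y r \<zero> = \<zero>" "r \<in> {1..<n} \<Longrightarrow> psi r \<zero> = \<zero>"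
  by (rule klin_zero[OF R.ee_klin R.abelian_group_axioms R.abelian_group_axioms], assumption)
     (rule klin_zero[OF R.y_klin R.abelian_group_axioms R.abelian_group_axioms], assumption,
      rule klin_zero[OF R.psi_klin R.abelian_group_axioms R.abelian_group_axioms], assumption)

lemma corner_space_kspace: "kspace corner_space sc"
proof -
  have uminus: "ee is (\<ominus> x) = \<ominus> ee is x" if "is \<in> S" "x \<in> carrier M" for "is" x
    using klin_sc[OF R.ee_klin[OF that(1)] that(2), of "-1"] R.sc_minus_one that R.ee_closed by simp
  have "abelian_group corner_space"
  proof (rule abelian_groupI)
    fix x assume x: "x \<in> carrier corner_space"
    then show "\<exists>z\<in>carrier corner_space. z \<oplus>\<^bsub>corner_space\<^esub> x = \<zero>\<^bsub>corner_space\<^esub>"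
      using uminus by (intro bexI[of _ "\<ominus> x"]) (auto simp: corner_space_simps R.l_neg)
  qed (auto simp: corner_space_simps R.a_ac ops_zero klin_add[OF R.ee_klin])
  then show ?thesis
    unfolding kspace_def kspace_axioms_def
    by (auto simp: corner_space_simps klin_sc[OF R.ee_klin] R.sc_add_left R.sc_add_right R.sc_mult)
qed

lemma corner_space_sum:
  assumes x: "x \<in> carrier corner_space" shows "(\<Oplus>is\<in>S0. ee is x) = x"
proof -
  have "(\<Oplus>is\<in>S0. ee is x) = (\<Oplus>is\<in>S. ee is x)"
    by (rule R.add.finprod_mono_neutral_cong_left)
       (use x S0_sub finite_S R.ee_closed in \<open>auto simp: corner_space_simps\<close>)
  then show ?thesis using R.ee_sum x by (simp add: corner_space_simps)
qed

lemma homog_corner_space: "is \<in> S0 \<Longrightarrow> R.homog is x \<Longrightarrow> x \<in> carrier corner_space"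
  using S0_sub R.ee_homog R.homog_closed by (auto simp: corner_space_simps)

lemma corner_space_ops:
  assumes x: "x \<in> carrier corner_space"
  shows "is \<in> S0 \<Longrightarrow> ee is x \<in> carrier corner_space" "r \<in> {1..n} \<Longrightarrow> y r x \<in> carrier corner_space" "r \<in> D0 \<Longrightarrow> psi r x \<in> carrier corner_space"
proof -
  have xM: "x \<in> carrier M" using x by (simp add: corner_space_simps)
  show "is \<in> S0 \<Longrightarrow> ee is x \<in> carrier corner_space" using homog_corner_space R.homog_ee[OF _ xM] S0_sub by blast
  show "r \<in> {1..n} \<Longrightarrow> y r x \<in> carrier corner_space"
    using x R.y_ee[of r _ x] R.y_closed[of r x] ops_zero(2)[of r] by (force simp: corner_space_simps)
  show "psi r x \<in> carrier corner_space" if r: "r \<in> D0"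
  proof -
    have rn: "r \<in> {1..<n}" using r D0_sub by auto
    \<comment> \<open>A swap at a position of \<open>D0\<close> is an involution preserving
      \<open>S0\<close>, hence it also preserves the complement of \<open>S0\<close>.\<close>
    have "ee is (psi r x) = \<zero>" if i: "is \<in> S - S0" for "is"
    proof -
      have s: "swap_entries r is \<in> S" "swap_entries r (swap_entries r is) = is"
        using i rn swap_S swap_swap[of r "is"] length_S by auto
      then have "swap_entries r is \<notin> S0" using S0_swap[OF r, of "swap_entries r is"] i by auto
      then have "ee (swap_entries r is) x = \<zero>" using x s by (simp add: corner_space_simps)
      then show ?thesis using R.psi_ee[OF rn s(1) xM] s(2) ops_zero(3)[OF rn] by simp
    qed
    then show ?thesis using R.psi_closed[OF rn xM] by (simp add: corner_space_simps)
  qed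
qed

lemma corner_space_rep: "qh_rep corner_space sc e n S0 D0 ee y psi"
  by (rule qh_rep_sub[OF R.qh_rep_axioms corner_space_kspace])
     (use corner_space_ops corner_space_sum S0_sub D0_sub S0_swap in \<open>auto simp: corner_space_simps\<close>)

lemma corner_space_fin_gen:
  assumes "fin_gen M sc" shows "fin_gen corner_space sc"
proof (rule fin_gen_sum[OF R.kspace_axioms corner_space_kspace assms, of S0 ee])
  show "finite S0" using finite_S S0_sub finite_subset by blast
  show "klin M sc corner_space sc (ee is)" if "is \<in> S0" for "is"
    using R.ee_klin[of "is"] homog_corner_space[OF that R.homog_ee] that S0_sub by (auto simp: klin_def corner_space_simps(3) subset_iff)
  fix x assume x: "x \<in> carrier corner_space"
  interpret corner_space: kspace corner_space sc by (rule corner_space_kspace)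
  have "finsum corner_space (\<lambda>is. ee is x) S0 = finsum M (\<lambda>is. ee is x) S0"
    by (rule finsum_subspace[OF R.abelian_group_axioms corner_space.abelian_group_axioms])
       (use x corner_space_ops in \<open>auto simp: corner_space_simps\<close>)
  then show "\<exists>v. (\<forall>j\<in>S0. v j \<in> carrier M) \<and> x = finsum corner_space (\<lambda>j. ee j (v j)) S0"
    using corner_space_sum[OF x] x by (intro exI[of _ "\<lambda>_. x"]) (simp add: corner_space_simps)
qed

end

section \<open>Morphisms are determined by, and extend from, the corner\<close>

locale two_reps = A: coloured_rep e n S col w0 M sc ee y psi + B: coloured_rep e n S col w0 N tc ff z chi
  for e n S col w0
    and M :: "('a, 'm) ring_scheme" and sc :: "'k::field \<Rightarrow> 'a \<Rightarrow> 'a" and ee y psi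
    and N :: "('b, 'n) ring_scheme" and tc :: "'k::field \<Rightarrow> 'b \<Rightarrow> 'b" and ff z chi
begin

text \<open>The index sets and the set of vectors are arguments so that one notion serves both the
  whole module and its corner.\<close>

definition ops_hom :: "int list set \<Rightarrow> nat set \<Rightarrow> 'a set \<Rightarrow> ('a \<Rightarrow> 'b) \<Rightarrow> bool" where
  "ops_hom S' D' X f \<longleftrightarrow> (\<forall>x\<in>X. (\<forall>is\<in>S'. f (ee is x) = ff is (f x)) \<and>
     (\<forall>r\<in>{1..n}. f (y r x) = z r (f x)) \<and> (\<forall>r\<in>D'. f (psi r x) = chi r (f x)))"

lemma hom_homog:
  assumes "klin M sc N tc f" "ops_hom S {1..<n} (carrier M) f" "is \<in> S" "A.R.homog is x"
  shows "B.R.homog is (f x)"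
proof -
  have x: "x \<in> carrier M" "ee is x = x" using assms(4) by (auto simp: A.R.homog_def)
  have "f (ee is x) = ff is (f x)" using assms(2,3) x(1) unfolding ops_hom_def by blast
  then show ?thesis using x klin_closed[OF assms(1)] by (simp add: B.R.homog_def)
qed

text \<open>\<open>Phi\<close> is a composite of operators \<psi>, and a descent depends on the
  sequence alone; so the same descent can be followed in both modules.\<close>

lemma hom_Phi:
  assumes f: "klin M sc N tc f" "ops_hom S {1..<n} (carrier M) f"
  shows "is \<in> S \<Longrightarrow> A.R.homog is x \<Longrightarrow> f (A.Phi is x) = B.Phi is (f x)"
proof (induction "is" arbitrary: x rule: A.descent_induct)
  case (sorted "is")
  then show ?case by (simp add: A.Phi_S0 B.Phi_S0)
next
  case (step "is" r)
  note a = A.descent_facts[OF step.hyps] and b = B.descent_facts[OF step.hyps]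
  have "f (psi r x) = chi r (f x)" using f(2) a(1) A.R.homog_closed[OF step.prems] by (simp add: ops_hom_def)
  then show ?case
    using step.IH[OF a(2,3) a(6)[OF step.prems]] a(7)[OF step.prems] b(7)[OF hom_homog[OF f step.hyps(1) step.prems]] by simp
qed

text \<open>Faithfulness: \<open>Phi\<close> moves a homogeneous vector into the corner, commutes
  with both morphisms, and is injective on the target component.\<close>

lemma hom_eqI:
  assumes f: "klin M sc N tc f" "ops_hom S {1..<n} (carrier M) f"
    and g: "klin M sc N tc g" "ops_hom S {1..<n} (carrier M) g"
    and eq: "\<And>x. x \<in> carrier A.corner_space \<Longrightarrow> f x = g x" and x: "x \<in> carrier M"
  shows "f x = g x"
proof (rule A.R.homog_ext[OF f(1) g(1) B.R.abelian_group_axioms _ x])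
  fix "is" x assume i: "is \<in> S" and x: "A.R.homog is x"
  have "A.Phi is x \<in> carrier A.corner_space" using A.homog_corner_space[OF A.sort_seq_S0[OF i] A.Phi_homog[OF i x]] .
  then have "B.Phi is (f x) = B.Phi is (g x)"
    using hom_Phi[OF f i x] hom_Phi[OF g i x] eq by metis
  then show "f x = g x" by (rule B.Phi_inj[OF i hom_homog[OF f i x] hom_homog[OF g i x]])
qed

text \<open>Fullness: \<open>hom_Phi\<close> forces the extension on the component of
  \<open>is\<close> to be \<open>g\<close> conjugated by the two maps \<open>Phi\<close>. That this
  commutes with all operators follows from \<open>Phi_y\<close>, \<open>Phi_psi\<close> and
  \<open>Phi_far\<close> on both sides.\<close>

lemma hom_extend:
  assumes g: "klin A.corner_space sc B.corner_space tc g" "ops_hom A.S0 A.D0 (carrier A.corner_space) g"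
  obtains f where "klin M sc N tc f" "ops_hom S {1..<n} (carrier M) f" "\<And>x. x \<in> carrier A.corner_space \<Longrightarrow> f x = g x"
proof -
  note corner_space = A.corner_space_simps and eN = B.corner_space_simps
  define h where "h is x = (SOME v. B.R.homog is v \<and> B.Phi is v = g (A.Phi is x))" for "is" x
  have Phi_in: "A.Phi is x \<in> carrier A.corner_space" if "is \<in> S" "A.R.homog is x" for "is" x
    using A.homog_corner_space[OF A.sort_seq_S0[OF that(1)] A.Phi_homog[OF that]] .
  have g_homog: "B.R.homog js (g x)" if "js \<in> A.S0" "A.R.homog js x" for js x
  proof -
    have "x \<in> carrier A.corner_space" by (rule A.homog_corner_space[OF that])
    then have "g (ee js x) = ff js (g x)" "g x \<in> carrier N"
      using g(2) that(1) klin_closed[OF g(1)] unfolding ops_hom_def by (blast, simp add: eN)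
    then show ?thesis using that(2) by (simp add: B.R.homog_def A.R.homog_def)
  qed
  have h: "B.R.homog is (h is x) \<and> B.Phi is (h is x) = g (A.Phi is x)" if "is \<in> S" "A.R.homog is x" for "is" x
    unfolding h_def
    by (rule someI_ex) (rule B.Phi_surj[OF that(1) g_homog[OF A.sort_seq_S0[OF that(1)] A.Phi_homog[OF that]]])
  \<comment> \<open>By injectivity of \<open>B.Phi\<close>, any homogeneous vector with the right
    image is the value of \<open>h\<close>. All later identities are proved by exhibiting such a
    vector.\<close>
  have hI: "h is x = v" if "is \<in> S" "A.R.homog is x" "B.R.homog is v" "B.Phi is v = g (A.Phi is x)" for "is" x v
    using B.Phi_inj[OF that(1) _ that(3)] h[OF that(1,2)] that(4) by simp
  have lin: "klin M sc N tc (\<lambda>x. h is (ee is x))" if i: "is \<in> S" for "is"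
  proof -
    note PA = A.Phi_klin_homog[OF i] and PB = B.Phi_klin_homog[OF i]
    note ek = A.R.ee_klin[OF i] and fk = B.R.ee_klin[OF i]
    note hh = h[OF i A.R.homog_ee[OF i]]
    show ?thesis
    proof (rule klinI)
      fix x assume x: "x \<in> carrier M"
      have hx: "B.R.homog is (h is (ee is x))" "B.Phi is (h is (ee is x)) = g (A.Phi is (ee is x))" using hh[OF x] by auto
      show "h is (ee is x) \<in> carrier N" using hx B.R.homog_closed by blast
      have px: "A.Phi is (ee is x) \<in> carrier A.corner_space" by (rule Phi_in[OF i A.R.homog_ee[OF i x]])
      show "h is (ee is (sc c x)) = tc c (h is (ee is x))" for c
      proof (rule hI[OF i])
        show "A.R.homog is (ee is (sc c x))" using A.R.homog_ee[OF i] x by simp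
        show homog: "B.R.homog is (tc c (h is (ee is x)))"
          using hx(1) klin_sc[OF fk, of "h is (ee is x)" c] by (simp add: B.R.homog_def)
        have "B.Phi is (tc c (h is (ee is x))) = tc c (B.Phi is (h is (ee is x)))"
          using klin_sc[OF PB B.R.homog_closed[OF hx(1)], of c] hx(1) homog by (simp add: B.R.homog_eq)
        then show "B.Phi is (tc c (h is (ee is x))) = g (A.Phi is (ee is (sc c x)))"
          using hx(2) klin_sc[OF g(1) px, of c] klin_sc[OF PA x, of c] by simp
      qed
      fix w assume w: "w \<in> carrier M"
      have hw: "B.R.homog is (h is (ee is w))" "B.Phi is (h is (ee is w)) = g (A.Phi is (ee is w))" using hh[OF w] by auto
      have pw: "A.Phi is (ee is w) \<in> carrier A.corner_space" by (rule Phi_in[OF i A.R.homog_ee[OF i w]])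
      show "h is (ee is (x \<oplus>\<^bsub>M\<^esub> w)) = h is (ee is x) \<oplus>\<^bsub>N\<^esub> h is (ee is w)"
      proof (rule hI[OF i])
        show "A.R.homog is (ee is (x \<oplus>\<^bsub>M\<^esub> w))" using A.R.homog_ee[OF i] x w by simp
        show homog: "B.R.homog is (h is (ee is x) \<oplus>\<^bsub>N\<^esub> h is (ee is w))"
          using hx(1) hw(1) klin_add[OF fk, of "h is (ee is x)" "h is (ee is w)"] by (simp add: B.R.homog_def)
        have "B.Phi is (h is (ee is x) \<oplus>\<^bsub>N\<^esub> h is (ee is w)) = B.Phi is (h is (ee is x)) \<oplus>\<^bsub>N\<^esub> B.Phi is (h is (ee is w))"
          using klin_add[OF PB B.R.homog_closed[OF hx(1)] B.R.homog_closed[OF hw(1)]] hx(1) hw(1) homog by (simp add: B.R.homog_eq)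
        then show "B.Phi is (h is (ee is x) \<oplus>\<^bsub>N\<^esub> h is (ee is w)) = g (A.Phi is (ee is (x \<oplus>\<^bsub>M\<^esub> w)))"
          using hx(2) hw(2) klin_add[OF g(1) px pw] klin_add[OF PA x w] by (simp add: corner_space eN)
      qed
    qed
  qed
  \<comment> \<open>The maps \<open>h is\<close> make sense on their own components only, so the
    projections are inserted before summing.\<close>
  define f where "f x = finsum N (\<lambda>is. h is (ee is x)) S" for x
  have f: "klin M sc N tc f" "\<And>is x. is \<in> S \<Longrightarrow> A.R.homog is x \<Longrightarrow> f x = h is x"
    unfolding f_def[abs_def] using A.R.glue[OF B.R.kspace_axioms lin] by auto
  have f_homog: "B.R.homog is (f x)" "B.Phi is (f x) = g (A.Phi is x)" if "is \<in> S" "A.R.homog is x" for "is" x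
    using f(2)[OF that] h[OF that] by auto
  have fI: "f x = v" if "is \<in> S" "A.R.homog is x" "B.R.homog is v" "B.Phi is v = g (A.Phi is x)" for "is" x v
    using f(2)[OF that(1,2)] hI[OF that] by simp
  have fz: "f \<zero>\<^bsub>M\<^esub> = \<zero>\<^bsub>N\<^esub>" by (rule klin_zero[OF f(1) A.R.abelian_group_axioms B.R.abelian_group_axioms])
  have "ops_hom S {1..<n} (carrier M) f"
    unfolding ops_hom_def
  proof (intro ballI conjI)
    fix x js assume x: "x \<in> carrier M" and js: "js \<in> S"
    show "f (ee js x) = ff js (f x)"
    proof (rule A.R.homog_ext[OF klin_comp[OF A.R.ee_klin[OF js] f(1)] klin_comp[OF f(1) B.R.ee_klin[OF js]] B.R.abelian_group_axioms _ x])
      fix "is" x assume i: "is \<in> S" "A.R.homog is x"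
      show "f (ee js x) = ff js (f x)"
        using A.R.ee_homog[OF js i] B.R.ee_homog[OF js i(1) f_homog(1)[OF i]] fz by auto
    qed
  next
    fix x r assume x: "x \<in> carrier M" and r: "r \<in> {1..n}"
    show "f (y r x) = z r (f x)"
    proof (rule A.R.homog_ext[OF klin_comp[OF A.R.y_klin[OF r] f(1)] klin_comp[OF f(1) B.R.y_klin[OF r]] B.R.abelian_group_axioms _ x])
      fix "is" x assume i: "is \<in> S" "A.R.homog is x"
      have "g (y (A.sort_pos is r) (A.Phi is x)) = z (A.sort_pos is r) (g (A.Phi is x))"
        using g(2) Phi_in[OF i] A.sort_pos_in[OF r] unfolding ops_hom_def by blast
      then show "f (y r x) = z r (f x)"
        using f_homog[OF i] r
        by (intro fI[OF i(1)] A.R.homog_y B.R.homog_y i) (simp_all only: A.Phi_y[OF i r] B.Phi_y[OF i(1) f_homog(1)[OF i] r])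
    qed
  next
    fix x r assume x: "x \<in> carrier M" and r: "r \<in> {1..<n}"
    show "f (psi r x) = chi r (f x)"
    proof (rule A.R.homog_ext[OF klin_comp[OF A.R.psi_klin[OF r] f(1)] klin_comp[OF f(1) B.R.psi_klin[OF r]] B.R.abelian_group_axioms _ x])
      fix "is" x assume i: "is \<in> S" "A.R.homog is x"
      show "f (psi r x) = chi r (f x)"
      proof (rule fI[OF A.swap_S[OF i(1) r] A.R.homog_psi[OF i(1) r i(2)] B.R.homog_psi[OF i(1) r f_homog(1)[OF i]]])
        show "B.Phi (swap_entries r is) (chi r (f x)) = g (A.Phi (swap_entries r is) (psi r x))"
        \<comment> \<open>For different colours \<open>psi r\<close> disappears under
          \<open>Phi\<close> on both sides; for equal colours it becomes \<open>psi\<close> at a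
          position of \<open>D0\<close>, where \<open>g\<close> is known to commute with it.\<close>
        proof (cases "A.colour_at is r = A.colour_at is (r + 1)")
          case False
          then show ?thesis using A.Phi_far[OF i(1) r False i(2)] B.Phi_far[OF i(1) r False f_homog(1)[OF i]] f_homog(2)[OF i] by simp
        next
          case True
          have "g (psi (A.sort_pos is r) (A.Phi is x)) = chi (A.sort_pos is r) (g (A.Phi is x))"
            using g(2) Phi_in[OF i] A.sort_seq_swap_same(2)[OF i(1) r True] unfolding ops_hom_def by blast
          then show ?thesis
            using A.Phi_psi[OF i r True] B.Phi_psi[OF i(1) f_homog(1)[OF i] r True] f_homog(2)[OF i] by simp
        qed
      qed
    qed
  qed
  moreover have "f x = g x" if x: "x \<in> carrier A.corner_space" for x
  proof -
    interpret corner_space: qh_rep A.corner_space sc e n A.S0 A.D0 ee y psi by (rule A.corner_space_rep)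
    interpret eN: kspace B.corner_space tc by (rule B.corner_space_kspace)
    have k1: "klin A.corner_space sc N tc f" "klin A.corner_space sc N tc g"
      using f(1) g(1) by (auto simp: klin_def corner_space eN Pi_iff)
    show ?thesis
    proof (rule corner_space.homog_ext[OF k1 B.R.abelian_group_axioms _ x])
      fix "is" x assume i: "is \<in> A.S0" and x: "corner_space.homog is x"
      then have iS: "is \<in> S" using A.S0_sub by auto
      have hx: "A.R.homog is x" using x by (simp add: corner_space.homog_def A.R.homog_def corner_space)
      show "f x = g x"
        by (rule fI[OF iS hx g_homog[OF i hx]]) (simp add: A.Phi_S0[OF i] B.Phi_S0[OF i])
    qed
  qed
  ultimately show ?thesis using f(1) that by blast
qed

end

subsection \<open>Blocks of separated weights\<close>

locale separated_sum =
  fixes e k :: nat and \<beta>s :: "nat \<Rightarrow> (int \<Rightarrow>\<^sub>0 nat)"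
  assumes \<beta>s_Q: "c \<in> {1..k} \<Longrightarrow> \<beta>s c \<in> Q_plus e"
    and sep: "c \<in> {1..k} \<Longrightarrow> d \<in> {1..k} \<Longrightarrow> c \<noteq> d \<Longrightarrow> separated e (\<beta>s c) (\<beta>s d)"
begin

definition \<beta> :: "int \<Rightarrow>\<^sub>0 nat" where "\<beta> = (\<Sum>c\<in>{1..k}. \<beta>s c)"
abbreviation ht :: "nat \<Rightarrow> nat" where "ht c \<equiv> height (\<beta>s c)"
abbreviation Res :: "nat \<Rightarrow> int list set" where "Res c \<equiv> residue_seqs e (\<beta>s c)"
abbreviation S :: "int list set" where "S \<equiv> residue_seqs e \<beta>"
abbreviation n :: nat where "n \<equiv> height \<beta>"

text \<open>In a sorted sequence block c occupies the positions \<open>off c + 1\<close> up to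
  \<open>off c + ht c\<close>.\<close>

definition off :: "nat \<Rightarrow> nat" where "off c = (\<Sum>d\<in>{1..<c}. ht d)"

text \<open>The value is arbitrary for residues outside the support of \<beta>.\<close>

definition col :: "int \<Rightarrow> nat" where
  "col i = (SOME c. c \<in> {1..k} \<and> Poly_Mapping.lookup (\<beta>s c) i \<noteq> 0)"

definition w0 :: "nat list" where "w0 = concat (map (\<lambda>c. replicate (ht c) c) [1..<Suc k])"

definition part :: "nat \<Rightarrow> int list \<Rightarrow> int list" where "part c is = take (ht c) (drop (off c) is)"

text \<open>\<open>separated\<close> includes the case j = i, so different blocks have disjoint
  supports and the choice made in \<open>col\<close> is forced.\<close>

lemma col_eq: 
  assumes "c \<in> {1..k}" "Poly_Mapping.lookup (\<beta>s c) i \<noteq> 0" shows "col i = c"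
proof -
  let ?P = "\<lambda>c. c \<in> {1..k} \<and> Poly_Mapping.lookup (\<beta>s c) i \<noteq> 0"
  have P: "?P (col i)" unfolding col_def by (rule someI[of ?P c]) (use assms in simp)
  have v: "i \<in> vertices e" using \<beta>s_Q[OF assms(1)] assms(2) by (auto simp: Q_plus_def in_keys_iff subset_iff)
  show ?thesis
  proof (rule ccontr)
    assume "col i \<noteq> c"
    have "separated e (\<beta>s (col i)) (\<beta>s c)" by (rule sep[OF conjunct1[OF P] assms(1) \<open>col i \<noteq> c\<close>])
    from this[unfolded separated_def, rule_format, OF v v] show False using P assms(2) by simp
  qed
qed

lemma lookup_\<beta>: "Poly_Mapping.lookup \<beta> i = (\<Sum>c\<in>{1..k}. Poly_Mapping.lookup (\<beta>s c) i)"
  by (simp add: \<beta>_def lookup_sum)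

lemma col_key: 
  assumes "Poly_Mapping.lookup \<beta> i \<noteq> 0"
  shows "col i \<in> {1..k}" "Poly_Mapping.lookup (\<beta>s (col i)) i = Poly_Mapping.lookup \<beta> i" "i \<in> vertices e"
proof -
  obtain c where c: "c \<in> {1..k}" "Poly_Mapping.lookup (\<beta>s c) i \<noteq> 0"
    using assms unfolding lookup_\<beta> by (auto simp del: atLeastAtMost_iff)
  show "col i \<in> {1..k}" using col_eq[OF c] c by simp
  show "i \<in> vertices e" using \<beta>s_Q[OF c(1)] c(2) by (auto simp: Q_plus_def in_keys_iff subset_iff)
  have "Poly_Mapping.lookup (\<beta>s d) i = (if d = c then Poly_Mapping.lookup (\<beta>s c) i else 0)" if "d \<in> {1..k}" for d
    using col_eq[OF c] col_eq[OF that] by auto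
  then have "Poly_Mapping.lookup \<beta> i = (\<Sum>d\<in>{1..k}. if d = c then Poly_Mapping.lookup (\<beta>s c) i else 0)"
    unfolding lookup_\<beta> by (intro sum.cong) auto
  then show "Poly_Mapping.lookup (\<beta>s (col i)) i = Poly_Mapping.lookup \<beta> i" using c col_eq[OF c] by simp
qed

lemma lookup_block: "c \<in> {1..k} \<Longrightarrow> Poly_Mapping.lookup (\<beta>s c) i = (if col i = c then Poly_Mapping.lookup \<beta> i else 0)"
proof -
  assume c: "c \<in> {1..k}"
  show ?thesis
  proof (cases "Poly_Mapping.lookup \<beta> i = 0")
    case True
    then show ?thesis using c by (auto simp: lookup_\<beta>)
  next
    case False
    then show ?thesis using col_key[OF False] col_eq[OF c, of i] by auto
  qed
qed

lemma size_filter_col: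
  assumes "is \<in> S" "c \<in> {1..k}"
  shows "size (filter_mset (\<lambda>i. col i = c) (mset is)) = ht c"
proof -
  have cnt: "count (filter_mset (\<lambda>i. col i = c) (mset is)) i = Poly_Mapping.lookup (\<beta>s c) i" for i
    using assms by (simp add: lookup_block residue_seqs_iff fun_eq_iff count_mset)
  have "set_mset (filter_mset (\<lambda>i. col i = c) (mset is)) = Poly_Mapping.keys (\<beta>s c)"
    unfolding set_eq_iff count_greater_zero_iff[symmetric] cnt by (simp add: in_keys_iff)
  then show ?thesis unfolding size_multiset_overloaded_eq cnt height_def by simp
qed

lemma col_range: "is \<in> S \<Longrightarrow> i \<in> set is \<Longrightarrow> col i \<in> {1..k}"
proof -
  assume "is \<in> S" "i \<in> set is"
  then have "i \<in> Poly_Mapping.keys \<beta>" using set_residue_seq by blast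
  then show ?thesis by (intro col_key) (simp add: in_keys_iff)
qed

lemma count_w0: "count (mset w0) c = (if c \<in> {1..k} then ht c else 0)"
proof -
  have "count (mset (concat (map (\<lambda>c. replicate (ht c) c) [1..<Suc j]))) c = (if c \<in> {1..j} then ht c else 0)" for j
    by (induction j) (auto simp: le_Suc_eq)
  then show ?thesis by (simp add: w0_def)
qed

lemma sorted_w0: "sorted w0"
proof -
  have "sorted (concat (map (\<lambda>c. replicate (ht c) c) [1..<Suc j])) \<and>
      set (concat (map (\<lambda>c. replicate (ht c) c) [1..<Suc j])) \<subseteq> {1..j}" for j
    by (induction j) (auto simp: sorted_append sorted_replicate split: if_splits)
  then show ?thesis by (simp add: w0_def)
qed

text \<open>\<open>far\<close> is separatedness restated, since every kind of arrow makes one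
  residue a successor or predecessor of the other. The colours of a sequence are counted through the
  multiplicities of its residues.\<close>

sublocale coloured e n S col w0
proof
  show "finite S" by (rule finite_residue_seqs)
  show "is \<in> S \<Longrightarrow> length is = n" for "is" by (rule length_residue_seq)
  show "is \<in> S \<Longrightarrow> mset js = mset is \<Longrightarrow> js \<in> S" for "is" js using residue_seqs_mset_cong by blast
  show "sorted w0" by (rule sorted_w0)
next
  fix "is" i j assume i: "is \<in> S" "i \<in> set is" "j \<in> set is" "col i \<noteq> col j"
  have ij: "Poly_Mapping.lookup \<beta> i \<noteq> 0" "Poly_Mapping.lookup \<beta> j \<noteq> 0"
    using set_residue_seq[OF i(1)] i(2,3) by (auto simp: in_keys_iff)
  have "separated e (\<beta>s (col i)) (\<beta>s (col j))"
    using sep col_key[OF ij(1)] col_key[OF ij(2)] i(4) by blast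
  then have "j \<notin> {i, succ_vertex e i, pred_vertex e i}"
    using col_key[OF ij(1)] col_key[OF ij(2)] ij unfolding separated_def by metis
  then show "\<not> arrow_right e i j \<and> \<not> arrow_left e i j \<and> \<not> arrow_both e i j"
    by (auto simp: arrow_right_def arrow_left_def arrow_both_def)
next
  fix "is" assume i: "is \<in> S"
  show "mset (map col is) = mset w0"
  proof (rule multiset_eqI)
    fix c
    have eq: "count (mset (map col is)) c = size (filter_mset (\<lambda>i. col i = c) (mset is))"
      by (induction "is") auto
    show "count (mset (map col is)) c = count (mset w0) c"
    proof (cases "c \<in> {1..k}")
      case True then show ?thesis using size_filter_col[OF i True] eq count_w0 by simp
    next
      case False
      then have "set_mset (filter_mset (\<lambda>i. col i = c) (mset is)) = {}" using col_range[OF i] by auto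
      then have "size (filter_mset (\<lambda>i. col i = c) (mset is)) = 0" by (simp only: set_mset_eq_empty_iff size_empty)
      then show ?thesis unfolding eq count_w0 using False by (simp only: if_False)
    qed
  qed
qed

lemma off_Suc: "c \<ge> 1 \<Longrightarrow> off (Suc c) = off c + ht c"
  by (simp add: off_def)

lemma off_mono: "c \<le> d \<Longrightarrow> off c \<le> off d"
  unfolding off_def by (intro sum_mono2) auto

lemma nth_w0: "c \<in> {1..k} \<Longrightarrow> a < ht c \<Longrightarrow> w0 ! (off c + a) = c"
proof -
  have "c \<in> {1..j} \<Longrightarrow> a < ht c \<Longrightarrow> concat (map (\<lambda>c. replicate (ht c) c) [1..<Suc j]) ! (off c + a) = c" for j
  proof (induction j)
    case (Suc j)
    have len: "length (concat (map (\<lambda>c. replicate (ht c) c) [1..<Suc j])) = off (Suc j)"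
      by (induction j) (auto simp: off_def)
    show ?case
    proof (cases "c = Suc j")
      case True
      then show ?thesis using Suc.prems len by (simp add: nth_append)
    next
      case False
      then have c: "c \<in> {1..j}" using Suc.prems by auto
      then have "off c + a < off (Suc j)"
        using off_mono[of "Suc c" "Suc j"] off_Suc[of c] Suc.prems by auto
      then show ?thesis using Suc.IH[OF c Suc.prems(2)] len by (simp add: nth_append)
    qed
  qed simp
  then show "c \<in> {1..k} \<Longrightarrow> a < ht c \<Longrightarrow> w0 ! (off c + a) = c" unfolding w0_def .
qed

lemma n_off: "n = off (Suc k)"
proof -
  have "finite (Poly_Mapping.keys \<beta>)" by simp
  have k: "Poly_Mapping.keys (\<beta>s c) \<subseteq> Poly_Mapping.keys \<beta>" if "c \<in> {1..k}" for c
    using lookup_block[OF that] by (auto simp: in_keys_iff split: if_splits)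
  have "n = (\<Sum>i\<in>Poly_Mapping.keys \<beta>. \<Sum>c\<in>{1..k}. Poly_Mapping.lookup (\<beta>s c) i)"
    by (simp add: height_def lookup_\<beta>)
  also have "\<dots> = (\<Sum>c\<in>{1..k}. \<Sum>i\<in>Poly_Mapping.keys \<beta>. Poly_Mapping.lookup (\<beta>s c) i)" by (rule sum.swap)
  also have "\<dots> = (\<Sum>c\<in>{1..k}. ht c)"
    unfolding height_def using k by (intro sum.cong refl sum.mono_neutral_right) (auto simp: in_keys_iff)
  also have "\<dots> = off (Suc k)" unfolding off_def by (rule sum.cong) auto
  finally show ?thesis .
qed

text \<open>With \<open>loc\<close>, coordinates on positions: the position
  \<open>off c + a\<close>, for a from 1 to \<open>ht c\<close>, has block c and local position
  a.\<close>

definition blk :: "nat \<Rightarrow> nat" where "blk r = w0 ! (r - 1)"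
definition loc :: "nat \<Rightarrow> nat" where "loc r = r - off (blk r)"

lemma blk_off: "c \<in> {1..k} \<Longrightarrow> a \<in> {1..ht c} \<Longrightarrow> blk (off c + a) = c"
  and loc_off: "c \<in> {1..k} \<Longrightarrow> a \<in> {1..ht c} \<Longrightarrow> loc (off c + a) = a"
  using nth_w0[of c "a - 1"] by (auto simp: blk_def loc_def)

lemma off_in: "c \<in> {1..k} \<Longrightarrow> a \<in> {1..ht c} \<Longrightarrow> off c + a \<in> {1..n}"
  using off_mono[of "Suc c" "Suc k"] off_Suc[of c] n_off by auto

lemma block_cases:
  assumes "r \<in> {1..n}" obtains c a where "c \<in> {1..k}" "a \<in> {1..ht c}" "r = off c + a"
proof -
  have "\<exists>c\<in>{1..j}. \<exists>a\<in>{1..ht c}. r = off c + a" if "r \<in> {1..off (Suc j)}" for j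
    using that
  proof (induction j)
    case 0 then show ?case by (simp add: off_def)
  next
    case (Suc j)
    show ?case
    proof (cases "r \<le> off (Suc j)")
      case True then show ?thesis using Suc by fastforce
    next
      case False
      then have "r - off (Suc j) \<in> {1..ht (Suc j)}" "r = off (Suc j) + (r - off (Suc j))"
        using Suc.prems off_Suc[of "Suc j"] by auto
      then show ?thesis by (intro bexI[of _ "Suc j"] bexI[of _ "r - off (Suc j)"]) auto
    qed
  qed
  then show ?thesis using assms n_off that by metis
qed

lemma w0_off: "c \<in> {1..k} \<Longrightarrow> a \<in> {1..ht c} \<Longrightarrow> w0 ! (off c + a - 1) = c"
  using blk_off by (simp add: blk_def)

lemma D0_off: "c \<in> {1..k} \<Longrightarrow> a \<in> {1..<ht c} \<Longrightarrow> off c + a \<in> D0"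
proof -
  assume c: "c \<in> {1..k}" and a: "a \<in> {1..<ht c}"
  have a2: "a \<in> {1..ht c}" "a + 1 \<in> {1..ht c}" using a by auto
  then show "off c + a \<in> D0"
    using off_in[OF c a2(1)] off_in[OF c a2(2)] w0_off[OF c a2(1)] w0_off[OF c a2(2)] by (auto simp: D0_def)
qed

lemma D0_cases:
  assumes "r \<in> D0" obtains c a where "c \<in> {1..k}" "a \<in> {1..<ht c}" "r = off c + a"
proof -
  have r: "r \<in> {1..n}" "r + 1 \<in> {1..n}" "w0 ! (r - 1) = w0 ! (r + 1 - 1)" using assms by (auto simp: D0_def)
  obtain c a where ca: "c \<in> {1..k}" "a \<in> {1..ht c}" "r = off c + a" by (rule block_cases[OF r(1)])
  obtain d b where db: "d \<in> {1..k}" "b \<in> {1..ht d}" "r + 1 = off d + b" by (rule block_cases[OF r(2)])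
  have "c = d" using w0_off[OF ca(1,2)] w0_off[OF db(1,2)] r(3) unfolding ca(3)[symmetric] db(3)[symmetric] by simp
  then have "a \<in> {1..<ht c}" using ca db by auto
  then show ?thesis using that ca by blast
qed

lemma length_part: "is \<in> S \<Longrightarrow> c \<in> {1..k} \<Longrightarrow> length (part c is) = ht c"
  using off_mono[of "Suc c" "Suc k"] off_Suc[of c] n_off length_S[of "is"] by (auto simp: part_def)

lemma entry_part:
  assumes "is \<in> S" "c \<in> {1..k}" "a \<in> {1..ht c}"
  shows "entry (part c is) a = entry is (off c + a)"
proof -
  have "off c + a \<le> length is" using off_in[OF assms(2,3)] length_S[OF assms(1)] by simp
  then show ?thesis using assms(3) by (auto simp: entry_def part_def)
qed

lemma S0_in_S: "is \<in> S0 \<Longrightarrow> is \<in> S" by (simp add: S0_def)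

text \<open>All entries in the c-th segment have colour c, so its multiset is contained in that of
  all entries of colour c. The sizes agree, hence the multisets do.\<close>

lemma part_in:
  assumes "is \<in> S0" "c \<in> {1..k}"
  shows "part c is \<in> Res c"
proof -
  have iS: "is \<in> S" using assms(1) by (rule S0_in_S)
  have colr: "col (entry is (off d + a)) = d" if "d \<in> {1..k}" "a \<in> {1..ht d}" for d a
    using S0_colour_at[OF assms(1) off_in[OF that]] w0_off[OF that] by (simp add: colour_at_def)
  have setp: "col i = c" if i: "i \<in> set (part c is)" for i
  proof -
    obtain j where "j < ht c" "i = part c is ! j" using i unfolding in_set_conv_nth length_part[OF iS assms(2)] by blast
    then have "i = entry (part c is) (Suc j)" "Suc j \<in> {1..ht c}" by (auto simp: entry_def)
    then show ?thesis using entry_part[OF iS assms(2), of "Suc j"] colr[OF assms(2), of "Suc j"] by simp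
  qed
  have "is = take (off c) is @ part c is @ drop (ht c) (drop (off c) is)"
    by (simp add: part_def del: drop_drop)
  then have "mset is = mset (part c is) + (mset (take (off c) is) + mset (drop (ht c) (drop (off c) is)))"
    by (metis mset_append union_assoc union_commute)
  then have sub: "mset (part c is) \<subseteq># mset is" by (simp only: mset_subset_eq_add_left)
  have "filter (\<lambda>i. col i = c) (part c is) = part c is" by (rule filter_True) (simp add: setp)
  then have "filter_mset (\<lambda>i. col i = c) (mset (part c is)) = mset (part c is)" by (metis mset_filter)
  then have "mset (part c is) \<subseteq># filter_mset (\<lambda>i. col i = c) (mset is)"
    using multiset_filter_mono[OF sub, of "\<lambda>i. col i = c"] by simp
  moreover have "size (mset (part c is)) = size (filter_mset (\<lambda>i. col i = c) (mset is))"
    using size_filter_col[OF iS assms(2)] length_part[OF iS assms(2)] by simp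
  ultimately have eq: "mset (part c is) = filter_mset (\<lambda>i. col i = c) (mset is)"
    by (metis mset_subset_size less_irrefl subset_mset.le_neq_trans)
  have "count_list (part c is) i = Poly_Mapping.lookup (\<beta>s c) i" for i
    unfolding count_mset[symmetric] eq using iS assms(2) by (simp add: lookup_block residue_seqs_iff fun_eq_iff count_mset)
  moreover have "set (part c is) \<subseteq> vertices e"
    using set_mset_mono[OF sub] iS by (auto simp: residue_seqs_iff)
  ultimately show ?thesis by (simp add: residue_seqs_iff fun_eq_iff)
qed

lemma part_swap:
  assumes "is \<in> S" "c \<in> {1..k}" "a \<in> {1..<ht c}" "d \<in> {1..k}"
  shows "part d (swap_entries (off c + a) is) = (if d = c then swap_entries a (part c is) else part d is)"
proof (rule entry_ext[of _ "ht d"])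
  have r: "off c + a \<in> {1..<n}" using D0_off[OF assms(2,3)] by (auto simp: D0_def)
  have sS: "swap_entries (off c + a) is \<in> S" by (rule swap_S[OF assms(1) r])
  show "length (part d (swap_entries (off c + a) is)) = ht d" by (rule length_part[OF sS assms(4)])
  show "length (if d = c then swap_entries a (part c is) else part d is) = ht d"
    using length_part[OF assms(1,2)] length_part[OF assms(1,4)] by simp
  fix s assume s: "s \<in> {1..ht d}"
  have a: "a \<in> {1..ht c}" "a + 1 \<in> {1..ht c}" using assms(3) by auto
  have len: "length is = n" using assms(1) by (rule length_S)
  have "entry (part d (swap_entries (off c + a) is)) s = entry (swap_entries (off c + a) is) (off d + s)"
    by (rule entry_part[OF sS assms(4) s])
  also have "\<dots> = (if off d + s = off c + a then entry is (off c + a + 1) else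
      if off d + s = off c + a + 1 then entry is (off c + a) else entry is (off d + s))"
    using entry_swap[of "off c + a" "is" "off d + s"] r len s by auto
  also have "\<dots> = entry (if d = c then swap_entries a (part c is) else part d is) s"
  proof (cases "d = c")
    case True
    then show ?thesis
      using entry_swap[of a "part c is" s] s assms(3) length_part[OF assms(1,2)]
        entry_part[OF assms(1,2) a(1)] entry_part[OF assms(1,2) a(2)] entry_part[OF assms(1,2), of s] by (auto simp: add.assoc)
  next
    case False
    have "off d + s \<noteq> off c + a" "off d + s \<noteq> off c + (a + 1)"
      using blk_off[OF assms(4) s] blk_off[OF assms(2) a(1)] blk_off[OF assms(2) a(2)] False by metis+
    then show ?thesis using False entry_part[OF assms(1,4) s] by simp
  qed
  finally show "entry (part d (swap_entries (off c + a) is)) s =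
      entry (if d = c then swap_entries a (part c is) else part d is) s" .
qed

lemma parts_eqI:
  assumes "is \<in> S" "js \<in> S" "\<And>c. c \<in> {1..k} \<Longrightarrow> part c is = part c js"
  shows "is = js"
proof (rule entry_ext[of _ n])
  fix s assume "s \<in> {1..n}"
  then obtain c a where "c \<in> {1..k}" "a \<in> {1..ht c}" "s = off c + a" by (rule block_cases)
  then show "entry is s = entry js s" using entry_part assms by metis
qed (use assms length_S in auto)

text \<open>Concatenation of the given parts. With \<open>part_in\<close> and
  \<open>parts_eqI\<close> this makes sorted sequences the same as tuples of residue sequences, one
  for each block.\<close>

lemma parts_surj:
  assumes t: "\<And>c. c \<in> {1..k} \<Longrightarrow> t c \<in> Res c"
  obtains "is" where "is \<in> S0" "\<And>c. c \<in> {1..k} \<Longrightarrow> part c is = t c"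
proof -
  let ?j = "concat (map t [1..<Suc k])"
  have lt: "length (t c) = ht c" if "c \<in> {1..k}" for c using length_residue_seq[OF t[OF that]] .
  have len: "length (concat (map t [1..<Suc j])) = off (Suc j)" if "j \<le> k" for j
    using that by (induction j) (auto simp: off_def lt)
  have nth: "c \<in> {1..j} \<Longrightarrow> a < ht c \<Longrightarrow> concat (map t [1..<Suc j]) ! (off c + a) = t c ! a" if "j \<le> k" for j c a
    using that
  proof (induction j)
    case (Suc j)
    show ?case
    proof (cases "c = Suc j")
      case True
      then show ?thesis using Suc.prems len[of j] by (simp add: nth_append)
    next
      case False
      then have c: "c \<in> {1..j}" using Suc.prems by auto
      then have "off c + a < off (Suc j)"
        using off_mono[of "Suc c" "Suc j"] off_Suc[of c] Suc.prems by auto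
      then show ?thesis using Suc.IH[OF c] Suc.prems len[of j] by (simp add: nth_append)
    qed
  qed simp
  have cnt: "count_list ?j i = Poly_Mapping.lookup \<beta> i" for i
  proof -
    have "count_list (concat (map t [1..<Suc j])) i = (\<Sum>c\<in>{1..j}. Poly_Mapping.lookup (\<beta>s c) i)" if "j \<le> k" for j
      using that
    proof (induction j)
      case (Suc j)
      have "count_list (t (Suc j)) i = Poly_Mapping.lookup (\<beta>s (Suc j)) i"
        using t[of "Suc j"] Suc.prems by (simp add: residue_seqs_iff)
      then show ?case using Suc by simp
    qed simp
    then show ?thesis by (simp add: lookup_\<beta>)
  qed
  have "set ?j \<subseteq> vertices e" using t by (auto simp: residue_seqs_iff) fastforce
  then have jS: "?j \<in> S" using cnt by (simp add: residue_seqs_iff fun_eq_iff)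
  have pt: "part c ?j = t c" if c: "c \<in> {1..k}" for c
    using nth[OF order_refl c] lt[OF c] length_part[OF jS c] len[of k] n_off length_S[OF jS]
    by (intro nth_equalityI) (auto simp: part_def simp del: upt_Suc)
  have "map col ?j = w0"
  proof (rule nth_equalityI)
    show "length (map col ?j) = length w0" using length_w0[OF jS] length_S[OF jS] by simp
    fix i assume "i < length (map col ?j)"
    then have "Suc i \<in> {1..n}" using length_S[OF jS] by simp
    then obtain c a where ca: "c \<in> {1..k}" "a \<in> {1..ht c}" "Suc i = off c + a" by (rule block_cases)
    have i: "i = off c + (a - 1)" "a - 1 < ht c" using ca by auto
    have "?j ! i = t c ! (a - 1)" unfolding i(1) by (rule nth[OF order_refl ca(1) i(2)])
    moreover have "col (t c ! (a - 1)) = c"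
    proof -
      have "t c ! (a - 1) \<in> set (t c)" using i(2) lt[OF ca(1)] by simp
      then have "Poly_Mapping.lookup (\<beta>s c) (t c ! (a - 1)) \<noteq> 0"
        using set_residue_seq[OF t[OF ca(1)]] by (simp add: in_keys_iff)
      then show ?thesis by (rule col_eq[OF ca(1)])
    qed
    ultimately show "map col ?j ! i = w0 ! i"
      using nth_w0[OF ca(1) i(2)] \<open>i < length (map col ?j)\<close> i(1) by simp
  qed
  then have "?j \<in> S0" using jS by (simp add: S0_def)
  then show ?thesis using that pt by blast
qed

end

section \<open>Commuting families of block operators\<close>

context kspace
begin

lemma klin_sq_act:
  assumes "klin M sc M sc y1" "klin M sc M sc y2"
  shows "klin M sc M sc (sq_act M e i j y1 y2)"
proof -
  note d = klin_diff[OF assms kspace_axioms] klin_diff[OF assms(2,1) kspace_axioms]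
  note c = klin_diff[OF klin_comp[OF d(1) assms(2)] klin_comp[OF d(1) assms(1)] kspace_axioms]
  show ?thesis
    unfolding sq_act_def[abs_def] using d c klin_id klin_0[OF kspace_axioms]
    by (cases "i = j"; cases "arrow_right e i j"; cases "arrow_left e i j"; cases "arrow_both e i j"; simp)
qed

lemma klin_braid_act:
  assumes "klin M sc M sc y1" "klin M sc M sc y2" "klin M sc M sc y3"
  shows "klin M sc M sc (braid_act M e i j l y1 y2 y3)"
proof -
  note p = klin_plus[OF assms(2,2) kspace_axioms]
  note q = klin_plus[OF klin_diff[OF assms(1) p kspace_axioms] assms(3) kspace_axioms]
  show ?thesis
    unfolding braid_act_def[abs_def] using q klin_uminus[OF klin_id kspace_axioms] klin_id klin_0[OF kspace_axioms]
    by (cases "i = l"; cases "arrow_right e l j"; cases "arrow_left e l j"; cases "arrow_both e l j"; simp)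
qed

end

text \<open>The operator form of a module over the tensor product; \<open>family_of_module\<close>
  and \<open>module_of_family\<close> translate.\<close>

locale block_family = separated_sum e k \<beta>s + kspace N sc
  for e k :: nat and \<beta>s and N :: "('a, 'm) ring_scheme" (structure) and sc :: "'k::field \<Rightarrow> 'a \<Rightarrow> 'a" +
  fixes opr :: "nat \<Rightarrow> qh_gen \<Rightarrow> 'a \<Rightarrow> 'a"
  assumes block_rep: "c \<in> {1..k} \<Longrightarrow> qh_rep N sc e (ht c) (Res c) {1..<ht c}
      (\<lambda>is. opr c (E is)) (\<lambda>a. opr c (Y a)) (\<lambda>a. opr c (Psi a))"
    and opr_comm: "c \<in> {1..k} \<Longrightarrow> d \<in> {1..k} \<Longrightarrow> c \<noteq> d \<Longrightarrow> g \<in> qh_gens e (\<beta>s c) \<Longrightarrow> h \<in> qh_gens e (\<beta>s d) \<Longrightarrow>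
      x \<in> carrier N \<Longrightarrow> opr c g (opr d h x) = opr d h (opr c g x)"
begin

abbreviation L :: "nat list" where "L \<equiv> [1..<Suc k]"

text \<open>The idempotent of a sorted sequence is the tensor product of the idempotents of its
  parts.\<close>

definition eeB :: "int list \<Rightarrow> 'a \<Rightarrow> 'a" where "eeB is = foldr (\<lambda>c. opr c (E (part c is))) L"
definition yB :: "nat \<Rightarrow> 'a \<Rightarrow> 'a" where "yB r = opr (blk r) (Y (loc r))"
definition psB :: "nat \<Rightarrow> 'a \<Rightarrow> 'a" where "psB r = opr (blk r) (Psi (loc r))"

lemma set_L: "set L = {1..k}" by auto

lemma opr_klin: "c \<in> {1..k} \<Longrightarrow> g \<in> qh_gens e (\<beta>s c) \<Longrightarrow> klin N sc N sc (opr c g)"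
proof -
  assume c: "c \<in> {1..k}" and g: "g \<in> qh_gens e (\<beta>s c)"
  interpret Rc: qh_rep N sc e "ht c" "Res c" "{1..<ht c}" "\<lambda>is. opr c (E is)" "\<lambda>a. opr c (Y a)" "\<lambda>a. opr c (Psi a)"
    by (rule block_rep[OF c])
  show ?thesis using g Rc.ee_klin Rc.y_klin Rc.psi_klin by (auto simp: qh_gens_def)
qed

lemma E_gen: "is \<in> S0 \<Longrightarrow> c \<in> {1..k} \<Longrightarrow> E (part c is) \<in> qh_gens e (\<beta>s c)"
  using part_in qh_gens_memb(3) by blast

lemma opr_closed: "c \<in> {1..k} \<Longrightarrow> g \<in> qh_gens e (\<beta>s c) \<Longrightarrow> x \<in> carrier N \<Longrightarrow> opr c g x \<in> carrier N"
  by (rule klin_closed[OF opr_klin])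

lemma fold_klin:
  assumes "\<And>c. c \<in> set K \<Longrightarrow> c \<in> {1..k} \<and> g c \<in> qh_gens e (\<beta>s c)"
  shows "klin N sc N sc (foldr (\<lambda>c. opr c (g c)) K)"
  using assms
proof (induction K)
  case (Cons c K)
  then show ?case using klin_comp[OF Cons.IH opr_klin[of c "g c"]] by (simp add: comp_def)
qed (simp add: klin_id id_def)

lemma eeB_klin: "is \<in> S0 \<Longrightarrow> klin N sc N sc (eeB is)"
  unfolding eeB_def using E_gen set_L by (intro fold_klin) blast

lemma fold_hom:
  assumes "\<And>d x. d \<in> set K \<Longrightarrow> x \<in> carrier N \<Longrightarrow> f (opr d (g d) x) = opr d (h d) (f x)"
    and "\<And>c. c \<in> set K \<Longrightarrow> c \<in> {1..k} \<and> g c \<in> qh_gens e (\<beta>s c)" and "x \<in> carrier N"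
  shows "f (foldr (\<lambda>c. opr c (g c)) K x) = foldr (\<lambda>c. opr c (h c)) K (f x)"
  using assms(1,2)
proof (induction K)
  case (Cons c K)
  have "klin N sc N sc (foldr (\<lambda>c. opr c (g c)) K)" using Cons.prems(2) by (intro fold_klin) simp
  then have "foldr (\<lambda>c. opr c (g c)) K x \<in> carrier N" using assms(3) by (rule klin_closed)
  then show ?case using Cons by simp
qed simp

text \<open>Reduces passing \<open>eeB\<close> to passing its factors one by one. The sequence may
  change on the way, as it does when \<open>f\<close> is some \<psi>.\<close>

lemma eeB_hom:
  assumes "is \<in> S0" "\<And>d x. d \<in> {1..k} \<Longrightarrow> x \<in> carrier N \<Longrightarrow> f (opr d (E (part d is)) x) = opr d (E (part d js)) (f x)"
    and "x \<in> carrier N"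
  shows "f (eeB is x) = eeB js (f x)"
  unfolding eeB_def using assms E_gen set_L by (intro fold_hom) blast+

lemma eeB_id: "(\<And>c. c \<in> {1..k} \<Longrightarrow> opr c (E (part c is)) x = x) \<Longrightarrow> eeB is x = x"
proof -
  have "foldr (\<lambda>c. opr c (E (part c is))) K x = x"
    if "\<And>c. c \<in> set K \<Longrightarrow> opr c (E (part c is)) x = x" for K
    using that by (induction K) auto
  then show "(\<And>c. c \<in> {1..k} \<Longrightarrow> opr c (E (part c is)) x = x) \<Longrightarrow> ?thesis"
    unfolding eeB_def using set_L by blast
qed

lemma opr_E_E: "c \<in> {1..k} \<Longrightarrow> i \<in> Res c \<Longrightarrow> j \<in> Res c \<Longrightarrow> x \<in> carrier N \<Longrightarrow>
    opr c (E i) (opr c (E j) x) = (if i = j then opr c (E i) x else \<zero>)"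
  using qh_rep.ee_ee[OF block_rep] by blast

text \<open>An idempotent of block c commutes with the factors of other blocks until it meets the
  factor of its own block, where orthogonality decides.\<close>

lemma opr_eeB:
  assumes "is \<in> S0" "c \<in> {1..k}" "j \<in> Res c" "x \<in> carrier N"
  shows "opr c (E j) (eeB is x) = (if j = part c is then eeB is x else \<zero>)"
proof -
  have jg: "E j \<in> qh_gens e (\<beta>s c)" using assms(3) by (rule qh_gens_memb(3))
  have "opr c (E j) (foldr (\<lambda>c. opr c (E (part c is))) K x) = (if j = part c is then foldr (\<lambda>c. opr c (E (part c is))) K x else \<zero>)"
    if "c \<in> set K" "set K \<subseteq> {1..k}" "distinct K" for K
    using that
  proof (induction K)
    case (Cons d K)
    have d: "d \<in> {1..k}" "E (part d is) \<in> qh_gens e (\<beta>s d)" using Cons.prems E_gen[OF assms(1)] by auto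
    have "klin N sc N sc (foldr (\<lambda>c. opr c (E (part c is))) K)" using Cons.prems E_gen[OF assms(1)] by (intro fold_klin) auto
    then have f: "foldr (\<lambda>c. opr c (E (part c is))) K x \<in> carrier N" using assms(4) by (rule klin_closed)
    show ?case
    proof (cases "c = d")
      case True
      then show ?thesis using opr_E_E[OF assms(2,3) part_in[OF assms(1,2)] f] by simp
    next
      case False
      then have "c \<in> set K" using Cons.prems by simp
      moreover have "opr d (E (part d is)) \<zero> = \<zero>"
        by (rule klin_zero[OF opr_klin[OF d] abelian_group_axioms abelian_group_axioms])
      ultimately show ?thesis using Cons opr_comm[OF assms(2) d(1) False jg d(2) f] by simp
    qed
  qed simp
  from this[of L, unfolded set_L, OF assms(2) order_refl distinct_upt] show ?thesis unfolding eeB_def .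
qed

lemma S0_finite: "finite S0" using finite_S S0_def by simp

lemma eeB_eeB:
  assumes "is \<in> S0" "js \<in> S0" "x \<in> carrier N"
  shows "eeB is (eeB js x) = (if is = js then eeB is x else \<zero>)"
proof (cases "is = js")
  case True
  then show ?thesis using opr_eeB[OF assms(1) _ part_in[OF assms(1)] assms(3)] by (auto intro!: eeB_id)
next
  case False
  then obtain c where c: "c \<in> {1..k}" "part c is \<noteq> part c js" using parts_eqI S0_in_S assms by blast
  have x: "eeB js x \<in> carrier N" by (rule klin_closed[OF eeB_klin[OF assms(2)] assms(3)])
  have z: "eeB is \<zero> = \<zero>" by (rule klin_zero[OF eeB_klin[OF assms(1)] abelian_group_axioms abelian_group_axioms])
  \<comment> \<open>The idempotent of a block in which the sequences differ is inserted on the left,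
    moved through \<open>eeB is\<close>, and annihilates \<open>eeB js x\<close>.\<close>
  have "eeB is (eeB js x) = opr c (E (part c is)) (eeB is (eeB js x))"
    using opr_eeB[OF assms(1) c(1) part_in[OF assms(1) c(1)] x] by simp
  also have "\<dots> = eeB is (opr c (E (part c is)) (eeB js x))"
  proof (rule eeB_hom[OF assms(1) _ x])
    fix d x assume d: "d \<in> {1..k}" "x \<in> carrier N"
    show "opr c (E (part c is)) (opr d (E (part d is)) x) = opr d (E (part d is)) (opr c (E (part c is)) x)"
      using opr_comm[OF c(1) d(1) _ E_gen[OF assms(1) c(1)] E_gen[OF assms(1) d(1)] d(2)] by (cases "c = d") auto
  qed
  also have "\<dots> = \<zero>" using opr_eeB[OF assms(2) c(1) part_in[OF assms(1) c(1)] assms(3)] c(2) z by simp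
  finally show ?thesis using False by simp
qed

text \<open>Completeness without expanding a product of sums: the outermost block is stripped off at
  each step. If every idempotent of block c kills a vector, that vector is 0, because these
  idempotents sum to the identity.\<close>

lemma eeB_zero_imp:
  assumes z: "z \<in> carrier N" and zero: "\<And>is. is \<in> S0 \<Longrightarrow> eeB is z = \<zero>"
  shows "z = \<zero>"
proof -
  have "z = \<zero>" if "set K \<subseteq> {1..k}" "distinct K"
      "\<And>t. (\<And>c. c \<in> {1..k} \<Longrightarrow> t c \<in> Res c) \<Longrightarrow> foldr (\<lambda>c. opr c (E (t c))) K z = \<zero>" for K
    using that
  proof (induction K)
    case Nil
    \<comment> \<open>The hypothesis quantifies over tuples of residue sequences, so at least one
      must exist: any list with the multiplicities prescribed by \<open>\<beta>s c\<close> is a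
      residue sequence of block c.\<close>
    have "\<exists>t. \<forall>c\<in>{1..k}. t c \<in> Res c"
    proof (rule bchoice, rule ballI, rule ccontr)
      fix c assume c: "c \<in> {1..k}" "\<nexists>t. t \<in> Res c"
      obtain xs where xs: "mset xs = Abs_multiset (Poly_Mapping.lookup (\<beta>s c))" using ex_mset by blast
      have "finite {x. 0 < Poly_Mapping.lookup (\<beta>s c) x}" using finite_lookup[of "\<beta>s c"] by simp
      then have "count (mset xs) = Poly_Mapping.lookup (\<beta>s c)" unfolding xs by (simp add: Abs_multiset_inverse)
      then have colour_at: "count_list xs = Poly_Mapping.lookup (\<beta>s c)" by (auto simp: count_mset fun_eq_iff)
      have "set xs \<subseteq> vertices e"
      proof
        fix i assume "i \<in> set xs"
        then have "Poly_Mapping.lookup (\<beta>s c) i \<noteq> 0" using count_list_0_iff[of xs i] colour_at by simp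
        then show "i \<in> vertices e" using \<beta>s_Q[OF c(1)] by (auto simp: Q_plus_def in_keys_iff subset_iff)
      qed
      then show False using colour_at c(2) by (auto simp: residue_seqs_iff)
    qed
    then show ?case using Nil(3) by (simp only: foldr.simps id_apply) blast
  next
    case (Cons c K)
    have c: "c \<in> {1..k}" using Cons.prems by simp
    interpret Rc: qh_rep N sc e "ht c" "Res c" "{1..<ht c}" "\<lambda>is. opr c (E is)" "\<lambda>a. opr c (Y a)" "\<lambda>a. opr c (Psi a)"
      by (rule block_rep[OF c])
    show ?case
    proof (rule Cons.IH)
      fix t assume t: "\<And>c. c \<in> {1..k} \<Longrightarrow> t c \<in> Res c"
      let ?f = "foldr (\<lambda>c. opr c (E (t c))) K z"
      have "klin N sc N sc (foldr (\<lambda>c. opr c (E (t c))) K)" using Cons.prems(1) t qh_gens_memb(3) by (intro fold_klin) auto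
      then have f: "?f \<in> carrier N" using z by (rule klin_closed)
      have "opr c (E j) ?f = \<zero>" if j: "j \<in> Res c" for j
      proof -
        \<comment> \<open>Only the c-th entry of the tuple is varied; as c does not occur in
          \<open>K\<close>, the inner vector stays the same.\<close>
        have "foldr (\<lambda>d. opr d (E ((t(c := j)) d))) (c # K) z = \<zero>" by (rule Cons.prems(3)) (use t j in auto)
        moreover have "foldr (\<lambda>d. opr d (E ((t(c := j)) d))) K z = ?f"
          using Cons.prems(2) by (intro foldr_cong) auto
        ultimately show ?thesis by simp
      qed
      then have "(\<Oplus>j\<in>Res c. opr c (E j) ?f) = (\<Oplus>j\<in>Res c. \<zero>)" by (intro finsum_cong') auto
      then show "?f = \<zero>" using Rc.ee_sum[OF f] by simp
    qed (use Cons.prems in auto)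
  qed
  moreover have "foldr (\<lambda>c. opr c (E (t c))) L z = \<zero>" if t: "\<And>c. c \<in> {1..k} \<Longrightarrow> t c \<in> Res c" for t
  proof -
    obtain "is" where i: "is \<in> S0" "\<And>c. c \<in> {1..k} \<Longrightarrow> part c is = t c" using parts_surj[of t] t by blast
    then have "eeB is z = foldr (\<lambda>c. opr c (E (t c))) L z" unfolding eeB_def by (intro foldr_cong) auto
    then show ?thesis using zero[OF i(1)] by simp
  qed
  ultimately show ?thesis using set_L by (metis distinct_upt order_refl)
qed

text \<open>By orthogonality every \<open>eeB\<close> kills the difference of x and the sum, so
  \<open>eeB_zero_imp\<close> applies.\<close>

lemma eeB_sum:
  assumes x: "x \<in> carrier N" shows "(\<Oplus>is\<in>S0. eeB is x) = x"
proof -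
  let ?s = "\<Oplus>is\<in>S0. eeB is x"
  have c: "(\<lambda>is. eeB is x) \<in> S0 \<rightarrow> carrier N" using klin_closed[OF eeB_klin x] by blast
  have s: "?s \<in> carrier N" by (rule finsum_closed[OF c])
  have "x \<ominus> ?s = \<zero>"
  proof (rule eeB_zero_imp)
    show "x \<ominus> ?s \<in> carrier N" using x s by (rule minus_closed)
    fix "is" assume i: "is \<in> S0"
    have "eeB is ?s = (\<Oplus>js\<in>S0. eeB is (eeB js x))"
      by (rule klin_finsum[OF eeB_klin[OF i] abelian_group_axioms abelian_group_axioms c])
    also have "\<dots> = (\<Oplus>js\<in>S0. if is = js then eeB js x else \<zero>)"
      using eeB_eeB[OF i _ x] c by (intro finsum_cong') (auto simp: Pi_iff)
    also have "\<dots> = eeB is x" by (rule finsum_singleton[OF i S0_finite c])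
    finally have "eeB is ?s = eeB is x" .
    then show "eeB is (x \<ominus> ?s) = \<zero>"
      using klin_minus[OF eeB_klin[OF i] abelian_group_axioms abelian_group_axioms x s] klin_closed[OF eeB_klin[OF i] x]
      by (simp add: a_minus_def r_neg)
  qed
  then show ?thesis using x s by (metis a_minus_def add.inv_equality add.inv_solve_right l_zero zero_closed)
qed

lemma Y_gen: "c \<in> {1..k} \<Longrightarrow> a \<in> {1..ht c} \<Longrightarrow> Y a \<in> qh_gens e (\<beta>s c)"
  and Psi_gen: "c \<in> {1..k} \<Longrightarrow> a \<in> {1..<ht c} \<Longrightarrow> Psi a \<in> qh_gens e (\<beta>s c)"
  using qh_gens_memb by blast+

lemma yB_off: "c \<in> {1..k} \<Longrightarrow> a \<in> {1..ht c} \<Longrightarrow> yB (off c + a) = opr c (Y a)"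
  by (simp add: yB_def blk_off loc_off)

lemma psB_off: "c \<in> {1..k} \<Longrightarrow> a \<in> {1..<ht c} \<Longrightarrow> psB (off c + a) = opr c (Psi a)"
  using blk_off[of c a] loc_off[of c a] by (simp add: psB_def)

text \<open>Positions are written as \<open>off c + a\<close>. Within a block the relations are
  those of \<open>block_rep\<close>, and operators of different blocks commute. Since only \<psi>
  with r in \<open>D0\<close> occur, no relation with a nontrivial right-hand side mixes two
  blocks.\<close>

lemma family_rep: "qh_rep N sc e n S0 D0 eeB yB psB"
proof
  show "finite S0" by (rule S0_finite)
  show "is \<in> S0 \<Longrightarrow> length is = n" for "is" using S0_in_S length_S by blast
  show "D0 \<subseteq> {1..<n}" by (rule D0_sub)
  show "r \<in> D0 \<Longrightarrow> is \<in> S0 \<Longrightarrow> swap_entries r is \<in> S0" for r "is" by (rule S0_swap)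
  show "is \<in> S0 \<Longrightarrow> klin N sc N sc (eeB is)" for "is" by (rule eeB_klin)
  show "is \<in> S0 \<Longrightarrow> js \<in> S0 \<Longrightarrow> x \<in> carrier N \<Longrightarrow> eeB is (eeB js x) = (if is = js then eeB is x else \<zero>)" for "is" js x
    by (rule eeB_eeB)
  show "x \<in> carrier N \<Longrightarrow> (\<Oplus>is\<in>S0. eeB is x) = x" for x by (rule eeB_sum)
next
  fix r assume "r \<in> {1..n}"
  then obtain c a where ca: "c \<in> {1..k}" "a \<in> {1..ht c}" "r = off c + a" by (rule block_cases)
  show "klin N sc N sc (yB r)" unfolding ca(3) yB_off[OF ca(1,2)] by (rule opr_klin[OF ca(1) Y_gen[OF ca(1,2)]])
  show "yB r (eeB is x) = eeB is (yB r x)" if i: "is \<in> S0" and x: "x \<in> carrier N" for "is" x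
    unfolding ca(3) yB_off[OF ca(1,2)]
  proof (rule eeB_hom[OF i _ x])
    fix d x assume d: "d \<in> {1..k}" "x \<in> carrier N"
    show "opr c (Y a) (opr d (E (part d is)) x) = opr d (E (part d is)) (opr c (Y a) x)"
      using opr_comm[OF ca(1) d(1) _ Y_gen[OF ca(1,2)] E_gen[OF i d(1)] d(2)]
        qh_rep.y_ee[OF block_rep[OF ca(1)] ca(2) part_in[OF i ca(1)] d(2)] by (cases "c = d") auto
  qed
  fix s x assume "s \<in> {1..n}" and x: "x \<in> carrier N"
  then obtain d b where db: "d \<in> {1..k}" "b \<in> {1..ht d}" "s = off d + b" using block_cases by metis
  show "yB r (yB s x) = yB s (yB r x)"
    unfolding ca(3) db(3) yB_off[OF ca(1,2)] yB_off[OF db(1,2)]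
    using opr_comm[OF ca(1) db(1) _ Y_gen[OF ca(1,2)] Y_gen[OF db(1,2)] x]
      qh_rep.y_y[OF block_rep[OF ca(1)] ca(2) _ x, of b] db(2) by (cases "c = d") auto
next
  fix r assume rD: "r \<in> D0"
  then obtain c a where ca: "c \<in> {1..k}" "a \<in> {1..<ht c}" "r = off c + a" by (rule D0_cases)
  have a: "a \<in> {1..ht c}" "a + 1 \<in> {1..ht c}" using ca(2) by auto
  interpret Rc: qh_rep N sc e "ht c" "Res c" "{1..<ht c}" "\<lambda>is. opr c (E is)" "\<lambda>a. opr c (Y a)" "\<lambda>a. opr c (Psi a)"
    by (rule block_rep[OF ca(1)])
  have ps: "psB r = opr c (Psi a)" unfolding ca(3) by (rule psB_off[OF ca(1,2)])
  have y: "yB r = opr c (Y a)" "yB (r + 1) = opr c (Y (a + 1))"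
    unfolding ca(3) add.assoc by (rule yB_off[OF ca(1) a(1)], rule yB_off[OF ca(1) a(2)])
  show "klin N sc N sc (psB r)" unfolding ps by (rule opr_klin[OF ca(1) Psi_gen[OF ca(1,2)]])
  {
    fix s x assume s: "s \<in> {1..n}" "s \<noteq> r" "s \<noteq> r + 1" and x: "x \<in> carrier N"
    obtain d b where db: "d \<in> {1..k}" "b \<in> {1..ht d}" "s = off d + b" by (rule block_cases[OF s(1)])
    show "psB r (yB s x) = yB s (psB r x)"
    proof (cases "c = d")
      case True
      then have "b \<noteq> a" "b \<noteq> a + 1" using s ca(3) db(3) by auto
      then show ?thesis
        unfolding ps db(3) yB_off[OF db(1,2)] using Rc.psi_y[OF ca(2) _ _ _ x, of b] db(2) True by simp
    next
      case False
      then show ?thesis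
        unfolding ps db(3) yB_off[OF db(1,2)] by (rule opr_comm[OF ca(1) db(1) _ Psi_gen[OF ca(1,2)] Y_gen[OF db(1,2)] x])
    qed
  next
    fix s x assume s: "s \<in> D0" "1 < \<bar>int r - int s\<bar>" and x: "x \<in> carrier N"
    obtain d b where db: "d \<in> {1..k}" "b \<in> {1..<ht d}" "s = off d + b" by (rule D0_cases[OF s(1)])
    show "psB r (psB s x) = psB s (psB r x)"
    proof (cases "c = d")
      case True
      then have "1 < \<bar>int a - int b\<bar>" using s ca(3) db(3) by auto
      then show ?thesis
        unfolding ps db(3) psB_off[OF db(1,2)] using Rc.psi_comm[OF ca(2) _ _ x, of b] db(2) True by simp
    next
      case False
      then show ?thesis
        unfolding ps db(3) psB_off[OF db(1,2)] by (rule opr_comm[OF ca(1) db(1) _ Psi_gen[OF ca(1,2)] Psi_gen[OF db(1,2)] x])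
    qed
  next
    fix "is" x assume i: "is \<in> S0" and x: "x \<in> carrier N"
    show "psB r (eeB is x) = eeB (swap_entries r is) (psB r x)"
      unfolding ps
    proof (rule eeB_hom[OF i _ x])
      fix d x assume d: "d \<in> {1..k}" "x \<in> carrier N"
      have "part d (swap_entries r is) = (if d = c then swap_entries a (part c is) else part d is)"
        unfolding ca(3) by (rule part_swap[OF S0_in_S[OF i] ca(1,2) d(1)])
      then show "opr c (Psi a) (opr d (E (part d is)) x) = opr d (E (part d (swap_entries r is))) (opr c (Psi a) x)"
        using opr_comm[OF ca(1) d(1) _ Psi_gen[OF ca(1,2)] E_gen[OF i d(1)] d(2)]
          Rc.psi_ee[OF ca(2) part_in[OF i ca(1)] d(2)] by (cases "c = d") auto
    qed
    let ?u = "eeB is x"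
    \<comment> \<open>For block c alone this vector is homogeneous with sequence
      \<open>part c is\<close>, so the relations of that block apply to it directly.\<close>
    have u: "Rc.homog (part c is) ?u"
      using opr_eeB[OF i ca(1) part_in[OF i ca(1)] x] klin_closed[OF eeB_klin[OF i] x] by (simp add: Rc.homog_def)
    note p = part_in[OF i ca(1)]
    have en: "entry is r = entry (part c is) a" "entry is (r + 1) = entry (part c is) (a + 1)"
      using entry_part[OF S0_in_S[OF i] ca(1) a(1)] entry_part[OF S0_in_S[OF i] ca(1) a(2)] ca(3) by simp_all
    show "psB r (yB (r + 1) ?u) = yB r (psB r ?u) \<oplus> (if entry is r = entry is (r + 1) then ?u else \<zero>)"
      unfolding ps y en by (rule Rc.psi_y_succ_homog[OF ca(2) p u])
    show "yB (r + 1) (psB r ?u) = psB r (yB r ?u) \<oplus> (if entry is r = entry is (r + 1) then ?u else \<zero>)"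
      unfolding ps y en by (rule Rc.y_succ_psi_homog[OF ca(2) p u])
    show "psB r (psB r ?u) = sq_act N e (entry is r) (entry is (r + 1)) (yB r) (yB (r + 1)) ?u"
      unfolding ps y en by (rule Rc.psi_psi_homog[OF ca(2) p u])
    assume r1: "r + 1 \<in> D0"
    obtain d b where db: "d \<in> {1..k}" "b \<in> {1..<ht d}" "r + 1 = off d + b" by (rule D0_cases[OF r1])
    \<comment> \<open>Membership of r in \<open>D0\<close> already puts position r + 1 into block c,
      so both operators \<psi> belong to the same block.\<close>
    have dc: "d = c" using blk_off[OF db(1), of b] blk_off[OF ca(1) a(2)] db(2,3) ca(3) by simp
    then have a1: "a + 1 \<in> {1..<ht c}" "a + 2 \<in> {1..ht c}" using db ca(3) by auto
    have ps1: "psB (r + 1) = opr c (Psi (a + 1))" unfolding ca(3) add.assoc by (rule psB_off[OF ca(1) a1(1)])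
    have y2: "yB (r + 2) = opr c (Y (a + 2))" unfolding ca(3) add.assoc by (rule yB_off[OF ca(1) a1(2)])
    have en2: "entry is (r + 2) = entry (part c is) (a + 2)"
      using entry_part[OF S0_in_S[OF i] ca(1) a1(2)] ca(3) by (simp add: add.assoc)
    show "psB r (psB (r + 1) (psB r ?u)) = psB (r + 1) (psB r (psB (r + 1) ?u)) \<oplus>
        braid_act N e (entry is r) (entry is (r + 1)) (entry is (r + 2)) (yB r) (yB (r + 1)) (yB (r + 2)) ?u"
      unfolding ps ps1 y y2 en en2 by (rule Rc.braid_homog[OF ca(2) a1(1) p u])
  }
qed

end

section \<open>From operators on sorted components back to block operators\<close>

locale single_rep = separated_sum e k \<beta>s +
  Q: qh_rep N sc e "height (separated_sum.\<beta> k \<beta>s)"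
    "coloured.S0 (residue_seqs e (separated_sum.\<beta> k \<beta>s)) (separated_sum.col k \<beta>s) (separated_sum.w0 k \<beta>s)"
    "coloured.D0 (height (separated_sum.\<beta> k \<beta>s)) (separated_sum.w0 k \<beta>s)" ee y ps
  for e k :: nat and \<beta>s and N :: "('a, 'm) ring_scheme" (structure) and sc :: "'k::field \<Rightarrow> 'a \<Rightarrow> 'a" and ee y ps
begin

text \<open>A generator of block c acts with its positions shifted by \<open>off c\<close>. The
  idempotent of j becomes the sum over all sorted sequences with c-th part j, which is the
  idempotent of j in slot c with units in all other slots.\<close>

definition opR :: "nat \<Rightarrow> qh_gen \<Rightarrow> 'a \<Rightarrow> 'a" where
  "opR c g x = (case g of Psi a \<Rightarrow> ps (off c + a) x | Y a \<Rightarrow> y (off c + a) x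
     | E j \<Rightarrow> \<Oplus>is\<in>{is \<in> S0. part c is = j}. ee is x)"

lemma opR_simps: "opR c (Psi a) = ps (off c + a)" "opR c (Y a) = y (off c + a)"
  by (simp_all add: opR_def fun_eq_iff)

lemma opR_E_klin: "klin N sc N sc (opR c (E j))"
  using Q.klin_sum[OF Q.ee_klin Q.kspace_axioms, of "{is \<in> S0. part c is = j}" "\<lambda>is. is"]
  by (simp add: opR_def[abs_def])

lemma opR_E_homog:
  assumes i: "is \<in> S0" and u: "Q.homog is u"
  shows "opR c (E j) u = (if part c is = j then u else \<zero>)"
proof -
  let ?X = "{is \<in> S0. part c is = j}"
  have "(\<Oplus>js\<in>?X. ee js u) = (\<Oplus>js\<in>?X. if is = js then u else \<zero>)"
    using Q.ee_homog[OF _ i u] Q.homog_closed[OF u] by (intro Q.finsum_cong') auto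
  also have "\<dots> = (if part c is = j then u else \<zero>)"
  proof (cases "part c is = j")
    case True
    then have "is \<in> ?X" using i by simp
    then show ?thesis using Q.finsum_singleton[of "is" ?X "\<lambda>_. u"] Q.finite_S Q.homog_closed[OF u] True by simp
  next
    case False
    then have "(\<Oplus>js\<in>?X. if is = js then u else \<zero>) = (\<Oplus>js\<in>?X. \<zero>)" by (intro Q.finsum_cong') auto
    then show ?thesis using False by simp
  qed
  finally show ?thesis by (simp add: opR_def)
qed

lemma y_off_klin: "c \<in> {1..k} \<Longrightarrow> a \<in> {1..ht c} \<Longrightarrow> klin N sc N sc (y (off c + a))"
  using Q.y_klin off_in by blast

lemma ps_off_klin: "c \<in> {1..k} \<Longrightarrow> a \<in> {1..<ht c} \<Longrightarrow> klin N sc N sc (ps (off c + a))"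
  using Q.psi_klin D0_off by blast

lemma klin_eqI_homog: 
  assumes "klin N sc N sc f" "klin N sc N sc g" "\<And>is u. is \<in> S0 \<Longrightarrow> Q.homog is u \<Longrightarrow> f u = g u" "x \<in> carrier N"
  shows "f x = g x"
  using Q.homog_ext[OF assms(1,2) Q.abelian_group_axioms assms(3,4)] .

text \<open>Here \<open>j'\<close> may differ from j: an operator \<psi> of block c changes the c-th
  part of the sequence, while other operators keep it.\<close>

lemma opR_E_comm_homog:
  assumes f: "klin N sc N sc f" and "\<And>is u. is \<in> S0 \<Longrightarrow> Q.homog is u \<Longrightarrow> \<exists>js\<in>S0. Q.homog js (f u) \<and> (part c js = j' \<longleftrightarrow> part c is = j)"
    and x: "x \<in> carrier N"
  shows "f (opR c (E j) x) = opR c (E j') (f x)"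
proof (rule klin_eqI_homog[OF klin_comp[OF opR_E_klin f] klin_comp[OF f opR_E_klin] _ x])
  fix "is" u assume i: "is \<in> S0" and u: "Q.homog is u"
  then obtain js where j: "js \<in> S0" "Q.homog js (f u)" "part c js = j' \<longleftrightarrow> part c is = j" using assms(2) by blast
  show "f (opR c (E j) u) = opR c (E j') (f u)"
    using opR_E_homog[OF i u] opR_E_homog[OF j(1,2)] j(3) klin_zero[OF f Q.abelian_group_axioms Q.abelian_group_axioms] by simp
qed

text \<open>Each relation involving idempotents is tested on a homogeneous vector u with sequence
  \<open>is\<close>. If the c-th part of \<open>is\<close> is j, it is the given relation with
  shifted positions; otherwise both sides vanish.\<close>

lemma opR_block_rep:
  assumes c: "c \<in> {1..k}"
  shows "qh_rep N sc e (ht c) (Res c) {1..<ht c} (\<lambda>is. opR c (E is)) (\<lambda>a. opR c (Y a)) (\<lambda>a. opR c (Psi a))"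
proof
  show "finite (Res c)" by (rule finite_residue_seqs)
  show "is \<in> Res c \<Longrightarrow> length is = ht c" for "is" by (rule length_residue_seq)
  show "r \<in> {1..<ht c} \<Longrightarrow> is \<in> Res c \<Longrightarrow> swap_entries r is \<in> Res c" for r "is" by (rule swap_residue_seq)
  show "klin N sc N sc (opR c (E is))" for "is" by (rule opR_E_klin)
  show "r \<in> {1..ht c} \<Longrightarrow> klin N sc N sc (opR c (Y r))" for r unfolding opR_simps by (rule y_off_klin[OF c])
  show "r \<in> {1..<ht c} \<Longrightarrow> klin N sc N sc (opR c (Psi r))" for r unfolding opR_simps by (rule ps_off_klin[OF c])
next
  fix i j x assume x: "x \<in> carrier N"
  show "opR c (E i) (opR c (E j) x) = (if i = j then opR c (E i) x else \<zero>)"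
  proof (rule klin_eqI_homog[OF klin_comp[OF opR_E_klin opR_E_klin] _ _ x])
    show "klin N sc N sc (\<lambda>x. if i = j then opR c (E i) x else \<zero>)"
      using opR_E_klin Q.klin_0[OF Q.kspace_axioms] by (cases "i = j") auto
    fix "is" u assume s: "is \<in> S0" and u: "Q.homog is u"
    show "opR c (E i) (opR c (E j) u) = (if i = j then opR c (E i) u else \<zero>)"
      using opR_E_homog[OF s u] klin_zero[OF opR_E_klin Q.abelian_group_axioms Q.abelian_group_axioms] by auto
  qed
next
  fix x assume x: "x \<in> carrier N"
  show "(\<Oplus>j\<in>Res c. opR c (E j) x) = x"
  proof (rule klin_eqI_homog[OF Q.klin_sum[OF opR_E_klin Q.kspace_axioms] Q.klin_id _ x])
    fix "is" u assume s: "is \<in> S0" and u: "Q.homog is u"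
    have "(\<Oplus>j\<in>Res c. opR c (E j) u) = (\<Oplus>j\<in>Res c. if part c is = j then u else \<zero>)"
      using opR_E_homog[OF s u] Q.homog_closed[OF u] by (intro Q.finsum_cong') auto
    also have "\<dots> = u"
      using Q.finsum_singleton[OF part_in[OF s c] finite_residue_seqs, of "\<lambda>_. u"] Q.homog_closed[OF u] by simp
    finally show "(\<Oplus>j\<in>Res c. opR c (E j) u) = u" .
  qed
next
  fix a j x assume a: "a \<in> {1..ht c}" and j: "j \<in> Res c" and x: "x \<in> carrier N"
  show "opR c (Y a) (opR c (E j) x) = opR c (E j) (opR c (Y a) x)"
    unfolding opR_simps
    by (rule opR_E_comm_homog[OF y_off_klin[OF c a] _ x]) (use Q.homog_y off_in[OF c a] in blast)
next
  fix a b x assume a: "a \<in> {1..ht c}" and b: "b \<in> {1..ht c}" and x: "x \<in> carrier N"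
  show "opR c (Y a) (opR c (Y b) x) = opR c (Y b) (opR c (Y a) x)"
    unfolding opR_simps by (rule Q.y_y[OF off_in[OF c a] off_in[OF c b] x])
next
  fix a b x assume a: "a \<in> {1..<ht c}" and b: "b \<in> {1..ht c}" "b \<noteq> a" "b \<noteq> a + 1" and x: "x \<in> carrier N"
  show "opR c (Psi a) (opR c (Y b) x) = opR c (Y b) (opR c (Psi a) x)"
    unfolding opR_simps by (rule Q.psi_y[OF D0_off[OF c a] off_in[OF c b(1)] _ _ x]) (use b in auto)
next
  fix a b x assume a: "a \<in> {1..<ht c}" and b: "b \<in> {1..<ht c}" "1 < \<bar>int a - int b\<bar>" and x: "x \<in> carrier N"
  show "opR c (Psi a) (opR c (Psi b) x) = opR c (Psi b) (opR c (Psi a) x)"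
    unfolding opR_simps by (rule Q.psi_comm[OF D0_off[OF c a] D0_off[OF c b(1)] _ x]) (use b in auto)
next
  fix a j x assume a: "a \<in> {1..<ht c}" and j: "j \<in> Res c" and x: "x \<in> carrier N"
  have a1: "a \<in> {1..ht c}" "a + 1 \<in> {1..ht c}" using a by auto
  note D = D0_off[OF c a]
  note kp = ps_off_klin[OF c a] and ky = y_off_klin[OF c a1(1)] and ky1 = y_off_klin[OF c a1(2), unfolded add.assoc[symmetric]]
  note kE = opR_E_klin[of c j]
  have z: "opR c (E j) \<zero> = \<zero>" "ps (off c + a) \<zero> = \<zero>" "y (off c + a) \<zero> = \<zero>" "y (off c + a + 1) \<zero> = \<zero>"
    by (rule klin_zero[OF _ Q.abelian_group_axioms Q.abelian_group_axioms], rule kE kp ky ky1)+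
  have en: "entry j a = entry is (off c + a)" "entry j (a + 1) = entry is (off c + a + 1)"
    if "is \<in> S0" "part c is = j" for "is"
    using entry_part[OF S0_in_S[OF that(1)] c a1(1)] entry_part[OF S0_in_S[OF that(1)] c a1(2)] that(2) by (simp_all add: add.assoc)
  have kd: "klin N sc N sc (\<lambda>x. if entry j a = entry j (a + 1) then opR c (E j) x else \<zero>)"
    using kE Q.klin_0[OF Q.kspace_axioms] by (cases "entry j a = entry j (a + 1)") auto
  show "opR c (Psi a) (opR c (E j) x) = opR c (E (swap_entries a j)) (opR c (Psi a) x)"
    unfolding opR_simps
  proof (rule opR_E_comm_homog[OF kp _ x])
    fix "is" u assume s: "is \<in> S0" "Q.homog is u"
    have "part c (swap_entries (off c + a) is) = swap_entries a (part c is)"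
      using part_swap[OF S0_in_S[OF s(1)] c a c] by simp
    moreover have "swap_entries a (part c is) = swap_entries a j \<longleftrightarrow> part c is = j"
      using swap_swap[of a "part c is"] swap_swap[of a j] a length_part[OF S0_in_S[OF s(1)] c] length_residue_seq[OF j] by metis
    ultimately show "\<exists>js\<in>S0. Q.homog js (ps (off c + a) u) \<and> (part c js = swap_entries a j \<longleftrightarrow> part c is = j)"
      using Q.homog_psi[OF s(1) D s(2)] S0_swap[OF D s(1)] by auto
  qed
  show "opR c (Psi a) (opR c (Y (a + 1)) (opR c (E j) x)) = opR c (Y a) (opR c (Psi a) (opR c (E j) x)) \<oplus>
      (if entry j a = entry j (a + 1) then opR c (E j) x else \<zero>)"
    unfolding opR_simps add.assoc[symmetric]
  proof (rule klin_eqI_homog[OF klin_comp[OF klin_comp[OF kE ky1] kp] Q.klin_plus[OF klin_comp[OF klin_comp[OF kE kp] ky] kd Q.kspace_axioms] _ x])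
    fix "is" u assume s: "is \<in> S0" "Q.homog is u"
    show "ps (off c + a) (y (off c + a + 1) (opR c (E j) u)) = y (off c + a) (ps (off c + a) (opR c (E j) u)) \<oplus>
        (if entry j a = entry j (a + 1) then opR c (E j) u else \<zero>)"
      using opR_E_homog[OF s, of c j] Q.psi_y_succ_homog[OF D s] en[OF s(1)] z by (cases "part c is = j") auto
  qed
  show "opR c (Y (a + 1)) (opR c (Psi a) (opR c (E j) x)) = opR c (Psi a) (opR c (Y a) (opR c (E j) x)) \<oplus>
      (if entry j a = entry j (a + 1) then opR c (E j) x else \<zero>)"
    unfolding opR_simps add.assoc[symmetric]
  proof (rule klin_eqI_homog[OF klin_comp[OF klin_comp[OF kE kp] ky1] Q.klin_plus[OF klin_comp[OF klin_comp[OF kE ky] kp] kd Q.kspace_axioms] _ x])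
    fix "is" u assume s: "is \<in> S0" "Q.homog is u"
    show "y (off c + a + 1) (ps (off c + a) (opR c (E j) u)) = ps (off c + a) (y (off c + a) (opR c (E j) u)) \<oplus>
        (if entry j a = entry j (a + 1) then opR c (E j) u else \<zero>)"
      using opR_E_homog[OF s, of c j] Q.y_succ_psi_homog[OF D s] en[OF s(1)] z by (cases "part c is = j") auto
  qed
  note ks = Q.klin_sq_act[OF ky ky1, of e "entry j a" "entry j (a + 1)"]
  show "opR c (Psi a) (opR c (Psi a) (opR c (E j) x)) =
      sq_act N e (entry j a) (entry j (a + 1)) (opR c (Y a)) (opR c (Y (a + 1))) (opR c (E j) x)"
    unfolding opR_simps add.assoc[symmetric]
  proof (rule klin_eqI_homog[OF klin_comp[OF klin_comp[OF kE kp] kp] klin_comp[OF kE ks] _ x])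
    fix "is" u assume s: "is \<in> S0" "Q.homog is u"
    show "ps (off c + a) (ps (off c + a) (opR c (E j) u)) =
        sq_act N e (entry j a) (entry j (a + 1)) (y (off c + a)) (y (off c + a + 1)) (opR c (E j) u)"
      using opR_E_homog[OF s, of c j] Q.psi_psi_homog[OF D s] en[OF s(1)] z
        klin_zero[OF ks Q.abelian_group_axioms Q.abelian_group_axioms] by (cases "part c is = j") auto
  qed
next
  fix a j x assume a: "a \<in> {1..<ht c}" "a + 1 \<in> {1..<ht c}" and j: "j \<in> Res c" and x: "x \<in> carrier N"
  have a1: "a \<in> {1..ht c}" "a + 1 \<in> {1..ht c}" "a + 2 \<in> {1..ht c}" using a by auto
  note D = D0_off[OF c a(1)] D0_off[OF c a(2), unfolded add.assoc[symmetric]]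
  note kp = ps_off_klin[OF c a(1)] and kp1 = ps_off_klin[OF c a(2), unfolded add.assoc[symmetric]]
  note ky = y_off_klin[OF c a1(1)] and ky1 = y_off_klin[OF c a1(2), unfolded add.assoc[symmetric]]
    and ky2 = y_off_klin[OF c a1(3), unfolded add.assoc[symmetric]]
  note kE = opR_E_klin[of c j]
  note kb = Q.klin_braid_act[OF ky ky1 ky2, of e "entry j a" "entry j (a + 1)" "entry j (a + 2)"]
  have en: "entry j a = entry is (off c + a)" "entry j (a + 1) = entry is (off c + a + 1)" "entry j (a + 2) = entry is (off c + a + 2)"
    if "is \<in> S0" "part c is = j" for "is"
    using entry_part[OF S0_in_S[OF that(1)] c a1(1)] entry_part[OF S0_in_S[OF that(1)] c a1(2)]
      entry_part[OF S0_in_S[OF that(1)] c a1(3)] that(2) by (simp_all add: add.assoc)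
  have z: "ps (off c + a) \<zero> = \<zero>" "ps (off c + a + 1) \<zero> = \<zero>"
    "braid_act N e (entry j a) (entry j (a + 1)) (entry j (a + 2)) (y (off c + a)) (y (off c + a + 1)) (y (off c + a + 2)) \<zero> = \<zero>"
    by (rule klin_zero[OF _ Q.abelian_group_axioms Q.abelian_group_axioms], rule kp kp1 kb)+
  show "opR c (Psi a) (opR c (Psi (a + 1)) (opR c (Psi a) (opR c (E j) x))) =
      opR c (Psi (a + 1)) (opR c (Psi a) (opR c (Psi (a + 1)) (opR c (E j) x))) \<oplus>
      braid_act N e (entry j a) (entry j (a + 1)) (entry j (a + 2)) (opR c (Y a)) (opR c (Y (a + 1))) (opR c (Y (a + 2))) (opR c (E j) x)"
    unfolding opR_simps add.assoc[symmetric]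
  proof (rule klin_eqI_homog[OF klin_comp[OF klin_comp[OF klin_comp[OF kE kp] kp1] kp]
        Q.klin_plus[OF klin_comp[OF klin_comp[OF klin_comp[OF kE kp1] kp] kp1] klin_comp[OF kE kb] Q.kspace_axioms] _ x])
    fix "is" u assume s: "is \<in> S0" "Q.homog is u"
    show "ps (off c + a) (ps (off c + a + 1) (ps (off c + a) (opR c (E j) u))) =
      ps (off c + a + 1) (ps (off c + a) (ps (off c + a + 1) (opR c (E j) u))) \<oplus>
      braid_act N e (entry j a) (entry j (a + 1)) (entry j (a + 2)) (y (off c + a)) (y (off c + a + 1)) (y (off c + a + 2)) (opR c (E j) u)"
    proof (cases "part c is = j")
      case True
      show ?thesis unfolding opR_E_homog[OF s, of c j] en[OF s(1) True] using Q.braid_homog[OF D s] True by simp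
    next
      case False
      show ?thesis unfolding opR_E_homog[OF s, of c j] using False z by simp
    qed
  qed
qed simp

lemma opR_comm:
  assumes c: "c \<in> {1..k}" and d: "d \<in> {1..k}" and cd: "c \<noteq> d"
    and g: "g \<in> qh_gens e (\<beta>s c)" and h: "h \<in> qh_gens e (\<beta>s d)" and x: "x \<in> carrier N"
  shows "opR c g (opR d h x) = opR d h (opR c g x)"
proof -
  have EE: "opR c (E i) (opR d (E j) x) = opR d (E j) (opR c (E i) x)" for c d i j
  proof (rule klin_eqI_homog[OF klin_comp[OF opR_E_klin opR_E_klin] klin_comp[OF opR_E_klin opR_E_klin] _ x])
    fix "is" u assume s: "is \<in> S0" "Q.homog is u"
    show "opR c (E i) (opR d (E j) u) = opR d (E j) (opR c (E i) u)"
      using opR_E_homog[OF s] klin_zero[OF opR_E_klin Q.abelian_group_axioms Q.abelian_group_axioms] by auto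
  qed
  have EY: "opR c (Y a) (opR d (E j) x) = opR d (E j) (opR c (Y a) x)"
    if c: "c \<in> {1..k}" and a: "a \<in> {1..ht c}" for c d a j
    unfolding opR_simps
    by (rule opR_E_comm_homog[OF y_off_klin[OF c a] _ x]) (use Q.homog_y off_in[OF c a] in blast)
  have EP: "opR c (Psi a) (opR d (E j) x) = opR d (E j) (opR c (Psi a) x)"
    if c: "c \<in> {1..k}" and a: "a \<in> {1..<ht c}" and d: "d \<in> {1..k}" and cd: "c \<noteq> d" for c d a j
    unfolding opR_simps
  proof (rule opR_E_comm_homog[OF ps_off_klin[OF c a] _ x])
    fix "is" u assume s: "is \<in> S0" "Q.homog is u"
    show "\<exists>js\<in>S0. Q.homog js (ps (off c + a) u) \<and> (part d js = j \<longleftrightarrow> part d is = j)"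
      using Q.homog_psi[OF s(1) D0_off[OF c a] s(2)] S0_swap[OF D0_off[OF c a] s(1)]
        part_swap[OF S0_in_S[OF s(1)] c a d] cd by auto
  qed
  have ne: "off c + a \<noteq> off d + b" if "c \<in> {1..k}" "d \<in> {1..k}" "c \<noteq> d" "a \<in> {1..ht c}" "b \<in> {1..ht d}" for c d a b
    using blk_off[OF that(1,4)] blk_off[OF that(2,5)] that(3) by metis
  have PY: "opR c (Psi a) (opR d (Y b) x) = opR d (Y b) (opR c (Psi a) x)"
    if c: "c \<in> {1..k}" and d: "d \<in> {1..k}" and cd: "c \<noteq> d" and a: "a \<in> {1..<ht c}" and b: "b \<in> {1..ht d}" for c d a b
    unfolding opR_simps
    using ne[OF c d cd _ b, of a] ne[OF c d cd _ b, of "a + 1"] a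
    by (intro Q.psi_y[OF D0_off[OF c a] off_in[OF d b] _ _ x]) auto
  have sorted_psi: "opR c (Psi a) (opR d (Psi b) x) = opR d (Psi b) (opR c (Psi a) x)"
    if a: "a \<in> {1..<ht c}" and b: "b \<in> {1..<ht d}" for a b
  proof -
    \<comment> \<open>Each \<psi> uses two positions inside its own block, so positions of different
      blocks cannot be equal or adjacent here and the distant commutation applies.\<close>
    have "off c + a \<noteq> off d + b" "off c + (a + 1) \<noteq> off d + b" "off c + a \<noteq> off d + (b + 1)"
      by (rule ne[OF c d cd]; use a b in auto)+
    then have "1 < \<bar>int (off c + a) - int (off d + b)\<bar>" by linarith
    then show ?thesis unfolding opR_simps by (rule Q.psi_comm[OF D0_off[OF c a] D0_off[OF d b] _ x])
  qed
  have YY: "opR c (Y a) (opR d (Y b) x) = opR d (Y b) (opR c (Y a) x)"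
    if "a \<in> {1..ht c}" "b \<in> {1..ht d}" for a b
    unfolding opR_simps by (rule Q.y_y[OF off_in[OF c that(1)] off_in[OF d that(2)] x])
  show ?thesis
    using g h unfolding qh_gens_def
    by (elim UnE imageE) (simp_all only: EE EY[OF c] EY[OF d] EP[OF c _ d cd] EP[OF d _ c cd[symmetric]]
        PY[OF c d cd] PY[OF d c cd[symmetric]] sorted_psi YY)
qed

sublocale B: block_family e k \<beta>s N sc opR
  by (intro block_family.intro block_family_axioms.intro separated_sum_axioms Q.kspace_axioms opR_block_rep opR_comm)

text \<open>Passing to block operators and multiplying their idempotents returns the original ones:
  if the sequences differ, they differ in some part, and that factor kills the vector.\<close>

lemma eeB_eq: "is \<in> S0 \<Longrightarrow> x \<in> carrier N \<Longrightarrow> B.eeB is x = ee is x"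
proof (rule klin_eqI_homog[OF B.eeB_klin Q.ee_klin])
  fix js u assume i: "is \<in> S0" and j: "js \<in> S0" and u: "Q.homog js u"
  show "B.eeB is u = ee is u"
  proof (cases "is = js")
    case True
    then show ?thesis using opR_E_homog[OF j u] Q.ee_homog[OF i j u] by (auto intro!: B.eeB_id)
  next
    case False
    then obtain c where c: "c \<in> {1..k}" "part c is \<noteq> part c js" using parts_eqI S0_in_S i j by blast
    have "B.eeB is u = opR c (E (part c is)) (B.eeB is u)"
      using B.opr_eeB[OF i c(1) part_in[OF i c(1)] Q.homog_closed[OF u]] by simp
    also have "\<dots> = B.eeB is (opR c (E (part c is)) u)"
    proof (rule B.eeB_hom[OF i _ Q.homog_closed[OF u]])
      fix d x assume d: "d \<in> {1..k}" "x \<in> carrier N"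
      show "opR c (E (part c is)) (opR d (E (part d is)) x) = opR d (E (part d is)) (opR c (E (part c is)) x)"
        using opR_comm[OF c(1) d(1) _ B.E_gen[OF i c(1)] B.E_gen[OF i d(1)] d(2)] by (cases "c = d") auto
    qed
    also have "\<dots> = \<zero>"
      using opR_E_homog[OF j u] c(2) klin_zero[OF B.eeB_klin[OF i] Q.abelian_group_axioms Q.abelian_group_axioms] by simp
    finally show ?thesis using False Q.ee_homog[OF i j u] by simp
  qed
qed auto

end

section \<open>Modules over the tensor product of the block algebras\<close>

lemma algebra_family_quiver_hecke:
  fixes \<beta>s :: "nat \<Rightarrow> (int \<Rightarrow>\<^sub>0 nat)"
  shows "algebra_family {1..k} (\<lambda>c. quiver_hecke TYPE('k::field) e (\<beta>s c)) [1..<Suc k]"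
proof (rule algebra_family.intro)
  fix c
  interpret P: presented_algebra "word_monoid (qh_gens e (\<beta>s c))" "qh_relations e (\<beta>s c) :: (qh_gen list \<Rightarrow>\<^sub>0 'k) set"
    by (rule presented_quiver_hecke)
  note conv = quiver_hecke_conv[of e "\<beta>s c", where 'k='k]
  show "monoid (quiver_hecke TYPE('k) e (\<beta>s c))" unfolding conv by (rule P.monoid_A)
  fix a assume a: "a \<in> carrier (quiver_hecke TYPE('k) e (\<beta>s c))"
  show "a \<oplus>\<^bsub>quiver_hecke TYPE('k) e (\<beta>s c)\<^esub> b \<in> carrier (quiver_hecke TYPE('k) e (\<beta>s c))"
    if "b \<in> carrier (quiver_hecke TYPE('k) e (\<beta>s c))" for b
    using a that unfolding conv by (rule P.add_A_closed)
  fix d :: 'k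
  show "d \<odot>\<^bsub>quiver_hecke TYPE('k) e (\<beta>s c)\<^esub> a \<in> carrier (quiver_hecke TYPE('k) e (\<beta>s c))"
    using a unfolding conv by (rule P.smult_A_closed)
  show "d \<odot>\<^bsub>quiver_hecke TYPE('k) e (\<beta>s c)\<^esub> a =
      (d \<odot>\<^bsub>quiver_hecke TYPE('k) e (\<beta>s c)\<^esub> \<one>\<^bsub>quiver_hecke TYPE('k) e (\<beta>s c)\<^esub>) \<otimes>\<^bsub>quiver_hecke TYPE('k) e (\<beta>s c)\<^esub> a"
    using a unfolding conv by (rule P.smult_A_conv)
  show "a \<otimes>\<^bsub>quiver_hecke TYPE('k) e (\<beta>s c)\<^esub> (d \<odot>\<^bsub>quiver_hecke TYPE('k) e (\<beta>s c)\<^esub> \<one>\<^bsub>quiver_hecke TYPE('k) e (\<beta>s c)\<^esub>) =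
      (d \<odot>\<^bsub>quiver_hecke TYPE('k) e (\<beta>s c)\<^esub> \<one>\<^bsub>quiver_hecke TYPE('k) e (\<beta>s c)\<^esub>) \<otimes>\<^bsub>quiver_hecke TYPE('k) e (\<beta>s c)\<^esub> a"
    using a unfolding conv by (rule P.smult_A_central)
qed auto

locale separated_algebras = separated_sum e k \<beta>s
  for K :: "'k::field itself" and e k :: nat and \<beta>s
begin

abbreviation "AA c \<equiv> quiver_hecke TYPE('k) e (\<beta>s c)"
abbreviation "elt c \<equiv> qh_elt TYPE('k) e (\<beta>s c)"

sublocale AF: algebra_family "{1..k}" AA "[1..<Suc k]"
  by (rule algebra_family_quiver_hecke)

abbreviation "TA \<equiv> tensor_algebras {1..k} AA"

text \<open>The generator \<open>g\<close> of the c-th factor acts through the pure tensor with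
  \<open>g\<close> in slot c and units elsewhere.\<close>

definition opT where
  "opT N c g x = AF.telt (AF.comp_tuple c (elt c g)) \<odot>\<^bsub>N\<^esub> x"

lemma elt_in: "g \<in> qh_gens e (\<beta>s c) \<Longrightarrow> elt c g \<in> carrier (AA c)"
  by (rule qh_elt_in)

lemma family_of_module:
  assumes N: "left_module TA N"
  shows "block_family e k \<beta>s N (scalar_act TA N) (opT N)"
proof (intro block_family.intro block_family_axioms.intro separated_sum_axioms AF.kspace_tensor[OF N])
  interpret kspace N "scalar_act TA N" by (rule AF.kspace_tensor[OF N])
  fix c assume c: "c \<in> {1..k}"
  define W where "W = AF.comp_module N c"
  note W = AF.comp_module[OF N c, folded W_def]
  have Wop: "elt c g \<odot>\<^bsub>W\<^esub> x = opT N c g x" for g x unfolding W_def AF.comp_module_def[OF N] opT_def by simp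
  have Wc: "carrier W = carrier N" "\<zero>\<^bsub>W\<^esub> = \<zero>\<^bsub>N\<^esub>" "add W = add N" unfolding W_def AF.comp_module_def[OF N] by simp_all
  interpret Q: qh_rep W "scalar_act (AA c) W" e "ht c" "Res c" "{1..<ht c}"
      "\<lambda>is x. opT N c (E is) x" "\<lambda>a x. opT N c (Y a) x" "\<lambda>a x. opT N c (Psi a) x"
    using qh_rep_of_module[OF W(1)] unfolding Wop .
  show "qh_rep N (scalar_act TA N) e (ht c) (Res c) {1..<ht c} (\<lambda>is. opT N c (E is)) (\<lambda>a. opT N c (Y a)) (\<lambda>a. opT N c (Psi a))"
    by (rule qh_rep_sub[OF Q.qh_rep_axioms kspace_axioms])
       (use W(2) Q.ee_closed Q.y_closed Q.psi_closed Q.ee_sum Q.swap_S in \<open>simp_all add: Wc\<close>)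
next
  fix c d g h x assume c: "c \<in> {1..k}" and d: "d \<in> {1..k}" and cd: "c \<noteq> d"
    and g: "g \<in> qh_gens e (\<beta>s c)" and h: "h \<in> qh_gens e (\<beta>s d)" and x: "x \<in> carrier N"
  note a = elt_in[OF g] and b = elt_in[OF h]
  have u: "AF.comp_tuple d (elt d h) c = \<one>\<^bsub>AA c\<^esub>" "AF.comp_tuple c (elt c g) d = \<one>\<^bsub>AA d\<^esub>"
    unfolding AF.comp_tuple_def using c d cd by simp_all
  \<comment> \<open>Both composites are the action of the pure tensor whose slots c and d are filled
    and whose other slots are units.\<close>
  have 1: "opT N c g (opT N d h x) = AF.telt ((AF.comp_tuple d (elt d h))(c := elt c g)) \<odot>\<^bsub>N\<^esub> x"
    using AF.comp_tuple_mult[OF N c a AF.comp_tuple_in[OF d b] x] unfolding u(1) monoid.r_one[OF AF.monoid_A[OF c] a] opT_def .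
  have 2: "opT N d h (opT N c g x) = AF.telt ((AF.comp_tuple c (elt c g))(d := elt d h)) \<odot>\<^bsub>N\<^esub> x"
    using AF.comp_tuple_mult[OF N d b AF.comp_tuple_in[OF c a] x] unfolding u(2) monoid.r_one[OF AF.monoid_A[OF d] b] opT_def .
  show "opT N c g (opT N d h x) = opT N d h (opT N c g x)"
    unfolding 1 2 AF.comp_tuple_def by (subst fun_upd_twist[OF cd]) (rule refl)
qed

text \<open>Reduced twice: from the tensor product to single slots by \<open>tensor_homI\<close>,
  and from a slot to generators by \<open>qh_hom_iff\<close> for the restricted module.\<close>

lemma tensor_hom_opT_iff:
  assumes N: "left_module TA N" and N2: "left_module TA N2"
  shows "f \<in> left_module_hom TA N N2 \<longleftrightarrow> f \<in> carrier N \<rightarrow>\<^sub>E carrier N2 \<and>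
    klin N (scalar_act TA N) N2 (scalar_act TA N2) f \<and>
    (\<forall>c\<in>{1..k}. \<forall>g\<in>qh_gens e (\<beta>s c). \<forall>x\<in>carrier N. f (opT N c g x) = opT N2 c g (f x))" (is "?l \<longleftrightarrow> ?r")
proof
  assume l: ?l
  show ?r
  proof (intro conjI ballI)
    show "f \<in> carrier N \<rightarrow>\<^sub>E carrier N2" "klin N (scalar_act TA N) N2 (scalar_act TA N2) f"
      using l unfolding AF.tensor_hom_iff[OF N N2] by (rule conjunct1, rule conjunct1[OF conjunct2])
    fix c g x assume "c \<in> {1..k}" "g \<in> qh_gens e (\<beta>s c)" "x \<in> carrier N"
    then show "f (opT N c g x) = opT N2 c g (f x)"
      using l AF.comp_tuple_in[OF _ elt_in] unfolding AF.tensor_hom_iff[OF N N2] opT_def by metis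
  qed
next
  assume r: ?r
  then have f: "f \<in> carrier N \<rightarrow>\<^sub>E carrier N2" "klin N (scalar_act TA N) N2 (scalar_act TA N2) f"
    and fg: "\<And>c g x. c \<in> {1..k} \<Longrightarrow> g \<in> qh_gens e (\<beta>s c) \<Longrightarrow> x \<in> carrier N \<Longrightarrow> f (opT N c g x) = opT N2 c g (f x)"
    by (rule conjunct1, rule conjunct1[OF conjunct2]) (use r in blast)
  show ?l
  proof (rule AF.tensor_homI[OF N N2 f])
    fix c a x assume c: "c \<in> {1..k}" and a: "a \<in> carrier (AA c)" and x: "x \<in> carrier N"
    define W W2 where "W = AF.comp_module N c" and "W2 = AF.comp_module N2 c"
    note W = AF.comp_module[OF N c, folded W_def] and W2 = AF.comp_module[OF N2 c, folded W2_def]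
    have defs: "carrier W = carrier N" "add W = add N" "carrier W2 = carrier N2" "add W2 = add N2"
      unfolding W_def W2_def AF.comp_module_def[OF N] AF.comp_module_def[OF N2] by simp_all
    have act: "a \<odot>\<^bsub>W\<^esub> x = AF.telt (AF.comp_tuple c a) \<odot>\<^bsub>N\<^esub> x" "a \<odot>\<^bsub>W2\<^esub> z = AF.telt (AF.comp_tuple c a) \<odot>\<^bsub>N2\<^esub> z" for a x z
      unfolding W_def W2_def AF.comp_module_def[OF N] AF.comp_module_def[OF N2] by simp_all
    have k: "klin W (scalar_act (AA c) W) W2 (scalar_act (AA c) W2) f"
    proof (rule klinI)
      fix x assume x: "x \<in> carrier W"
      then have x': "x \<in> carrier N" "f x \<in> carrier N2" using f(1) by (auto simp: defs)
      show "f x \<in> carrier W2" using x' by (simp add: defs)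
      show "f (scalar_act (AA c) W d x) = scalar_act (AA c) W2 d (f x)" for d
        unfolding W(2)[OF x'(1)] W2(2)[OF x'(2)] by (rule klin_sc[OF f(2) x'(1)])
      show "f (x \<oplus>\<^bsub>W\<^esub> z) = f x \<oplus>\<^bsub>W2\<^esub> f z" if "z \<in> carrier W" for z
        using that x' klin_add[OF f(2)] by (simp add: defs)
    qed
    have "f (elt c g \<odot>\<^bsub>W\<^esub> x) = elt c g \<odot>\<^bsub>W2\<^esub> f x" if "g \<in> qh_gens e (\<beta>s c)" "x \<in> carrier W" for g x
      using fg[OF c that(1)] that(2) unfolding act opT_def defs by blast
    then have "f \<in> left_module_hom (AA c) W W2"
      unfolding qh_hom_iff[OF W(1) W2(1)] using k f(1) unfolding defs by blast
    then have "f (a \<odot>\<^bsub>W\<^esub> x) = a \<odot>\<^bsub>W2\<^esub> f x"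
      using a x unfolding left_module_hom_def defs by blast
    then show "f (AF.telt (AF.comp_tuple c a) \<odot>\<^bsub>N\<^esub> x) = AF.telt (AF.comp_tuple c a) \<odot>\<^bsub>N2\<^esub> f x"
      unfolding act .
  qed
qed

lemma module_scalar_klin:
  assumes c: "c \<in> {1..k}" and W: "left_module (AA c) W" and a: "a \<in> carrier (AA c)"
  shows "klin W (scalar_act (AA c) W) W (scalar_act (AA c) W) (\<lambda>x. a \<odot>\<^bsub>W\<^esub> x)"
proof -
  interpret W: left_module "AA c" W by fact
  have one: "d \<odot>\<^bsub>AA c\<^esub> \<one>\<^bsub>AA c\<^esub> \<in> carrier (AA c)" for d by (rule AF.smult_closed[OF c AF.one_in[OF c]])
  show ?thesis
  proof (rule klinI)
    fix x d assume x: "x \<in> carrier W"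
    show "a \<odot>\<^bsub>W\<^esub> scalar_act (AA c) W d x = scalar_act (AA c) W d (a \<odot>\<^bsub>W\<^esub> x)"
      unfolding scalar_act_def W.act_mult[OF a one x, symmetric] W.act_mult[OF one a x, symmetric] AF.smult_central[OF c a] ..
  qed (use a in \<open>simp_all add: W.act_closed W.act_add_right\<close>)
qed

text \<open>Commutation is known for generators of different blocks only, whereas a module over the
  tensor product needs it for all elements of the block algebras.\<close>

lemma module_of_family:
  assumes "block_family e k \<beta>s N sc opr"
  shows "\<exists>\<sigma>. left_module TA (with_smult N \<sigma>) \<and>
    (\<forall>d. \<forall>x\<in>carrier N. scalar_act TA (with_smult N \<sigma>) d x = sc d x) \<and>
    (\<forall>c\<in>{1..k}. \<forall>g\<in>qh_gens e (\<beta>s c). \<forall>x\<in>carrier N. opT (with_smult N \<sigma>) c g x = opr c g x)"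
proof -
  interpret B: block_family e k \<beta>s N sc opr by fact
  have "\<forall>c\<in>{1..k}. \<exists>s. left_module (AA c) (with_smult N s) \<and>
      (\<forall>d. \<forall>x\<in>carrier N. scalar_act (AA c) (with_smult N s) d x = sc d x) \<and>
      (\<forall>g\<in>qh_gens e (\<beta>s c). \<forall>x\<in>carrier N. s (elt c g) x = opr c g x)"
  proof
    fix c assume c: "c \<in> {1..k}"
    show "\<exists>s. left_module (AA c) (with_smult N s) \<and>
      (\<forall>d. \<forall>x\<in>carrier N. scalar_act (AA c) (with_smult N s) d x = sc d x) \<and>
      (\<forall>g\<in>qh_gens e (\<beta>s c). \<forall>x\<in>carrier N. s (elt c g) x = opr c g x)"
      using module_of_qh_rep[OF B.block_rep[OF c]] unfolding qh_gens_def by blast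
  qed
  then obtain s where s: "\<And>c. c \<in> {1..k} \<Longrightarrow> left_module (AA c) (with_smult N (s c))"
    and sc: "\<And>c d x. c \<in> {1..k} \<Longrightarrow> x \<in> carrier N \<Longrightarrow> scalar_act (AA c) (with_smult N (s c)) d x = sc d x"
    and sg: "\<And>c g x. c \<in> {1..k} \<Longrightarrow> g \<in> qh_gens e (\<beta>s c) \<Longrightarrow> x \<in> carrier N \<Longrightarrow> s c (elt c g) x = opr c g x"
    by (metis (no_types, lifting) bchoice)
  have s_closed: "s c a x \<in> carrier N" if "c \<in> {1..k}" "a \<in> carrier (AA c)" "x \<in> carrier N" for c a x
    using left_module.act_closed[OF s[OF that(1)] that(2), of x] that(3) by simp
  \<comment> \<open>A linear map commuting with the generators of block c is an endomorphism of that
    module, hence commutes with the whole algebra.\<close>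
  have hom_comm: "f (s c a x) = s c a (f x)"
    if c: "c \<in> {1..k}" and a: "a \<in> carrier (AA c)" and x: "x \<in> carrier N" and f: "klin N sc N sc f"
      and fg: "\<And>g x. g \<in> qh_gens e (\<beta>s c) \<Longrightarrow> x \<in> carrier N \<Longrightarrow> f (opr c g x) = opr c g (f x)" for c a x f
  proof -
    let ?W = "with_smult N (s c)" and ?f = "restrict f (carrier N)"
    have fc: "f x \<in> carrier N" if "x \<in> carrier N" for x using f that by (rule klin_closed)
    have "klin ?W (scalar_act (AA c) ?W) ?W (scalar_act (AA c) ?W) ?f"
      using klin_add[OF f] klin_sc[OF f] fc by (intro klinI) (auto simp: sc[OF c])
    moreover have "?f (elt c g \<odot>\<^bsub>?W\<^esub> x) = elt c g \<odot>\<^bsub>?W\<^esub> ?f x" if "g \<in> qh_gens e (\<beta>s c)" "x \<in> carrier ?W" for g x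
      using that fg[OF that(1)] sg[OF c that(1)] fc B.opr_closed[OF c that(1)] by simp
    ultimately have "?f \<in> left_module_hom (AA c) ?W ?W"
      unfolding qh_hom_iff[OF s[OF c] s[OF c]] using fc by auto
    then have "?f (s c a x) = s c a (?f x)" using a x unfolding left_module_hom_def by simp
    then show ?thesis using x s_closed[OF c a x] by simp
  qed
  \<comment> \<open>\<open>hom_comm\<close> is used twice: generators of d against the algebra of c
    here, then elements of the algebra of c against the algebra of d in
    \<open>comm2\<close>.\<close>
  have comm1: "opr d h (s c a x) = s c a (opr d h x)"
    if "c \<in> {1..k}" "d \<in> {1..k}" "c \<noteq> d" "a \<in> carrier (AA c)" "h \<in> qh_gens e (\<beta>s d)" "x \<in> carrier N" for c d a h x
    by (rule hom_comm[OF that(1,4,6) B.opr_klin[OF that(2,5)]]) (use B.opr_comm[OF that(1,2,3) _ that(5)] in simp)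
  have comm2: "s c a (s d b x) = s d b (s c a x)"
    if "c \<in> {1..k}" "d \<in> {1..k}" "c \<noteq> d" "a \<in> carrier (AA c)" "b \<in> carrier (AA d)" "x \<in> carrier N" for c d a b x
  proof (rule hom_comm[OF that(2,5,6)])
    show "klin N sc N sc (s c a)"
      using module_scalar_klin[OF that(1) s[OF that(1)] that(4)] by (simp add: klin_def sc[OF that(1)] s_closed[OF that(1,4)])
    show "s c a (opr d g x) = opr d g (s c a x)" if "g \<in> qh_gens e (\<beta>s d)" "x \<in> carrier N" for g x
      using comm1 that \<open>c \<in> {1..k}\<close> \<open>d \<in> {1..k}\<close> \<open>c \<noteq> d\<close> \<open>a \<in> carrier (AA c)\<close> by simp
  qed
  have "\<exists>\<sigma>. left_module TA (with_smult N \<sigma>) \<and>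
    (\<forall>d. \<forall>x\<in>carrier N. scalar_act TA (with_smult N \<sigma>) d x = sc d x) \<and>
    (\<forall>t\<in>(\<Pi>\<^sub>E i\<in>{1..k}. carrier (AA i)). \<forall>x\<in>carrier N. \<sigma> (AF.telt t) x = foldr (\<lambda>i. s i (t i)) [1..<Suc k] x)"
    by (rule AF.module_of_family[OF B.kspace_axioms s sc comm2])
  then obtain \<sigma> where \<sigma>: "left_module TA (with_smult N \<sigma>) \<and>
    (\<forall>d. \<forall>x\<in>carrier N. scalar_act TA (with_smult N \<sigma>) d x = sc d x) \<and>
    (\<forall>t\<in>(\<Pi>\<^sub>E i\<in>{1..k}. carrier (AA i)). \<forall>x\<in>carrier N. \<sigma> (AF.telt t) x = foldr (\<lambda>i. s i (t i)) [1..<Suc k] x)"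
    by (rule exE)
  note \<sigma> = conjunct1[OF \<sigma>] conjunct1[OF conjunct2[OF \<sigma>]] conjunct2[OF conjunct2[OF \<sigma>], rule_format]
  have "opT (with_smult N \<sigma>) c g x = opr c g x" if c: "c \<in> {1..k}" and g: "g \<in> qh_gens e (\<beta>s c)" and x: "x \<in> carrier N" for c g x
  proof -
    let ?t = "AF.comp_tuple c (elt c g)"
    \<comment> \<open>All slots except c carry the unit and act as the identity.\<close>
    have "foldr (\<lambda>i. s i (?t i)) K x = (if c \<in> set K then s c (elt c g) x else x)" if "distinct K" "set K \<subseteq> {1..k}" for K
      using that
    proof (induction K)
      case (Cons d K)
      have d: "d \<in> {1..k}" using Cons.prems by simp
      have one: "s d \<one>\<^bsub>AA d\<^esub> z = z" if "z \<in> carrier N" for z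
        using left_module.act_one[OF s[OF d], of z] that by simp
      have t: "?t d = (if d = c then elt c g else \<one>\<^bsub>AA d\<^esub>)"
        unfolding AF.comp_tuple_def using d by simp
      show ?case
        using Cons one s_closed[OF c elt_in[OF g] x] x t by (auto simp del: atLeastAtMost_iff)
    qed simp
    from this[of "[1..<Suc k]", unfolded B.set_L, OF distinct_upt order_refl]
    have "foldr (\<lambda>i. s i (?t i)) [1..<Suc k] x = s c (elt c g) x" using c by (simp only: if_True)
    then show ?thesis
      using \<sigma>(3)[OF AF.comp_tuple_in[OF c elt_in[OF g]] x] sg[OF c g x] unfolding opT_def by (simp only: with_smult_simps)
  qed
  then show ?thesis using \<sigma>(1,2) by blast
qed

end

section \<open>Morphisms for sorted components and for block operators\<close>

locale two_single_reps = A: single_rep e k \<beta>s M sc ee y ps + B: single_rep e k \<beta>s N tc ff z ch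
  for e k \<beta>s
    and M :: "('a, 'm) ring_scheme" and sc :: "'k::field \<Rightarrow> 'a \<Rightarrow> 'a" and ee y ps
    and N :: "('b, 'n) ring_scheme" and tc :: "'k::field \<Rightarrow> 'b \<Rightarrow> 'b" and ff z ch
begin

lemma opR_hom:
  assumes f: "klin M sc N tc f"
    and "\<And>is x. is \<in> A.S0 \<Longrightarrow> x \<in> carrier M \<Longrightarrow> f (ee is x) = ff is (f x)"
    and "\<And>r x. r \<in> {1..A.n} \<Longrightarrow> x \<in> carrier M \<Longrightarrow> f (y r x) = z r (f x)"
    and "\<And>r x. r \<in> A.D0 \<Longrightarrow> x \<in> carrier M \<Longrightarrow> f (ps r x) = ch r (f x)"
    and c: "c \<in> {1..k}" and g: "g \<in> qh_gens e (\<beta>s c)" and x: "x \<in> carrier M"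
  shows "f (A.opR c g x) = B.opR c g (f x)"
proof (cases g)
  case (Psi a)
  then show ?thesis using assms(4)[OF A.D0_off[OF c, of a] x] g by (auto simp: A.opR_simps B.opR_simps qh_gens_def)
next
  case (Y a)
  then show ?thesis using assms(3)[OF A.off_in[OF c, of a] x] g by (auto simp: A.opR_simps B.opR_simps qh_gens_def)
next
  case (E j)
  have fx: "f x \<in> carrier N" using f x by (rule klin_closed)
  have "f (A.opR c g x) = finsum N (\<lambda>is. f (ee is x)) {is \<in> A.S0. A.part c is = j}"
    unfolding E A.opR_def
    using klin_finsum[OF f A.Q.abelian_group_axioms B.Q.abelian_group_axioms, of "\<lambda>is. ee is x" "{is \<in> A.S0. A.part c is = j}"]
      A.Q.ee_closed x by auto
  also have "\<dots> = finsum N (\<lambda>is. ff is (f x)) {is \<in> A.S0. A.part c is = j}"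
    using assms(2) x fx B.Q.ee_closed by (intro B.Q.finsum_cong') auto
  finally show ?thesis by (simp add: E B.opR_def)
qed

text \<open>Each idempotent on sorted components is a product of block idempotents by
  \<open>eeB_eq\<close>, and each \<open>y\<close> and \<psi> is a shifted block operator; so
  commuting with the block operators suffices.\<close>

lemma ops_of_opR_hom:
  assumes f: "klin M sc N tc f"
    and comm: "\<And>c g x. c \<in> {1..k} \<Longrightarrow> g \<in> qh_gens e (\<beta>s c) \<Longrightarrow> x \<in> carrier M \<Longrightarrow> f (A.opR c g x) = B.opR c g (f x)"
    and x: "x \<in> carrier M"
  shows "is \<in> A.S0 \<Longrightarrow> f (ee is x) = ff is (f x)" "r \<in> {1..A.n} \<Longrightarrow> f (y r x) = z r (f x)"
    "r \<in> A.D0 \<Longrightarrow> f (ps r x) = ch r (f x)"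
proof -
  have fx: "f x \<in> carrier N" using f x by (rule klin_closed)
  show "f (ee is x) = ff is (f x)" if i: "is \<in> A.S0"
  proof -
    have g: "E (A.part c is) \<in> qh_gens e (\<beta>s c)" if "c \<in> {1..k}" for c by (rule A.B.E_gen[OF i that])
    have "f (foldr (\<lambda>c. A.opR c (E (A.part c is))) K x) = foldr (\<lambda>c. B.opR c (E (A.part c is))) K (f x)"
      if "set K \<subseteq> {1..k}" for K
      using that
    proof (induction K)
      case (Cons c K)
      have "klin M sc M sc (foldr (\<lambda>c. A.opR c (E (A.part c is))) K)" using Cons.prems g by (intro A.B.fold_klin) auto
      then have "foldr (\<lambda>c. A.opR c (E (A.part c is))) K x \<in> carrier M" using x by (rule klin_closed)
      then show ?case using Cons comm[of c "E (A.part c is)"] g[of c] by simp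
    qed simp
    from this[of "[1..<Suc k]", unfolded A.B.set_L, OF order_refl]
    have "f (A.B.eeB is x) = B.B.eeB is (f x)" unfolding A.B.eeB_def B.B.eeB_def .
    then show ?thesis using A.eeB_eq[OF i x] B.eeB_eq[OF i fx] by simp
  qed
  show "f (y r x) = z r (f x)" if r: "r \<in> {1..A.n}"
  proof -
    obtain c a where ca: "c \<in> {1..k}" "a \<in> {1..A.ht c}" "r = A.off c + a" by (rule A.block_cases[OF r])
    then show ?thesis using comm[OF ca(1) qh_gens_memb(1)[OF ca(2)] x] by (simp add: A.opR_simps B.opR_simps)
  qed
  show "f (ps r x) = ch r (f x)" if r: "r \<in> A.D0"
  proof -
    obtain c a where ca: "c \<in> {1..k}" "a \<in> {1..<A.ht c}" "r = A.off c + a" by (rule A.D0_cases[OF r])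
    then show ?thesis using comm[OF ca(1) qh_gens_memb(2)[OF ca(2)] x] by (simp add: A.opR_simps B.opR_simps)
  qed
qed

end

subsection \<open>The equivalence\<close>

text \<open>As \<open>K\<close> is infinite, a nonzero module \<open>N\<close> has as many elements as any of its finite powers, so the module induced from \<open>N\<close> can be realised on a subset of the type of elements of \<open>N\<close>.\<close>

lemma infinite_UNIV_alg_closed: "infinite (UNIV :: 'a::alg_closed_field set)"
proof
  assume fin: "finite (UNIV :: 'a set)"
  \<comment> \<open>Over a finite field this product vanishes everywhere, so adding 1 gives a
    polynomial of positive degree without roots.\<close>
  let ?q = "\<Prod>a\<in>UNIV. [:- a, 1:] :: 'a poly"
  have "degree ?q = card (UNIV :: 'a set)" by (subst degree_prod_eq_sum_degree) auto
  then have dq: "degree ?q > 0" using fin by (simp add: finite_UNIV_card_ge_0)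
  then have "degree (?q + 1) > 0" by (simp add: degree_add_eq_left)
  then obtain x where "poly (?q + 1) x = 0" using alg_closed_imp_poly_has_root by blast
  moreover have "poly ?q x = 0" using fin by (simp add: poly_prod)
  ultimately show False by simp
qed

lemma (in kspace) infinite_carrier:
  assumes "infinite (UNIV :: 'k set)" "x \<in> carrier M" "x \<noteq> \<zero>"
  shows "infinite (carrier M)"
proof -
  have "inj (\<lambda>c. sc c x)"
  proof (rule injI, rule ccontr)
    fix c d assume eq: "sc c x = sc d x" and ne: "c \<noteq> d"
    have "sc (c - d) x \<oplus> sc d x = \<zero> \<oplus> sc d x" using sc_add_left[OF assms(2), of "c - d" d] eq assms(2) by simp
    then have "sc (c - d) x = \<zero>" using assms(2) by (simp only: add.right_cancel sc_closed zero_closed)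
    then have "sc (inverse (c - d) * (c - d)) x = \<zero>" by (simp only: sc_mult[OF assms(2)] sc_zero_right)
    then show False using ne assms by simp
  qed
  then have "infinite (range (\<lambda>c. sc c x))" using assms(1) finite_imageD by blast
  moreover have "range (\<lambda>c. sc c x) \<subseteq> carrier M" using assms(2) by auto
  ultimately show ?thesis using finite_subset by blast
qed

text \<open>Induction on \<open>S\<close>: a new coordinate is paired with the code of the remaining
  ones by a bijection between B x B and B.\<close>

lemma embed_funcset:
  assumes "infinite B" "finite S"
  shows "\<exists>f. inj_on f (S \<rightarrow>\<^sub>E B) \<and> f ` (S \<rightarrow>\<^sub>E B) \<subseteq> B"
  using assms(2)
proof (induction S)
  case empty
  obtain b where "b \<in> B" using assms(1) by (metis finite.emptyI ex_in_conv)
  then show ?case by (intro exI[of _ "\<lambda>_. b"]) auto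
next
  case (insert s S)
  then obtain f where f: "inj_on f (S \<rightarrow>\<^sub>E B)" "f ` (S \<rightarrow>\<^sub>E B) \<subseteq> B" by blast
  obtain g where g: "bij_betw g (B \<times> B) B"
    using card_of_Times_same_infinite[OF assms(1)] card_of_ordIso by blast
  let ?h = "\<lambda>x. g (x s, f (restrict x S))"
  have r: "restrict x S \<in> S \<rightarrow>\<^sub>E B" if "x \<in> insert s S \<rightarrow>\<^sub>E B" for x using that by auto
  have p: "(x s, f (restrict x S)) \<in> B \<times> B" if "x \<in> insert s S \<rightarrow>\<^sub>E B" for x using that r[OF that] f(2) by auto
  have "inj_on ?h (insert s S \<rightarrow>\<^sub>E B)"
  proof (rule inj_onI)
    fix x z assume x: "x \<in> insert s S \<rightarrow>\<^sub>E B" and z: "z \<in> insert s S \<rightarrow>\<^sub>E B" and eq: "?h x = ?h z"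
    have "(x s, f (restrict x S)) = (z s, f (restrict z S))"
      using g p[OF x] p[OF z] eq by (auto simp: bij_betw_def dest!: inj_onD)
    then have "x s = z s" "restrict x S = restrict z S" using inj_onD[OF f(1)] r[OF x] r[OF z] by auto
    then have eqs: "x i = z i" if "i \<in> insert s S" for i using that by (metis insertE restrict_apply')
    show "x = z" using x z eqs by (intro extensionalityI[of _ "insert s S"]) (simp_all only: PiE_iff)
  qed
  moreover have "?h ` (insert s S \<rightarrow>\<^sub>E B) \<subseteq> B" using p g by (auto simp: bij_betw_def)
  ultimately show ?case by blast
qed

text \<open>A zero module has a finite carrier but leaves only one family of values, so it is
  treated apart.\<close>

lemma (in kspace) embed_family:
  assumes "infinite (UNIV :: 'k set)" "finite S"
  shows "\<exists>\<iota> :: ('s \<Rightarrow> 'a) \<Rightarrow> 'a. inj_on \<iota> (S \<rightarrow>\<^sub>E carrier M)"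
proof (cases "carrier M = {\<zero>}")
  case True
  have "x = z" if "x \<in> S \<rightarrow>\<^sub>E carrier M" "z \<in> S \<rightarrow>\<^sub>E carrier M" for x z
    using that unfolding True by (intro extensionalityI[of _ S]) (auto simp: PiE_iff)
  then have "inj_on (\<lambda>_. \<zero>) (S \<rightarrow>\<^sub>E carrier M)" by (intro inj_onI)
  then show ?thesis by blast
next
  case False
  then obtain x where "x \<in> carrier M" "x \<noteq> \<zero>" using zero_closed by blast
  then show ?thesis using embed_funcset[OF infinite_carrier[OF assms(1)] assms(2)] by blast
qed

text \<open>Transport of structure along an injection; it moves the induced module from families
  back to the type of elements of \<open>N\<close>.\<close>

definition transport :: "('a \<Rightarrow> 'b) \<Rightarrow> ('r, 'a) module \<Rightarrow> ('r, 'b) module" where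
  "transport \<iota> M = \<lparr>carrier = \<iota> ` carrier M, monoid.mult = undefined, one = undefined, ring.zero = \<iota> \<zero>\<^bsub>M\<^esub>,
     add = (\<lambda>a b. \<iota> (inv_into (carrier M) \<iota> a \<oplus>\<^bsub>M\<^esub> inv_into (carrier M) \<iota> b)),
     module.smult = (\<lambda>r a. \<iota> (r \<odot>\<^bsub>M\<^esub> inv_into (carrier M) \<iota> a))\<rparr>"

lemma transport_simps:
  assumes "inj_on \<iota> (carrier M)"
  shows "carrier (transport \<iota> M) = \<iota> ` carrier M" "\<zero>\<^bsub>transport \<iota> M\<^esub> = \<iota> \<zero>\<^bsub>M\<^esub>"
    "x \<in> carrier M \<Longrightarrow> z \<in> carrier M \<Longrightarrow> \<iota> x \<oplus>\<^bsub>transport \<iota> M\<^esub> \<iota> z = \<iota> (x \<oplus>\<^bsub>M\<^esub> z)"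
    "x \<in> carrier M \<Longrightarrow> r \<odot>\<^bsub>transport \<iota> M\<^esub> \<iota> x = \<iota> (r \<odot>\<^bsub>M\<^esub> x)"
  using inv_into_f_f[OF assms] by (simp_all add: transport_def)

lemma transport_module:
  assumes \<iota>: "inj_on \<iota> (carrier M)" and M: "left_module A M"
  shows "left_module A (transport \<iota> M)"
proof -
  interpret M: left_module A M by fact
  note t = transport_simps[OF \<iota>]
  have "abelian_group (transport \<iota> M)"
  proof (rule abelian_groupI)
    fix a assume "a \<in> carrier (transport \<iota> M)"
    then obtain x where "x \<in> carrier M" "a = \<iota> x" unfolding t by blast
    then show "\<exists>b\<in>carrier (transport \<iota> M). b \<oplus>\<^bsub>transport \<iota> M\<^esub> a = \<zero>\<^bsub>transport \<iota> M\<^esub>"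
      by (intro bexI[of _ "\<iota> (\<ominus>\<^bsub>M\<^esub> x)"]) (auto simp: t M.l_neg)
  qed (auto simp: t M.a_ac)
  moreover have "left_module_axioms A (transport \<iota> M)"
    unfolding left_module_axioms_def t(1)
    by (auto simp: t M.act_closed M.act_add_left M.act_add_right M.act_mult M.act_one)
  ultimately show ?thesis by (simp add: left_module_def)
qed

lemma scalar_act_transport:
  "inj_on \<iota> (carrier M) \<Longrightarrow> x \<in> carrier M \<Longrightarrow> scalar_act A (transport \<iota> M) c (\<iota> x) = \<iota> (scalar_act A M c x)"
  unfolding scalar_act_def by (simp add: transport_simps)

section \<open>The corner of the induced module\<close>

context sorted_rep
begin

lemma induced_sub: "carrier induced \<subseteq> S \<rightarrow>\<^sub>E carrier N"
  unfolding PiE_def using induced_in induced_carrier by auto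

lemma induced_fin_gen:
  assumes "fin_gen N sc" shows "fin_gen induced induced_sc"
proof (rule fin_gen_sum[OF Q.kspace_axioms induced_kspace assms finite_S])
  show "klin N sc induced induced_sc (\<lambda>v. single_at is (ee (sort_seq is) v))" if "is \<in> S" for "is"
    by (rule single_at_klin[OF that _ Q.ee_klin[OF sort_seq_in[OF that]]]) (rule Q.homog_ee[OF sort_seq_in[OF that]])
  fix x assume x: "x \<in> carrier induced"
  have "finsum induced (\<lambda>is. single_at is (ee (sort_seq is) (x is))) S = finsum induced (\<lambda>is. induced_ee is x) S"
    using single_at_in induced_homog[OF x] Q.homog_eq[OF induced_homog[OF x]]
    by (intro G.finsum_cong') (auto simp: induced_ee_def)
  then show "\<exists>v. (\<forall>is\<in>S. v is \<in> carrier N) \<and> x = finsum induced (\<lambda>is. single_at is (ee (sort_seq is) (v is))) S"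
    using induced_ee_sum[OF x] induced_in[OF x] by (intro exI[of _ x]) auto
qed

text \<open>Sorted labels carry the components themselves, so \<open>N\<close> sits in the induced
  module as the families vanishing at unsorted labels. These form its corner.\<close>

definition theta :: "'a \<Rightarrow> int list \<Rightarrow> 'a" where
  "theta x = (\<lambda>is\<in>S. if is \<in> S0 then ee is x else \<zero>)"

lemma theta_in: "x \<in> carrier N \<Longrightarrow> theta x \<in> carrier induced"
  using Q.homog_ee homog_sub(1)[OF sort_seq_S0] by (auto simp: theta_def induced_carrier sort_seq_sorted)

lemma theta_klin: "klin N sc induced induced_sc theta"
  using theta_in klin_add[OF Q.ee_klin] klin_sc[OF Q.ee_klin]
  by (intro klinI) (auto simp: theta_def induced_add induced_sc_def fun_eq_iff)

lemma theta_ops: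
  assumes x: "x \<in> carrier N"
  shows "js \<in> S0 \<Longrightarrow> theta (ee js x) = induced_ee js (theta x)"
    "r \<in> {1..n} \<Longrightarrow> theta (y r x) = induced_y r (theta x)"
    "r \<in> D0 \<Longrightarrow> theta (psi r x) = induced_psi r (theta x)"
proof -
  show "theta (ee js x) = induced_ee js (theta x)" if js: "js \<in> S0"
    using js S0_sub x Q.ee_ee by (auto simp: theta_def induced_ee_def single_at_def fun_eq_iff)
  show "theta (y r x) = induced_y r (theta x)" if r: "r \<in> {1..n}"
    using Q.y_ee[OF r _ x] sort_pos_sorted[OF _ r] y_sort_pos_zero[OF r] by (auto simp: theta_def induced_y_def fun_eq_iff)
  show "theta (psi r x) = induced_psi r (theta x)" if r: "r \<in> D0"
  proof (rule extensionalityI[of _ S])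
    fix "is" assume i: "is \<in> S"
    have rn: "r \<in> {1..<n}" using r D0_sub by blast
    have ss: "swap_entries r (swap_entries r is) = is" using swap_swap length_S[OF i] rn by metis
    have sS: "swap_entries r is \<in> S" by (rule swap_S[OF i rn])
    show "theta (psi r x) is = induced_psi r (theta x) is"
    proof (cases "is \<in> S0")
      case True
      then have s0: "swap_entries r is \<in> S0" using S0_swap[OF r] by blast
      have "r \<in> {1..n}" "r + 1 \<in> {1..n}" using rn by auto
      \<comment> \<open>At sorted labels and for r in \<open>D0\<close> the colours agree and the
        sorted position of r is r, so \<open>sorted_psi\<close> is the given
        \<open>psi r\<close>.\<close>
      then have "colour_at (swap_entries r is) r = colour_at (swap_entries r is) (r + 1)" "sort_pos (swap_entries r is) r = r"
        using S0_colour_at[OF s0] r sort_pos_sorted[OF s0] by (auto simp: D0_def)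
      then show ?thesis
        using True s0 i sS Q.psi_ee[OF r s0 x] ss by (simp add: theta_def induced_psi_def sorted_psi_def)
    next
      case False
      then have "swap_entries r is \<notin> S0" using S0_swap[OF r, of "swap_entries r is"] ss by auto
      then show ?thesis using False i sS sorted_psi_zero[OF sS rn] by (simp add: theta_def induced_psi_def)
    qed
  qed (simp_all add: theta_def induced_psi_def)
qed

lemma theta_inj:
  assumes "x \<in> carrier N" "z \<in> carrier N" "theta x = theta z"
  shows "x = z"
proof -
  have eq: "ee is x = ee is z" if "is \<in> S0" for "is"
    using fun_cong[OF assms(3), of "is"] that S0_sub by (auto simp: theta_def)
  have "(\<Oplus>is\<in>S0. ee is x) = (\<Oplus>is\<in>S0. ee is z)"
    using eq Q.ee_closed assms by (intro Q.finsum_cong') auto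
  then show ?thesis using Q.ee_sum assms by simp
qed

text \<open>The vanishing condition is membership in the corner; the preimage is the sum of the
  values at sorted labels.\<close>

lemma theta_surj:
  assumes w: "w \<in> carrier induced" and zero: "\<And>is. is \<in> S - S0 \<Longrightarrow> w is = \<zero>"
  shows "\<exists>x\<in>carrier N. theta x = w"
proof -
  let ?x = "\<Oplus>is\<in>S0. w is"
  have h: "Q.homog is (w is)" if "is \<in> S0" for "is"
    using induced_homog[OF w, of "is"] that S0_sub sort_seq_sorted[OF that] by auto
  have c: "w \<in> S0 \<rightarrow> carrier N" using h Q.homog_closed by blast
  have "ee is ?x = w is" if i: "is \<in> S0" for "is"
  proof -
    have "ee is ?x = (\<Oplus>js\<in>S0. ee is (w js))"
      by (rule klin_finsum[OF Q.ee_klin[OF i] Q.abelian_group_axioms Q.abelian_group_axioms c])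
    also have "\<dots> = (\<Oplus>js\<in>S0. if is = js then w js else \<zero>)"
      using Q.ee_homog[OF i _ h] c by (intro Q.finsum_cong') auto
    also have "\<dots> = w is" by (rule Q.finsum_singleton[OF i Q.finite_S c])
    finally show ?thesis .
  qed
  moreover have x: "?x \<in> carrier N" by (rule Q.finsum_closed[OF c])
  ultimately have "theta ?x = w"
    using w zero by (intro extensionalityI[of _ S]) (auto simp: theta_def induced_carrier)
  then show ?thesis using x by blast
qed

end

section \<open>The functor to modules over the tensor product\<close>

context separated_algebras
begin

abbreviation "RA \<equiv> quiver_hecke TYPE('k) e \<beta>"

definition opM where "opM M g x = qh_elt TYPE('k) e \<beta> g \<odot>\<^bsub>M\<^esub> x"

abbreviation "eeM M \<equiv> \<lambda>is. opM M (E is)"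
abbreviation "yM M \<equiv> \<lambda>r. opM M (Y r)"
abbreviation "psM M \<equiv> \<lambda>r. opM M (Psi r)"

lemma coloured_rep_of_module:
  assumes "left_module RA M"
  shows "coloured_rep e n S col w0 M (scalar_act RA M) (eeM M) (yM M) (psM M)"
  using qh_rep_of_module[OF assms] coloured_axioms unfolding coloured_rep_def opM_def by blast

definition corner where
  "corner M = coloured_rep.corner_space S col w0 M (eeM M)"

lemma corner_rep:
  assumes "left_module RA M"
  shows "single_rep e k \<beta>s (corner M) (scalar_act RA M) (eeM M) (yM M) (psM M)"
proof -
  interpret C: coloured_rep e n S col w0 M "scalar_act RA M" "eeM M" "yM M" "psM M"
    by (rule coloured_rep_of_module[OF assms])
  show ?thesis using C.corner_space_rep separated_sum_axioms unfolding single_rep_def corner_def by blast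
qed

text \<open>\<open>module_of_family\<close> gives only the existence of such an action, so one is
  chosen. The conditions fix its scalars and the action of all generators on the corner.\<close>

definition corner_smult where
  "corner_smult M = (SOME s. left_module TA (with_smult (corner M) s) \<and>
    (\<forall>d. \<forall>x\<in>carrier (corner M). scalar_act TA (with_smult (corner M) s) d x = scalar_act RA M d x) \<and>
    (\<forall>c\<in>{1..k}. \<forall>g\<in>qh_gens e (\<beta>s c). \<forall>x\<in>carrier (corner M).
       opT (with_smult (corner M) s) c g x = single_rep.opR e k \<beta>s (corner M) (eeM M) (yM M) (psM M) c g x))"

definition corner_functor where "corner_functor M = with_smult (corner M) (corner_smult M)"

lemma corner_functor:
  assumes M: "left_module RA M"
  shows "left_module TA (corner_functor M)"
    "x \<in> carrier (corner M) \<Longrightarrow> scalar_act TA (corner_functor M) d x = scalar_act RA M d x"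
    "c \<in> {1..k} \<Longrightarrow> g \<in> qh_gens e (\<beta>s c) \<Longrightarrow> x \<in> carrier (corner M) \<Longrightarrow>
      opT (corner_functor M) c g x = single_rep.opR e k \<beta>s (corner M) (eeM M) (yM M) (psM M) c g x"
    "carrier (corner_functor M) = carrier (corner M)" "add (corner_functor M) = add (corner M)"
proof -
  interpret C: single_rep e k \<beta>s "corner M" "scalar_act RA M" "eeM M" "yM M" "psM M" by (rule corner_rep[OF M])
  note ex = module_of_family[OF C.B.block_family_axioms]
  note sp = someI_ex[OF ex, folded corner_smult_def, folded corner_functor_def]
  show "left_module TA (corner_functor M)" using sp by (rule conjunct1)
  show "x \<in> carrier (corner M) \<Longrightarrow> scalar_act TA (corner_functor M) d x = scalar_act RA M d x" using sp by blast
  show "c \<in> {1..k} \<Longrightarrow> g \<in> qh_gens e (\<beta>s c) \<Longrightarrow> x \<in> carrier (corner M) \<Longrightarrow> opT (corner_functor M) c g x = C.opR c g x"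
    using sp by blast
  show "carrier (corner_functor M) = carrier (corner M)" "add (corner_functor M) = add (corner M)" by (simp_all add: corner_functor_def)
qed

lemma corner_sub:
  assumes "left_module RA M"
  shows "carrier (corner M) \<subseteq> carrier M" "add (corner M) = add M"
proof -
  interpret C: coloured_rep e n S col w0 M "scalar_act RA M" "eeM M" "yM M" "psM M"
    by (rule coloured_rep_of_module[OF assms])
  show "carrier (corner M) \<subseteq> carrier M" "add (corner M) = add M" by (auto simp: corner_def C.corner_space_def)
qed

lemma corner_functor_klin_iff:
  assumes "left_module RA M" "left_module RA N"
  shows "klin (corner_functor M) (scalar_act TA (corner_functor M)) (corner_functor N) (scalar_act TA (corner_functor N)) f \<longleftrightarrow>
    klin (corner M) (scalar_act RA M) (corner N) (scalar_act RA N) f"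
  using corner_functor(2)[OF assms(1)] corner_functor(2)[OF assms(2)]
  unfolding klin_def corner_functor(4,5)[OF assms(1)] corner_functor(4,5)[OF assms(2)] by (auto simp: Pi_iff)

lemma corner_functor_finite_dim:
  assumes M: "left_module RA M" and "finite_dim RA M"
  shows "finite_dim TA (corner_functor M)"
proof -
  interpret C: coloured_rep e n S col w0 M "scalar_act RA M" "eeM M" "yM M" "psM M"
    by (rule coloured_rep_of_module[OF M])
  have fg: "fin_gen (corner M) (scalar_act RA M)"
    using C.corner_space_fin_gen assms(2) unfolding corner_def finite_dim_iff by blast
  have k1: "kspace (corner M) (scalar_act RA M)" using C.corner_space_kspace unfolding corner_def .
  have k2: "kspace (corner_functor M) (scalar_act TA (corner_functor M))" by (rule AF.kspace_tensor[OF corner_functor(1)[OF M]])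
  have id: "klin (corner M) (scalar_act RA M) (corner_functor M) (scalar_act TA (corner_functor M)) (\<lambda>x. x)"
    using corner_functor(2,4,5)[OF M] by (simp add: klin_def)
  show ?thesis
    unfolding finite_dim_iff by (rule fin_gen_image[OF k1 k2 fg id]) (simp add: corner_functor(4)[OF M])
qed

lemma RA_hom_iff:
  assumes M: "left_module RA M" and N: "left_module RA N"
  shows "f \<in> left_module_hom RA M N \<longleftrightarrow> f \<in> carrier M \<rightarrow>\<^sub>E carrier N \<and> klin M (scalar_act RA M) N (scalar_act RA N) f \<and>
    two_reps.ops_hom n (eeM M) (yM M) (psM M) (eeM N) (yM N) (psM N) S {1..<n} (carrier M) f"
proof -
  interpret T: two_reps e n S col w0 M "scalar_act RA M" "eeM M" "yM M" "psM M" N "scalar_act RA N" "eeM N" "yM N" "psM N"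
    using coloured_rep_of_module[OF M] coloured_rep_of_module[OF N] by (simp add: two_reps_def)
  have "(\<forall>g\<in>qh_gens e \<beta>. \<forall>x\<in>carrier M. f (opM M g x) = opM N g (f x)) \<longleftrightarrow> T.ops_hom S {1..<n} (carrier M) f"
    unfolding T.ops_hom_def qh_gens_def by blast
  then show ?thesis unfolding qh_hom_iff[OF M N] opM_def by simp
qed

text \<open>Describes the target hom-sets by \<open>ops_hom\<close>, as \<open>RA_hom_iff\<close>
  does for the source, so that \<open>hom_eqI\<close> and \<open>hom_extend\<close> apply to the
  functor.\<close>

lemma corner_functor_hom_iff:
  assumes M: "left_module RA M" and N: "left_module RA N"
  shows "f \<in> left_module_hom TA (corner_functor M) (corner_functor N) \<longleftrightarrow> f \<in> carrier (corner M) \<rightarrow>\<^sub>E carrier (corner N) \<and>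
    klin (corner M) (scalar_act RA M) (corner N) (scalar_act RA N) f \<and>
    two_reps.ops_hom n (eeM M) (yM M) (psM M) (eeM N) (yM N) (psM N) S0 D0 (carrier (corner M)) f"
    (is "_ \<longleftrightarrow> _ \<and> ?k \<and> ?o")
proof -
  interpret T: two_reps e n S col w0 M "scalar_act RA M" "eeM M" "yM M" "psM M" N "scalar_act RA N" "eeM N" "yM N" "psM N"
    using coloured_rep_of_module[OF M] coloured_rep_of_module[OF N] by (simp add: two_reps_def)
  interpret U: two_single_reps e k \<beta>s "corner M" "scalar_act RA M" "eeM M" "yM M" "psM M" "corner N" "scalar_act RA N" "eeM N" "yM N" "psM N"
    using corner_rep[OF M] corner_rep[OF N] by (simp add: two_single_reps_def)
  have *: "(\<forall>c\<in>{1..k}. \<forall>g\<in>qh_gens e (\<beta>s c). \<forall>x\<in>carrier (corner_functor M). f (opT (corner_functor M) c g x) = opT (corner_functor N) c g (f x)) \<longleftrightarrow> ?o" if k: ?k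
  proof -
    have fx: "f x \<in> carrier (corner N)" if "x \<in> carrier (corner M)" for x using k that by (rule klin_closed)
    have "(\<forall>c\<in>{1..k}. \<forall>g\<in>qh_gens e (\<beta>s c). \<forall>x\<in>carrier (corner_functor M). f (opT (corner_functor M) c g x) = opT (corner_functor N) c g (f x)) \<longleftrightarrow>
      (\<forall>c\<in>{1..k}. \<forall>g\<in>qh_gens e (\<beta>s c). \<forall>x\<in>carrier (corner M). f (U.A.opR c g x) = U.B.opR c g (f x))"
      unfolding corner_functor(4)[OF M] using corner_functor(3)[OF M] corner_functor(3)[OF N] fx by simp
    also have "\<dots> \<longleftrightarrow> ?o"
    proof
      assume a: "\<forall>c\<in>{1..k}. \<forall>g\<in>qh_gens e (\<beta>s c). \<forall>x\<in>carrier (corner M). f (U.A.opR c g x) = U.B.opR c g (f x)"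
      have c: "f (U.A.opR c g x) = U.B.opR c g (f x)" if "c \<in> {1..k}" "g \<in> qh_gens e (\<beta>s c)" "x \<in> carrier (corner M)" for c g x
        using a that by blast
      show ?o unfolding T.ops_hom_def using U.ops_of_opR_hom[OF k c] by blast
    next
      assume o: ?o
      show "\<forall>c\<in>{1..k}. \<forall>g\<in>qh_gens e (\<beta>s c). \<forall>x\<in>carrier (corner M). f (U.A.opR c g x) = U.B.opR c g (f x)"
        by (intro ballI U.opR_hom[OF k]) (use o in \<open>unfold T.ops_hom_def, blast+\<close>)
    qed
    finally show ?thesis .
  qed
  have "f \<in> left_module_hom TA (corner_functor M) (corner_functor N) \<longleftrightarrow> f \<in> carrier (corner M) \<rightarrow>\<^sub>E carrier (corner N) \<and> ?k \<and>
      (\<forall>c\<in>{1..k}. \<forall>g\<in>qh_gens e (\<beta>s c). \<forall>x\<in>carrier (corner_functor M). f (opT (corner_functor M) c g x) = opT (corner_functor N) c g (f x))"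
    unfolding tensor_hom_opT_iff[OF corner_functor(1)[OF M] corner_functor(1)[OF N]] corner_functor_klin_iff[OF M N] corner_functor(4)[OF N] corner_functor(4)[OF M] ..
  then show ?thesis using * by blast
qed

end

text \<open>The isomorphism runs opposite to \<open>f\<close>; the inverse function is restricted to
  the carrier because morphisms are extensional.\<close>

lemma cat_iso_of_bij:
  assumes f: "f \<in> left_module_hom A N M" and bij: "bij_betw f (carrier N) (carrier M)"
    and N: "left_module A N"
  shows "cat_iso (fd_modules V A) M N (\<lambda>z\<in>carrier M. inv_into (carrier N) f z)"
proof -
  interpret N: left_module A N by fact
  let ?g = "\<lambda>z\<in>carrier M. inv_into (carrier N) f z"
  have inj: "inj_on f (carrier N)" and im: "f ` carrier N = carrier M" using bij by (auto simp: bij_betw_def)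
  have gf: "?g (f x) = x" if "x \<in> carrier N" for x using inv_into_f_f[OF inj that] im that by auto
  have fg: "f (?g z) = z" "?g z \<in> carrier N" if "z \<in> carrier M" for z
    using that im f_inv_into_f[of z f "carrier N"] inv_into_into[of z f "carrier N"] by auto
  have "?g \<in> left_module_hom A M N"
    unfolding left_module_hom_def
  proof (intro CollectI conjI ballI)
    show "?g \<in> carrier M \<rightarrow>\<^sub>E carrier N" using fg(2) by (intro restrict_PiE_iff[THEN iffD2] ballI) simp
    fix z assume z: "z \<in> carrier M"
    obtain x where x: "x \<in> carrier N" "z = f x" using z im by blast
    { fix w assume w: "w \<in> carrier M"
      obtain v where v: "v \<in> carrier N" "w = f v" using w im by blast
      have "f (x \<oplus>\<^bsub>N\<^esub> v) = z \<oplus>\<^bsub>M\<^esub> w" using f x v by (simp add: left_module_hom_def)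
      then show "?g (z \<oplus>\<^bsub>M\<^esub> w) = ?g z \<oplus>\<^bsub>N\<^esub> ?g w" using gf[of "x \<oplus>\<^bsub>N\<^esub> v"] gf[OF x(1)] gf[OF v(1)] x v by simp }
    fix a assume a: "a \<in> carrier A"
    have "f (a \<odot>\<^bsub>N\<^esub> x) = a \<odot>\<^bsub>M\<^esub> z" using f x a by (simp add: left_module_hom_def)
    then show "?g (a \<odot>\<^bsub>M\<^esub> z) = a \<odot>\<^bsub>N\<^esub> ?g z" using gf[of "a \<odot>\<^bsub>N\<^esub> x"] gf[OF x(1)] x a N.act_closed by simp
  qed
  moreover have "compose (carrier M) f ?g = (\<lambda>z\<in>carrier M. z)"
    using fg by (auto simp: compose_def fun_eq_iff)
  moreover have "compose (carrier N) ?g f = (\<lambda>x\<in>carrier N. x)"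
    using gf by (auto simp: compose_def fun_eq_iff)
  ultimately show ?thesis
    unfolding cat_iso_def fd_modules_def using f by auto
qed

context block_family
begin

lemma family_single_rep: "single_rep e k \<beta>s N sc eeB yB psB"
  using family_rep separated_sum_axioms by (simp add: single_rep_def)

text \<open>The round trip complementary to \<open>eeB_eq\<close>: from block operators to sorted
  components and back.\<close>

lemma family_opR:
  assumes c: "c \<in> {1..k}" and g: "g \<in> qh_gens e (\<beta>s c)" and x: "x \<in> carrier N"
  shows "single_rep.opR e k \<beta>s N eeB yB psB c g x = opr c g x"
proof -
  interpret R: single_rep e k \<beta>s N sc eeB yB psB by (rule family_single_rep)
  show ?thesis
  proof (cases g)
    case (Psi a)
    then show ?thesis using psB_off[OF c, of a] g by (auto simp: R.opR_simps qh_gens_def)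
  next
    case (Y a)
    then show ?thesis using yB_off[OF c, of a] g by (auto simp: R.opR_simps qh_gens_def)
  next
    case (E j)
    then have j: "j \<in> Res c" using g by (auto simp: qh_gens_def)
    show ?thesis
      unfolding E
    proof (rule R.klin_eqI_homog[OF R.opR_E_klin opr_klin[OF c g, unfolded E] _ x])
      fix "is" u assume i: "is \<in> S0" and u: "R.Q.homog is u"
      show "R.opR c (E j) u = opr c (E j) u"
        using R.opR_E_homog[OF i u, of c j] opr_eeB[OF i c j R.Q.homog_closed[OF u]] R.Q.homog_eq[OF u] by auto
    qed
  qed
qed

end

context separated_algebras
begin

text \<open>Given \<open>N\<close>, its block operators act on it as a space with sorted components
  only. The module induced from it is moved into the type \<open>'v\<close>, and
  \<open>theta\<close> identifies \<open>N\<close> with the corner of the result.\<close>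

lemma corner_functor_dense:
  fixes N :: "((((nat \<Rightarrow> (qh_gen list \<Rightarrow>\<^sub>0 'k) set) \<Rightarrow>\<^sub>0 'k) set), 'v) module"
  assumes inf: "infinite (UNIV :: 'k set)" and N: "left_module TA N" and fd: "finite_dim TA N"
  shows "\<exists>M. left_module RA M \<and> finite_dim RA M \<and> (\<exists>h. cat_iso (fd_modules TYPE('v) TA) (corner_functor M) N h)"
proof -
  let ?sc = "scalar_act TA N"
  interpret B: block_family e k \<beta>s N ?sc "opT N" by (rule family_of_module[OF N])
  interpret G: sorted_rep e n S col w0 N ?sc B.eeB B.yB B.psB
    using B.family_rep coloured_axioms by (simp add: sorted_rep_def)
  obtain s where s: "left_module RA (with_smult G.induced s)"
      "\<And>c x. x \<in> carrier G.induced \<Longrightarrow> scalar_act RA (with_smult G.induced s) c x = G.induced_sc c x"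
      "\<And>x is. x \<in> carrier G.induced \<Longrightarrow> is \<in> S \<Longrightarrow> s (qh_elt TYPE('k) e \<beta> (E is)) x = G.induced_ee is x"
      "\<And>x r. x \<in> carrier G.induced \<Longrightarrow> r \<in> {1..n} \<Longrightarrow> s (qh_elt TYPE('k) e \<beta> (Y r)) x = G.induced_y r x"
      "\<And>x r. x \<in> carrier G.induced \<Longrightarrow> r \<in> {1..<n} \<Longrightarrow> s (qh_elt TYPE('k) e \<beta> (Psi r)) x = G.induced_psi r x"
    using module_of_qh_rep[OF G.induced_rep] by blast
  define W where "W = with_smult G.induced s"
  have Wc: "carrier W = carrier G.induced" "\<zero>\<^bsub>W\<^esub> = \<zero>\<^bsub>G.induced\<^esub>" "add W = add G.induced" "module.smult W = s" by (simp_all add: W_def)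
  \<comment> \<open>Elements of the induced module are families indexed by sequences, whereas
    objects need elements in \<open>'v\<close>; infiniteness of the field provides the
    embedding.\<close>
  obtain \<iota> :: "(int list \<Rightarrow> 'v) \<Rightarrow> 'v" where "inj_on \<iota> (S \<rightarrow>\<^sub>E carrier N)"
    using B.embed_family[OF inf finite_S] by blast
  then have \<iota>: "inj_on \<iota> (carrier W)" using G.induced_sub inj_on_subset unfolding Wc by blast
  define M where "M = transport \<iota> W"
  note t = transport_simps[OF \<iota>, folded M_def, unfolded Wc]
  have M: "left_module RA M" unfolding M_def by (rule transport_module[OF \<iota>]) (simp add: W_def s(1))
  have scM: "scalar_act RA M c (\<iota> x) = \<iota> (G.induced_sc c x)" if "x \<in> carrier G.induced" for c x
    using scalar_act_transport[OF \<iota>, of x RA c] that s(2) by (simp add: M_def Wc(1)) (simp add: W_def)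
  have opsM: "is \<in> S \<Longrightarrow> eeM M is (\<iota> x) = \<iota> (G.induced_ee is x)" "r \<in> {1..n} \<Longrightarrow> yM M r (\<iota> x) = \<iota> (G.induced_y r x)"
    "r \<in> {1..<n} \<Longrightarrow> psM M r (\<iota> x) = \<iota> (G.induced_psi r x)" if "x \<in> carrier G.induced" for x "is" r
    unfolding opM_def t(4)[OF that] by (simp_all only: s(3-5)[OF that])
  interpret C: coloured_rep e n S col w0 M "scalar_act RA M" "eeM M" "yM M" "psM M"
    by (rule coloured_rep_of_module[OF M])
  have \<iota>_klin: "klin G.induced G.induced_sc M (scalar_act RA M) \<iota>"
    by (rule klinI) (simp_all add: t scM)
  have "fin_gen M (scalar_act RA M)"
    by (rule fin_gen_image[OF G.induced_kspace C.R.kspace_axioms G.induced_fin_gen \<iota>_klin])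
       (use fd in \<open>auto simp: finite_dim_iff t(1)\<close>)
  then have fdM: "finite_dim RA M" by (simp add: finite_dim_iff)
  define \<Theta> where "\<Theta> = (\<lambda>x\<in>carrier N. \<iota> (G.theta x))"
  have \<Theta>: "\<Theta> x = \<iota> (G.theta x)" if "x \<in> carrier N" for x using that by (simp add: \<Theta>_def)
  have cor: "z \<in> carrier (corner M) \<longleftrightarrow> z \<in> carrier M \<and> (\<forall>is\<in>S - S0. eeM M is z = \<zero>\<^bsub>M\<^esub>)" for z
    unfolding corner_def by (rule C.corner_space_simps(1))
  have cor_add: "add (corner M) = add M" by (rule corner_sub(2)[OF M])
  \<comment> \<open>Translates the kernel condition defining the corner into vanishing of the family
    at unsorted labels.\<close>
  have eeG0: "G.induced_ee is w = \<zero>\<^bsub>G.induced\<^esub> \<longleftrightarrow> w is = \<zero>\<^bsub>N\<^esub>" if "is \<in> S" for "is" w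
    using that by (auto simp: G.induced_ee_def G.single_at_def G.induced_zero fun_eq_iff)
  have \<iota>_inj: "x = z" if "x \<in> carrier G.induced" "z \<in> carrier G.induced" "\<iota> x = \<iota> z" for x z
    using inj_onD[OF \<iota>[unfolded Wc]] that by blast
  have \<Theta>_in: "\<Theta> x \<in> carrier (corner M)" if x: "x \<in> carrier N" for x
  proof -
    have "eeM M is (\<iota> (G.theta x)) = \<zero>\<^bsub>M\<^esub>" if "is \<in> S - S0" for "is"
    proof -
      have "G.theta x is = \<zero>\<^bsub>N\<^esub>" using that by (simp add: G.theta_def)
      then have "G.induced_ee is (G.theta x) = \<zero>\<^bsub>G.induced\<^esub>" using eeG0 that by blast
      then show ?thesis using opsM(1)[OF G.theta_in[OF x], of "is"] that t(2) by simp
    qed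
    then show ?thesis unfolding cor \<Theta>[OF x] t(1) using G.theta_in[OF x] by blast
  qed
  have \<Theta>_klin: "klin N ?sc (corner M) (scalar_act RA M) \<Theta>"
  proof (rule klinI)
    fix x assume x: "x \<in> carrier N"
    show "\<Theta> x \<in> carrier (corner M)" by (rule \<Theta>_in[OF x])
    show "\<Theta> (?sc c x) = scalar_act RA M c (\<Theta> x)" for c
      unfolding \<Theta>[OF x] \<Theta>[OF B.sc_closed[OF x]] klin_sc[OF G.theta_klin x] scM[OF G.theta_in[OF x]] ..
    show "\<Theta> (x \<oplus>\<^bsub>N\<^esub> z) = \<Theta> x \<oplus>\<^bsub>corner M\<^esub> \<Theta> z" if z: "z \<in> carrier N" for z
      using x z klin_add[OF G.theta_klin x z] t(3)[OF G.theta_in[OF x] G.theta_in[OF z]] by (simp add: \<Theta> cor_add)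
  qed
  interpret U: two_single_reps e k \<beta>s N ?sc B.eeB B.yB B.psB "corner M" "scalar_act RA M" "eeM M" "yM M" "psM M"
    using corner_rep[OF M] B.family_single_rep by (simp add: two_single_reps_def)
  have \<Theta>_opT: "\<Theta> (opT N c g x) = opT (corner_functor M) c g (\<Theta> x)"
    if c: "c \<in> {1..k}" and g: "g \<in> qh_gens e (\<beta>s c)" and x: "x \<in> carrier N" for c g x
  proof -
    have "\<Theta> (U.A.opR c g x) = U.B.opR c g (\<Theta> x)"
    proof (rule U.opR_hom[OF \<Theta>_klin _ _ _ c g x])
      fix "is" x assume i: "is \<in> S0" and x: "x \<in> carrier N"
      show "\<Theta> (B.eeB is x) = eeM M is (\<Theta> x)"
        using opsM(1)[OF G.theta_in[OF x], of "is"] i S0_sub G.theta_ops(1)[OF x i] G.Q.ee_closed[OF i x] by (auto simp: \<Theta>[OF x] \<Theta>)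
    next
      fix r x assume r: "r \<in> {1..n}" and x: "x \<in> carrier N"
      show "\<Theta> (B.yB r x) = yM M r (\<Theta> x)"
        using opsM(2)[OF G.theta_in[OF x] r] G.theta_ops(2)[OF x r] G.Q.y_closed[OF r x] by (simp add: \<Theta>[OF x] \<Theta>)
    next
      fix r x assume r: "r \<in> D0" and x: "x \<in> carrier N"
      then show "\<Theta> (B.psB r x) = psM M r (\<Theta> x)"
        using opsM(3)[OF G.theta_in[OF x] subsetD[OF D0_sub r]] G.theta_ops(3)[OF x r] G.Q.psi_closed[OF r x] by (simp add: \<Theta>[OF x] \<Theta>)
    qed
    then show ?thesis using B.family_opR[OF c g x] corner_functor(3)[OF M c g \<Theta>_in[OF x]] by simp
  qed
  have "klin N ?sc (corner_functor M) (scalar_act TA (corner_functor M)) \<Theta>"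
    using \<Theta>_klin corner_functor(2)[OF M \<Theta>_in] unfolding klin_def corner_functor(4,5)[OF M] by simp
  then have hom: "\<Theta> \<in> left_module_hom TA N (corner_functor M)"
    unfolding tensor_hom_opT_iff[OF N corner_functor(1)[OF M]] corner_functor(4)[OF M]
    using \<Theta>_in \<Theta>_opT by (auto simp: \<Theta>_def)
  have "bij_betw \<Theta> (carrier N) (carrier (corner_functor M))"
    unfolding bij_betw_def corner_functor(4)[OF M]
  proof (intro conjI inj_onI equalityI subsetI)
    fix x z assume "x \<in> carrier N" "z \<in> carrier N" "\<Theta> x = \<Theta> z"
    then show "x = z" using \<iota>_inj G.theta_in G.theta_inj by (simp add: \<Theta>)
  next
    fix z assume "z \<in> \<Theta> ` carrier N" then show "z \<in> carrier (corner M)" using \<Theta>_in by blast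
  next
    fix z assume z: "z \<in> carrier (corner M)"
    then obtain w where w: "w \<in> carrier G.induced" "z = \<iota> w" unfolding cor t(1) by blast
    have "w is = \<zero>\<^bsub>N\<^esub>" if i: "is \<in> S - S0" for "is"
    proof -
      have "\<iota> (G.induced_ee is w) = \<iota> \<zero>\<^bsub>G.induced\<^esub>"
        using z i opsM(1)[OF w(1), of "is"] unfolding cor w(2) t(2) by simp
      then have "G.induced_ee is w = \<zero>\<^bsub>G.induced\<^esub>"
        using \<iota>_inj klin_closed[OF G.induced_ee_klin w(1)] i by blast
      then show ?thesis using eeG0 i by blast
    qed
    then obtain x where "x \<in> carrier N" "G.theta x = w" using G.theta_surj[OF w(1)] by blast
    then show "z \<in> \<Theta> ` carrier N" using w(2) \<Theta> by force
  qed
  \<comment> \<open>\<open>\<Theta>\<close> goes from \<open>N\<close> to the corner, while density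
    asks for an isomorphism in the other direction.\<close>
  from cat_iso_of_bij[OF hom this N] show ?thesis using M fdM by blast
qed

definition corner_map where "corner_map M N f = restrict f (carrier (corner M))"

lemma corner_map_hom:
  assumes M: "left_module RA M" and N: "left_module RA N" and f: "f \<in> left_module_hom RA M N"
  shows "corner_map M N f \<in> left_module_hom TA (corner_functor M) (corner_functor N)"
proof -
  interpret T: two_reps e n S col w0 M "scalar_act RA M" "eeM M" "yM M" "psM M" N "scalar_act RA N" "eeM N" "yM N" "psM N"
    using coloured_rep_of_module[OF M] coloured_rep_of_module[OF N] by (simp add: two_reps_def)
  have k: "klin M (scalar_act RA M) N (scalar_act RA N) f" and o: "T.ops_hom S {1..<n} (carrier M) f"
    using f unfolding RA_hom_iff[OF M N] by blast+
  have c: "corner M = T.A.corner_space" "corner N = T.B.corner_space" by (simp_all add: corner_def)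
  have f0: "f \<zero>\<^bsub>M\<^esub> = \<zero>\<^bsub>N\<^esub>" by (rule klin_zero[OF k T.A.R.abelian_group_axioms T.B.R.abelian_group_axioms])
  have sub: "x \<in> carrier M" if "x \<in> carrier T.A.corner_space" for x using that by (simp add: T.A.corner_space_simps)
  have fin: "f x \<in> carrier T.B.corner_space" if x: "x \<in> carrier T.A.corner_space" for x
  proof -
    have "eeM N is (f x) = \<zero>\<^bsub>N\<^esub>" if i: "is \<in> S - S0" for "is"
    proof -
      have "f (eeM M is x) = eeM N is (f x)" using o sub[OF x] i unfolding T.ops_hom_def by blast
      moreover have "eeM M is x = \<zero>\<^bsub>M\<^esub>" using x i by (simp add: T.A.corner_space_simps)
      ultimately show ?thesis using f0 by simp
    qed
    then show ?thesis using klin_closed[OF k sub[OF x]] by (simp add: T.B.corner_space_simps)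
  qed
  let ?g = "restrict f (carrier T.A.corner_space)"
  interpret corner_space: kspace T.A.corner_space "scalar_act RA M" by (rule T.A.corner_space_kspace)
  have "klin T.A.corner_space (scalar_act RA M) T.B.corner_space (scalar_act RA N) ?g"
    using fin klin_add[OF k] klin_sc[OF k] sub corner_space.a_closed corner_space.sc_closed
    by (intro klinI) (simp_all add: T.A.corner_space_simps(3) T.B.corner_space_simps(3))
  moreover have "T.ops_hom S0 D0 (carrier T.A.corner_space) ?g"
    unfolding T.ops_hom_def
  proof (intro ballI conjI)
    fix x assume x: "x \<in> carrier T.A.corner_space"
    note op = T.A.corner_space_ops[OF x]
    show "?g (eeM M is x) = eeM N is (?g x)" if "is \<in> S0" for "is"
      using o sub[OF x] op(1)[OF that] that S0_sub x unfolding T.ops_hom_def by auto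
    show "?g (yM M r x) = yM N r (?g x)" if "r \<in> {1..n}" for r
      using o sub[OF x] op(2)[OF that] that x unfolding T.ops_hom_def by (simp del: atLeastAtMost_iff)
    show "?g (psM M r x) = psM N r (?g x)" if "r \<in> D0" for r
      using o sub[OF x] op(3)[OF that] subsetD[OF D0_sub that] x unfolding T.ops_hom_def by (simp del: atLeastLessThan_iff)
  qed
  ultimately show ?thesis
    unfolding corner_functor_hom_iff[OF M N] corner_map_def c using fin by simp
qed

lemma corner_map_inj:
  assumes M: "left_module RA M" and N: "left_module RA N"
  shows "inj_on (corner_map M N) (left_module_hom RA M N)"
proof (rule inj_onI)
  interpret T: two_reps e n S col w0 M "scalar_act RA M" "eeM M" "yM M" "psM M" N "scalar_act RA N" "eeM N" "yM N" "psM N"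
    using coloured_rep_of_module[OF M] coloured_rep_of_module[OF N] by (simp add: two_reps_def)
  fix f g assume f: "f \<in> left_module_hom RA M N" and g: "g \<in> left_module_hom RA M N" and eq: "corner_map M N f = corner_map M N g"
  have f': "f \<in> carrier M \<rightarrow>\<^sub>E carrier N" "klin M (scalar_act RA M) N (scalar_act RA N) f" "T.ops_hom S {1..<n} (carrier M) f"
    using f unfolding RA_hom_iff[OF M N] by blast+
  have g': "g \<in> carrier M \<rightarrow>\<^sub>E carrier N" "klin M (scalar_act RA M) N (scalar_act RA N) g" "T.ops_hom S {1..<n} (carrier M) g"
    using g unfolding RA_hom_iff[OF M N] by blast+
  have "f x = g x" if "x \<in> carrier T.A.corner_space" for x
    using fun_cong[OF eq, of x] that by (simp add: corner_map_def corner_def)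
  then have "f x = g x" if "x \<in> carrier M" for x
    using T.hom_eqI[OF f'(2,3) g'(2,3) _ that] by blast
  then show "f = g" using f'(1) g'(1) by (intro extensionalityI[of _ "carrier M"]) (auto simp: PiE_def)
qed

lemma corner_map_surj:
  assumes M: "left_module RA M" and N: "left_module RA N" and h: "h \<in> left_module_hom TA (corner_functor M) (corner_functor N)"
  shows "\<exists>f\<in>left_module_hom RA M N. corner_map M N f = h"
proof -
  interpret T: two_reps e n S col w0 M "scalar_act RA M" "eeM M" "yM M" "psM M" N "scalar_act RA N" "eeM N" "yM N" "psM N"
    using coloured_rep_of_module[OF M] coloured_rep_of_module[OF N] by (simp add: two_reps_def)
  have c: "corner M = T.A.corner_space" "corner N = T.B.corner_space" by (simp_all add: corner_def)
  have h': "h \<in> carrier T.A.corner_space \<rightarrow>\<^sub>E carrier T.B.corner_space" "klin T.A.corner_space (scalar_act RA M) T.B.corner_space (scalar_act RA N) h"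
      "T.ops_hom S0 D0 (carrier T.A.corner_space) h"
    using h unfolding corner_functor_hom_iff[OF M N] c by blast+
  obtain f where f: "klin M (scalar_act RA M) N (scalar_act RA N) f" "T.ops_hom S {1..<n} (carrier M) f"
      "\<And>x. x \<in> carrier T.A.corner_space \<Longrightarrow> f x = h x"
    by (rule T.hom_extend[OF h'(2,3)]) (rule that)
  \<comment> \<open>\<open>hom_extend\<close> says nothing about values outside the carrier, but
    morphisms of the category are extensional.\<close>
  let ?f = "restrict f (carrier M)"
  have fx: "f x \<in> carrier N" if "x \<in> carrier M" for x using f(1) that by (rule klin_closed)
  have k: "klin M (scalar_act RA M) N (scalar_act RA N) ?f"
    by (rule klin_cong[OF T.A.R.kspace_axioms f(1)]) simp
  have o: "T.ops_hom S {1..<n} (carrier M) ?f"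
    unfolding T.ops_hom_def
  proof (intro ballI conjI)
    fix x assume x: "x \<in> carrier M"
    show "?f (eeM M is x) = eeM N is (?f x)" if "is \<in> S" for "is"
      using f(2) T.A.R.ee_closed[OF that x] that x unfolding T.ops_hom_def by simp
    show "?f (yM M r x) = yM N r (?f x)" if "r \<in> {1..n}" for r
      using f(2) T.A.R.y_closed[OF that x] that x unfolding T.ops_hom_def by (simp del: atLeastAtMost_iff)
    show "?f (psM M r x) = psM N r (?f x)" if "r \<in> {1..<n}" for r
      using f(2) T.A.R.psi_closed[OF that x] that x unfolding T.ops_hom_def by (simp del: atLeastLessThan_iff)
  qed
  have "?f \<in> left_module_hom RA M N" unfolding RA_hom_iff[OF M N] using fx k o by auto
  moreover have "corner_map M N ?f = h"
  proof (rule extensionalityI[of _ "carrier T.A.corner_space"])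
    show "h \<in> extensional (carrier T.A.corner_space)" using h'(1) by (simp add: PiE_def)
    show "corner_map M N ?f x = h x" if "x \<in> carrier T.A.corner_space" for x
      using that f(3)[OF that] by (simp add: corner_map_def c T.A.corner_space_simps(1))
  qed (unfold corner_map_def c, rule restrict_extensional)
  ultimately show ?thesis by blast
qed

lemma cat_functor_corner: "cat_functor (fd_modules TYPE('v) RA) (fd_modules TYPE('v) TA) corner_functor corner_map"
proof (intro cat_functor.intro cat_functor_axioms.intro category_fd_modules)
  fix M :: "((qh_gen list \<Rightarrow>\<^sub>0 'k) set, 'v) module" assume "M \<in> cobj (fd_modules TYPE('v) RA)"
  then have M: "left_module RA M" "finite_dim RA M" by (simp_all add: fd_modules_def)
  show "corner_functor M \<in> cobj (fd_modules TYPE('v) TA)"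
    using corner_functor(1)[OF M(1)] corner_functor_finite_dim[OF M] by (simp add: fd_modules_def)
  show "corner_map M M (cid (fd_modules TYPE('v) RA) M) = cid (fd_modules TYPE('v) TA) (corner_functor M)"
    using corner_sub(1)[OF M(1)] by (auto simp: fd_modules_def corner_map_def corner_functor(4)[OF M(1)] fun_eq_iff)
  fix N :: "((qh_gen list \<Rightarrow>\<^sub>0 'k) set, 'v) module" and f assume "N \<in> cobj (fd_modules TYPE('v) RA)"
    and "f \<in> chom (fd_modules TYPE('v) RA) M N"
  then have N: "left_module RA N" and f: "f \<in> left_module_hom RA M N" by (simp_all add: fd_modules_def)
  have Ff: "corner_map M N f \<in> left_module_hom TA (corner_functor M) (corner_functor N)" by (rule corner_map_hom[OF M(1) N f])
  then show "corner_map M N f \<in> chom (fd_modules TYPE('v) TA) (corner_functor M) (corner_functor N)" by (simp add: fd_modules_def)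
  fix P :: "((qh_gen list \<Rightarrow>\<^sub>0 'k) set, 'v) module" and g
  have "f x \<in> carrier (corner N)" if "x \<in> carrier (corner M)" for x
    using Ff that by (auto simp: left_module_hom_def corner_functor(4)[OF M(1)] corner_functor(4)[OF N] corner_map_def)
  then show "corner_map M P (ccomp (fd_modules TYPE('v) RA) M N P g f) =
      ccomp (fd_modules TYPE('v) TA) (corner_functor M) (corner_functor N) (corner_functor P) (corner_map N P g) (corner_map M N f)"
    using corner_sub(1)[OF M(1)] by (auto simp: fd_modules_def corner_map_def corner_functor(4)[OF M(1)] compose_def fun_eq_iff)
qed

lemma fd_modules_equivalent:
  assumes "infinite (UNIV :: 'k set)"
  shows "equivalent_categories (fd_modules TYPE('v) RA) (fd_modules TYPE('v) TA)"
proof (rule equivalent_categories_fully_faithful[OF cat_functor_corner])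
  fix N assume "N \<in> cobj (fd_modules TYPE('v) TA)"
  then show "\<exists>M\<in>cobj (fd_modules TYPE('v) RA). \<exists>h. cat_iso (fd_modules TYPE('v) TA) (corner_functor M) N h"
    using corner_functor_dense[OF assms, of N] by (auto simp: fd_modules_def)
qed (use corner_map_inj corner_map_surj in \<open>auto simp: fd_modules_def\<close>)

end

theorem corollary5p13:
  fixes e k n :: nat and m :: "nat \<Rightarrow> nat"
    and \<beta>s :: "nat \<Rightarrow> (int \<Rightarrow>\<^sub>0 nat)" and \<beta> :: "int \<Rightarrow>\<^sub>0 nat"
  assumes "e \<noteq> 1"
    and "(\<exists>q :: 'k::alg_closed_field. q \<noteq> 0 \<and> q \<noteq> 1 \<and> e = quantum_characteristic q)
         \<or> CHAR('k) = e"
    and "(\<Sum>i\<in>{1..k}. m i) = n"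
    and "\<And>i. i \<in> {1..k} \<Longrightarrow> \<beta>s i \<in> Q_plus_n e (m i)"
    and "\<beta> = (\<Sum>i\<in>{1..k}. \<beta>s i)"
    and "\<And>i j. \<lbrakk>i \<in> {1..k}; j \<in> {1..k}; i \<noteq> j\<rbrakk> \<Longrightarrow> separated e (\<beta>s i) (\<beta>s j)"
  shows "equivalent_categories
           (fd_modules TYPE('v) (quiver_hecke TYPE('k) e \<beta>))
           (fd_modules TYPE('v)
              (tensor_algebras {1..k} (\<lambda>i. quiver_hecke TYPE('k) e (\<beta>s i))))"
proof -
  interpret separated_algebras "TYPE('k)" e k \<beta>s
    by unfold_locales (use assms(4,6) in \<open>auto simp: Q_plus_n_def\<close>)
  have "\<beta> = separated_sum.\<beta> k \<beta>s" by (simp add: assms(5) \<beta>_def)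
  \<comment> \<open>Algebraic closedness enters as infiniteness of K, which gives the induced
    modules room in \<open>'v\<close>.\<close>
  then show ?thesis using fd_modules_equivalent[OF infinite_UNIV_alg_closed] by simp
qed

end
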